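(* Let $X=\mathbb R^n$, let $E$ be a finite dimensional Hilbert space, $\mathscr H=L^2(X;E)$, and let $m\ge1$ be an integer. For multi-indices $\alpha,\beta$ with $|\alpha|,|\beta|\le m$ let $a_{\alpha\beta}$ and $b_{\alpha\beta}$ be operators of class $C^{\rm u}(Q;\mathscr H^{m-|\beta|},\mathscr H^{|\alpha|-m})$ such that the operators $D^*aD-z$ and $D^*bD-z$ are bijective maps $\mathscr H^m\to\mathscr H^{-m}$ for some complex $z$, where $$D^*aD=\sum_{|\alpha|,|\beta|\le m}P^\alpha a_{\alpha\beta}P^\beta,\qquad D^*bD=\sum_{|\alpha|,|\beta|\le m}P^\alpha b_{\alpha\beta}P^\beta .$$ Let $\Delta_a$ and $\Delta_b$ be the operators in $\mathscr H$ associated to $D^*aD$ and $D^*bD$ respectively. Assume that $$\lim_{r\to\infty}\|\theta(Q/r)(a_{\alpha\beta}-b_{\alpha\beta})\|_{\mathscr H^{m-|\beta|}\to\mathscr H^{|\alpha|-m}}=0$$ for each $\alpha,\beta$, where $\theta$ is a $C^\infty$ function on $X$ equal to zero on a neighborhood of the origin and equal to one on a neighborhood of infinity. Then $\Delta_b$ is a compact perturbation of $\Delta_a$ and the operators $\Delta_a$ and $\Delta_b$ have the same essential spectrum.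
   Context: $\mathscr H^s$ is the Sobolev space of order $s\in\mathbb R$ of $E$-valued distributions on $\mathbb R^n$, with $\mathscr H^{-s}$ identified with the antilinear dual of $\mathscr H^s$. $P_k=-i\partial_k$, $P^\alpha=P_1^{\alpha_1}\cdots P_n^{\alpha_n}$; $\theta(Q/r)$ is the operator of multiplication by $x\mapsto\theta(x/r)$. Let $V_k$, $k\in\mathbb R^n$, be multiplication by $e^{i\langle x,k\rangle}$. A bounded operator $S:\mathscr H^s\to\mathscr H^t$ is of class $C^{\rm u}(Q;\mathscr H^s,\mathscr H^t)$ if the map $k\mapsto V_{-k}SV_k\in\mathcal B(\mathscr H^s,\mathscr H^t)$ is norm continuous. The operator $\Delta_a$ in $\mathscr H$ associated to $D^*aD:\mathscr H^m\to\mathscr H^{-m}$ is its restriction to the domain $\{u\in\mathscr H^m:D^*aDu\in\mathscr H\}$; similarly for $\Delta_b$. A closed operator $B$ in $\mathscr H$ is a compact perturbation of a closed operator $A$ if there is $z\in\rho(A)\cap\rho(B)$ such that $(A-z)^{-1}-(B-z)^{-1}$ is compact. The essential spectrum of $A$ is the set of $\lambda\in\mathbb C$ such that $A-\lambda$ is not Fredholm. *)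

theory Defs
  imports "HOL-Analysis.Analysis" "HOL-Library.Function_Algebras"
begin

section \<open>Finite dimensional complex Hilbert spaces\<close>

text \<open>
  The real inner product and the norm are the ones induced by the complex inner product.
  The superclasses \<^class>\<open>banach\<close>, \<^class>\<open>heine_borel\<close> and \<^class>\<open>second_countable_topology\<close>
  cost no generality: they hold automatically in finite dimension. The zero space is allowed.
\<close>

class fin_dim_hilbert = real_inner + banach + heine_borel + second_countable_topology +
  fixes scaleC :: "complex \<Rightarrow> 'a \<Rightarrow> 'a"  (infixr "*\<^sub>C" 75)
    and cinner :: "'a \<Rightarrow> 'a \<Rightarrow> complex"
  assumes scaleC_add_right: "c *\<^sub>C (x + y) = c *\<^sub>C x + c *\<^sub>C y"
    and scaleC_add_left: "(c + d) *\<^sub>C x = c *\<^sub>C x + d *\<^sub>C x"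
    and scaleC_scaleC: "c *\<^sub>C (d *\<^sub>C x) = (c * d) *\<^sub>C x"
    and scaleC_one: "1 *\<^sub>C x = x"
    and scaleR_scaleC: "r *\<^sub>R x = complex_of_real r *\<^sub>C x"
    and cinner_commute: "cinner x y = cnj (cinner y x)"
    and cinner_add_right: "cinner x (y + z) = cinner x y + cinner x z"
    and cinner_scaleC_right: "cinner x (c *\<^sub>C y) = c * cinner x y"
    and inner_eq_Re_cinner: "inner x y = Re (cinner x y)"
    and finite_dim: "\<exists>B. finite B \<and> (\<forall>x. \<exists>c. x = (\<Sum>b\<in>B. c b *\<^sub>C b))"

lemma vector_space_scaleC: "vector_space (scaleC :: complex \<Rightarrow> 'e \<Rightarrow> 'e::fin_dim_hilbert)"
  by unfold_locales (simp_all add: scaleC_add_right scaleC_add_left scaleC_scaleC scaleC_one)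

instantiation complex :: fin_dim_hilbert
begin

definition "scaleC_complex = ((*) :: complex \<Rightarrow> complex \<Rightarrow> complex)"
definition "cinner_complex x y = cnj x * (y::complex)"

instance
proof
  show "\<exists>B::complex set. finite B \<and> (\<forall>x. \<exists>c. x = (\<Sum>b\<in>B. c b *\<^sub>C b))"
    by (intro exI[of _ "{1}"]) (auto simp: scaleC_complex_def)
qed (simp_all add: scaleC_complex_def cinner_complex_def inner_complex_def algebra_simps
      scaleR_conv_of_real)

end

section \<open>Schwartz functions\<close>

definition partial_deriv :: "'n \<Rightarrow> (real^'n \<Rightarrow> complex) \<Rightarrow> real^'n \<Rightarrow> complex" where
  "partial_deriv k \<phi> x = frechet_derivative \<phi> (at x) (axis k 1)"

definition iter_partial :: "'n list \<Rightarrow> (real^'n \<Rightarrow> complex) \<Rightarrow> real^'n \<Rightarrow> complex" where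
  "iter_partial ks \<phi> = foldr partial_deriv ks \<phi>"

text \<open>Class \<open>C\<^sup>\<infinity>\<close>: all iterated partial derivatives, in any order, exist and are
  (Frechet) differentiable everywhere.\<close>

definition smooth :: "(real^'n \<Rightarrow> complex) \<Rightarrow> bool" where
  "smooth \<phi> \<longleftrightarrow> (\<forall>ks x. iter_partial ks \<phi> differentiable (at x))"

definition schwartz :: "(real^'n \<Rightarrow> complex) set" where
  "schwartz = {\<phi>. smooth \<phi> \<and>
     (\<forall>N ks. bounded (range (\<lambda>x. (1 + norm x) ^ N *\<^sub>R iter_partial ks \<phi> x)))}"

definition schwartz_seminorm :: "nat \<Rightarrow> (real^'n \<Rightarrow> complex) \<Rightarrow> real" where
  "schwartz_seminorm N \<phi> =
     (SUP (ks, x) \<in> {ks. length ks \<le> N} \<times> UNIV. (1 + norm x) ^ N * norm (iter_partial ks \<phi> x))"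

definition fourier :: "(real^'n \<Rightarrow> complex) \<Rightarrow> real^'n \<Rightarrow> complex" where
  "fourier \<phi> \<xi> = complex_of_real ((2 * pi) powr (- real CARD('n) / 2)) *
     (\<integral>x. exp (- \<i> * complex_of_real (x \<bullet> \<xi>)) * \<phi> x \<partial>lborel)"

section \<open>Tempered distributions with values in E\<close>

text \<open>
  A distribution is a function on \<open>real^'n \<Rightarrow> complex\<close> of which only the values on
  \<^const>\<open>schwartz\<close> matter; it is \<open>0\<close> elsewhere, so that equality of distributions is equality
  of functions. The pairing is bilinear: a function \<open>f\<close> acts by \<open>\<phi> \<mapsto> \<integral> \<phi> f\<close>.
  Addition and subtraction are pointwise.
\<close>

type_synonym ('n, 'e) functional = "(real^'n \<Rightarrow> complex) \<Rightarrow> 'e"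

definition scaleF :: "complex \<Rightarrow> ('n::finite, 'e::fin_dim_hilbert) functional \<Rightarrow> ('n, 'e) functional" where
  "scaleF c u = (\<lambda>\<phi>. c *\<^sub>C u \<phi>)"

lemma vector_space_scaleF:
  "vector_space (scaleF :: complex \<Rightarrow> ('n::finite, 'e::fin_dim_hilbert) functional \<Rightarrow> _)"
  by unfold_locales
    (auto simp: scaleF_def fun_eq_iff scaleC_add_right scaleC_add_left scaleC_scaleC scaleC_one)

definition tempered :: "('n::finite, 'e::fin_dim_hilbert) functional set" where
  "tempered = {u.
     (\<forall>\<phi>\<in>schwartz. \<forall>\<psi>\<in>schwartz. u (\<lambda>x. \<phi> x + \<psi> x) = u \<phi> + u \<psi>) \<and>
     (\<forall>c. \<forall>\<phi>\<in>schwartz. u (\<lambda>x. c * \<phi> x) = c *\<^sub>C u \<phi>) \<and>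
     (\<exists>N C. \<forall>\<phi>\<in>schwartz. norm (u \<phi>) \<le> C * schwartz_seminorm N \<phi>) \<and>
     (\<forall>\<phi>. \<phi> \<notin> schwartz \<longrightarrow> u \<phi> = 0)}"

definition transposed ::
  "((real^'n \<Rightarrow> complex) \<Rightarrow> (real^'n \<Rightarrow> complex)) \<Rightarrow> ('n::finite, 'e::fin_dim_hilbert) functional \<Rightarrow> ('n, 'e) functional"
  where "transposed L u = (\<lambda>\<phi>. if \<phi> \<in> schwartz then u (L \<phi>) else 0)"

definition fun_dist :: "(real^'n \<Rightarrow> 'e::fin_dim_hilbert) \<Rightarrow> ('n, 'e) functional" where
  "fun_dist f = (\<lambda>\<phi>. if \<phi> \<in> schwartz then (\<integral>x. \<phi> x *\<^sub>C f x \<partial>lborel) else 0)"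

definition fourier_dist :: "('n::finite, 'e::fin_dim_hilbert) functional \<Rightarrow> ('n, 'e) functional" where
  "fourier_dist = transposed fourier"

definition mult_op ::
  "(real^'n \<Rightarrow> complex) \<Rightarrow> ('n::finite, 'e::fin_dim_hilbert) functional \<Rightarrow> ('n, 'e) functional" where
  "mult_op g = transposed (\<lambda>\<phi> x. g x * \<phi> x)"

text \<open>\<open>P\<^sub>k = - \<i> \<partial>\<^sub>k\<close>; since \<open>(\<partial>\<^sub>k u) \<phi> = - u (\<partial>\<^sub>k \<phi>)\<close>, it is the transpose of \<open>\<i> \<partial>\<^sub>k\<close>.\<close>

definition P_op :: "'n \<Rightarrow> ('n::finite, 'e::fin_dim_hilbert) functional \<Rightarrow> ('n, 'e) functional" where
  "P_op k = transposed (\<lambda>\<phi> x. \<i> * partial_deriv k \<phi> x)"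

text \<open>The coordinates are indexed by a finite linearly ordered type, which fixes the order of the
  factors in \<open>P\<^sup>\<alpha> = P\<^sub>1\<^bsup>\<alpha>\<^sub>1\<^esup> \<dots> P\<^sub>n\<^bsup>\<alpha>\<^sub>n\<^esup>\<close>.\<close>

definition P_pow ::
  "('n::{finite,linorder} \<Rightarrow> nat) \<Rightarrow> ('n, 'e::fin_dim_hilbert) functional \<Rightarrow> ('n, 'e) functional"
  where "P_pow \<alpha> u = foldr (\<lambda>k. P_op k ^^ \<alpha> k) (sorted_list_of_set UNIV) u"

definition mi_order :: "('n::finite \<Rightarrow> nat) \<Rightarrow> nat" where
  "mi_order \<alpha> = (\<Sum>k\<in>UNIV. \<alpha> k)"

definition V_op :: "real^'n \<Rightarrow> ('n::finite, 'e::fin_dim_hilbert) functional \<Rightarrow> ('n, 'e) functional" where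
  "V_op k = mult_op (\<lambda>x. exp (\<i> * complex_of_real (x \<bullet> k)))"

section \<open>The space L2 and Sobolev spaces\<close>

definition weighted_L2_rep ::
  "(real^'n \<Rightarrow> real) \<Rightarrow> ('n::finite, 'e::fin_dim_hilbert) functional \<Rightarrow> (real^'n \<Rightarrow> 'e) \<Rightarrow> bool" where
  "weighted_L2_rep w u f \<longleftrightarrow> f \<in> borel_measurable borel \<and>
     integrable lborel (\<lambda>x. w x * (norm (f x))\<^sup>2) \<and> u = fun_dist f"

definition weighted_L2 :: "(real^'n \<Rightarrow> real) \<Rightarrow> ('n::finite, 'e::fin_dim_hilbert) functional set" where
  "weighted_L2 w = {u. \<exists>f. weighted_L2_rep w u f}"

text \<open>The representing function is unique up to null sets, so the choice is immaterial.\<close>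

definition weighted_L2_norm ::
  "(real^'n \<Rightarrow> real) \<Rightarrow> ('n::finite, 'e::fin_dim_hilbert) functional \<Rightarrow> real" where
  "weighted_L2_norm w u = sqrt (\<integral>x. w x * (norm ((SOME f. weighted_L2_rep w u f) x))\<^sup>2 \<partial>lborel)"

abbreviation L2 :: "('n::finite, 'e::fin_dim_hilbert) functional set" where
  "L2 \<equiv> weighted_L2 (\<lambda>_. 1)"

abbreviation L2_norm :: "('n::finite, 'e::fin_dim_hilbert) functional \<Rightarrow> real" where
  "L2_norm \<equiv> weighted_L2_norm (\<lambda>_. 1)"

definition sobolev_weight :: "real \<Rightarrow> real^'n \<Rightarrow> real" where
  "sobolev_weight s \<xi> = (1 + (norm \<xi>)\<^sup>2) powr s"

definition sobolev :: "real \<Rightarrow> ('n::finite, 'e::fin_dim_hilbert) functional set" where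
  "sobolev s = {u \<in> tempered. fourier_dist u \<in> weighted_L2 (sobolev_weight s)}"

definition sobolev_norm :: "real \<Rightarrow> ('n::finite, 'e::fin_dim_hilbert) functional \<Rightarrow> real" where
  "sobolev_norm s u = weighted_L2_norm (sobolev_weight s) (fourier_dist u)"

section \<open>Bounded operators between Sobolev spaces\<close>

text \<open>Operators are total functions on functionals; only their values on their domain matter.\<close>

definition clinear_on ::
  "('n::finite, 'e::fin_dim_hilbert) functional set \<Rightarrow> (('n, 'e) functional \<Rightarrow> ('n, 'e) functional) \<Rightarrow> bool"
  where "clinear_on D T \<longleftrightarrow> module.subspace scaleF D \<and>
     (\<forall>u\<in>D. \<forall>v\<in>D. T (u + v) = T u + T v) \<and> (\<forall>c. \<forall>u\<in>D. T (scaleF c u) = scaleF c (T u))"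

definition op_norm ::
  "real \<Rightarrow> real \<Rightarrow> (('n::finite, 'e::fin_dim_hilbert) functional \<Rightarrow> ('n, 'e) functional) \<Rightarrow> ennreal" where
  "op_norm s t S = (SUP u \<in> {u \<in> sobolev s. sobolev_norm s u \<le> 1}. ennreal (sobolev_norm t (S u)))"

definition bounded_op ::
  "real \<Rightarrow> real \<Rightarrow> (('n::finite, 'e::fin_dim_hilbert) functional \<Rightarrow> ('n, 'e) functional) \<Rightarrow> bool" where
  "bounded_op s t S \<longleftrightarrow> clinear_on (sobolev s) S \<and> S ` sobolev s \<subseteq> sobolev t \<and> op_norm s t S < \<infinity>"

definition conj_V ::
  "real^'n \<Rightarrow> (('n::finite, 'e::fin_dim_hilbert) functional \<Rightarrow> ('n, 'e) functional)
    \<Rightarrow> ('n, 'e) functional \<Rightarrow> ('n, 'e) functional" where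
  "conj_V k S u = V_op (- k) (S (V_op k u))"

definition class_Cu ::
  "real \<Rightarrow> real \<Rightarrow> (('n::finite, 'e::fin_dim_hilbert) functional \<Rightarrow> ('n, 'e) functional) \<Rightarrow> bool" where
  "class_Cu s t S \<longleftrightarrow> bounded_op s t S \<and>
     (\<forall>k\<^sub>0. ((\<lambda>k. op_norm s t (\<lambda>u. conj_V k S u - conj_V k\<^sub>0 S u)) \<longlongrightarrow> 0) (at k\<^sub>0))"

section \<open>Unbounded operators in L2\<close>

text \<open>An operator in \<^const>\<open>L2\<close> is given by its domain \<open>D\<close> and a map \<open>A\<close>.\<close>

definition L2_tendsto ::
  "(nat \<Rightarrow> ('n::finite, 'e::fin_dim_hilbert) functional) \<Rightarrow> ('n, 'e) functional \<Rightarrow> bool" where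
  "L2_tendsto f g \<longleftrightarrow> (\<lambda>j. L2_norm (f j - g)) \<longlonglongrightarrow> 0"

definition closed_operator ::
  "('n::finite, 'e::fin_dim_hilbert) functional set \<Rightarrow> (('n, 'e) functional \<Rightarrow> ('n, 'e) functional)
    \<Rightarrow> bool" where
  "closed_operator D A \<longleftrightarrow> D \<subseteq> L2 \<and> A ` D \<subseteq> L2 \<and> clinear_on D A \<and>
     (\<forall>f u v. (\<forall>j. f j \<in> D) \<and> u \<in> L2 \<and> v \<in> L2 \<and> L2_tendsto f u \<and> L2_tendsto (\<lambda>j. A (f j)) v
        \<longrightarrow> u \<in> D \<and> A u = v)"

definition shift_op ::
  "(('n::finite, 'e::fin_dim_hilbert) functional \<Rightarrow> ('n, 'e) functional) \<Rightarrow> complex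
    \<Rightarrow> ('n, 'e) functional \<Rightarrow> ('n, 'e) functional" where
  "shift_op A z u = A u - scaleF z u"

definition resolvent ::
  "('n::finite, 'e::fin_dim_hilbert) functional set \<Rightarrow> (('n, 'e) functional \<Rightarrow> ('n, 'e) functional)
    \<Rightarrow> complex \<Rightarrow> ('n, 'e) functional \<Rightarrow> ('n, 'e) functional" where
  "resolvent D A z = inv_into D (shift_op A z)"

definition resolvent_set ::
  "('n::finite, 'e::fin_dim_hilbert) functional set \<Rightarrow> (('n, 'e) functional \<Rightarrow> ('n, 'e) functional)
    \<Rightarrow> complex set" where
  "resolvent_set D A = {z. bij_betw (shift_op A z) D L2 \<and>
     (\<exists>C. \<forall>f\<in>L2. L2_norm (resolvent D A z f) \<le> C * L2_norm f)}"

definition compact_operator ::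
  "(('n::finite, 'e::fin_dim_hilbert) functional \<Rightarrow> ('n, 'e) functional) \<Rightarrow> bool" where
  "compact_operator K \<longleftrightarrow> clinear_on L2 K \<and> K ` L2 \<subseteq> L2 \<and>
     (\<forall>f :: nat \<Rightarrow> _. (\<forall>j. f j \<in> L2 \<and> L2_norm (f j) \<le> 1) \<longrightarrow>
        (\<exists>(r :: nat \<Rightarrow> nat) g. strict_mono r \<and> g \<in> L2 \<and> L2_tendsto (\<lambda>j. K (f (r j))) g))"

text \<open>\<open>B\<close> (with domain \<open>D\<^sub>B\<close>) is a compact perturbation of \<open>A\<close> (with domain \<open>D\<^sub>A\<close>).\<close>

definition compact_perturbation ::
  "('n::finite, 'e::fin_dim_hilbert) functional set \<Rightarrow> (('n, 'e) functional \<Rightarrow> ('n, 'e) functional)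
    \<Rightarrow> ('n, 'e) functional set \<Rightarrow> (('n, 'e) functional \<Rightarrow> ('n, 'e) functional) \<Rightarrow> bool" where
  "compact_perturbation D\<^sub>B B D\<^sub>A A \<longleftrightarrow> closed_operator D\<^sub>B B \<and> closed_operator D\<^sub>A A \<and>
     (\<exists>z \<in> resolvent_set D\<^sub>A A \<inter> resolvent_set D\<^sub>B B.
        compact_operator (\<lambda>f. resolvent D\<^sub>A A z f - resolvent D\<^sub>B B z f))"

text \<open>Fredholm: finite dimensional kernel and closed range of finite codimension in \<^const>\<open>L2\<close>.\<close>

definition fredholm ::
  "('n::finite, 'e::fin_dim_hilbert) functional set \<Rightarrow> (('n, 'e) functional \<Rightarrow> ('n, 'e) functional)
    \<Rightarrow> bool" where
  "fredholm D T \<longleftrightarrow>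
     (\<exists>B. finite B \<and> {u \<in> D. T u = 0} \<subseteq> module.span scaleF B) \<and>
     (\<forall>f g. (\<forall>j. f j \<in> T ` D) \<and> g \<in> L2 \<and> L2_tendsto f g \<longrightarrow> g \<in> T ` D) \<and>
     (\<exists>B \<subseteq> L2. finite B \<and> L2 \<subseteq> module.span scaleF (T ` D \<union> B))"

definition essential_spectrum ::
  "('n::finite, 'e::fin_dim_hilbert) functional set \<Rightarrow> (('n, 'e) functional \<Rightarrow> ('n, 'e) functional)
    \<Rightarrow> complex set" where
  "essential_spectrum D A = {z. \<not> fredholm D (shift_op A z)}"

section \<open>The operators in divergence form\<close>

type_synonym ('n, 'e) coefficients =
  "('n \<Rightarrow> nat) \<Rightarrow> ('n \<Rightarrow> nat) \<Rightarrow> ('n, 'e) functional \<Rightarrow> ('n, 'e) functional"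

definition DaD :: "nat \<Rightarrow> ('n::{finite,linorder}, 'e::fin_dim_hilbert) coefficients
    \<Rightarrow> ('n, 'e) functional \<Rightarrow> ('n, 'e) functional" where
  "DaD m a u = (\<Sum>\<alpha> | mi_order \<alpha> \<le> m. \<Sum>\<beta> | mi_order \<beta> \<le> m. P_pow \<alpha> (a \<alpha> \<beta> (P_pow \<beta> u)))"

text \<open>The operator associated to \<open>D\<^sup>*aD\<close> is the restriction of \<^const>\<open>DaD\<close> to this domain.\<close>

definition Delta_dom :: "nat \<Rightarrow> ('n::{finite,linorder}, 'e::fin_dim_hilbert) coefficients
    \<Rightarrow> ('n, 'e) functional set" where
  "Delta_dom m a = {u \<in> sobolev (real m). DaD m a u \<in> L2}"

end

theory Submission
  imports Defs "HOL-Probability.Probability" "HOL-Complex_Analysis.Great_Picard"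
begin

text \<open>
  Conjugation by the Fourier transform and the weight \<open>(1 + |\<xi>|\<^sup>2)\<^bsup>s/2\<^esup>\<close> identifies every
  Sobolev space with one Hilbert space, so that all operators become bounded operators on it.
  Class \<open>C\<^sup>u(Q)\<close> means that commutators with \<open>V\<^sub>k\<close> are small for small \<open>k\<close>; this property
  passes to compositions and inverses, hence to the resolvents \<open>R\<^sub>a\<close>, \<open>R\<^sub>b\<close> of the two forms. In
  \<open>R\<^sub>a - R\<^sub>b = \<Sum> R\<^sub>a P\<^sup>\<alpha> (b - a) P\<^sup>\<beta> R\<^sub>b\<close> each \<open>W = (b - a) P\<^sup>\<beta> R\<^sub>b\<close> is close in norm to \<open>g(\<epsilon>Q) W\<close>
  with \<open>g = 1 - \<theta>\<close> compactly supported. As \<open>g(\<epsilon>Q)\<close> is a superposition of the \<open>V\<^sub>\<epsilon>\<^sub>k\<close>, it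
  almost commutes with \<open>W\<close>, and \<open>W g(\<epsilon>Q)\<close> is compact from \<open>L\<^sup>2\<close> because \<open>g(\<epsilon>Q)\<close> maps \<open>L\<^sup>2\<close>
  compactly into the Sobolev space of order \<open>-m\<close>. The essential spectra agree because \<open>\<Delta> - \<lambda>\<close>
  is Fredholm iff \<open>1 - (\<lambda> - z) (\<Delta> - z)\<^sup>-\<^sup>1\<close> is, and Fredholm operators are stable under compact
  perturbations.
\<close>

section \<open>Bounded operators between Banach spaces\<close>

text \<open>The side on which the cut-off stands matters: only to the right of \<open>W\<close> does
  it meet functions in L2, and there the inclusion into order -m, with m \<ge> 1, supplies the gain
  that makes it compact. The obstacle is that \<open>W\<close> contains a resolvent, of which
  nothing is known except that it inverts a form. Hence the class is used only as smallness of
  \<open>T V\<^sub>k - V\<^sub>k T\<close> for k near 0. Inverses are then covered by \<open>R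
  V\<^sub>k - V\<^sub>k R = - R (T V\<^sub>k - V\<^sub>k T) R\<close>, and the rapidly decreasing
  density in the superposition absorbs the polynomial growth in k of the norms of
  \<open>V\<^sub>k\<close> on Sobolev spaces. The model space is a real Hilbert space and the
  Fredholm theory is done over the reals; complex linearity is the side condition
  \<open>clin\<close>, and real and complex spans are reconciled when essential spectra are
  compared. L2 is defined in position and the Sobolev spaces in frequency, so Plancherel's theorem
  has to link them.\<close>

text \<open>Solving up to half of the right hand side and iterating solves exactly.\<close>

lemma approx_solvable_imp_solvable:
  fixes T :: "'a::banach \<Rightarrow> 'b::real_normed_vector"
  assumes T: "bounded_linear T" and S: "subspace S" "\<And>x. T x \<in> S" and "M \<ge> 0"
    and approx: "\<And>y. y \<in> S \<Longrightarrow> \<exists>x. norm x \<le> M * norm y \<and> norm (y - T x) \<le> norm y / 2"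
    and y: "y \<in> S"
  shows "\<exists>x. T x = y \<and> norm x \<le> 2 * M * norm y"
proof -
  interpret T: bounded_linear T by fact
  obtain g where g: "\<And>y. y \<in> S \<Longrightarrow> norm (g y) \<le> M * norm y"
      "\<And>y. y \<in> S \<Longrightarrow> norm (y - T (g y)) \<le> norm y / 2"
    using approx by metis
  \<comment> \<open>\<open>Y n\<close> is the residual left after n corrections; the exact solution
    is the sum of all the corrections \<open>g (Y n)\<close>.\<close>
  define Y where "Y n = ((\<lambda>y. y - T (g y)) ^^ n) y" for n
  have YS: "Y n \<in> S" for n
    by (induction n) (auto simp: Y_def y S intro!: subspace_diff)
  have Yn: "norm (Y n) \<le> norm y * (1/2) ^ n" for n
  proof (induction n)
    case (Suc n)
    have "norm (Y (Suc n)) \<le> norm (Y n) / 2" using g(2)[OF YS[of n]] by (simp add: Y_def)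
    then show ?case using Suc by simp
  qed (simp add: Y_def)
  have le: "norm (g (Y n)) \<le> M * norm y * (1/2) ^ n" for n
    using g(1)[OF YS[of n]] mult_left_mono[OF Yn[of n] \<open>M \<ge> 0\<close>] by simp
  have geo: "(\<lambda>n. M * norm y * (1/2) ^ n) sums (M * norm y * 2)"
    using sums_mult[OF geometric_sums[of "1/2::real"], of "M * norm y"] by simp
  have sm: "summable (\<lambda>n. norm (g (Y n)))"
    by (rule summable_comparison_test'[OF sums_summable[OF geo], of 0]) (use le in auto)
  define x where "x = (\<Sum>n. g (Y n))"
  have "(\<lambda>n. T (g (Y n))) sums T x"
    unfolding x_def by (rule T.sums[OF summable_sums[OF summable_norm_cancel[OF sm]]])
  moreover have "(\<lambda>n. T (g (Y n))) = (\<lambda>n. Y n - Y (Suc n))"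
    by (simp add: Y_def)
  moreover have "(\<lambda>n. Y n - Y (Suc n)) sums (Y 0 - 0)"
  proof (rule telescope_sums')
    have lim: "(\<lambda>n. norm y * (1/2) ^ n) \<longlonglongrightarrow> 0"
      using tendsto_mult_left[OF LIMSEQ_realpow_zero[of "1/2::real"], of "norm y"] by simp
    show "Y \<longlonglongrightarrow> 0"
      by (rule Lim_null_comparison[OF _ lim]) (use Yn in auto)
  qed
  ultimately have "T x = y"
    using sums_unique2[of "\<lambda>n. Y n - Y (Suc n)" "T x" "Y 0 - 0"] by (simp add: Y_def)
  moreover have "norm x \<le> M * norm y * 2"
    unfolding x_def using summable_norm[OF sm] suminf_le[OF le sm sums_summable[OF geo]] sums_unique[OF geo]
    by linarith
  ultimately show ?thesis by (auto simp: mult_ac)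
qed

text \<open>The open mapping theorem onto a closed range, with its constant. Baire's theorem is
  applied inside the range, which is complete because it is closed; it yields only approximate
  solutions with a bound, and \<open>approx_solvable_imp_solvable\<close> makes them exact.\<close>

lemma open_mapping_closed_range:
  fixes T :: "'a::banach \<Rightarrow> 'b::banach"
  assumes T: "bounded_linear T" and cl: "closed (range T)"
  obtains M where "M \<ge> 0" "\<And>y. y \<in> range T \<Longrightarrow> \<exists>x. T x = y \<and> norm x \<le> M * norm y"
proof -
  interpret T: bounded_linear T by fact
  define S where "S = range T"
  have sub: "subspace S"
    unfolding S_def using T.linear subspace_UNIV linear_subspace_image by blast
  have clS: "closed S" using cl by (simp add: S_def)
  interpret MS: Metric_space S dist
    by unfold_locales (auto simp: dist_commute dist_triangle)
  have mc: "MS.mcomplete"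
    unfolding MS.mcomplete_def MS.MCauchy_def MS.limitin_metric
  proof (intro allI impI)
    fix \<sigma> :: "nat \<Rightarrow> 'b"
    assume "range \<sigma> \<subseteq> S \<and> (\<forall>\<epsilon>>0. \<exists>N. \<forall>n n'. N \<le> n \<longrightarrow> N \<le> n' \<longrightarrow> dist (\<sigma> n) (\<sigma> n') < \<epsilon>)"
    then have "range \<sigma> \<subseteq> S" "Cauchy \<sigma>" by (auto simp: Cauchy_def)
    then obtain l where l: "\<sigma> \<longlonglongrightarrow> l" using Cauchy_convergent convergent_def by blast
    then have "l \<in> S" using clS \<open>range \<sigma> \<subseteq> S\<close> by (meson closed_sequentially rangeI subsetD)
    then show "\<exists>x. x \<in> S \<and> (\<forall>\<epsilon>>0. \<forall>\<^sub>F n in sequentially. \<sigma> n \<in> S \<and> dist (\<sigma> n) x < \<epsilon>)"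
      using l \<open>range \<sigma> \<subseteq> S\<close> by (intro exI[of _ l]) (auto simp: tendsto_iff image_subset_iff)
  qed
  define F where "F n = closure (T ` cball 0 (real n))" for n
  have FS: "F n \<subseteq> S" for n
    unfolding F_def using clS by (intro closure_minimal) (auto simp: S_def)
  have cF: "closedin MS.mtopology (F n)" for n
    unfolding MS.closedin_metric
  proof (intro conjI FS allI impI)
    fix x assume "x \<in> S - F n"
    then have "x \<in> - F n" "open (- F n)" by (auto simp: F_def)
    then obtain e where "e > 0" "ball x e \<subseteq> - F n" by (meson openE)
    then show "\<exists>r>0. disjnt (F n) (MS.mball x r)"
      by (intro exI[of _ e]) (auto simp: disjnt_def MS.mball_def)
  qed
  have US: "\<Union>(range F) = S"
  proof
    show "S \<subseteq> \<Union>(range F)"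
    proof
      fix y assume "y \<in> S"
      then obtain x where "y = T x" by (auto simp: S_def)
      moreover obtain n where "norm x \<le> real n" using real_arch_simple by blast
      ultimately have "y \<in> F n" unfolding F_def by (intro closure_subset[THEN subsetD]) auto
      then show "y \<in> \<Union>(range F)" by blast
    qed
  qed (use FS in auto)
  have "\<exists>n. MS.mtopology interior_of F n \<noteq> {}"
  proof (rule ccontr)
    assume "\<not> ?thesis"
    then have "MS.mtopology interior_of \<Union>(range F) = {}"
      by (intro MS.metric_Baire_category_alt mc) (use cF in auto)
    moreover have "0 \<in> S" using sub by (rule subspace_0)
    ultimately show False
      by (metis US MS.topspace_mtopology empty_iff interior_of_topspace)
  qed
  then obtain n x0 where "x0 \<in> MS.mtopology interior_of F n" by blast
  then obtain U where U: "openin MS.mtopology U" "x0 \<in> U" "U \<subseteq> F n"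
    unfolding interior_of_def by blast
  then have "\<exists>e>0. x0 \<in> S \<and> MS.mball x0 e \<subseteq> F n"
    unfolding MS.openin_mtopology by (meson subsetD subset_trans)
  then obtain e where e: "e > 0" "x0 \<in> S" "\<And>y. y \<in> S \<Longrightarrow> dist x0 y < e \<Longrightarrow> y \<in> F n"
    by (auto simp: MS.mball_def subset_iff)
  \<comment> \<open>The ball obtained from Baire's theorem is centred at x0, not at 0. Approximating
    both x0 + y and x0 and subtracting recentres it, at the price of the factor 2.\<close>
  have app: "\<exists>x. norm x \<le> 2 * real n \<and> norm (y - T x) < d" if "y \<in> S" "norm y < e" "d > 0" for y d
  proof -
    have "x0 + y \<in> F n" using that e sub by (intro e) (auto simp: dist_norm subspace_add)
    then obtain a where a: "norm a \<le> n" "dist (T a) (x0 + y) < d/2"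
      unfolding F_def closure_approachable using \<open>d > 0\<close> by (fastforce elim: allE[of _ "d/2"])
    have "x0 \<in> F n" using e by (intro e) auto
    then obtain b where b: "norm b \<le> n" "dist (T b) x0 < d/2"
      unfolding F_def closure_approachable using \<open>d > 0\<close> by (fastforce elim: allE[of _ "d/2"])
    have "norm (a - b) \<le> 2 * real n" using a(1) b(1) norm_triangle_ineq4[of a b] by linarith
    moreover have "norm (y - T (a - b)) < d"
    proof -
      have eq: "y - T (a - b) = (x0 + y - T a) - (x0 - T b)" by (simp add: T.diff)
      have "norm (y - T (a - b)) \<le> norm (x0 + y - T a) + norm (x0 - T b)"
        unfolding eq by (rule norm_triangle_ineq4)
      moreover have "norm (x0 + y - T a) < d/2" "norm (x0 - T b) < d/2"
        using a(2) b(2) by (simp_all add: dist_norm norm_minus_commute)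
      ultimately show ?thesis by linarith
    qed
    ultimately show ?thesis by blast
  qed
  \<comment> \<open>A vector y is rescaled to norm e/2 and solved up to e/4 by an x of norm at most
    2 n. Undoing the scaling multiplies by 2 norm y / e, which gives this constant and the error
    norm y / 2.\<close>
  define M where "M = 4 * real n / e"
  have M0: "M \<ge> 0" using e by (simp add: M_def)
  have "\<exists>x. norm x \<le> M * norm y \<and> norm (y - T x) \<le> norm y / 2" if yS: "y \<in> S" for y
  proof (cases "y = 0")
    case True then show ?thesis by (intro exI[of _ 0]) (simp add: T.zero)
  next
    case False
    define c where "c = e / (2 * norm y)"
    have c: "c > 0" using False e by (simp add: c_def)
    have cy: "norm (c *\<^sub>R y) = e / 2" using False e by (simp add: c_def)
    obtain x where x: "norm x \<le> 2 * real n" "norm (c *\<^sub>R y - T x) < e / 4"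
      using app[OF subspace_scale[OF sub yS, of c], of "e/4"] cy e by fastforce
    have "norm ((1/c) *\<^sub>R x) \<le> M * norm y"
      using x(1) c False e by (simp add: c_def M_def field_simps)
    moreover have "norm (y - T ((1/c) *\<^sub>R x)) \<le> norm y / 2"
    proof -
      have eq: "y - T ((1/c) *\<^sub>R x) = (1/c) *\<^sub>R (c *\<^sub>R y - T x)" using c by (simp add: T.scaleR scaleR_diff_right)
      have "norm (y - T ((1/c) *\<^sub>R x)) = (1/c) * norm (c *\<^sub>R y - T x)" unfolding eq using c by simp
      also have "\<dots> \<le> (1/c) * (e/4)" using c x(2) by (intro mult_left_mono) auto
      also have "\<dots> = norm y / 2" using e by (simp add: c_def)
      finally show ?thesis .
    qed
    ultimately show ?thesis by blast
  qed
  then show thesis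
    using approx_solvable_imp_solvable[OF T sub _ M0] that[of "2 * M"] M0 by (auto simp: S_def)
qed

lemma bij_blinfun_inverse:
  fixes T :: "'a::banach \<Rightarrow>\<^sub>L 'b::banach"
  assumes "bij (blinfun_apply T)"
  obtains R where "R o\<^sub>L T = id_blinfun" "T o\<^sub>L R = id_blinfun"
proof -
  have T: "bounded_linear (blinfun_apply T)" by (rule blinfun.bounded_linear_right)
  have [simp]: "range (blinfun_apply T) = UNIV" using assms by (simp add: bij_is_surj)
  obtain M where M: "\<And>y. \<exists>x. T x = y \<and> norm x \<le> M * norm y"
    using open_mapping_closed_range[OF T] by (metis UNIV_I closed_UNIV \<open>range (blinfun_apply T) = UNIV\<close>)
  define R where "R = inv (blinfun_apply T)"
  have TR: "T (R y) = y" for y unfolding R_def using assms by (simp add: bij_is_surj surj_f_inv_f)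
  have RT: "R (T x) = x" for x unfolding R_def using assms by (simp add: bij_is_inj)
  have "bounded_linear R"
  proof (rule bounded_linear_intro[where K=M])
    show "norm (R y) \<le> norm y * M" for y using M[of y] RT by (auto simp: mult.commute)
    show "R (x + y) = R x + R y" for x y by (metis RT TR blinfun.add_right)
    show "R (c *\<^sub>R x) = c *\<^sub>R R x" for c x by (metis RT TR blinfun.scaleR_right)
  qed
  then show thesis
    by (intro that[of "Blinfun R"] blinfun_eqI) (simp_all add: bounded_linear_Blinfun_apply TR RT)
qed

section \<open>Compact operators\<close>

definition compact_blinfun :: "('a::real_normed_vector \<Rightarrow>\<^sub>L 'b::real_normed_vector) \<Rightarrow> bool" where
  "compact_blinfun K \<longleftrightarrow>
     (\<forall>f::nat \<Rightarrow> 'a. bounded (range f) \<longrightarrow> (\<exists>r::nat \<Rightarrow> nat. strict_mono r \<and> convergent (\<lambda>j. K (f (r j)))))"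

lemma compact_blinfunD:
  fixes K :: "'a::real_normed_vector \<Rightarrow>\<^sub>L 'b::real_normed_vector"
  assumes "compact_blinfun K" "\<And>j::nat. norm (f j) \<le> B"
  obtains r l where "strict_mono (r::nat \<Rightarrow> nat)" "(\<lambda>j. K (f (r j))) \<longlonglongrightarrow> l"
proof -
  have "bounded (range f)" using assms(2) by (auto simp: bounded_iff)
  then show ?thesis using assms(1) that unfolding compact_blinfun_def convergent_def by blast
qed

lemma compact_blinfun_unit_ballI:
  fixes K :: "'a::real_normed_vector \<Rightarrow>\<^sub>L 'b::real_normed_vector"
  assumes "\<And>f::nat \<Rightarrow> _. (\<And>j. norm (f j) \<le> 1) \<Longrightarrow> \<exists>r::nat \<Rightarrow> nat. strict_mono r \<and> convergent (\<lambda>j. K (f (r j)))"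
  shows "compact_blinfun K"
  unfolding compact_blinfun_def
proof (intro allI impI)
  fix f :: "nat \<Rightarrow> 'a" assume "bounded (range f)"
  then obtain B where B: "B > 0" "\<And>j. norm (f j) \<le> B" by (auto simp: bounded_pos)
  obtain r :: "nat \<Rightarrow> nat" and l where r: "strict_mono r" "(\<lambda>j. K ((1/B) *\<^sub>R f (r j))) \<longlonglongrightarrow> l"
    using assms[of "\<lambda>j. (1/B) *\<^sub>R f j"] B by (auto simp: convergent_def)
  have "(\<lambda>j. B *\<^sub>R K ((1/B) *\<^sub>R f (r j))) \<longlonglongrightarrow> B *\<^sub>R l" using r by (intro tendsto_intros)
  then show "\<exists>r::nat \<Rightarrow> nat. strict_mono r \<and> convergent (\<lambda>j. K (f (r j)))"
    using B r by (auto simp: blinfun.scaleR_right convergent_def)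
qed

lemma compact_blinfun_totally_bounded:
  fixes K :: "'a::real_normed_vector \<Rightarrow>\<^sub>L 'b::real_normed_vector"
  assumes "compact_blinfun K" "e > 0"
  obtains C where "finite C" "\<And>x. norm x \<le> 1 \<Longrightarrow> \<exists>c\<in>C. norm (K x - c) < e"
proof -
  have "Met_TC.mtotally_bounded (blinfun_apply K ` cball 0 1)"
    unfolding Met_TC.mtotally_bounded_sequentially
  proof (intro conjI allI impI)
    fix \<sigma> :: "nat \<Rightarrow> 'b" assume \<sigma>: "range \<sigma> \<subseteq> blinfun_apply K ` cball 0 1"
    have "\<exists>x. \<sigma> j = K x \<and> norm x \<le> 1" for j
    proof -
      have "\<sigma> j \<in> blinfun_apply K ` cball 0 1" using \<sigma> by blast
      then show ?thesis by auto
    qed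
    then obtain f where f: "\<And>j. \<sigma> j = K (f j)" "\<And>j. norm (f j) \<le> 1" by metis
    obtain r l where "strict_mono (r :: nat \<Rightarrow> nat)" "(\<lambda>j. K (f (r j))) \<longlonglongrightarrow> l"
      using compact_blinfunD[OF assms(1), of f 1] f(2) by blast
    then show "\<exists>r::nat \<Rightarrow> nat. strict_mono r \<and> Met_TC.MCauchy (\<sigma> \<circ> r)"
      by (auto intro!: exI[of _ r] simp: f(1) o_def LIMSEQ_imp_Cauchy)
  qed simp
  then have "\<exists>C. finite C \<and> C \<subseteq> blinfun_apply K ` cball 0 1 \<and> blinfun_apply K ` cball 0 1 \<subseteq> (\<Union>x\<in>C. ball x e)"
    unfolding Met_TC.mtotally_bounded_def mball_eq_ball using \<open>e > 0\<close> by (elim allE impE)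
  then obtain C where C: "finite C" "blinfun_apply K ` cball 0 1 \<subseteq> (\<Union>x\<in>C. ball x e)" by (elim exE conjE)
  show ?thesis
  proof (rule that[OF C(1)])
    fix x :: 'a assume "norm x \<le> 1"
    then have "K x \<in> (\<Union>x\<in>C. ball x e)" using C(2) by (intro subsetD[OF C(2)] imageI) simp
    then show "\<exists>c\<in>C. norm (K x - c) < e" by (auto simp: dist_norm norm_minus_commute)
  qed
qed

text \<open>Total boundedness of the image of the unit ball replaces a diagonal argument: a finite
  e/4-net for a nearby compact L gives an e-net for K. Completeness of the target then turns Cauchy
  subsequences into convergent ones.\<close>

lemma compact_blinfun_limit:
  fixes K :: "'a::real_normed_vector \<Rightarrow>\<^sub>L 'b::banach"
  assumes "\<And>e. e > 0 \<Longrightarrow> \<exists>L. compact_blinfun L \<and> norm (K - L) < e"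
  shows "compact_blinfun K"
proof (rule compact_blinfun_unit_ballI)
  have tb: "Met_TC.mtotally_bounded (blinfun_apply K ` cball 0 1)"
    unfolding Met_TC.mtotally_bounded_def
  proof (intro allI impI)
    fix e :: real assume "e > 0"
    then obtain L where L: "compact_blinfun L" "norm (K - L) < e/4" using assms[of "e/4"] by auto
    obtain C where C: "finite C" "\<And>x. norm x \<le> 1 \<Longrightarrow> \<exists>c\<in>C. norm (L x - c) < e/4"
      using compact_blinfun_totally_bounded[OF L(1), of "e/4"] \<open>e > 0\<close> by auto
    \<comment> \<open>The points of a net have to belong to the set itself. So each useful centre c
      is traded for \<open>K (p c)\<close>, where \<open>p c\<close> lies in the unit ball and
      \<open>L (p c)\<close> is near c; the four errors of e/4 add up to e.\<close>
    define p where "p c = (SOME x. norm x \<le> 1 \<and> norm (L x - c) < e/4)" for c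
    define D where "D = (\<lambda>c. K (p c)) ` {c\<in>C. \<exists>x. norm x \<le> 1 \<and> norm (L x - c) < e/4}"
    have p: "norm (p c) \<le> 1" "norm (L (p c) - c) < e/4" if "\<exists>x. norm x \<le> 1 \<and> norm (L x - c) < e/4" for c
      using someI_ex[OF that] by (auto simp: p_def)
    have KL: "norm (K x - L x) < e/4" if "norm x \<le> 1" for x
    proof -
      have "norm (K x - L x) \<le> norm (K - L) * norm x" by (metis blinfun.diff_left norm_blinfun)
      also have "\<dots> \<le> norm (K - L) * 1" using that by (intro mult_left_mono) auto
      finally show ?thesis using L by simp
    qed
    have "\<exists>d\<in>D. norm (d - K x) < e" if x: "norm x \<le> 1" for x
    proof -
      obtain c where c: "c \<in> C" "norm (L x - c) < e/4" using C(2)[OF x] by blast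
      then have pc: "norm (p c) \<le> 1" "norm (L (p c) - c) < e/4" using x p[of c] by blast+
      have tri: "norm (a + b - c - d) \<le> norm a + norm b + norm c + norm d" for a b c d :: 'b
        using norm_triangle_ineq[of a b] norm_triangle_ineq4[of "a + b" c] norm_triangle_ineq4[of "a + b - c" d]
        by linarith
      have "K (p c) - K x = (K (p c) - L (p c)) + (L (p c) - c) - (L x - c) - (K x - L x)" by simp
      then have "norm (K (p c) - K x) \<le> norm (K (p c) - L (p c)) + norm (L (p c) - c) + norm (L x - c) + norm (K x - L x)"
        by (metis tri)
      then have "norm (K (p c) - K x) < e" using KL[OF x] KL[OF pc(1)] pc c by linarith
      then show ?thesis using c x by (auto simp: D_def)
    qed
    moreover have "D \<subseteq> blinfun_apply K ` cball 0 1"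
    proof
      fix d assume "d \<in> D"
      then obtain c where "d = K (p c)" "\<exists>x. norm x \<le> 1 \<and> norm (L x - c) < e/4" unfolding D_def by blast
      then show "d \<in> blinfun_apply K ` cball 0 1" using p(1) by auto
    qed
    moreover have "finite D" using C(1) by (simp add: D_def)
    ultimately show "\<exists>C. finite C \<and> C \<subseteq> blinfun_apply K ` cball 0 1 \<and> blinfun_apply K ` cball 0 1 \<subseteq> (\<Union>x\<in>C. Met_TC.mball x e)"
      by (intro exI[of _ D]) (auto simp: dist_norm)
  qed
  fix f :: "nat \<Rightarrow> 'a" assume "\<And>j. norm (f j) \<le> 1"
  then have "range (\<lambda>j. K (f j)) \<subseteq> blinfun_apply K ` cball 0 1" by auto
  then obtain r :: "nat \<Rightarrow> nat" where "strict_mono r" "Met_TC.MCauchy ((\<lambda>j. K (f j)) \<circ> r)"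
    using tb unfolding Met_TC.mtotally_bounded_sequentially by blast
  then show "\<exists>r::nat \<Rightarrow> nat. strict_mono r \<and> convergent (\<lambda>j. K (f (r j)))"
    by (intro exI[of _ r]) (simp add: o_def Cauchy_convergent_iff)
qed

lemma compact_blinfun_compose_left:
  fixes K :: "'a::real_normed_vector \<Rightarrow>\<^sub>L 'b::real_normed_vector"
    and T :: "'b \<Rightarrow>\<^sub>L 'c::real_normed_vector"
  assumes "compact_blinfun K"
  shows "compact_blinfun (T o\<^sub>L K)"
  unfolding compact_blinfun_def
proof (intro allI impI)
  fix f :: "nat \<Rightarrow> 'a" assume "bounded (range f)"
  then obtain r :: "nat \<Rightarrow> nat" and l where "strict_mono r" "(\<lambda>j. K (f (r j))) \<longlonglongrightarrow> l"
    using assms by (auto simp: compact_blinfun_def convergent_def)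
  then have "(\<lambda>j. T (K (f (r j)))) \<longlonglongrightarrow> T l" by (intro tendsto_intros)
  with \<open>strict_mono r\<close> show "\<exists>r::nat \<Rightarrow> nat. strict_mono r \<and> convergent (\<lambda>j. (T o\<^sub>L K) (f (r j)))"
    by (auto simp: convergent_def)
qed

lemma compact_blinfun_0: "compact_blinfun 0"
  unfolding compact_blinfun_def by (auto intro!: exI[of _ id] simp: strict_mono_def convergent_const)

lemma compact_blinfun_add:
  fixes K L :: "'a::real_normed_vector \<Rightarrow>\<^sub>L 'b::real_normed_vector"
  assumes "compact_blinfun K" "compact_blinfun L"
  shows "compact_blinfun (K + L)"
  unfolding compact_blinfun_def
proof (intro allI impI)
  fix f :: "nat \<Rightarrow> 'a" assume b: "bounded (range f)"
  then obtain r :: "nat \<Rightarrow> nat" where r: "strict_mono r" "convergent (\<lambda>j. K (f (r j)))"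
    using assms by (auto simp: compact_blinfun_def)
  have "bounded (range (\<lambda>j. f (r j)))" using b by (auto simp: bounded_iff)
  then obtain q :: "nat \<Rightarrow> nat" where q: "strict_mono q" "convergent (\<lambda>j. L (f (r (q j))))"
    using assms(2) unfolding compact_blinfun_def by blast
  have "convergent (\<lambda>j. K (f (r (q j))))"
    using convergent_subseq_convergent[OF r(2) q(1)] by (simp add: o_def)
  then have "convergent (\<lambda>j. (K + L) (f ((r \<circ> q) j)))"
    using convergent_add q(2) by (simp add: blinfun.add_left)
  then show "\<exists>r::nat \<Rightarrow> nat. strict_mono r \<and> convergent (\<lambda>j. (K + L) (f (r j)))"
    using strict_mono_o[OF r(1) q(1)] by blast
qed

lemma compact_blinfun_sum:
  "(\<And>i. i \<in> I \<Longrightarrow> compact_blinfun (K i)) \<Longrightarrow> compact_blinfun (\<Sum>i\<in>I. K i)"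
  by (induction I rule: infinite_finite_induct) (auto intro: compact_blinfun_0 compact_blinfun_add)

section \<open>Riesz representation\<close>

text \<open>The representer is the minimizer of \<Phi> on M: the parallelogram law makes a
  minimizing sequence Cauchy. Allowing a closed subspace gives two results at once, the Riesz
  theorem on the whole space and, with f an inner product, the orthogonal projection onto M.\<close>

lemma riesz_on_subspace:
  fixes f :: "'a::{real_inner,banach} \<Rightarrow> real"
  assumes f: "bounded_linear f" and M: "subspace M" "closed M"
  obtains y where "y \<in> M" "\<And>x. x \<in> M \<Longrightarrow> f x = inner y x"
proof -
  interpret f: bounded_linear f by fact
  define \<Phi> where "\<Phi> x = (norm x)\<^sup>2 - 2 * f x" for x
  obtain K where K: "\<And>x. norm (f x) \<le> norm x * K" using f.bounded by blast
  have lb: "\<Phi> x \<ge> - (K\<^sup>2)" for x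
  proof -
    have "(norm x - K)\<^sup>2 \<ge> 0" by simp
    then show ?thesis using K[of x] by (auto simp: \<Phi>_def power2_eq_square algebra_simps)
  qed
  define d where "d = (INF x\<in>M. \<Phi> x)"
  have bdd: "bdd_below (\<Phi> ` M)" using lb by (auto intro!: bdd_belowI2)
  have ne: "M \<noteq> {}" using M subspace_0 by blast
  have d_le: "d \<le> \<Phi> x" if "x \<in> M" for x unfolding d_def using bdd that by (rule cINF_lower)
  have "\<exists>x\<in>M. \<Phi> x < d + 1 / Suc n" for n
    using cINF_less_iff[OF ne bdd, of "d + 1 / Suc n"] by (simp add: d_def)
  then obtain X where X: "\<And>n. X n \<in> M" "\<And>n. \<Phi> (X n) < d + 1 / Suc n" by metis
  have par: "(norm (x - y))\<^sup>2 \<le> 2 * (\<Phi> x - d) + 2 * (\<Phi> y - d)" if "x \<in> M" "y \<in> M" for x y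
  proof -
    have "(1/2) *\<^sub>R (x + y) \<in> M" using that M by (simp add: subspace_add subspace_scale)
    then have "4 * d \<le> 4 * \<Phi> ((1/2) *\<^sub>R (x + y))" using d_le by simp
    also have "\<dots> = 2 * \<Phi> x + 2 * \<Phi> y - (norm (x - y))\<^sup>2"
      by (simp add: \<Phi>_def power2_norm_eq_inner f.scaleR f.add inner_simps inner_commute algebra_simps)
    finally show ?thesis by simp
  qed
  have "Cauchy X"
  proof (rule metric_CauchyI)
    fix e :: real assume "e > 0"
    then obtain N where N: "1 / real (Suc N) < e\<^sup>2 / 4"
      using reals_Archimedean[of "e\<^sup>2 / 4"] by (auto simp: inverse_eq_divide)
    have "dist (X m) (X n) < e" if "m \<ge> N" "n \<ge> N" for m n
    proof -
      have "1 / real (Suc m) \<le> 1 / Suc N" "1 / real (Suc n) \<le> 1 / Suc N"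
        using that by (auto simp: frac_le)
      moreover have "S < E" if "a \<le> c" "b \<le> c" "S \<le> 2 * (p - d) + 2 * (q - d)" "p < d + a" "q < d + b" "c < E / 4"
        for a b c S E p q :: real
      proof -
        have "S < 2 * a + 2 * b" using that(3-5) by argo
        then show ?thesis using that(1,2,6) by argo
      qed
      ultimately have "(norm (X m - X n))\<^sup>2 < e\<^sup>2" 
        using par[OF X(1)[of m] X(1)[of n]] X(2)[of m] X(2)[of n] N by blast
      then show ?thesis using \<open>e > 0\<close> by (simp add: dist_norm power_less_imp_less_base)
    qed
    then show "\<exists>N. \<forall>m\<ge>N. \<forall>n\<ge>N. dist (X m) (X n) < e" by blast
  qed
  then obtain y where y: "X \<longlonglongrightarrow> y" using Cauchy_convergent convergent_def by blast
  have yM: "y \<in> M" using M(2) X(1) y closed_sequentially by blast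
  have "(\<lambda>n. \<Phi> (X n)) \<longlonglongrightarrow> \<Phi> y"
    unfolding \<Phi>_def using y by (intro tendsto_intros f.tendsto)
  moreover have "(\<lambda>n. d + 1 / real (Suc n)) \<longlonglongrightarrow> d + 0"
    by (intro tendsto_intros LIMSEQ_Suc[OF lim_1_over_n])
  ultimately have "\<Phi> y \<le> d"
    by (intro LIMSEQ_le[of "\<lambda>n. \<Phi> (X n)" _ "\<lambda>n. d + 1 / real (Suc n)"]) (use X(2) less_imp_le in auto)
  then have min: "\<Phi> y \<le> \<Phi> x" if "x \<in> M" for x using d_le[OF that] by simp
  have "f x = inner y x" if x: "x \<in> M" for x
  proof (rule ccontr)
    assume ne: "f x \<noteq> inner y x"
    define c where "c = f x - inner y x"
    have c0: "c \<noteq> 0" using ne by (simp add: c_def)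
    have x0: "norm x > 0" using ne f.zero by auto
    \<comment> \<open>This t minimizes the quadratic polynomial in t by which \<Phi> changes along
      x, and the minimum is negative because c is not 0.\<close>
    define t where "t = c / (norm x)\<^sup>2"
    have "y + t *\<^sub>R x \<in> M" using x yM M by (simp add: subspace_add subspace_scale)
    then have "0 \<le> \<Phi> (y + t *\<^sub>R x) - \<Phi> y" using min by simp
    also have "\<dots> = t * (t * (norm x)\<^sup>2) - 2 * t * c"
      by (simp add: \<Phi>_def power2_norm_eq_inner f.scaleR f.add inner_simps inner_commute algebra_simps c_def)
    also have "\<dots> = - (c\<^sup>2 / (norm x)\<^sup>2)" using x0 by (simp add: t_def power2_eq_square)
    finally show False using c0 x0 by (simp add: divide_le_0_iff)
  qed
  with yM show thesis by (rule that)
qed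

lemma riesz:
  fixes f :: "'a::{real_inner,banach} \<Rightarrow> real"
  assumes "bounded_linear f"
  obtains y where "\<And>x. f x = inner y x"
  using riesz_on_subspace[OF assms subspace_UNIV closed_UNIV] that by (metis UNIV_I)

text \<open>If y is the orthogonal projection of z onto M, then z - y is orthogonal to M. This is
  the density criterion behind \<open>closure_span_gen\<close>.\<close>

lemma closed_subspace_eq_UNIV:
  fixes M :: "'a::{real_inner,banach} set"
  assumes "subspace M" "closed M" and perp: "\<And>z. (\<And>x. x \<in> M \<Longrightarrow> inner z x = 0) \<Longrightarrow> z = 0"
  shows "M = UNIV"
proof -
  have "z \<in> M" for z
  proof -
    obtain y where y: "y \<in> M" "\<And>x. x \<in> M \<Longrightarrow> inner z x = inner y x"
      using riesz_on_subspace[OF bounded_linear_inner_right[of z] assms(1,2)] by blast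
    then have "z - y = 0" by (intro perp) (simp add: inner_diff_left)
    then show ?thesis using y by simp
  qed
  then show ?thesis by blast
qed

section \<open>Fredholm operators and compact perturbations\<close>

text \<open>Orthogonal projection onto a finite dimensional space. Its compactness is the form in
  which bounded sequences of such a space get convergent subsequences.\<close>

lemma finite_span_projection:
  fixes B :: "'a::real_inner set"
  assumes "finite B"
  obtains P :: "'a \<Rightarrow>\<^sub>L 'a" where "\<And>x. P x \<in> span B" "\<And>x. x \<in> span B \<Longrightarrow> P x = x"
    "\<And>x y. y \<in> span B \<Longrightarrow> inner (x - P x) y = 0" "compact_blinfun P"
proof -
  obtain C where C: "finite C" "span C = span B" "pairwise orthogonal C"
    using basis_orthogonal[OF assms] by blast
  \<comment> \<open>\<open>C\<close> is orthogonal but not normalized, and it may contain 0;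
    division by zero then contributes the harmless term 0.\<close>
  define p where "p x = (\<Sum>c\<in>C. (inner c x / inner c c) *\<^sub>R c)" for x
  have bl: "bounded_linear p"
    unfolding p_def
    by (intro bounded_linear_sum bounded_linear_scaleR_const
        bounded_linear_compose[OF bounded_linear_divide] bounded_linear_inner_right)
  have app: "blinfun_apply (Blinfun p) = p" using bl by (rule bounded_linear_Blinfun_apply)
  have pB: "p x \<in> span B" for x
    unfolding p_def C(2)[symmetric] by (intro span_sum span_scale span_base)
  have orth: "inner (x - p x) y = 0" if "y \<in> span B" for x y
  proof -
    have "inner c (x - p x) = 0" if c: "c \<in> C" for c
    proof -
      have "inner c (p x) = (\<Sum>d\<in>C. (inner d x / inner d d) * inner c d)"
        by (simp add: p_def inner_sum_right)
      also have "\<dots> = (\<Sum>d\<in>C. if d = c then (inner c x / inner c c) * inner c c else 0)"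
        using C(3) c by (intro sum.cong refl) (auto simp: pairwise_def orthogonal_def)
      also have "\<dots> = inner c x" using C(1) c by simp
      finally show ?thesis by (simp add: inner_diff_right)
    qed
    then have "span C \<subseteq> {y. inner (x - p x) y = 0}"
      by (intro span_minimal subspaceI) (auto simp: inner_add_right inner_add_left inner_commute[of "x - p x"])
    with that C(2) show ?thesis by auto
  qed
  have idem: "p x = x" if "x \<in> span B" for x
  proof -
    have "inner (x - p x) (x - p x) = 0" using that pB by (intro orth) (simp add: span_diff)
    then show ?thesis by simp
  qed
  have "compact_blinfun (Blinfun p)"
    unfolding compact_blinfun_def app
  proof (intro allI impI)
    fix f :: "nat \<Rightarrow> 'a" assume f: "bounded (range f)"
    \<comment> \<open>Induction over the finite set of coefficients produces one subsequence along
      which all of them converge.\<close>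
    have "\<exists>r::nat\<Rightarrow>nat. strict_mono r \<and> (\<forall>c\<in>D. convergent (\<lambda>j. inner c (f (r j))))" if "finite D" for D
      using that
    proof induction
      case (insert c D)
      then obtain r :: "nat \<Rightarrow> nat" where r: "strict_mono r" "\<forall>c\<in>D. convergent (\<lambda>j. inner c (f (r j)))" by blast
      have "bounded (inner c ` range (\<lambda>j. f (r j)))"
        using f by (intro bounded_linear_image bounded_linear_inner_right) (auto simp: bounded_iff)
      then have "bounded (range (\<lambda>j. inner c (f (r j))))" by (simp add: image_image)
      then obtain q :: "nat \<Rightarrow> nat" and l where q: "strict_mono q" "((\<lambda>j. inner c (f (r j))) \<circ> q) \<longlonglongrightarrow> l"
        using bounded_imp_convergent_subsequence by blast
      have "convergent (\<lambda>j. inner d (f (r (q j))))" if "d \<in> D" for d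
        using convergent_subseq_convergent[OF r(2)[rule_format, OF that] q(1)] by (simp add: o_def)
      with q r(1) show ?case
        using strict_mono_o[OF r(1) q(1)] by (intro exI[of _ "r \<circ> q"]) (auto simp: convergent_def o_def)
    qed (auto simp: strict_mono_def intro!: exI[of _ id])
    then obtain r :: "nat \<Rightarrow> nat" where r: "strict_mono r" "\<forall>c\<in>C. convergent (\<lambda>j. inner c (f (r j)))" using C(1) by blast
    then obtain l where l: "\<And>c. c \<in> C \<Longrightarrow> (\<lambda>j. inner c (f (r j))) \<longlonglongrightarrow> l c"
      unfolding convergent_def by metis
    have "(\<lambda>j. p (f (r j))) \<longlonglongrightarrow> (\<Sum>c\<in>C. (l c / inner c c) *\<^sub>R c)"
      unfolding p_def divide_inverse using l by (intro tendsto_intros) auto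
    with r(1) show "\<exists>r::nat\<Rightarrow>nat. strict_mono r \<and> convergent (\<lambda>j. p (f (r j)))"
      by (auto simp: convergent_def)
  qed
  with pB idem orth show thesis by (intro that[of "Blinfun p"]) (simp_all add: app)
qed

text \<open>The spans are real spans, whereas \<open>fredholm\<close> uses complex ones. Adjoining
  the multiples by i of finitely many generators passes from one to the other, so finiteness means
  the same.\<close>

definition fredholm_blinfun :: "('a::real_normed_vector \<Rightarrow>\<^sub>L 'a) \<Rightarrow> bool" where
  "fredholm_blinfun T \<longleftrightarrow> (\<exists>B. finite B \<and> {x. T x = 0} \<subseteq> span B) \<and> closed (range (blinfun_apply T)) \<and>
     (\<exists>B. finite B \<and> span (range (blinfun_apply T) \<union> B) = UNIV)"

text \<open>This property characterizes the operators with closed range and finite dimensional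
  kernel, and it is visibly stable under compact perturbations.\<close>

definition semi_fredholm :: "('a::real_normed_vector \<Rightarrow>\<^sub>L 'b::real_normed_vector) \<Rightarrow> bool" where
  "semi_fredholm T \<longleftrightarrow> (\<forall>f::nat \<Rightarrow> 'a. bounded (range f) \<longrightarrow> convergent (\<lambda>j. T (f j)) \<longrightarrow>
     (\<exists>r::nat \<Rightarrow> nat. strict_mono r \<and> convergent (\<lambda>j. f (r j))))"

text \<open>With u a preimage of the limit, the open mapping constant provides a null sequence w
  such that \<open>f j - u - w j\<close> lies in the kernel. There bounded sequences have convergent
  subsequences, the kernel being finite dimensional.\<close>

lemma semi_fredholmI:
  fixes T :: "'a::{real_inner,banach} \<Rightarrow>\<^sub>L 'b::banach"
  assumes B: "finite B" "{x. T x = 0} \<subseteq> span B" and cl: "closed (range (blinfun_apply T))"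
  shows "semi_fredholm T"
  unfolding semi_fredholm_def
proof (intro allI impI)
  fix f :: "nat \<Rightarrow> 'a" assume f: "bounded (range f)" and "convergent (\<lambda>j. T (f j))"
  then obtain g where g: "(\<lambda>j. T (f j)) \<longlonglongrightarrow> g" by (auto simp: convergent_def)
  then have "g \<in> range (blinfun_apply T)" using closed_sequentially[OF cl, of "\<lambda>j. T (f j)" g] by simp
  then obtain u where u: "g = T u" by blast
  obtain M where M: "M \<ge> 0" "\<And>y. y \<in> range (blinfun_apply T) \<Longrightarrow> \<exists>x. T x = y \<and> norm x \<le> M * norm y"
    by (rule open_mapping_closed_range[OF blinfun.bounded_linear_right cl]) (rule that)
  have "\<exists>w. T w = T (f j) - T u \<and> norm w \<le> M * norm (T (f j) - T u)" for j
    by (rule M(2)) (simp flip: blinfun.diff_right)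
  then obtain w where w: "\<And>j. T (w j) = T (f j) - T u" "\<And>j. norm (w j) \<le> M * norm (T (f j) - T u)"
    by metis
  have "(\<lambda>j. M * norm (T (f j) - T u)) \<longlonglongrightarrow> M * norm (T u - T u)"
    using g unfolding u by (rule tendsto_mult_left[OF tendsto_norm[OF tendsto_diff[OF _ tendsto_const]]])
  then have "(\<lambda>j. M * norm (T (f j) - T u)) \<longlonglongrightarrow> 0" by simp
  then have w0: "w \<longlonglongrightarrow> 0"
    by (rule Lim_null_comparison[rotated]) (use w(2) in auto)
  define z where "z j = f j - u - w j" for j
  have zB: "z j \<in> span B" for j using B w(1) by (auto simp: z_def blinfun.diff_right)
  have "bounded (range w)" using w0 by (meson convergentI convergent_imp_bounded)
  then obtain b where b: "\<And>j. norm (w j) \<le> b" by (auto simp: bounded_iff)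
  obtain a where a: "\<And>j. norm (f j) \<le> a" using f by (auto simp: bounded_iff)
  have "norm (z j) \<le> a + norm u + b" for j
    unfolding z_def using a[of j] b[of j] norm_triangle_ineq4[of "f j - u" "w j"] norm_triangle_ineq4[of "f j" u]
    by linarith
  then have "bounded (range z)" by (auto simp: bounded_iff)
  moreover obtain P :: "'a \<Rightarrow>\<^sub>L 'a" where P: "\<And>x. x \<in> span B \<Longrightarrow> P x = x" "compact_blinfun P"
    by (rule finite_span_projection[OF B(1)]) (rule that)
  ultimately obtain r :: "nat \<Rightarrow> nat" where r: "strict_mono r" "convergent (\<lambda>j. P (z (r j)))"
    unfolding compact_blinfun_def by blast
  have "(\<lambda>j. w (r j)) \<longlonglongrightarrow> 0" using LIMSEQ_subseq_LIMSEQ[OF w0 r(1)] by (simp add: o_def)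
  then have "convergent (\<lambda>j. w (r j))" by (rule convergentI)
  moreover have "convergent (\<lambda>j. z (r j))" using r(2) by (simp add: P(1) zB)
  ultimately have "convergent (\<lambda>j. z (r j) + u + w (r j))"
    by (intro convergent_add convergent_const)
  with r(1) show "\<exists>r::nat\<Rightarrow>nat. strict_mono r \<and> convergent (\<lambda>j. f (r j))" by (auto simp: z_def)
qed

text \<open>On the kernel the property makes the closed unit ball compact, and F. Riesz's argument
  makes the kernel finite dimensional. On the orthogonal complement of the kernel it gives a lower
  bound for T, which closes the range.\<close>

lemma semi_fredholmD:
  fixes T :: "'a::{real_inner,banach} \<Rightarrow>\<^sub>L 'b::banach"
  assumes T: "semi_fredholm T"
  obtains B where "finite B" "span B = {x. T x = 0}" "closed (range (blinfun_apply T))"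
proof -
  define N where "N = {x. T x = 0}"
  have subN: "subspace N" by (auto simp: N_def intro!: subspaceI simp: blinfun.add_right blinfun.scaleR_right)
  have clN: "closed N" unfolding N_def
    by (intro closed_Collect_eq continuous_intros)
  have "seq_compact (N \<inter> cball 0 1)"
  proof (rule seq_compactI)
    fix f :: "nat \<Rightarrow> 'a" assume f: "\<forall>n. f n \<in> N \<inter> cball 0 1"
    then have "bounded (range f)" by (auto simp: bounded_iff)
    moreover have "convergent (\<lambda>j. T (f j))" using f by (auto simp: N_def convergent_const)
    ultimately obtain r :: "nat \<Rightarrow> nat" and l where r: "strict_mono r" "(\<lambda>j. f (r j)) \<longlonglongrightarrow> l"
      using T unfolding semi_fredholm_def convergent_def by metis
    moreover have "l \<in> N \<inter> cball 0 1"
      by (rule closed_sequentially[OF closed_Int[OF clN closed_cball] _ r(2)]) (use f in blast)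
    ultimately show "\<exists>l\<in>N \<inter> cball 0 1. \<exists>r. strict_mono r \<and> (f \<circ> r) \<longlonglongrightarrow> l" by (auto simp: o_def)
  qed
  then obtain B where B: "finite B" "B \<subseteq> N \<inter> cball 0 1" "N \<inter> cball 0 1 \<subseteq> (\<Union>x\<in>B. ball x 1)"
    using seq_compact_imp_totally_bounded zero_less_one by metis
  have BN: "span B \<subseteq> N" using B(2) subN by (intro span_minimal) auto
  obtain P :: "'a \<Rightarrow>\<^sub>L 'a" where P: "\<And>x. P x \<in> span B" "\<And>x. x \<in> span B \<Longrightarrow> P x = x"
    "\<And>x y. y \<in> span B \<Longrightarrow> inner (x - P x) y = 0" by (rule finite_span_projection[OF B(1)]) (rule that)
  have "x \<in> span B" if x: "x \<in> N" for x
  proof (rule ccontr)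
    assume "x \<notin> span B"
    then have ne: "x - P x \<noteq> 0" using P(1)[of x] by auto
    \<comment> \<open>A unit vector of the kernel orthogonal to the net has distance at least 1 from
      every net point, although the net has mesh less than 1.\<close>
    define y where "y = (1 / norm (x - P x)) *\<^sub>R (x - P x)"
    have ny: "norm y = 1" using ne by (simp add: y_def)
    have "y \<in> N" unfolding y_def using x P(1)[of x] BN subN by (auto intro!: subspace_scale subspace_diff)
    then obtain c where c: "c \<in> B" "dist c y < 1" using B(3) ny by fastforce
    have "inner y c = 0" unfolding y_def using P(3)[of c x] c by (simp add: span_base)
    then have "(norm (y - c))\<^sup>2 = 1 + (norm c)\<^sup>2"
      using ny by (simp add: power2_norm_eq_inner inner_diff_left inner_diff_right inner_commute norm_eq_1)
    moreover have "(norm (y - c))\<^sup>2 < 1\<^sup>2"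
      using c(2) by (intro power_strict_mono) (auto simp: dist_norm norm_minus_commute)
    ultimately show False by (simp add: sum_power2_ge_zero not_less)
  qed
  then have sB: "span B = N" using BN by auto
  \<comment> \<open>Otherwise unit vectors u with \<open>P u = 0\<close> and T u tending to 0 would
    subconverge to a unit vector of the kernel annihilated by P, yet P is the identity on the
    kernel.\<close>
  have "\<exists>c>0. \<forall>u. P u = 0 \<longrightarrow> c * norm u \<le> norm (T u)"
  proof (rule ccontr)
    assume neg: "\<not> ?thesis"
    have "\<exists>u. P u = 0 \<and> norm u = 1 \<and> norm (T u) < 1 / real (Suc n)" for n
    proof -
      obtain u where u: "P u = 0" "norm (T u) < (1 / real (Suc n)) * norm u"
        using neg by (metis not_le of_nat_0_less_iff zero_less_Suc zero_less_divide_1_iff)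
      then have "u \<noteq> 0" by auto
      with u show ?thesis
        by (intro exI[of _ "(1 / norm u) *\<^sub>R u"]) (simp add: blinfun.scaleR_right field_simps)
    qed
    then obtain u where u: "\<And>n. P (u n) = 0" "\<And>n. norm (u n) = 1" "\<And>n. norm (T (u n)) < 1 / real (Suc n)" by metis
    have Tu: "(\<lambda>n. T (u n)) \<longlonglongrightarrow> 0"
      by (rule Lim_null_comparison[OF _ LIMSEQ_Suc[OF lim_1_over_n]]) (intro always_eventually allI less_imp_le u(3))
    have "bounded (range u)" using u(2) by (auto simp: bounded_iff intro!: exI[of _ 1])
    then obtain r :: "nat \<Rightarrow> nat" and l where r: "strict_mono r" "(\<lambda>j. u (r j)) \<longlonglongrightarrow> l"
      using T Tu unfolding semi_fredholm_def convergent_def by blast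
    have "(\<lambda>j. T (u (r j))) \<longlonglongrightarrow> T l" "(\<lambda>j. P (u (r j))) \<longlonglongrightarrow> P l" "(\<lambda>j. norm (u (r j))) \<longlonglongrightarrow> norm l"
      using r(2) by (auto intro!: tendsto_intros)
    moreover have "(\<lambda>j. T (u (r j))) \<longlonglongrightarrow> 0" using LIMSEQ_subseq_LIMSEQ[OF Tu r(1)] by (simp add: o_def)
    ultimately have "T l = 0" "P l = 0" "norm l = 1" 
      using u(1,2) by (auto dest: LIMSEQ_unique simp: LIMSEQ_const_iff)
    then show False using sB P(2)[of l] by (auto simp: N_def)
  qed
  then obtain c where c: "c > 0" "\<And>u. P u = 0 \<Longrightarrow> c * norm u \<le> norm (T u)" by blast
  have "closed (range (blinfun_apply T))"
    unfolding closed_sequential_limits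
  proof (intro allI impI)
    fix h g assume hg: "(\<forall>n. h n \<in> range (blinfun_apply T)) \<and> h \<longlonglongrightarrow> g"
    then have "\<forall>n. \<exists>v. h n = T v" by blast
    then obtain v where v: "\<And>n. h n = T (v n)" by metis
    define u where "u n = v n - P (v n)" for n
    have Pu: "P (u n - u m) = 0" for n m
      using P(1,2) by (simp add: u_def blinfun.diff_right)
    have TP: "T (P x) = 0" for x using P(1)[of x] sB by (auto simp: N_def)
    have hu: "h n = T (u n)" for n by (simp add: u_def v blinfun.diff_right TP)
    have "Cauchy u"
    proof (rule metric_CauchyI)
      fix e :: real assume "e > 0"
      then have "c * e > 0" using c by simp
      moreover have "Cauchy h" using hg LIMSEQ_imp_Cauchy by blast
      ultimately obtain N where N: "\<And>m n. m \<ge> N \<Longrightarrow> n \<ge> N \<Longrightarrow> dist (h m) (h n) < c * e"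
        unfolding Cauchy_def by meson
      have "dist (u m) (u n) < e" if "m \<ge> N" "n \<ge> N" for m n
      proof -
        have "c * norm (u m - u n) \<le> norm (h m - h n)"
          using c(2)[OF Pu[of m n]] by (simp add: hu blinfun.diff_right)
        then have "c * norm (u m - u n) < c * e" using N[OF that] by (simp add: dist_norm)
        then show ?thesis using c(1) by (simp add: dist_norm)
      qed
      then show "\<exists>N. \<forall>m\<ge>N. \<forall>n\<ge>N. dist (u m) (u n) < e" by blast
    qed
    then obtain l where "u \<longlonglongrightarrow> l" using Cauchy_convergent convergent_def by blast
    then have "(\<lambda>n. T (u n)) \<longlonglongrightarrow> T l" by (intro tendsto_intros)
    then have "g = T l" using hg hu LIMSEQ_unique by (metis (no_types, lifting) ext)
    then show "g \<in> range (blinfun_apply T)" by blast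
  qed
  with B(1) sB show thesis using that by (auto simp: N_def)
qed

lemma semi_fredholm_add_compact:
  fixes T K :: "'a::real_normed_vector \<Rightarrow>\<^sub>L 'b::real_normed_vector"
  assumes "semi_fredholm T" "compact_blinfun K"
  shows "semi_fredholm (T + K)"
  unfolding semi_fredholm_def
proof (intro allI impI)
  fix f :: "nat \<Rightarrow> 'a" assume f: "bounded (range f)" "convergent (\<lambda>j. (T + K) (f j))"
  then obtain r :: "nat \<Rightarrow> nat" where r: "strict_mono r" "convergent (\<lambda>j. K (f (r j)))"
    using assms(2) by (auto simp: compact_blinfun_def)
  have "convergent (\<lambda>j. (T + K) (f (r j)))"
    using convergent_subseq_convergent[OF f(2) r(1)] by (simp add: o_def)
  from convergent_diff[OF this r(2)] have "convergent (\<lambda>j. T (f (r j)))" by (simp add: blinfun.add_left)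
  moreover have "bounded (range (\<lambda>j. f (r j)))" using f(1) by (auto simp: bounded_iff)
  ultimately obtain q :: "nat \<Rightarrow> nat" where q: "strict_mono q" "convergent (\<lambda>j. f (r (q j)))"
    using assms(1) unfolding semi_fredholm_def by blast
  then show "\<exists>r::nat\<Rightarrow>nat. strict_mono r \<and> convergent (\<lambda>j. f (r j))"
    using strict_mono_o[OF r(1) q(1)] by (intro exI[of _ "r \<circ> q"]) auto
qed

text \<open>Finite codimension: \<open>(x, y) \<mapsto> T x + P y\<close>, with \<open>P\<close> a projection onto a complement, is
  surjective, hence remains so under small perturbations, and the remaining part of the compact
  operator has finite rank.\<close>

lemma finite_codim_add_compact:
  fixes T K :: "'a::{real_inner,banach} \<Rightarrow>\<^sub>L 'a"
  assumes B: "finite B" "span (range (blinfun_apply T) \<union> B) = UNIV" and K: "compact_blinfun K"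
  shows "\<exists>B. finite B \<and> span (range (blinfun_apply (T + K)) \<union> B) = UNIV"
proof -
  obtain P :: "'a \<Rightarrow>\<^sub>L 'a" where P: "\<And>x. P x \<in> span B" "\<And>x. x \<in> span B \<Longrightarrow> P x = x"
    by (rule finite_span_projection[OF B(1)]) (rule that)
  define \<Psi> where "\<Psi> p = T (fst p) + P (snd p)" for p
  have bl\<Psi>: "bounded_linear \<Psi>"
    unfolding \<Psi>_def
    by (intro bounded_linear_add bounded_linear_compose[OF blinfun.bounded_linear_right]
        bounded_linear_fst bounded_linear_snd)
  have "y \<in> range \<Psi>" for y
  proof -
    have sp: "span (range (blinfun_apply T)) = range (blinfun_apply T)"
      by (rule span_eq_iff[THEN iffD2]) (metis blinfun.bounded_linear_right bounded_linear.linear linear_subspace_image subspace_UNIV)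
    have "y \<in> span (range (blinfun_apply T) \<union> B)" using B(2) by simp
    then obtain a b where "a \<in> range (blinfun_apply T)" "b \<in> span B" "y = a + b"
      unfolding span_Un sp by auto
    then obtain x where "y = T x + P b" using P(2) by auto
    then have "y = \<Psi> (x, b)" by (simp add: \<Psi>_def)
    then show ?thesis by blast
  qed
  then have "range \<Psi> = UNIV" by blast
  then obtain M where M: "M \<ge> 0" "\<And>y. \<exists>p. \<Psi> p = y \<and> norm p \<le> M * norm y"
    using open_mapping_closed_range[OF bl\<Psi>] by (metis UNIV_I closed_UNIV)
  \<comment> \<open>The tolerance is chosen so that the part of K left after removing finite rank,
    applied to a preimage bounded by M, costs at most half of the norm.\<close>
  obtain C where C: "finite C" "\<And>x. norm x \<le> 1 \<Longrightarrow> \<exists>c\<in>C. norm (K x - c) < 1 / (2 * (M + 1))"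
    using compact_blinfun_totally_bounded[OF K, of "1 / (2 * (M + 1))"] M(1) by auto
  obtain Q :: "'a \<Rightarrow>\<^sub>L 'a" where Q: "\<And>x. Q x \<in> span C"
      "\<And>x y. y \<in> span C \<Longrightarrow> inner (x - Q x) y = 0"
    by (rule finite_span_projection[OF C(1)]) (rule that)
  have small: "norm (K x - Q (K x)) \<le> 1 / (2 * (M + 1)) * norm x" for x
  proof (cases "x = 0")
    case False
    define x' where "x' = (1 / norm x) *\<^sub>R x"
    have "norm x' \<le> 1" by (simp add: x'_def)
    then obtain c where c: "c \<in> C" "norm (K x' - c) < 1 / (2 * (M + 1))" using C(2) by blast
    \<comment> \<open>\<open>Q (K x')\<close> is the best approximation of \<open>K x'\<close> in
      the span of the net, so it is at least as close as the net point c.\<close>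
    have "inner (K x' - Q (K x')) (Q (K x') - c) = 0"
      using Q c by (intro Q(2)) (auto intro!: span_diff simp: span_base)
    then have "(norm (K x' - Q (K x') + (Q (K x') - c)))\<^sup>2 = (norm (K x' - Q (K x')))\<^sup>2 + (norm (Q (K x') - c))\<^sup>2"
      by (intro norm_add_Pythagorean) (simp add: orthogonal_def)
    then have "(norm (K x' - Q (K x')))\<^sup>2 \<le> (norm (K x' - c))\<^sup>2" by simp
    then have "norm (K x' - Q (K x')) \<le> norm (K x' - c)" by (rule power2_le_imp_le) simp
    moreover have "K x - Q (K x) = norm x *\<^sub>R (K x' - Q (K x'))"
      using False by (simp add: x'_def blinfun.scaleR_right scaleR_diff_right[symmetric])
    ultimately have "norm (K x - Q (K x)) = norm x * norm (K x' - Q (K x'))" "norm (K x' - Q (K x')) \<le> 1 / (2 * (M + 1))"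
      using c by auto
    then show ?thesis by (metis mult.commute mult_left_mono norm_ge_zero)
  qed (simp add: blinfun.zero_right)
  \<comment> \<open>The added operator is K without its finite rank part. When
    \<open>\<Psi>' p = y\<close> is solved, the removed part and the term with P lie in the finite
    dimensional spans that are adjoined to the range of \<open>T + K\<close>.\<close>
  define \<Psi>' where "\<Psi>' p = \<Psi> p + (K (fst p) - Q (K (fst p)))" for p
  have bl\<Psi>': "bounded_linear \<Psi>'"
    unfolding \<Psi>'_def
    by (intro bounded_linear_add bl\<Psi> bounded_linear_sub bounded_linear_compose[OF blinfun.bounded_linear_right]
        bounded_linear_fst)
  have surj: "\<exists>p. \<Psi>' p = y \<and> norm p \<le> 2 * M * norm y" for y
  proof (rule approx_solvable_imp_solvable[OF bl\<Psi>' subspace_UNIV UNIV_I M(1) _ UNIV_I])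
    fix y
    obtain p where p: "\<Psi> p = y" "norm p \<le> M * norm y" using M(2) by blast
    have "norm (y - \<Psi>' p) = norm (K (fst p) - Q (K (fst p)))" using p by (simp add: \<Psi>'_def norm_minus_commute)
    also have "\<dots> \<le> 1 / (2 * (M + 1)) * norm (fst p)" by (rule small)
    also have "\<dots> \<le> 1 / (2 * (M + 1)) * (M * norm y)"
      using p(2) norm_fst_le[of "fst p" "snd p"] M(1) by (intro mult_left_mono) auto
    also have "\<dots> \<le> norm y / 2"
    proof -
      have "M * norm y \<le> (M + 1) * norm y" by (simp add: algebra_simps)
      then show ?thesis using M(1) by (simp add: field_simps)
    qed
    finally show "\<exists>x. norm x \<le> M * norm y \<and> norm (y - \<Psi>' x) \<le> norm y / 2" using p by blast
  qed
  have "span (range (blinfun_apply (T + K)) \<union> (B \<union> C)) = UNIV"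
  proof -
    have "y \<in> span (range (blinfun_apply (T + K)) \<union> (B \<union> C))" for y
    proof -
      obtain p where "\<Psi>' p = y" using surj by blast
      moreover have "\<Psi>' p = (T + K) (fst p) + P (snd p) - Q (K (fst p))"
        by (simp add: \<Psi>'_def \<Psi>_def blinfun.add_left algebra_simps)
      ultimately have "y = (T + K) (fst p) + P (snd p) - Q (K (fst p))" by simp
      moreover have "span B \<subseteq> span (range (blinfun_apply (T + K)) \<union> (B \<union> C))"
        "span C \<subseteq> span (range (blinfun_apply (T + K)) \<union> (B \<union> C))" by (auto intro!: span_mono)
      ultimately show ?thesis
        using P(1)[of "snd p"] Q(1)[of "K (fst p)"] by (auto intro!: span_diff span_add simp: span_base)
    qed
    then show ?thesis by blast
  qed
  then show ?thesis using B(1) C(1) by (intro exI[of _ "B \<union> C"]) auto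
qed

theorem fredholm_blinfun_add_compact:
  fixes T K :: "'a::{real_inner,banach} \<Rightarrow>\<^sub>L 'a"
  assumes "fredholm_blinfun T" "compact_blinfun K"
  shows "fredholm_blinfun (T + K)"
proof -
  have "semi_fredholm (T + K)"
    using assms semi_fredholmI semi_fredholm_add_compact unfolding fredholm_blinfun_def by blast
  then obtain B where "finite B" "span B = {x. (T + K) x = 0}" "closed (range (blinfun_apply (T + K)))"
    by (rule semi_fredholmD)
  then show ?thesis
    using finite_codim_add_compact[of _ T K] assms unfolding fredholm_blinfun_def by blast
qed

section \<open>Schwartz functions\<close>

lemma partial_deriv_eq:
  fixes f :: "real^'n \<Rightarrow> complex"
  shows "(f has_derivative f') (at x) \<Longrightarrow> partial_deriv k f x = f' (axis k 1)"
  unfolding partial_deriv_def by (metis frechet_derivative_at)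

lemma differentiable_has_frechet:
  "f differentiable at x \<Longrightarrow> (f has_derivative frechet_derivative f (at x)) (at x)"
  by (simp add: frechet_derivative_works)

lemma partial_deriv_add:
  fixes f g :: "real^'n \<Rightarrow> complex"
  assumes "\<And>x. f differentiable at x" "\<And>x. g differentiable at x"
  shows "partial_deriv k (\<lambda>x. f x + g x) = (\<lambda>x. partial_deriv k f x + partial_deriv k g x)"
proof
  fix x
  show "partial_deriv k (\<lambda>x. f x + g x) x = partial_deriv k f x + partial_deriv k g x"
    using partial_deriv_eq[OF has_derivative_add[OF assms[THEN differentiable_has_frechet]]]
    by (simp add: partial_deriv_def)
qed

lemma partial_deriv_mult:
  fixes f g :: "real^'n \<Rightarrow> complex"
  assumes "\<And>x. f differentiable at x" "\<And>x. g differentiable at x"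
  shows "partial_deriv k (\<lambda>x. f x * g x) = (\<lambda>x. partial_deriv k f x * g x + f x * partial_deriv k g x)"
proof
  fix x
  show "partial_deriv k (\<lambda>x. f x * g x) x = partial_deriv k f x * g x + f x * partial_deriv k g x"
    using partial_deriv_eq[OF has_derivative_mult[OF assms[THEN differentiable_has_frechet]]]
    by (simp add: partial_deriv_def algebra_simps)
qed

lemma partial_deriv_const: "partial_deriv k (\<lambda>x. c) = (\<lambda>x. 0)"
  by (rule ext) (rule partial_deriv_eq[OF has_derivative_const])

text \<open>A tree of derivatives: each step peels off the derivative applied first, and Q is
  imposed at every node down to depth N. With Q trivial, \<open>decays\<close> or
  \<open>slow\<close> it describes smooth functions, Schwartz functions and their multipliers, so
  closure properties are proved by one induction on N instead of on lists of directions.\<close>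

fun diff_level :: "((real^'n \<Rightarrow> complex) \<Rightarrow> bool) \<Rightarrow> nat \<Rightarrow> (real^'n \<Rightarrow> complex) \<Rightarrow> bool" where
  "diff_level Q 0 f \<longleftrightarrow> (\<forall>x. f differentiable at x) \<and> Q f"
| "diff_level Q (Suc N) f \<longleftrightarrow>
     (\<forall>x. f differentiable at x) \<and> Q f \<and> (\<forall>k. diff_level Q N (partial_deriv k f))"

lemma diff_level_differentiable: "diff_level Q N f \<Longrightarrow> f differentiable at x"
  by (cases N) auto

lemma diff_level_base: "diff_level Q N f \<Longrightarrow> Q f"
  by (cases N) auto

lemma diff_level_SucD: "diff_level Q (Suc N) f \<Longrightarrow> diff_level Q N f"
  by (induction N arbitrary: f) auto

lemma iter_partial_Nil: "iter_partial [] f = f"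
  by (simp add: iter_partial_def)

lemma iter_partial_snoc: "iter_partial (ks @ [k]) f = iter_partial ks (partial_deriv k f)"
  by (simp add: iter_partial_def)

text \<open>The last entry of a list of directions is the derivative applied first, so lists are
  taken apart from the right.\<close>

lemma diff_level_iff:
  "diff_level Q N f \<longleftrightarrow>
     (\<forall>ks. length ks \<le> N \<longrightarrow> (\<forall>x. iter_partial ks f differentiable at x) \<and> Q (iter_partial ks f))"
proof (induction N arbitrary: f)
  case (Suc N)
  let ?G = "\<lambda>ks f. (\<forall>x. iter_partial ks f differentiable at x) \<and> Q (iter_partial ks f)"
  show ?case
  proof
    assume L: "diff_level Q (Suc N) f"
    show "\<forall>ks. length ks \<le> Suc N \<longrightarrow> ?G ks f"
    proof (intro allI impI)
      fix ks :: "'a list" assume len: "length ks \<le> Suc N"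
      show "?G ks f"
      proof (cases ks rule: rev_cases)
        case Nil with L show ?thesis by (simp add: iter_partial_Nil)
      next
        case (snoc ys k)
        with L len Suc[of "partial_deriv k f"] show ?thesis by (simp add: iter_partial_snoc)
      qed
    qed
  next
    assume R: "\<forall>ks. length ks \<le> Suc N \<longrightarrow> ?G ks f"
    have "diff_level Q N (partial_deriv k f)" for k
      unfolding Suc using R[rule_format, of "ks @ [k]" for ks] by (simp add: iter_partial_snoc)
    with R[rule_format, of "[]"] show "diff_level Q (Suc N) f" by (simp add: iter_partial_Nil)
  qed
qed (simp add: iter_partial_Nil)

lemma diff_level_add:
  assumes Q: "\<And>f g. Q f \<Longrightarrow> Q g \<Longrightarrow> Q (\<lambda>x. f x + g x)"
  shows "diff_level Q N f \<Longrightarrow> diff_level Q N g \<Longrightarrow> diff_level Q N (\<lambda>x. f x + g x)"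
  by (induction N arbitrary: f g) (auto simp: partial_deriv_add Q)

text \<open>Leibniz' rule by induction on the depth. Three predicates are kept apart so that slow
  growth times rapid decay can decay.\<close>

lemma diff_level_mult:
  assumes Q: "\<And>f g. Q1 f \<Longrightarrow> Q2 g \<Longrightarrow> Q (\<lambda>x. f x * g x)"
    and add: "\<And>f g. Q f \<Longrightarrow> Q g \<Longrightarrow> Q (\<lambda>x. f x + g x)"
  shows "diff_level Q1 N f \<Longrightarrow> diff_level Q2 N g \<Longrightarrow> diff_level Q N (\<lambda>x. f x * g x)"
proof (induction N arbitrary: f g)
  case (Suc N)
  have d: "\<And>x. f differentiable at x" "\<And>x. g differentiable at x"
    using Suc.prems diff_level_differentiable by blast+
  have "diff_level Q N (\<lambda>x. partial_deriv k f x * g x + f x * partial_deriv k g x)" for k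
    by (intro diff_level_add add Suc.IH) (use Suc.prems diff_level_SucD in auto)
  moreover have "Q (\<lambda>x. f x * g x)" using Suc.prems by (intro Q) auto
  ultimately show ?case using d by (auto simp: partial_deriv_mult)
qed (auto intro: Q)

lemma diff_level_scale:
  fixes c :: real
  assumes Q: "\<And>f a. Q f \<Longrightarrow> Q (\<lambda>x. a * f (c *\<^sub>R x))"
  shows "diff_level Q N f \<Longrightarrow> diff_level Q N (\<lambda>x. a * f (c *\<^sub>R x))"
proof (induction N arbitrary: f a)
  case (Suc N)
  have d: "(f has_derivative frechet_derivative f (at x)) (at x)" for x
    using Suc.prems by (auto intro: differentiable_has_frechet)
  have hd: "((\<lambda>x. a * f (c *\<^sub>R x)) has_derivative (\<lambda>h. a * frechet_derivative f (at (c *\<^sub>R x)) (c *\<^sub>R h))) (at x)" for x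
    by (rule has_derivative_mult_right, rule has_derivative_compose[OF _ d])
      (auto intro!: derivative_eq_intros)
  have pd: "partial_deriv k (\<lambda>x. a * f (c *\<^sub>R x)) = (\<lambda>x. (a * complex_of_real c) * partial_deriv k f (c *\<^sub>R x))" for k
  proof
    fix x
    interpret D: bounded_linear "frechet_derivative f (at (c *\<^sub>R x))"
      using d[of "c *\<^sub>R x"] by (rule has_derivative_bounded_linear)
    show "partial_deriv k (\<lambda>x. a * f (c *\<^sub>R x)) x = (a * complex_of_real c) * partial_deriv k f (c *\<^sub>R x)"
      using partial_deriv_eq[OF hd[of x], of k]
      unfolding D.scaleR by (simp add: partial_deriv_def scaleR_conv_of_real)
  qed
  have "diff_level Q N (partial_deriv k (\<lambda>x. a * f (c *\<^sub>R x)))" for k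
    unfolding pd using Suc by auto
  moreover have "Q (\<lambda>x. a * f (c *\<^sub>R x))" using Suc.prems by (intro Q) auto
  ultimately show ?case using hd by (auto simp: differentiable_def)
next
  case 0
  then have "f differentiable at (c *\<^sub>R x)" for x by auto
  then have "(\<lambda>x. f (c *\<^sub>R x)) differentiable at x" for x
    by (rule differentiable_compose) auto
  with 0 show ?case by (auto intro: Q)
qed

lemma smooth_iff: "smooth f \<longleftrightarrow> (\<forall>N. diff_level (\<lambda>_. True) N f)"
  unfolding smooth_def diff_level_iff by auto

section \<open>Rapid decay, polynomial growth and multipliers of the Schwartz space\<close>

definition decays :: "(real^'n \<Rightarrow> complex) \<Rightarrow> bool" where
  "decays f \<longleftrightarrow> (\<forall>N. \<exists>C. \<forall>x. (1 + norm x) ^ N * norm (f x) \<le> C)"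

lemma decays_iff: "decays f \<longleftrightarrow> (\<forall>N. bounded (range (\<lambda>x. (1 + norm x) ^ N *\<^sub>R f x)))"
proof -
  have "norm ((1 + norm x) ^ N *\<^sub>R f x) = (1 + norm x) ^ N * norm (f x)" for x N
    by (simp add: abs_of_nonneg)
  then show ?thesis by (simp add: decays_def bounded_iff)
qed

lemma schwartz_iff: "\<phi> \<in> schwartz \<longleftrightarrow> (\<forall>N. diff_level decays N \<phi>)"
  unfolding schwartz_def smooth_def diff_level_iff decays_iff by auto

lemma schwartz_differentiable: "\<phi> \<in> schwartz \<Longrightarrow> \<phi> differentiable at x"
  using diff_level_differentiable schwartz_iff by blast

lemma schwartz_decays: "\<phi> \<in> schwartz \<Longrightarrow> decays \<phi>"
  using diff_level_base schwartz_iff by blast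

lemma schwartz_partial: "\<phi> \<in> schwartz \<Longrightarrow> partial_deriv k \<phi> \<in> schwartz"
  unfolding schwartz_iff by (meson diff_level.simps(2))

lemma schwartz_bound:
  assumes "\<phi> \<in> schwartz"
  obtains C where "C \<ge> 0" "\<And>x. norm (\<phi> x) \<le> C / (1 + norm x) ^ N"
proof -
  obtain C where C: "\<And>x. (1 + norm x) ^ N * norm (\<phi> x) \<le> C"
    using schwartz_decays[OF assms] unfolding decays_def by metis
  have "0 \<le> (1 + norm (0::real^'a)) ^ N * norm (\<phi> 0)" by simp
  then have "C \<ge> 0" using C[of 0] by linarith
  moreover have "norm (\<phi> x) \<le> C / (1 + norm x) ^ N" for x
    using C[of x] by (simp add: pos_le_divide_eq add_pos_nonneg mult.commute)
  ultimately show thesis by (rule that)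
qed

definition slow :: "(real^'n \<Rightarrow> complex) \<Rightarrow> bool" where
  "slow f \<longleftrightarrow> (\<exists>N C. C \<ge> 0 \<and> (\<forall>x. norm (f x) \<le> C * (1 + norm x) ^ N))"

text \<open>The multiplier space of the Schwartz space, often written O_M: every derivative is
  bounded by a polynomial whose degree may depend on the derivative.\<close>

definition slowly_growing :: "(real^'n \<Rightarrow> complex) set" where
  "slowly_growing = {f. \<forall>N. diff_level slow N f}"

lemma decays_add:
  assumes "decays f" "decays g" shows "decays (\<lambda>x. f x + g x)"
  unfolding decays_def
proof
  fix N
  obtain C D where CD: "\<And>x. (1 + norm x) ^ N * norm (f x) \<le> C" "\<And>x. (1 + norm x) ^ N * norm (g x) \<le> D"
    using assms unfolding decays_def by metis
  have "(1 + norm x) ^ N * norm (f x + g x) \<le> C + D" for x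
  proof -
    have "(1 + norm x) ^ N * norm (f x + g x) \<le> (1 + norm x) ^ N * (norm (f x) + norm (g x))"
      by (intro mult_left_mono norm_triangle_ineq) auto
    also have "\<dots> \<le> C + D" using CD[of x] by (simp add: distrib_left)
    finally show ?thesis .
  qed
  then show "\<exists>C. \<forall>x. (1 + norm x) ^ N * norm (f x + g x) \<le> C" by blast
qed

lemma slow_add:
  assumes "slow f" "slow g" shows "slow (\<lambda>x. f x + g x)"
proof -
  obtain M C N D where *: "C \<ge> 0" "D \<ge> 0" "\<And>x. norm (f x) \<le> C * (1 + norm x) ^ M" "\<And>x. norm (g x) \<le> D * (1 + norm x) ^ N"
    using assms unfolding slow_def by metis
  have "norm (f x + g x) \<le> (C + D) * (1 + norm x) ^ (M + N)" for x
  proof -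
    have "norm (f x + g x) \<le> norm (f x) + norm (g x)" by (rule norm_triangle_ineq)
    also have "\<dots> \<le> C * (1 + norm x) ^ M + D * (1 + norm x) ^ N" by (intro add_mono *)
    also have "\<dots> \<le> C * (1 + norm x) ^ (M + N) + D * (1 + norm x) ^ (M + N)"
      by (intro add_mono mult_left_mono power_increasing *) auto
    finally show ?thesis by (simp add: algebra_simps)
  qed
  then show ?thesis using * unfolding slow_def by (meson add_nonneg_nonneg)
qed

lemma slow_mult:
  assumes "slow f" "slow g" shows "slow (\<lambda>x. f x * g x)"
proof -
  obtain M C N D where *: "C \<ge> 0" "D \<ge> 0" "\<And>x. norm (f x) \<le> C * (1 + norm x) ^ M" "\<And>x. norm (g x) \<le> D * (1 + norm x) ^ N"
    using assms unfolding slow_def by metis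
  have "norm (f x * g x) \<le> (C * D) * (1 + norm x) ^ (M + N)" for x
  proof -
    have "norm (f x * g x) \<le> (C * (1 + norm x) ^ M) * (D * (1 + norm x) ^ N)"
      unfolding norm_mult by (intro mult_mono *) (use *(1) in auto)
    then show ?thesis by (simp add: power_add mult_ac)
  qed
  then show ?thesis using * unfolding slow_def by (meson mult_nonneg_nonneg)
qed

lemma slow_mult_decays:
  assumes "slow f" "decays g" shows "decays (\<lambda>x. f x * g x)"
  unfolding decays_def
proof
  fix N
  obtain M C where *: "C \<ge> 0" "\<And>x. norm (f x) \<le> C * (1 + norm x) ^ M" using assms unfolding slow_def by metis
  obtain D where D: "\<And>x. (1 + norm x) ^ (N + M) * norm (g x) \<le> D"
    using assms unfolding decays_def by metis
  have "(1 + norm x) ^ N * norm (f x * g x) \<le> C * D" for x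
  proof -
    have "(1 + norm x) ^ N * norm (f x * g x) \<le> (1 + norm x) ^ N * ((C * (1 + norm x) ^ M) * norm (g x))"
      unfolding norm_mult by (intro mult_left_mono mult_right_mono *) auto
    also have "\<dots> = C * ((1 + norm x) ^ (N + M) * norm (g x))" by (simp add: power_add mult_ac)
    also have "\<dots> \<le> C * D" by (intro mult_left_mono D *)
    finally show ?thesis .
  qed
  then show "\<exists>C. \<forall>x. (1 + norm x) ^ N * norm (f x * g x) \<le> C" by blast
qed

lemma slow_bounded: "(\<And>x. norm (f x) \<le> C) \<Longrightarrow> slow f"
  unfolding slow_def by (metis mult.right_neutral norm_ge_zero order_trans power_0)

lemma decays_imp_slow: assumes "decays f" shows "slow f"
proof -
  obtain C where "\<And>x. (1 + norm x) ^ 0 * norm (f x) \<le> C" using assms unfolding decays_def by metis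
  then show ?thesis by (intro slow_bounded[of f C]) auto
qed

lemma schwartz_add: "\<phi> \<in> schwartz \<Longrightarrow> \<psi> \<in> schwartz \<Longrightarrow> (\<lambda>x. \<phi> x + \<psi> x) \<in> schwartz"
  unfolding schwartz_iff by (blast intro: diff_level_add decays_add)

lemma slowly_growing_mult_schwartz:
  "g \<in> slowly_growing \<Longrightarrow> \<phi> \<in> schwartz \<Longrightarrow> (\<lambda>x. g x * \<phi> x) \<in> schwartz"
  unfolding schwartz_iff slowly_growing_def by (blast intro: diff_level_mult slow_mult_decays decays_add)

lemma diff_level_slow_const: "diff_level slow N (\<lambda>x. c)"
proof (induction N arbitrary: c)
  have "slow (\<lambda>x. c)" for c by (rule slow_bounded[of _ "norm c"]) simp
  moreover case (Suc N)
  ultimately show ?case by (auto simp: partial_deriv_const)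
next
  show "diff_level slow 0 (\<lambda>x. c)" for c
    by (auto intro!: slow_bounded[of _ "norm c"])
qed

lemma slowly_growing_const: "(\<lambda>x. c) \<in> slowly_growing"
  by (simp add: slowly_growing_def diff_level_slow_const)

lemma schwartz_cmult: "\<phi> \<in> schwartz \<Longrightarrow> (\<lambda>x. c * \<phi> x) \<in> schwartz"
  by (rule slowly_growing_mult_schwartz[OF slowly_growing_const])

lemma schwartz_diff: "\<phi> \<in> schwartz \<Longrightarrow> \<psi> \<in> schwartz \<Longrightarrow> (\<lambda>x. \<phi> x - \<psi> x) \<in> schwartz"
  using schwartz_add[OF _ schwartz_cmult[of \<psi> "-1"]] by simp

lemma has_derivative_coord:
  "((\<lambda>x::real^'n. complex_of_real (x $ k)) has_derivative (\<lambda>h. complex_of_real (h $ k))) (at x)"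
  by (auto intro!: derivative_eq_intros bounded_linear_imp_has_derivative
      bounded_linear_compose[OF bounded_linear_of_real] bounded_linear_vec_nth)

lemma slowly_growing_coord: "(\<lambda>x::real^'n. complex_of_real (x $ k)) \<in> slowly_growing"
proof -
  have "slow (\<lambda>x::real^'n. complex_of_real (x $ k))"
    unfolding slow_def
  proof (intro exI[of _ 1] conjI allI)
    fix x :: "real^'n"
    show "norm (complex_of_real (x $ k)) \<le> 1 * (1 + norm x) ^ 1"
      using component_le_norm_cart[of x k] by simp
  qed auto
  moreover have "partial_deriv j (\<lambda>x::real^'n. complex_of_real (x $ k)) = (\<lambda>x. complex_of_real (axis j 1 $ k))" for j
    by (rule ext) (rule partial_deriv_eq[OF has_derivative_coord])
  moreover have "(\<lambda>x::real^'n. complex_of_real (x $ k)) differentiable at x" for x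
    using has_derivative_coord differentiable_def by blast
  moreover have "diff_level slow N (\<lambda>x::real^'n. complex_of_real (axis j 1 $ k))" for N j
    by (rule diff_level_slow_const)
  ultimately have "diff_level slow N (\<lambda>x::real^'n. complex_of_real (x $ k))" for N
    by (cases N) auto
  then show ?thesis by (simp add: slowly_growing_def)
qed

lemma schwartz_coord: "\<phi> \<in> schwartz \<Longrightarrow> (\<lambda>x. complex_of_real (x $ k) * \<phi> x) \<in> schwartz"
  by (rule slowly_growing_mult_schwartz[OF slowly_growing_coord])

lemma slowly_growing_plane_wave: "(\<lambda>x::real^'n. exp (\<i> * complex_of_real (x \<bullet> \<xi>))) \<in> slowly_growing"
proof -
  \<comment> \<open>The constant c is carried along because differentiation changes only this
    factor; the family is then stable under derivatives and the induction closes.\<close>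
  let ?e = "\<lambda>c (x::real^'n). c * exp (\<i> * complex_of_real (x \<bullet> \<xi>))"
  have hd: "(?e c has_derivative (\<lambda>h. c * (exp (\<i> * complex_of_real (x \<bullet> \<xi>)) * (\<i> * complex_of_real (h \<bullet> \<xi>))))) (at x)" for c x
  proof (rule has_derivative_mult_right)
    have "bounded_linear (\<lambda>h. \<i> * complex_of_real (h \<bullet> \<xi>))"
      by (intro bounded_linear_mult_right[THEN bounded_linear_compose] bounded_linear_of_real[THEN bounded_linear_compose]
          bounded_linear_inner_left)
    from has_derivative_compose[OF bounded_linear_imp_has_derivative[OF this] DERIV_exp[unfolded has_field_derivative_def]]
    show "((\<lambda>x. exp (\<i> * complex_of_real (x \<bullet> \<xi>))) has_derivative
        (\<lambda>h. exp (\<i> * complex_of_real (x \<bullet> \<xi>)) * (\<i> * complex_of_real (h \<bullet> \<xi>)))) (at x)"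
      by (simp add: mult_ac)
  qed
  have "slow (?e c)" for c by (rule slow_bounded[of _ "norm c"]) (simp add: norm_mult)
  moreover have "partial_deriv k (?e c) = ?e (c * \<i> * complex_of_real (axis k 1 \<bullet> \<xi>))" for k c
    by (rule ext, subst partial_deriv_eq[OF hd]) (simp add: mult_ac)
  moreover have "?e c differentiable at x" for c x using hd differentiable_def by blast
  ultimately have "diff_level slow N (?e c)" for N c
    by (induction N arbitrary: c) auto
  from this[of _ 1] show ?thesis by (simp add: slowly_growing_def)
qed

lemma schwartz_plane_wave:
  "\<phi> \<in> schwartz \<Longrightarrow> (\<lambda>x. exp (\<i> * complex_of_real (x \<bullet> \<xi>)) * \<phi> x) \<in> schwartz"
  by (rule slowly_growing_mult_schwartz[OF slowly_growing_plane_wave])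

lemma schwartz_scale:
  fixes \<phi> :: "real^'n \<Rightarrow> complex" and c :: real
  assumes "c \<noteq> 0" "\<phi> \<in> schwartz"
  shows "(\<lambda>x. \<phi> (c *\<^sub>R x)) \<in> schwartz"
proof -
  have dec: "decays (\<lambda>x. a * f (c *\<^sub>R x))" if f: "decays f" for f :: "real^'n \<Rightarrow> complex" and a
    unfolding decays_def
  proof
    fix N
    obtain C where C: "\<And>x. (1 + norm x) ^ N * norm (f x) \<le> C" using f unfolding decays_def by metis
    \<comment> \<open>For this d one has 1 + norm x \<le> d (1 + norm (c x)) for all x, whether |c|
      is small or large.\<close>
    define d where "d = 1 + 1 / \<bar>c\<bar>"
    have d: "d \<ge> 0" by (simp add: d_def)
    have "(1 + norm x) ^ N * norm (a * f (c *\<^sub>R x)) \<le> d ^ N * norm a * C" for x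
    proof -
      have "1 + norm x \<le> d * (1 + norm (c *\<^sub>R x))"
        using \<open>c \<noteq> 0\<close> by (simp add: d_def field_simps)
      then have "(1 + norm x) ^ N \<le> d ^ N * (1 + norm (c *\<^sub>R x)) ^ N"
        unfolding power_mult_distrib[symmetric] by (intro power_mono) auto
      then have "(1 + norm x) ^ N * (norm a * norm (f (c *\<^sub>R x))) \<le> (d ^ N * (1 + norm (c *\<^sub>R x)) ^ N) * (norm a * norm (f (c *\<^sub>R x)))"
        by (rule mult_right_mono) auto
      also have "\<dots> = d ^ N * norm a * ((1 + norm (c *\<^sub>R x)) ^ N * norm (f (c *\<^sub>R x)))" by (simp only: mult_ac)
      also have "\<dots> \<le> d ^ N * norm a * C" using d by (intro mult_left_mono C) auto
      finally show ?thesis by (simp add: norm_mult)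
    qed
    then show "\<exists>C. \<forall>x. (1 + norm x) ^ N * norm (a * f (c *\<^sub>R x)) \<le> C" by blast
  qed
  have "diff_level decays N (\<lambda>x. 1 * \<phi> (c *\<^sub>R x))" for N
    by (rule diff_level_scale[where Q=decays]) (use assms(2) dec in \<open>auto simp: schwartz_iff\<close>)
  then show ?thesis by (simp add: schwartz_iff)
qed

lemma smooth_const_diff:
  fixes f :: "real^'n \<Rightarrow> complex"
  assumes f: "smooth f"
  shows "smooth (\<lambda>x. c - f x)"
proof -
  have "diff_level (\<lambda>_. True) N (\<lambda>x::real^'n. c)" for N and c :: complex
    by (induction N arbitrary: c) (auto simp: partial_deriv_const)
  moreover have "diff_level (\<lambda>_. True) N (\<lambda>x. -1 * f (1 *\<^sub>R x))" for N
    by (rule diff_level_scale) (use f in \<open>auto simp: smooth_iff\<close>)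
  ultimately have "diff_level (\<lambda>_. True) N (\<lambda>x. c + (-1 * f (1 *\<^sub>R x)))" for N
    by (intro diff_level_add) auto
  then show ?thesis by (simp add: smooth_iff)
qed

lemma partial_deriv_zero_outside:
  fixes f :: "real^'n \<Rightarrow> complex"
  assumes "\<And>x. norm x > R \<Longrightarrow> f x = 0" "norm x > R"
  shows "partial_deriv k f x = 0"
proof -
  have "((\<lambda>x. 0) has_derivative (\<lambda>h. 0)) (at x)" by (rule has_derivative_const)
  then have "(f has_derivative (\<lambda>h. 0)) (at x)"
  proof (rule has_derivative_transform_within_open)
    show "open {x. norm x > R}" by (intro open_Collect_less continuous_intros)
  qed (use assms in auto)
  then show ?thesis by (rule partial_deriv_eq)
qed

lemma smooth_compact_support_schwartz:
  fixes f :: "real^'n \<Rightarrow> complex"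
  assumes "smooth f" "\<And>x. norm x > R \<Longrightarrow> f x = 0"
  shows "f \<in> schwartz"
proof -
  have dec: "decays f" if f: "\<And>x. f differentiable at x" "\<And>x. norm x > R \<Longrightarrow> f x = 0" for f :: "real^'n \<Rightarrow> complex"
    unfolding decays_def
  proof
    fix N
    have "continuous_on (cball 0 R) (\<lambda>x. (1 + norm x) ^ N * norm (f x))"
      using f(1) by (intro continuous_intros differentiable_imp_continuous_on)
        (auto simp: differentiable_on_def differentiable_at_withinI)
    then have "bounded ((\<lambda>x. (1 + norm x) ^ N * norm (f x)) ` cball 0 R)"
      by (intro compact_imp_bounded compact_continuous_image compact_cball)
    then obtain C where "\<forall>y\<in>(\<lambda>x. (1 + norm x) ^ N * norm (f x)) ` cball 0 R. norm y \<le> C"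
      unfolding bounded_iff by blast
    then have C: "norm x \<le> R \<Longrightarrow> \<bar>(1 + norm x) ^ N * norm (f x)\<bar> \<le> C" for x
      by auto
    have "(1 + norm x) ^ N * norm (f x) \<le> max C 0" for x
    proof (cases "norm x \<le> R")
      case True
      then show ?thesis using C[OF True] by linarith
    qed (simp add: f(2))
    then show "\<exists>C. \<forall>x. (1 + norm x) ^ N * norm (f x) \<le> C" by blast
  qed
  have "diff_level decays N f" if "diff_level (\<lambda>_. True) N f" "\<And>x. norm x > R \<Longrightarrow> f x = 0" for N and f :: "real^'n \<Rightarrow> complex"
    using that
  proof (induction N arbitrary: f)
    case (Suc N)
    have "diff_level decays N (partial_deriv k f)" for k
      using Suc.prems partial_deriv_zero_outside[of R f] by (intro Suc.IH) auto
    moreover have "decays f" using Suc.prems by (intro dec) auto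
    ultimately show ?case using Suc.prems by auto
  qed (use dec in auto)
  then show ?thesis using assms by (auto simp: schwartz_iff smooth_iff)
qed

lemma has_derivative_gauss:
  "((\<lambda>x::real^'n. complex_of_real (exp (- (norm x)\<^sup>2 / 2))) has_derivative
    (\<lambda>h. complex_of_real (exp (- (norm x)\<^sup>2 / 2) * - (x \<bullet> h)))) (at x)"
  unfolding power2_norm_eq_inner
  by (rule has_derivative_of_real) (auto intro!: derivative_eq_intros simp: inner_commute)

lemma schwartz_gauss: "(\<lambda>x::real^'n. complex_of_real (exp (- (norm x)\<^sup>2 / 2))) \<in> schwartz"
proof -
  let ?g = "\<lambda>x::real^'n. complex_of_real (exp (- (norm x)\<^sup>2 / 2))"
  have dec: "decays ?g"
    unfolding decays_def
  proof
    fix N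
    have "(1 + norm x) ^ N * norm (?g x) \<le> exp (real N * (real N + 1))" for x :: "real^'n"
    proof -
      have "(1 + norm x) ^ N \<le> exp (norm x) ^ N" by (intro power_mono exp_ge_add_one_self) auto
      also have "\<dots> = exp (real N * norm x)" by (rule exp_of_nat_mult[symmetric])
      finally have "(1 + norm x) ^ N * norm (?g x) \<le> exp (real N * norm x) * exp (- (norm x)\<^sup>2 / 2)"
        by (simp add: mult_right_mono)
      also have "\<dots> = exp (real N * norm x - (norm x)\<^sup>2 / 2)" by (simp add: exp_add[symmetric])
      also have "\<dots> \<le> exp (real N * (real N + 1))"
      proof -
        have "0 \<le> (norm x - real N)\<^sup>2 + (real N)\<^sup>2" by simp
        then have "real N * norm x - (norm x)\<^sup>2 / 2 \<le> real N * (real N + 1)"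
          by (simp add: power2_eq_square algebra_simps)
        then show ?thesis by simp
      qed
      finally show ?thesis .
    qed
    then show "\<exists>C. \<forall>x. (1 + norm x) ^ N * norm (?g x) \<le> C" by blast
  qed
  \<comment> \<open>Differentiation multiplies the Gaussian by a linear polynomial, so depth N + 1
    reduces to depth N by the product rule.\<close>
  have pd: "partial_deriv k ?g = (\<lambda>x. (-1 * complex_of_real ((1::real) *\<^sub>R x $ k)) * ?g x)" for k
    by (rule ext, subst partial_deriv_eq[OF has_derivative_gauss]) (simp add: inner_axis mult_ac)
  have co: "diff_level slow N (\<lambda>x::real^'n. -1 * complex_of_real ((1::real) *\<^sub>R x $ k))" for N k
    using slowly_growing_coord[of k]
    by (intro diff_level_mult[of slow slow slow, OF slow_mult slow_add diff_level_slow_const])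
      (auto simp: slowly_growing_def)
  have di: "?g differentiable at x" for x
    using has_derivative_gauss differentiable_def by blast
  have "diff_level decays N ?g" for N
  proof (induction N)
    case (Suc N)
    have "diff_level decays N (partial_deriv k ?g)" for k
      unfolding pd by (intro diff_level_mult[OF slow_mult_decays decays_add co Suc])
    then show ?case using dec di by auto
  qed (use dec di in auto)
  then show ?thesis by (simp add: schwartz_iff)
qed

section \<open>Integrals of products\<close>

lemma lborel_prod:
  fixes g :: "'a::euclidean_space \<Rightarrow> real \<Rightarrow> 'b::{real_normed_field,banach,second_countable_topology}"
  assumes g: "\<And>b. b \<in> Basis \<Longrightarrow> integrable lborel (g b)"
  shows integrable_lborel_prod: "integrable lborel (\<lambda>x::'a. \<Prod>b\<in>Basis. g b (x \<bullet> b))"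
    and integral_lborel_prod: "(\<integral>x. (\<Prod>b\<in>Basis. g b ((x::'a) \<bullet> b)) \<partial>lborel) = (\<Prod>b\<in>Basis. \<integral>x. g b x \<partial>lborel)"
proof -
  interpret product_sigma_finite "\<lambda>b::'a. lborel :: real measure" by standard
  have lb: "(lborel :: 'a measure) = distr (\<Pi>\<^sub>M b\<in>Basis. lborel) borel (\<lambda>f. \<Sum>b\<in>Basis. f b *\<^sub>R b)"
    unfolding lborel_def[where 'a='a] lborel_eq_real[symmetric] by simp
  have m1: "(\<lambda>f. \<Sum>b\<in>Basis. f b *\<^sub>R b) \<in> (\<Pi>\<^sub>M b\<in>(Basis::'a set). (lborel::real measure)) \<rightarrow>\<^sub>M borel"
    by measurable
  have [measurable]: "g b \<in> borel_measurable borel" if "b \<in> Basis" for b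
    using g[OF that] by (simp add: integrable_iff_bounded)
  have m2: "(\<lambda>x::'a. \<Prod>b\<in>Basis. g b (x \<bullet> b)) \<in> borel_measurable borel" by measurable
  have eq: "(\<Prod>b\<in>Basis. g b ((\<Sum>c\<in>Basis. f c *\<^sub>R c) \<bullet> b)) = (\<Prod>b\<in>Basis. g b (f b))" for f :: "'a \<Rightarrow> real"
    by (intro prod.cong refl) simp
  show "integrable lborel (\<lambda>x::'a. \<Prod>b\<in>Basis. g b (x \<bullet> b))"
    by (subst lb, subst integrable_distr_eq[OF m1 m2], subst eq) (intro product_integrable_prod finite_Basis g)
  show "(\<integral>x. (\<Prod>b\<in>Basis. g b ((x::'a) \<bullet> b)) \<partial>lborel) = (\<Prod>b\<in>Basis. \<integral>x. g b x \<partial>lborel)"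
    by (subst lb, subst integral_distr[OF m1 m2], subst eq) (intro product_integral_prod finite_Basis g)
qed

text \<open>The power dominates the product over all coordinates of 1 plus the squared coordinate,
  whose reciprocal is integrable by reduction to dimension one. It is the standard integrable
  majorant below.\<close>

lemma integrable_inverse_power_norm:
  "integrable lborel (\<lambda>x::real^'n. 1 / (1 + norm x) ^ (2 * CARD('n)))"
proof -
  have "integrable lborel (\<lambda>t::real. inverse (1 + t\<^sup>2))"
    using integrable_inverse_1_plus_square by (simp add: set_integrable_def)
  then have "integrable lborel (\<lambda>x::real^'n. \<Prod>b\<in>Basis. inverse (1 + (x \<bullet> b)\<^sup>2))"
    by (intro integrable_lborel_prod)
  then show ?thesis
  proof (rule Bochner_Integration.integrable_bound)
    show "(\<lambda>x::real^'n. 1 / (1 + norm x) ^ (2 * CARD('n))) \<in> borel_measurable lborel" by measurable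
    show "AE x::real^'n in lborel. norm (1 / (1 + norm x) ^ (2 * CARD('n))) \<le> norm (\<Prod>b\<in>Basis. inverse (1 + (x \<bullet> b)\<^sup>2))"
    proof (intro AE_I2)
      fix x :: "real^'n"
      have "(\<Prod>b\<in>(Basis::(real^'n) set). (1 + (x \<bullet> b)\<^sup>2)) \<le> (\<Prod>b\<in>(Basis::(real^'n) set). (1 + norm x)\<^sup>2)"
      proof (intro prod_mono conjI)
        fix b :: "real^'n" assume b: "b \<in> Basis"
        have "(x \<bullet> b)\<^sup>2 \<le> (norm x)\<^sup>2"
          using Basis_le_norm[OF b, of x] by (simp add: abs_le_square_iff[symmetric])
        moreover have "(1 + norm x)\<^sup>2 = 1 + (norm x)\<^sup>2 + 2 * norm x" by (simp add: power2_eq_square algebra_simps)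
        ultimately show "1 + (x \<bullet> b)\<^sup>2 \<le> (1 + norm x)\<^sup>2" using norm_ge_zero[of x] by linarith
      qed auto
      also have "\<dots> = (1 + norm x) ^ (2 * CARD('n))" by (simp add: power_mult)
      finally have le: "(\<Prod>b\<in>(Basis::(real^'n) set). (1 + (x \<bullet> b)\<^sup>2)) \<le> (1 + norm x) ^ (2 * CARD('n))" .
      have "(\<Prod>b\<in>(Basis::(real^'n) set). (1 + (x \<bullet> b)\<^sup>2)) > 0" by (intro prod_pos) (auto simp: add_pos_nonneg)
      from le_imp_inverse_le[OF le this]
      have "1 / (1 + norm x) ^ (2 * CARD('n)) \<le> (\<Prod>b\<in>Basis. inverse (1 + (x \<bullet> b)\<^sup>2))"
        by (simp add: inverse_eq_divide prod_dividef)
      moreover have "0 \<le> 1 / (1 + norm x) ^ (2 * CARD('n))" by simp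
      ultimately show "norm (1 / (1 + norm x) ^ (2 * CARD('n))) \<le> norm (\<Prod>b\<in>Basis. inverse (1 + (x \<bullet> b)\<^sup>2))"
        by (simp only: real_norm_def)
    qed
  qed
qed

text \<open>Up to normalization this is the characteristic function of the standard normal
  distribution.\<close>

lemma gauss_fourier_1d:
  "integrable lborel (\<lambda>x::real. exp (- \<i> * complex_of_real (x * t)) * complex_of_real (exp (- x\<^sup>2 / 2)))"
  "(\<integral>x. exp (- \<i> * complex_of_real (x * t)) * complex_of_real (exp (- x\<^sup>2 / 2)) \<partial>lborel)
     = complex_of_real (sqrt (2 * pi) * exp (- t\<^sup>2 / 2))"
proof -
  let ?f = "\<lambda>x::real. exp (- \<i> * complex_of_real (x * t))"
  have nn: "AE x in lborel. 0 \<le> std_normal_density x" by simp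
  have eq: "?f x * complex_of_real (exp (- x\<^sup>2 / 2)) = complex_of_real (sqrt (2 * pi)) * (std_normal_density x *\<^sub>R iexp (- t * x))" for x
    by (simp add: std_normal_density_def scaleR_conv_of_real mult_ac)
  have bnd: "integrable std_normal_distribution (\<lambda>x. iexp (- t * x))"
  proof -
    interpret real_distribution std_normal_distribution by (rule real_dist_normal_dist)
    show ?thesis by (rule integrable_iexp) auto
  qed
  have int: "integrable lborel (\<lambda>x. std_normal_density x *\<^sub>R iexp (- t * x))"
    using bnd by (subst (asm) integrable_density[OF _ _ nn]) auto
  show "integrable lborel (\<lambda>x::real. ?f x * complex_of_real (exp (- x\<^sup>2 / 2)))"
    unfolding eq by (intro integrable_mult_right int)
  have E: "(\<integral>x. std_normal_density x *\<^sub>R iexp (- t * x) \<partial>lborel) = char std_normal_distribution (- t)"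
    unfolding char_def by (subst integral_density[OF _ _ nn]) auto
  show "(\<integral>x. ?f x * complex_of_real (exp (- x\<^sup>2 / 2)) \<partial>lborel) = complex_of_real (sqrt (2 * pi) * exp (- t\<^sup>2 / 2))"
    unfolding eq integral_mult_right_zero E by (simp add: char_std_normal_distribution)
qed

definition gauss :: "real^'n \<Rightarrow> real" where
  "gauss x = exp (- (norm x)\<^sup>2 / 2)"

lemma gauss_prod: "gauss x = (\<Prod>b\<in>Basis. exp (- (x \<bullet> b)\<^sup>2 / 2))"
proof -
  have "(norm x)\<^sup>2 = (\<Sum>b\<in>Basis. (x \<bullet> b)\<^sup>2)"
    unfolding power2_norm_eq_inner by (subst euclidean_inner) (simp add: power2_eq_square)
  then show ?thesis by (simp add: gauss_def exp_sum[symmetric] sum_negf sum_divide_distrib[symmetric])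
qed

lemma gauss_fourier:
  fixes \<xi> :: "real^'n"
  shows "integrable lborel (\<lambda>x. exp (- \<i> * complex_of_real (x \<bullet> \<xi>)) * complex_of_real (gauss x))"
    and "(\<integral>x. exp (- \<i> * complex_of_real (x \<bullet> \<xi>)) * complex_of_real (gauss x) \<partial>lborel)
      = complex_of_real ((2 * pi) powr (real CARD('n) / 2) * gauss \<xi>)"
proof -
  define g where "g b = (\<lambda>t::real. exp (- \<i> * complex_of_real (t * (\<xi> \<bullet> b))) * complex_of_real (exp (- t\<^sup>2 / 2)))" for b
  have eq: "exp (- \<i> * complex_of_real (x \<bullet> \<xi>)) * complex_of_real (gauss x) = (\<Prod>b\<in>Basis. g b (x \<bullet> b))" for x
  proof -
    have "(\<Sum>b\<in>Basis. - \<i> * complex_of_real ((x \<bullet> b) * (\<xi> \<bullet> b))) = - \<i> * complex_of_real (x \<bullet> \<xi>)"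
      by (subst (2) euclidean_inner) (simp add: sum_distrib_left)
    then have "exp (- \<i> * complex_of_real (x \<bullet> \<xi>)) = (\<Prod>b\<in>Basis. exp (- \<i> * complex_of_real ((x \<bullet> b) * (\<xi> \<bullet> b))))"
      by (simp add: exp_sum[symmetric])
    then show ?thesis by (simp add: g_def gauss_prod prod.distrib)
  qed
  show "integrable lborel (\<lambda>x. exp (- \<i> * complex_of_real (x \<bullet> \<xi>)) * complex_of_real (gauss x))"
    unfolding eq by (intro integrable_lborel_prod) (simp only: g_def gauss_fourier_1d)
  have "(\<integral>x. exp (- \<i> * complex_of_real (x \<bullet> \<xi>)) * complex_of_real (gauss x) \<partial>lborel) = (\<Prod>b\<in>Basis. \<integral>x. g b x \<partial>lborel)"
    unfolding eq by (intro integral_lborel_prod) (simp only: g_def gauss_fourier_1d)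
  also have "\<dots> = (\<Prod>b\<in>(Basis::(real^'n) set). complex_of_real (sqrt (2 * pi) * exp (- (\<xi> \<bullet> b)\<^sup>2 / 2)))"
    by (simp only: g_def gauss_fourier_1d)
  also have "\<dots> = complex_of_real (sqrt (2 * pi) ^ CARD('n) * gauss \<xi>)"
    by (simp add: gauss_prod prod.distrib)
  also have "sqrt (2 * pi) ^ CARD('n) = (2 * pi) powr (real CARD('n) / 2)"
    by (simp add: powr_half_sqrt[symmetric] powr_powr powr_realpow[symmetric] mult.commute)
  finally show "(\<integral>x. exp (- \<i> * complex_of_real (x \<bullet> \<xi>)) * complex_of_real (gauss x) \<partial>lborel)
      = complex_of_real ((2 * pi) powr (real CARD('n) / 2) * gauss \<xi>)" .
qed

lemma gauss_integrable: "integrable lborel (gauss :: real^'n \<Rightarrow> real)"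
  and gauss_integral: "(\<integral>x. gauss (x::real^'n) \<partial>lborel) = (2 * pi) powr (real CARD('n) / 2)"
proof -
  have i: "integrable lborel (\<lambda>x::real^'n. complex_of_real (gauss x))"
    using gauss_fourier(1)[of 0] by simp
  then show "integrable lborel (gauss :: real^'n \<Rightarrow> real)" by (simp only: complex_of_real_integrable_eq)
  have "complex_of_real (\<integral>x. gauss (x::real^'n) \<partial>lborel) = complex_of_real ((2 * pi) powr (real CARD('n) / 2))"
    using gauss_fourier(2)[of 0] i by (simp add: gauss_def[of 0])
  then show "(\<integral>x. gauss (x::real^'n) \<partial>lborel) = (2 * pi) powr (real CARD('n) / 2)"
    by (simp only: of_real_eq_iff)
qed

lemma gauss_pos: "gauss x > 0" by (simp add: gauss_def)

lemma gauss_measurable [measurable]: "gauss \<in> borel_measurable borel"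
  unfolding gauss_def[abs_def] by measurable

section \<open>Affine changes of variables in Lebesgue integrals\<close>

lemma lborel_integral_scale:
  fixes f :: "'a::euclidean_space \<Rightarrow> 'b::{banach,second_countable_topology}"
  assumes "f \<in> borel_measurable borel" "c \<noteq> 0"
  shows "(\<integral>x. f x \<partial>lborel) = \<bar>c\<bar> ^ DIM('a) *\<^sub>R (\<integral>x. f (t + c *\<^sub>R x) \<partial>lborel)"
proof -
  have "(\<integral>x. f x \<partial>lborel) = (\<integral>x. f x \<partial>density (distr lborel borel (\<lambda>x. t + c *\<^sub>R x)) (\<lambda>_. \<bar>c\<bar>^DIM('a)))"
    using lborel_affine[OF assms(2), of t] by simp
  also have "\<dots> = (\<integral>x. (\<bar>c\<bar>^DIM('a)) *\<^sub>R f x \<partial>distr lborel borel (\<lambda>x. t + c *\<^sub>R x))"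
    using assms by (subst integral_density) (auto simp: ennreal_power)
  also have "\<dots> = (\<integral>x. (\<bar>c\<bar>^DIM('a)) *\<^sub>R f (t + c *\<^sub>R x) \<partial>lborel)"
    using assms by (subst integral_distr) auto
  finally show ?thesis by simp
qed

lemma lborel_distr_scale_unit:
  fixes t :: "'a::euclidean_space"
  assumes "\<bar>c\<bar> = 1"
  shows "distr lborel borel (\<lambda>x. t + c *\<^sub>R x) = lborel"
proof -
  have "c \<noteq> 0" using assms by auto
  from lborel_affine[OF this, of t] show ?thesis by (simp add: assms density_1)
qed

lemma lborel_integral_shift:
  fixes f :: "'a::euclidean_space \<Rightarrow> 'b::{banach,second_countable_topology}"
  assumes "f \<in> borel_measurable borel" "\<bar>c\<bar> = 1"
  shows "(\<integral>x. f (t + c *\<^sub>R x) \<partial>lborel) = (\<integral>x. f x \<partial>lborel)"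
proof -
  have "c \<noteq> 0" using assms by auto
  then show ?thesis using lborel_integral_scale[OF assms(1), of c t] assms(2) by simp
qed

lemma lborel_integrable_shift:
  fixes f :: "'a::euclidean_space \<Rightarrow> 'b::{banach,second_countable_topology}"
  assumes "integrable lborel f" "\<bar>c\<bar> = 1"
  shows "integrable lborel (\<lambda>x. f (t + c *\<^sub>R x))"
proof -
  have "integrable (distr lborel borel (\<lambda>x. t + c *\<^sub>R x)) f"
    unfolding lborel_distr_scale_unit[OF assms(2)] by (rule assms)
  then show ?thesis by (subst (asm) integrable_distr_eq) (use assms(1) in \<open>auto simp: integrable_iff_bounded\<close>)
qed

section \<open>The Fourier transform of Schwartz functions\<close>

lemma prod_integrable_bound:
  fixes f :: "'a::euclidean_space \<times> 'b::euclidean_space \<Rightarrow> 'c::{banach,second_countable_topology}"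
  assumes f [measurable]: "f \<in> borel_measurable (lborel \<Otimes>\<^sub>M lborel)"
    and A: "integrable lborel A" and B: "integrable lborel B"
    and le: "\<And>x y. norm (f (x, y)) \<le> A x * B y"
  shows "integrable (lborel \<Otimes>\<^sub>M lborel) f"
proof -
  have [measurable]: "A \<in> borel_measurable borel" "B \<in> borel_measurable borel"
    using A B by (auto simp: integrable_iff_bounded)
  have "integrable (lborel \<Otimes>\<^sub>M lborel) (\<lambda>p. A (fst p) * B (snd p))"
  proof (rule lborel_pair.Fubini_integrable)
    show "integrable lborel (\<lambda>x. \<integral>y. norm (A (fst (x, y)) * B (snd (x, y))) \<partial>lborel)"
      using A B by (simp add: abs_mult)
  qed (use B in auto)
  then show ?thesis
  proof (rule Bochner_Integration.integrable_bound[OF _ f])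
    show "AE p in lborel \<Otimes>\<^sub>M lborel. norm (f p) \<le> norm (A (fst p) * B (snd p))"
      using le by (intro AE_I2) (metis abs_ge_self order_trans prod.collapse real_norm_def)
  qed
qed

lemma lborel_Fubini_bound:
  fixes f :: "'a::euclidean_space \<Rightarrow> 'b::euclidean_space \<Rightarrow> 'c::{banach,second_countable_topology}"
  assumes f: "case_prod f \<in> borel_measurable (lborel \<Otimes>\<^sub>M lborel)"
    and A: "integrable lborel A" and B: "integrable lborel B"
    and le: "\<And>x y. norm (f x y) \<le> A x * B y"
  shows "(\<integral>y. \<integral>x. f x y \<partial>lborel \<partial>lborel) = (\<integral>x. \<integral>y. f x y \<partial>lborel \<partial>lborel)"
  by (rule lborel_pair.Fubini_integral, rule prod_integrable_bound[OF f A B]) (use le in simp)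

lemma schwartz_continuous: "\<phi> \<in> schwartz \<Longrightarrow> continuous_on A \<phi>"
  using schwartz_differentiable differentiable_imp_continuous_on
  by (metis differentiable_at_withinI differentiable_on_def)

lemma schwartz_measurable: "\<phi> \<in> schwartz \<Longrightarrow> \<phi> \<in> borel_measurable borel"
  by (intro borel_measurable_continuous_onI schwartz_continuous)

lemma integrable_power_bound:
  fixes f :: "real^'n \<Rightarrow> 'b::{banach,second_countable_topology}"
  assumes "f \<in> borel_measurable borel" "\<And>x. norm (f x) \<le> C / (1 + norm x) ^ (2 * CARD('n))"
  shows "integrable lborel f"
proof (rule Bochner_Integration.integrable_bound)
  show "integrable lborel (\<lambda>x::real^'n. C * (1 / (1 + norm x) ^ (2 * CARD('n))))"
    by (intro integrable_mult_right integrable_inverse_power_norm)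
  show "AE x in lborel. norm (f x) \<le> norm (C * (1 / (1 + norm x) ^ (2 * CARD('n))))"
    using assms(2) by (intro AE_I2) (metis abs_ge_self mult.right_neutral order_trans real_norm_def times_divide_eq_right)
qed (use assms in simp)

lemma schwartz_integrable_power:
  assumes "\<phi> \<in> schwartz"
  shows "integrable lborel (\<lambda>x. (1 + norm x) ^ N * norm (\<phi> x))"
proof -
  obtain C where C: "\<And>x. norm (\<phi> x) \<le> C / (1 + norm x) ^ (N + 2 * CARD('a))"
    using schwartz_bound[OF assms] by metis
  show ?thesis
  proof (rule integrable_power_bound)
    have [measurable]: "\<phi> \<in> borel_measurable borel" using assms by (rule schwartz_measurable)
    show "(\<lambda>x. (1 + norm x) ^ N * norm (\<phi> x)) \<in> borel_measurable borel" by measurable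
    fix x :: "real^'a"
    have "(1 + norm x) ^ N * norm (\<phi> x) \<le> (1 + norm x) ^ N * (C / (1 + norm x) ^ (N + 2 * CARD('a)))"
      by (intro mult_left_mono C) auto
    also have "\<dots> = C / (1 + norm x) ^ (2 * CARD('a))"
    proof -
      have "1 + norm x \<noteq> 0" using norm_ge_zero[of x] by linarith
      then show ?thesis by (simp add: power_add)
    qed
    finally show "norm ((1 + norm x) ^ N * norm (\<phi> x)) \<le> C / (1 + norm x) ^ (2 * CARD('a))" by simp
  qed
qed

lemma schwartz_integrable: "\<phi> \<in> schwartz \<Longrightarrow> integrable lborel \<phi>"
  using schwartz_integrable_power[of \<phi> 0] schwartz_measurable[of \<phi>] by (simp add: integrable_norm_iff)

text \<open>The unitary normalization of the Fourier transform; the type argument carries the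
  dimension.\<close>

definition fconst :: "'n::finite itself \<Rightarrow> real" where
  "fconst _ = (2 * pi) powr (- real CARD('n) / 2)"

lemma fconst_pos: "fconst TYPE('n::finite) > 0" by (simp add: fconst_def)

lemma fconst_mult: "fconst TYPE('n::finite) * (2 * pi) powr (real CARD('n) / 2) = 1"
  by (simp add: fconst_def powr_add[symmetric])

lemma fourier_eq:
  fixes \<phi> :: "real^'n \<Rightarrow> complex"
  shows "fourier \<phi> \<xi> = complex_of_real (fconst TYPE('n)) * (\<integral>x. exp (- \<i> * complex_of_real (x \<bullet> \<xi>)) * \<phi> x \<partial>lborel)"
  by (simp add: fourier_def fconst_def)

lemma fourier_integrable:
  assumes "integrable lborel \<phi>"
  shows "integrable lborel (\<lambda>x. exp (- \<i> * complex_of_real (x \<bullet> \<xi>)) * \<phi> x)"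
  by (rule Bochner_Integration.integrable_bound[OF assms]) 
    (use assms in \<open>auto simp: norm_mult integrable_iff_bounded\<close>)

lemma fourier_norm_le:
  fixes \<phi> :: "real^'n \<Rightarrow> complex"
  shows "norm (fourier \<phi> \<xi>) \<le> fconst TYPE('n) * (\<integral>x. norm (\<phi> x) \<partial>lborel)"
proof -
  have "norm (\<integral>x. exp (- \<i> * complex_of_real (x \<bullet> \<xi>)) * \<phi> x \<partial>lborel) \<le> (\<integral>x. norm (exp (- \<i> * complex_of_real (x \<bullet> \<xi>)) * \<phi> x) \<partial>lborel)"
    by (rule integral_norm_bound)
  then show ?thesis by (simp add: fourier_eq norm_mult abs_of_pos fconst_pos mult_left_mono)
qed

lemma fourier_cmult: "fourier (\<lambda>x. c * \<phi> x) \<xi> = c * fourier \<phi> \<xi>"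
  unfolding fourier_eq mult.left_commute[of _ c] integral_mult_right_zero by simp

lemma fourier_add:
  assumes "integrable lborel \<phi>" "integrable lborel \<psi>"
  shows "fourier (\<lambda>x. \<phi> x + \<psi> x) \<xi> = fourier \<phi> \<xi> + fourier \<psi> \<xi>"
  using Bochner_Integration.integral_add[OF assms[THEN fourier_integrable]] 
  by (simp add: fourier_eq distrib_left)

text \<open>Difference quotients have integral zero by translation invariance, and dominated
  convergence passes to the derivative. This is the integration by parts behind
  \<open>fourier_partial_deriv\<close>.\<close>

lemma integral_partial_deriv_zero:
  fixes \<psi> :: "real^'n \<Rightarrow> complex"
  assumes \<psi>: "\<psi> \<in> schwartz"
  shows "(\<integral>x. partial_deriv k \<psi> x \<partial>lborel) = 0"
proof -
  let ?D = "partial_deriv k \<psi>" and ?m = "2 * CARD('n)"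
  have D: "?D \<in> schwartz" using \<psi> by (rule schwartz_partial)
  have [measurable]: "\<psi> \<in> borel_measurable borel" "?D \<in> borel_measurable borel"
    using \<psi> D schwartz_measurable by auto
  obtain C where C: "C \<ge> 0" "\<And>x. norm (?D x) \<le> C / (1 + norm x) ^ ?m" using schwartz_bound[OF D] by metis
  \<comment> \<open>Difference quotients with step 1/(j + 1). A displacement of length at most 1
    changes 1 + norm x by a factor of at most 2, whence the uniform majorant with
    \<open>2 ^ ?m\<close>.\<close>
  define q where "q j x = (real (Suc j)) *\<^sub>R (\<psi> (x + (1 / real (Suc j)) *\<^sub>R axis k 1) - \<psi> x)" for j x
  have hd: "(\<psi> has_derivative frechet_derivative \<psi> (at x)) (at x)" for x
    using schwartz_differentiable[OF \<psi>] by (rule differentiable_has_frechet)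
  have path: "((\<lambda>t. \<psi> (x + t *\<^sub>R axis k 1)) has_derivative (\<lambda>s. s *\<^sub>R ?D (x + t *\<^sub>R axis k 1))) (at t)" for x t
  proof -
    interpret L: bounded_linear "frechet_derivative \<psi> (at (x + t *\<^sub>R axis k 1))"
      using hd by (rule has_derivative_bounded_linear)
    have "((\<lambda>t. x + t *\<^sub>R axis k 1) has_derivative (\<lambda>s. s *\<^sub>R axis k 1)) (at t)"
      by (auto intro!: derivative_eq_intros)
    from has_derivative_compose[OF this hd] show ?thesis
      by (simp add: partial_deriv_def L.scaleR)
  qed
  have lim: "(\<lambda>j. q j x) \<longlonglongrightarrow> ?D x" for x
  proof -
    have "((\<lambda>t. \<psi> (x + t *\<^sub>R axis k 1)) has_vector_derivative ?D x) (at 0)"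
      using path[of x 0] by (simp add: has_vector_derivative_def)
    then have L: "(\<lambda>h. norm (\<psi> (x + h *\<^sub>R axis k 1) - \<psi> x - h *\<^sub>R ?D x) / norm h) \<midarrow>0\<rightarrow> 0"
      unfolding has_vector_derivative_def has_derivative_at by simp
    have "((\<lambda>h. (1 / h) *\<^sub>R (\<psi> (x + h *\<^sub>R axis k 1) - \<psi> x)) \<longlongrightarrow> ?D x) (at 0)"
    proof (rule LIM_zero_cancel, rule tendsto_norm_zero_cancel, rule Lim_transform_within[OF L zero_less_one])
      fix h :: real assume "0 < dist h 0"
      then have "(1 / h) *\<^sub>R (\<psi> (x + h *\<^sub>R axis k 1) - \<psi> x) - ?D x = (1 / h) *\<^sub>R (\<psi> (x + h *\<^sub>R axis k 1) - \<psi> x - h *\<^sub>R ?D x)"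
        by (simp add: scaleR_diff_right[of "1 / h" "_ - _"])
      then show "norm (\<psi> (x + h *\<^sub>R axis k 1) - \<psi> x - h *\<^sub>R ?D x) / norm h = norm ((1 / h) *\<^sub>R (\<psi> (x + h *\<^sub>R axis k 1) - \<psi> x) - ?D x)"
        by simp
    qed
    moreover have "filterlim (\<lambda>j. 1 / real (Suc j)) (at 0) sequentially"
      unfolding filterlim_at using LIMSEQ_Suc[OF lim_1_over_n] by auto
    ultimately show ?thesis
      unfolding q_def using filterlim_compose[of "\<lambda>h. (1 / h) *\<^sub>R (\<psi> (x + h *\<^sub>R axis k 1) - \<psi> x)"] by fastforce
  qed
  have bound: "norm (q j x) \<le> (C * 2 ^ ?m) / (1 + norm x) ^ ?m" for j x
  proof -
    have "\<exists>t\<in>{0<..<1 / real (Suc j)}. norm (\<psi> (x + (1 / real (Suc j)) *\<^sub>R axis k 1) - \<psi> (x + 0 *\<^sub>R axis k 1))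
        \<le> norm ((1 / real (Suc j) - 0) *\<^sub>R ?D (x + t *\<^sub>R axis k 1))"
      using path by (intro mvt_general has_derivative_continuous_on) (auto intro: has_derivative_at_withinI)
    then obtain t where t: "0 < t" "t < 1 / real (Suc j)"
      "norm (\<psi> (x + (1 / real (Suc j)) *\<^sub>R axis k 1) - \<psi> x) \<le> (1 / real (Suc j)) * norm (?D (x + t *\<^sub>R axis k 1))"
      by auto
    have "t \<le> 1" using t(2) by (smt (verit) divide_le_eq_1 of_nat_Suc of_nat_0_le_iff)
    then have "norm (t *\<^sub>R (axis k 1 :: real^'n)) \<le> 1" using t(1) by simp
    then have "1 + norm x \<le> 2 * (1 + norm (x + t *\<^sub>R axis k 1))"
      using norm_triangle_ineq4[of "x + t *\<^sub>R axis k 1" "t *\<^sub>R axis k 1"] norm_ge_zero[of "x + t *\<^sub>R axis k 1"]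
      by (smt (verit) add_diff_cancel_right')
    then have "(1 + norm x) ^ ?m \<le> 2 ^ ?m * (1 + norm (x + t *\<^sub>R axis k 1)) ^ ?m"
      unfolding power_mult_distrib[symmetric] by (intro power_mono) auto
    then have *: "C / (1 + norm (x + t *\<^sub>R axis k 1)) ^ ?m \<le> (C * 2 ^ ?m) / (1 + norm x) ^ ?m"
      using C(1) by (simp add: divide_simps add_pos_nonneg zero_less_power) (simp add: mult_left_mono mult_ac)
    have "norm (q j x) = real (Suc j) * norm (\<psi> (x + (1 / real (Suc j)) *\<^sub>R axis k 1) - \<psi> x)"
      by (simp add: q_def)
    also have "\<dots> \<le> norm (?D (x + t *\<^sub>R axis k 1))" using t(3) by (simp add: field_simps)
    also have "\<dots> \<le> C / (1 + norm (x + t *\<^sub>R axis k 1)) ^ ?m" by (rule C)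
    finally show ?thesis using * by linarith
  qed
  have qi: "(\<integral>x. q j x \<partial>lborel) = 0" for j
  proof -
    have i: "integrable lborel (\<lambda>x. \<psi> (x + (1 / real (Suc j)) *\<^sub>R axis k 1))"
      using lborel_integrable_shift[OF schwartz_integrable[OF \<psi>], of 1 "(1 / real (Suc j)) *\<^sub>R axis k 1"] by (simp add: add.commute)
    have "(\<integral>x. \<psi> (x + (1 / real (Suc j)) *\<^sub>R axis k 1) \<partial>lborel) = (\<integral>x. \<psi> x \<partial>lborel)"
      using lborel_integral_shift[of \<psi> 1 "(1 / real (Suc j)) *\<^sub>R axis k 1"] by (simp add: add.commute)
    then show ?thesis
      unfolding q_def using i schwartz_integrable[OF \<psi>] by simp
  qed
  have "(\<lambda>j. \<integral>x. q j x \<partial>lborel) \<longlonglongrightarrow> (\<integral>x. ?D x \<partial>lborel)"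
  proof (rule integral_dominated_convergence)
    show "integrable lborel (\<lambda>x::real^'n. (C * 2 ^ ?m) / (1 + norm x) ^ ?m)"
      using integrable_mult_right[OF integrable_inverse_power_norm, of "C * 2 ^ ?m"] by simp
    show "AE x in lborel. norm (q j x) \<le> (C * 2 ^ ?m) / (1 + norm x) ^ ?m" for j
      using bound by (intro AE_I2)
    show "AE x in lborel. (\<lambda>j. q j x) \<longlonglongrightarrow> ?D x" using lim by (intro AE_I2)
    show "q j \<in> borel_measurable lborel" for j unfolding q_def[abs_def] by measurable
  qed simp
  then show ?thesis by (simp add: qi LIMSEQ_const_iff)
qed

lemma partial_deriv_plane_wave:
  "partial_deriv k (\<lambda>x::real^'n. exp (\<i> * complex_of_real (x \<bullet> \<xi>))) = (\<lambda>x. \<i> * complex_of_real (\<xi> $ k) * exp (\<i> * complex_of_real (x \<bullet> \<xi>)))"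
proof
  fix x
  have "bounded_linear (\<lambda>h::real^'n. \<i> * complex_of_real (h \<bullet> \<xi>))"
    by (intro bounded_linear_mult_right[THEN bounded_linear_compose] bounded_linear_of_real[THEN bounded_linear_compose]
        bounded_linear_inner_left)
  from has_derivative_compose[OF bounded_linear_imp_has_derivative[OF this] DERIV_exp[unfolded has_field_derivative_def]]
  have "((\<lambda>x. exp (\<i> * complex_of_real (x \<bullet> \<xi>))) has_derivative
      (\<lambda>h. exp (\<i> * complex_of_real (x \<bullet> \<xi>)) * (\<i> * complex_of_real (h \<bullet> \<xi>)))) (at x)" .
  from partial_deriv_eq[OF this, of k]
  show "partial_deriv k (\<lambda>x::real^'n. exp (\<i> * complex_of_real (x \<bullet> \<xi>))) x = \<i> * complex_of_real (\<xi> $ k) * exp (\<i> * complex_of_real (x \<bullet> \<xi>))"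
    by (simp add: inner_axis inner_commute mult_ac)
qed

lemma fourier_partial_deriv:
  assumes \<phi>: "\<phi> \<in> schwartz"
  shows "fourier (partial_deriv k \<phi>) \<xi> = \<i> * complex_of_real (\<xi> $ k) * fourier \<phi> \<xi>"
proof -
  let ?e = "\<lambda>x. exp (\<i> * complex_of_real (x \<bullet> (- \<xi>)))"
  have e: "?e x = exp (- \<i> * complex_of_real (x \<bullet> \<xi>))" for x by simp
  have de: "?e differentiable at x" for x
    using slowly_growing_plane_wave[of "- \<xi>"] unfolding slowly_growing_def
    by (blast intro: diff_level_differentiable)
  have d\<phi>: "\<phi> differentiable at x" for x using \<phi> by (rule schwartz_differentiable)
  have "0 = (\<integral>x. partial_deriv k (\<lambda>x. ?e x * \<phi> x) x \<partial>lborel)"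
    using integral_partial_deriv_zero[OF schwartz_plane_wave[OF \<phi>, of "- \<xi>"]] by simp
  also have "\<dots> = (\<integral>x. (- \<i> * complex_of_real (\<xi> $ k)) * (?e x * \<phi> x) + ?e x * partial_deriv k \<phi> x \<partial>lborel)"
    unfolding partial_deriv_mult[OF de d\<phi>] partial_deriv_plane_wave by (simp add: mult_ac)
  also have "\<dots> = (- \<i> * complex_of_real (\<xi> $ k)) * (\<integral>x. ?e x * \<phi> x \<partial>lborel) + (\<integral>x. ?e x * partial_deriv k \<phi> x \<partial>lborel)"
  proof -
    have "integrable lborel (\<lambda>x. ?e x * \<phi> x)" "integrable lborel (\<lambda>x. ?e x * partial_deriv k \<phi> x)"
      unfolding e by (intro fourier_integrable schwartz_integrable schwartz_partial \<phi>)+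
    then show ?thesis
      by (simp only: Bochner_Integration.integral_add integrable_mult_right integral_mult_right_zero)
  qed
  finally have "(\<integral>x. ?e x * partial_deriv k \<phi> x \<partial>lborel) = \<i> * complex_of_real (\<xi> $ k) * (\<integral>x. ?e x * \<phi> x \<partial>lborel)"
    by (simp add: algebra_simps add_eq_0_iff)
  then show ?thesis unfolding e fourier_eq by simp
qed

lemma exp_i_taylor: "norm (exp (- \<i> * complex_of_real t) - 1 + \<i> * complex_of_real t) \<le> t\<^sup>2 / 2"
proof -
  have S: "(\<Sum>k\<le>1. (\<i> * complex_of_real (- t)) ^ k / fact k) = 1 - \<i> * complex_of_real t" by simp
  have "exp (- \<i> * complex_of_real t) - 1 + \<i> * complex_of_real t = iexp (- t) - (1 - \<i> * complex_of_real t)" by simp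
  then show ?thesis using iexp_approx1[of "- t" 1] unfolding S by (simp only:) (simp add: power2_eq_square)
qed

text \<open>The second order Taylor remainder of the exponential, integrated against a Schwartz
  function, leaves an error quadratic in h. This yields the Frechet derivative that
  \<open>smooth\<close> asks for, not merely partial derivatives.\<close>

lemma fourier_has_derivative:
  fixes \<phi> :: "real^'n \<Rightarrow> complex"
  assumes \<phi>: "\<phi> \<in> schwartz"
  shows "(fourier \<phi> has_derivative
    (\<lambda>h. \<Sum>k\<in>UNIV. complex_of_real (h $ k) * fourier (\<lambda>x. - \<i> * (complex_of_real (x $ k) * \<phi> x)) \<xi>)) (at \<xi>)"
    (is "(_ has_derivative ?L) _")
proof -
  have bl: "bounded_linear ?L"
    by (intro bounded_linear_sum bounded_linear_mult_left[THEN bounded_linear_compose]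
      bounded_linear_of_real[THEN bounded_linear_compose] bounded_linear_vec_nth)
  define K where "K = fconst TYPE('n) * (\<integral>x. (1 + norm x) ^ 2 * norm (\<phi> x) \<partial>lborel)"
  let ?E = "\<lambda>\<xi> x. exp (- \<i> * complex_of_real (x \<bullet> \<xi>)) :: complex"
  have est: "norm (fourier \<phi> (\<xi> + h) - fourier \<phi> \<xi> - ?L h) \<le> K * (norm h)\<^sup>2" for h
  proof -
    have i: "integrable lborel (\<lambda>x. ?E \<eta> x * \<phi> x)" for \<eta> using \<phi> by (intro fourier_integrable schwartz_integrable)
    have ik: "integrable lborel (\<lambda>x. ?E \<xi> x * (- \<i> * (complex_of_real (x $ k) * \<phi> x)))" for k
      using \<phi> by (intro fourier_integrable schwartz_integrable schwartz_cmult schwartz_coord)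
    let ?R = "\<lambda>x. ?E (\<xi> + h) x * \<phi> x - ?E \<xi> x * \<phi> x - (\<Sum>k\<in>UNIV. complex_of_real (h $ k) * (?E \<xi> x * (- \<i> * (complex_of_real (x $ k) * \<phi> x))))"
    have iR: "integrable lborel ?R"
      by (intro Bochner_Integration.integrable_diff Bochner_Integration.integrable_sum integrable_mult_right i ik)
    define J where "J k = (\<integral>x. ?E \<xi> x * (- \<i> * (complex_of_real (x $ k) * \<phi> x)) \<partial>lborel)" for k
    have "(\<integral>x. ?R x \<partial>lborel) = (\<integral>x. ?E (\<xi> + h) x * \<phi> x \<partial>lborel) - (\<integral>x. ?E \<xi> x * \<phi> x \<partial>lborel)
        - (\<Sum>k\<in>UNIV. complex_of_real (h $ k) * J k)"
      by (subst Bochner_Integration.integral_diff, (intro Bochner_Integration.integrable_diff Bochner_Integration.integrable_sum integrable_mult_right i ik)+,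
          subst Bochner_Integration.integral_diff, (intro i)+,
          subst Bochner_Integration.integral_sum, (intro integrable_mult_right ik)+)
        (simp only: integral_mult_right_zero J_def)
    then have "fourier \<phi> (\<xi> + h) - fourier \<phi> \<xi> - ?L h = complex_of_real (fconst TYPE('n)) * (\<integral>x. ?R x \<partial>lborel)"
      unfolding fourier_eq J_def[symmetric]
      by (simp only: right_diff_distrib sum_distrib_left mult.left_commute)
    moreover have "norm (\<integral>x. ?R x \<partial>lborel) \<le> (\<integral>x. (norm h)\<^sup>2 * ((1 + norm x) ^ 2 * norm (\<phi> x)) \<partial>lborel)"
    proof (rule order_trans[OF integral_norm_bound], rule integral_mono)
      show "integrable lborel (\<lambda>x. norm (?R x))" using iR by (rule integrable_norm)
      show "integrable lborel (\<lambda>x. (norm h)\<^sup>2 * ((1 + norm x) ^ 2 * norm (\<phi> x)))"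
        by (intro integrable_mult_right schwartz_integrable_power \<phi>)
      fix x
      have "(\<Sum>k\<in>UNIV. complex_of_real (h $ k) * (?E \<xi> x * (- \<i> * (complex_of_real (x $ k) * \<phi> x))))
          = - \<i> * ?E \<xi> x * \<phi> x * (\<Sum>k\<in>UNIV. complex_of_real (x $ k * h $ k))"
        by (simp add: sum_distrib_left sum_negf mult_ac)
      also have "(\<Sum>k\<in>UNIV. complex_of_real (x $ k * h $ k)) = complex_of_real (x \<bullet> h)"
        by (simp only: inner_vec_def inner_real_def of_real_sum)
      finally have "?R x = ?E \<xi> x * \<phi> x * (exp (- \<i> * complex_of_real (x \<bullet> h)) - 1 + \<i> * complex_of_real (x \<bullet> h))"
        by (simp add: inner_add_right exp_add[symmetric] algebra_simps exp_diff exp_minus)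
          (simp add: field_simps)
      then have "norm (?R x) = norm (\<phi> x) * norm (exp (- \<i> * complex_of_real (x \<bullet> h)) - 1 + \<i> * complex_of_real (x \<bullet> h))"
        by (simp add: norm_mult)
      also have "\<dots> \<le> norm (\<phi> x) * ((x \<bullet> h)\<^sup>2 / 2)" by (intro mult_left_mono exp_i_taylor) auto
      also have "\<dots> \<le> norm (\<phi> x) * ((norm h)\<^sup>2 * (1 + norm x) ^ 2)"
      proof (intro mult_left_mono)
        have "\<bar>x \<bullet> h\<bar> \<le> norm x * norm h" by (rule Cauchy_Schwarz_ineq2)
        also have "\<dots> \<le> (1 + norm x) * norm h" by (intro mult_right_mono) auto
        finally have "(x \<bullet> h)\<^sup>2 \<le> ((1 + norm x) * norm h)\<^sup>2" by (simp add: abs_le_square_iff[symmetric])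
        then have "(x \<bullet> h)\<^sup>2 \<le> (norm h)\<^sup>2 * (1 + norm x) ^ 2" by (simp add: power_mult_distrib mult.commute)
        moreover have "0 \<le> (x \<bullet> h)\<^sup>2" by simp
        ultimately show "(x \<bullet> h)\<^sup>2 / 2 \<le> (norm h)\<^sup>2 * (1 + norm x) ^ 2" by linarith
      qed auto
      finally show "norm (?R x) \<le> (norm h)\<^sup>2 * ((1 + norm x) ^ 2 * norm (\<phi> x))" by (simp add: mult_ac)
    qed
    ultimately have "norm (fourier \<phi> (\<xi> + h) - fourier \<phi> \<xi> - ?L h)
        \<le> fconst TYPE('n) * (\<integral>x. (norm h)\<^sup>2 * ((1 + norm x) ^ 2 * norm (\<phi> x)) \<partial>lborel)"
      using fconst_pos[where 'n='n] by (simp only: norm_mult norm_of_real abs_of_pos mult_left_mono less_imp_le)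
    then show ?thesis unfolding K_def integral_mult_right_zero by (simp only: mult_ac)
  qed
  show ?thesis
    unfolding has_derivative_at
  proof (intro conjI bl)
    show "(\<lambda>h. norm (fourier \<phi> (\<xi> + h) - fourier \<phi> \<xi> - ?L h) / norm h) \<midarrow>0\<rightarrow> 0"
    proof (rule Lim_null_comparison)
      show "((\<lambda>h::real^'n. K * norm h) \<longlongrightarrow> 0) (at 0)" by (auto intro!: tendsto_eq_intros)
      show "\<forall>\<^sub>F h in at 0. norm (norm (fourier \<phi> (\<xi> + h) - fourier \<phi> \<xi> - ?L h) / norm h) \<le> K * norm h"
        unfolding eventually_at_filter
      proof (intro always_eventually allI impI)
        fix h :: "real^'n" assume "h \<noteq> 0"
        then show "norm (norm (fourier \<phi> (\<xi> + h) - fourier \<phi> \<xi> - ?L h) / norm h) \<le> K * norm h"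
          using est[of h] by (simp add: divide_le_eq power2_eq_square mult_ac)
      qed
    qed
  qed
qed

lemma partial_deriv_fourier:
  assumes \<phi>: "\<phi> \<in> schwartz"
  shows "partial_deriv k (fourier \<phi>) = fourier (\<lambda>x. - \<i> * (complex_of_real (x $ k) * \<phi> x))"
proof
  fix \<xi>
  show "partial_deriv k (fourier \<phi>) \<xi> = fourier (\<lambda>x. - \<i> * (complex_of_real (x $ k) * \<phi> x)) \<xi>"
  proof (subst partial_deriv_eq[OF fourier_has_derivative[OF \<phi>]])
    let ?F = "\<lambda>j. fourier (\<lambda>x. - \<i> * (complex_of_real (x $ j) * \<phi> x)) \<xi>"
    have "(\<Sum>j\<in>UNIV. complex_of_real (axis k 1 $ j) * ?F j) = (\<Sum>j\<in>UNIV. if j = k then ?F j else 0)"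
      by (intro sum.cong) (auto simp: axis_def)
    then show "(\<Sum>j\<in>UNIV. complex_of_real (axis k 1 $ j) * ?F j) = ?F k" by simp
  qed
qed

section \<open>Continuity of the Fourier transform in the Schwartz seminorms\<close>

lemma schwartz_seminorm_bdd:
  assumes \<phi>: "\<phi> \<in> schwartz"
  shows "bdd_above ((\<lambda>(ks, x). (1 + norm x) ^ N * norm (iter_partial ks \<phi> x)) ` ({ks. length ks \<le> N} \<times> UNIV))"
proof -
  have fin: "finite {ks :: 'a list. length ks \<le> N}"
    using finite_lists_length_le[of "UNIV :: 'a set" N] by simp
  have "\<exists>C. \<forall>x. (1 + norm x) ^ N * norm (iter_partial ks \<phi> x) \<le> C" for ks
    using \<phi> unfolding schwartz_iff diff_level_iff decays_def by blast
  then obtain C where C: "\<And>ks x. (1 + norm x) ^ N * norm (iter_partial ks \<phi> x) \<le> C ks" by metis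
  show ?thesis
  proof (rule bdd_aboveI2)
    fix p :: "'a list \<times> (real^'a)" assume "p \<in> {ks. length ks \<le> N} \<times> UNIV"
    then have "C (fst p) \<le> Max (C ` {ks. length ks \<le> N})" using fin by (intro Max_ge) auto
    then show "(case p of (ks, x) \<Rightarrow> (1 + norm x) ^ N * norm (iter_partial ks \<phi> x)) \<le> Max (C ` {ks. length ks \<le> N})"
      using C[of "snd p" "fst p"] by (simp add: case_prod_beta)
  qed
qed

lemma schwartz_seminorm_ge:
  assumes \<phi>: "\<phi> \<in> schwartz" and "length ks \<le> N"
  shows "(1 + norm x) ^ N * norm (iter_partial ks \<phi> x) \<le> schwartz_seminorm N \<phi>"
  unfolding schwartz_seminorm_def
  using cSUP_upper[OF _ schwartz_seminorm_bdd[OF \<phi>], of "(ks, x)" N] assms(2) by simp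

lemma fourier_iter_partial:
  "\<phi> \<in> schwartz \<Longrightarrow> fourier (iter_partial (replicate N k) \<phi>) \<xi> = (\<i> * complex_of_real (\<xi> $ k)) ^ N * fourier \<phi> \<xi>"
proof (induction N arbitrary: \<phi>)
  case (Suc N)
  have "iter_partial (replicate (Suc N) k) \<phi> = iter_partial (replicate N k) (partial_deriv k \<phi>)"
    by (metis iter_partial_snoc replicate_Suc replicate_append_same)
  then show ?case using Suc.IH[OF schwartz_partial[OF Suc.prems]] Suc.prems fourier_partial_deriv[OF Suc.prems] by simp
qed (simp add: iter_partial_Nil)

lemma schwartz_iter_partial: "\<phi> \<in> schwartz \<Longrightarrow> iter_partial ks \<phi> \<in> schwartz"
  by (induction ks) (auto simp: iter_partial_def schwartz_partial)

text \<open>It trades the weight for pure powers of single coordinates, which the Fourier transform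
  turns into iterated derivatives in one direction.\<close>

lemma power_1_plus_norm_le:
  fixes \<xi> :: "real^'n"
  shows "(1 + norm \<xi>) ^ N \<le> real (CARD('n) + 1) ^ N * (1 + (\<Sum>k\<in>UNIV. \<bar>\<xi> $ k\<bar> ^ N))"
proof -
  obtain j where j: "\<And>k. \<bar>\<xi> $ k\<bar> \<le> \<bar>\<xi> $ j\<bar>"
  proof -
    have "Max (range (\<lambda>k. \<bar>\<xi> $ k\<bar>)) \<in> range (\<lambda>k. \<bar>\<xi> $ k\<bar>)" by (rule Max_in) auto
    then obtain j where j: "Max (range (\<lambda>k. \<bar>\<xi> $ k\<bar>)) = \<bar>\<xi> $ j\<bar>" by blast
    show thesis by (rule that[of j], subst j[symmetric], rule Max_ge) auto
  qed
  define t where "t = max 1 \<bar>\<xi> $ j\<bar>"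
  have "norm \<xi> \<le> (\<Sum>k\<in>UNIV. \<bar>\<xi> $ k\<bar>)" by (rule norm_le_l1_cart)
  also have "\<dots> \<le> (\<Sum>k\<in>(UNIV::'n set). t)" by (rule sum_mono) (use j in \<open>auto simp: t_def le_max_iff_disj\<close>)
  finally have "1 + norm \<xi> \<le> real (CARD('n) + 1) * t" by (simp add: algebra_simps t_def)
  then have "(1 + norm \<xi>) ^ N \<le> (real (CARD('n) + 1) * t) ^ N" by (intro power_mono) auto
  also have "\<dots> = real (CARD('n) + 1) ^ N * t ^ N" by (rule power_mult_distrib)
  also have "t ^ N \<le> 1 + (\<Sum>k\<in>UNIV. \<bar>\<xi> $ k\<bar> ^ N)"
  proof (cases "\<bar>\<xi> $ j\<bar> \<le> 1")
    case True then show ?thesis by (simp add: t_def max_absorb1 sum_nonneg)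
  next
    case False
    have "\<bar>\<xi> $ j\<bar> ^ N \<le> (\<Sum>k\<in>UNIV. \<bar>\<xi> $ k\<bar> ^ N)" by (rule member_le_sum) auto
    with False show ?thesis by (simp add: t_def max_def)
  qed
  finally show ?thesis by (simp add: mult_left_mono)
qed

text \<open>The constants do not depend on \<phi>: this uniformity is what makes the functionals
  \<open>J s h\<close> tempered.\<close>

lemma fourier_seminorm_bound:
  obtains C M where "C \<ge> 0"
    "\<And>\<phi> \<xi>. \<phi> \<in> schwartz \<Longrightarrow> (1 + norm \<xi>) ^ N * norm (fourier \<phi> (\<xi> :: real^'n)) \<le> C * schwartz_seminorm M \<phi>"
proof -
  define m where "m = 2 * CARD('n)"
  define K where "K = fconst TYPE('n) * (\<integral>x. 1 / (1 + norm (x::real^'n)) ^ m \<partial>lborel)"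
  have K0: "K \<ge> 0" unfolding K_def using fconst_pos[where 'n='n] by (intro mult_nonneg_nonneg integral_nonneg) auto
  \<comment> \<open>Up to N derivatives are taken, and a weight of order m makes each of them
    integrable; a single seminorm has to provide both.\<close>
  define M where "M = max N m"
  have *: "norm (fourier (iter_partial ks \<phi>) \<xi>) \<le> K * schwartz_seminorm M \<phi>"
    if \<phi>: "\<phi> \<in> schwartz" and len: "length ks \<le> N" for \<phi> :: "real^'n \<Rightarrow> complex" and ks \<xi>
  proof -
    have "(\<integral>x. norm (iter_partial ks \<phi> x) \<partial>lborel) \<le> (\<integral>x. schwartz_seminorm M \<phi> * (1 / (1 + norm (x::real^'n)) ^ m) \<partial>lborel)"
    proof (rule integral_mono)
      show "integrable lborel (\<lambda>x. norm (iter_partial ks \<phi> x))"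
        using \<phi> by (intro integrable_norm schwartz_integrable schwartz_iter_partial)
      show "integrable lborel (\<lambda>x. schwartz_seminorm M \<phi> * (1 / (1 + norm (x::real^'n)) ^ m))"
        unfolding m_def by (intro integrable_mult_right integrable_inverse_power_norm)
      fix x :: "real^'n"
      have "(1 + norm x) ^ m * norm (iter_partial ks \<phi> x) \<le> (1 + norm x) ^ M * norm (iter_partial ks \<phi> x)"
        by (intro mult_right_mono power_increasing) (auto simp: M_def)
      also have "\<dots> \<le> schwartz_seminorm M \<phi>" by (rule schwartz_seminorm_ge[OF \<phi>]) (use len in \<open>simp add: M_def\<close>)
      finally show "norm (iter_partial ks \<phi> x) \<le> schwartz_seminorm M \<phi> * (1 / (1 + norm x) ^ m)"
        by (simp add: pos_le_divide_eq add_pos_nonneg mult.commute)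
    qed
    then have "fconst TYPE('n) * (\<integral>x. norm (iter_partial ks \<phi> x) \<partial>lborel) \<le> K * schwartz_seminorm M \<phi>"
      unfolding K_def integral_mult_right_zero using fconst_pos[where 'n='n] by (simp add: mult.commute mult.left_commute mult_left_mono)
    then show ?thesis using fourier_norm_le[of "iter_partial ks \<phi>" \<xi>] by linarith
  qed
  define A where "A = real (CARD('n) + 1) ^ N"
  have "(1 + norm \<xi>) ^ N * norm (fourier \<phi> \<xi>) \<le> (A * (1 + real CARD('n)) * K) * schwartz_seminorm M \<phi>"
    if \<phi>: "\<phi> \<in> schwartz" for \<phi> and \<xi> :: "real^'n"
  proof -
    have "norm (fourier \<phi> \<xi>) \<le> K * schwartz_seminorm M \<phi>"
      using *[OF \<phi>, of "[]"] by (simp add: iter_partial_Nil)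
    moreover have "\<bar>\<xi> $ k\<bar> ^ N * norm (fourier \<phi> \<xi>) \<le> K * schwartz_seminorm M \<phi>" for k
      using *[OF \<phi>, of "replicate N k" \<xi>] by (simp add: fourier_iter_partial[OF \<phi>] norm_mult norm_power)
    ultimately have "norm (fourier \<phi> \<xi>) + (\<Sum>k\<in>UNIV. \<bar>\<xi> $ k\<bar> ^ N * norm (fourier \<phi> \<xi>))
        \<le> K * schwartz_seminorm M \<phi> + (\<Sum>k\<in>(UNIV::'n set). K * schwartz_seminorm M \<phi>)"
      by (intro add_mono sum_mono) auto
    then have le: "(1 + (\<Sum>k\<in>UNIV. \<bar>\<xi> $ k\<bar> ^ N)) * norm (fourier \<phi> \<xi>) \<le> (1 + real CARD('n)) * (K * schwartz_seminorm M \<phi>)"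
      by (simp add: distrib_right sum_distrib_right)
    have "(1 + norm \<xi>) ^ N * norm (fourier \<phi> \<xi>) \<le> (A * (1 + (\<Sum>k\<in>UNIV. \<bar>\<xi> $ k\<bar> ^ N))) * norm (fourier \<phi> \<xi>)"
      unfolding A_def by (intro mult_right_mono power_1_plus_norm_le) auto
    also have "\<dots> = A * ((1 + (\<Sum>k\<in>UNIV. \<bar>\<xi> $ k\<bar> ^ N)) * norm (fourier \<phi> \<xi>))" by (rule mult.assoc)
    also have "\<dots> \<le> A * ((1 + real CARD('n)) * (K * schwartz_seminorm M \<phi>))"
      using le by (rule mult_left_mono) (simp add: A_def)
    finally show ?thesis by (simp only: mult_ac)
  qed
  moreover have "A * (1 + real CARD('n)) * K \<ge> 0" using K0 by (simp add: A_def)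
  ultimately show thesis using that by blast
qed

lemma fourier_schwartz:
  fixes \<phi> :: "real^'n \<Rightarrow> complex"
  assumes "\<phi> \<in> schwartz"
  shows "fourier \<phi> \<in> schwartz"
proof -
  have dec: "decays (fourier \<phi>)" if \<phi>: "\<phi> \<in> schwartz" for \<phi> :: "real^'n \<Rightarrow> complex"
    unfolding decays_def
  proof
    fix N
    obtain C M where "\<And>\<phi> \<xi>. \<phi> \<in> schwartz \<Longrightarrow> (1 + norm \<xi>) ^ N * norm (fourier \<phi> (\<xi> :: real^'n)) \<le> C * schwartz_seminorm M \<phi>"
      by (rule fourier_seminorm_bound[where 'n='n, of N]) (rule that)
    with \<phi> show "\<exists>C. \<forall>x. (1 + norm x) ^ N * norm (fourier \<phi> x) \<le> C" by blast
  qed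
  have "diff_level decays N (fourier \<phi>)" if "\<phi> \<in> schwartz" for N and \<phi> :: "real^'n \<Rightarrow> complex"
    using that
  proof (induction N arbitrary: \<phi>)
    case 0 then show ?case using dec fourier_has_derivative[OF 0] by (auto simp: differentiable_def)
  next
    case (Suc N)
    have "diff_level decays N (partial_deriv k (fourier \<phi>))" for k
      unfolding partial_deriv_fourier[OF Suc.prems]
      by (intro Suc.IH schwartz_cmult schwartz_coord Suc.prems)
    then show ?case using dec[OF Suc.prems] fourier_has_derivative[OF Suc.prems] by (auto simp: differentiable_def)
  qed
  with assms show ?thesis unfolding schwartz_iff[of "fourier \<phi>"] by blast
qed

section \<open>Fourier inversion\<close>

lemma gauss_kernel_integral:
  fixes z :: "real^'n"
  assumes "\<epsilon> > 0"
  shows "(\<integral>\<xi>. exp (- \<i> * complex_of_real (z \<bullet> \<xi>)) * complex_of_real (gauss (\<epsilon> *\<^sub>R \<xi>)) \<partial>lborel)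
    = complex_of_real ((2 * pi) powr (real CARD('n) / 2) * (1 / \<epsilon>) ^ CARD('n) * gauss ((1 / \<epsilon>) *\<^sub>R z))"
proof -
  let ?f = "\<lambda>\<eta>. exp (- \<i> * complex_of_real (\<eta> \<bullet> ((1 / \<epsilon>) *\<^sub>R z))) * complex_of_real (gauss \<eta>)"
  have "(\<integral>\<eta>. ?f \<eta> \<partial>lborel) = \<bar>\<epsilon>\<bar> ^ DIM(real^'n) *\<^sub>R (\<integral>\<xi>. ?f (0 + \<epsilon> *\<^sub>R \<xi>) \<partial>lborel)"
    by (rule lborel_integral_scale) (use assms in auto)
  moreover have "(\<integral>\<xi>. ?f (0 + \<epsilon> *\<^sub>R \<xi>) \<partial>lborel) = (\<integral>\<xi>. exp (- \<i> * complex_of_real (z \<bullet> \<xi>)) * complex_of_real (gauss (\<epsilon> *\<^sub>R \<xi>)) \<partial>lborel)"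
    by (rule Bochner_Integration.integral_cong) (use assms in \<open>simp_all add: inner_commute[of _ z]\<close>)
  ultimately have "complex_of_real ((2 * pi) powr (real CARD('n) / 2) * gauss ((1 / \<epsilon>) *\<^sub>R z))
     = \<epsilon> ^ CARD('n) *\<^sub>R (\<integral>\<xi>. exp (- \<i> * complex_of_real (z \<bullet> \<xi>)) * complex_of_real (gauss (\<epsilon> *\<^sub>R \<xi>)) \<partial>lborel)"
    using assms gauss_fourier(2)[of "(1 / \<epsilon>) *\<^sub>R z"] by simp
  then show ?thesis using assms
    by (simp add: scaleR_conv_of_real[where 'a=complex] power_one_over field_simps)
qed

lemma gauss_scale_integrable:
  assumes "c \<noteq> 0" shows "integrable lborel (\<lambda>\<xi>::real^'n. gauss (c *\<^sub>R \<xi>))"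
proof -
  have "integrable lborel (\<lambda>\<xi>::real^'n. complex_of_real (exp (- (norm (c *\<^sub>R \<xi>))\<^sup>2 / 2)))"
    using schwartz_integrable[OF schwartz_scale[OF assms schwartz_gauss]] .
  then show ?thesis unfolding gauss_def by (simp only: complex_of_real_integrable_eq)
qed

text \<open>The Gaussian makes the double integral absolutely convergent for merely integrable h, so
  Fubini applies and the inner integral is again a Gaussian. Letting \<epsilon> tend to 0 gives
  inversion in \<open>ifourier_fourier\<close> and injectivity in
  \<open>fourier_L1_inj\<close>.\<close>

lemma gauss_regularization:
  fixes h :: "real^'n \<Rightarrow> complex"
  assumes h: "integrable lborel h" and \<epsilon>: "\<epsilon> > 0"
  shows "(\<integral>\<xi>. (\<integral>y. exp (- \<i> * complex_of_real (y \<bullet> \<xi>)) * h y \<partial>lborel) * (exp (\<i> * complex_of_real (x \<bullet> \<xi>)) * complex_of_real (gauss (\<epsilon> *\<^sub>R \<xi>))) \<partial>lborel)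
    = complex_of_real ((2 * pi) powr (real CARD('n) / 2) * (1 / \<epsilon>) ^ CARD('n)) * (\<integral>y. h y * complex_of_real (gauss ((1 / \<epsilon>) *\<^sub>R (y - x))) \<partial>lborel)"
    (is "?L = ?R")
proof -
  have [measurable]: "h \<in> borel_measurable borel" using h by (simp add: integrable_iff_bounded)
  let ?K = "\<lambda>\<xi> y. exp (- \<i> * complex_of_real (y \<bullet> \<xi>)) * h y * (exp (\<i> * complex_of_real (x \<bullet> \<xi>)) * complex_of_real (gauss (\<epsilon> *\<^sub>R \<xi>)))"
  have "?L = (\<integral>\<xi>. \<integral>y. ?K \<xi> y \<partial>lborel \<partial>lborel)" by (simp only: integral_mult_left_zero)
  also have "\<dots> = (\<integral>y. \<integral>\<xi>. ?K \<xi> y \<partial>lborel \<partial>lborel)"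
  proof (rule lborel_Fubini_bound)
    show "(\<lambda>(y, \<xi>). ?K \<xi> y) \<in> borel_measurable (lborel \<Otimes>\<^sub>M lborel)" by measurable
    show "integrable lborel (\<lambda>y. norm (h y))" using h by (rule integrable_norm)
    show "integrable lborel (\<lambda>\<xi>::real^'n. gauss (\<epsilon> *\<^sub>R \<xi>))" using \<epsilon> by (intro gauss_scale_integrable) auto
    show "norm (?K \<xi> y) \<le> norm (h y) * gauss (\<epsilon> *\<^sub>R \<xi>)" for \<xi> y
      by (simp add: norm_mult abs_of_pos gauss_pos)
  qed
  also have "\<dots> = (\<integral>y. h y * (\<integral>\<xi>. exp (- \<i> * complex_of_real ((y - x) \<bullet> \<xi>)) * complex_of_real (gauss (\<epsilon> *\<^sub>R \<xi>)) \<partial>lborel) \<partial>lborel)"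
  proof -
    have "?K \<xi> y = h y * (exp (- \<i> * complex_of_real ((y - x) \<bullet> \<xi>)) * complex_of_real (gauss (\<epsilon> *\<^sub>R \<xi>)))" for \<xi> y
      by (simp add: inner_diff_left algebra_simps exp_add exp_diff exp_minus divide_inverse)
    then show ?thesis by (simp only: integral_mult_right_zero)
  qed
  also have "\<dots> = (\<integral>y. complex_of_real ((2 * pi) powr (real CARD('n) / 2) * (1 / \<epsilon>) ^ CARD('n)) * (h y * complex_of_real (gauss ((1 / \<epsilon>) *\<^sub>R (y - x)))) \<partial>lborel)"
    unfolding gauss_kernel_integral[OF \<epsilon>] by (simp add: mult_ac)
  also have "\<dots> = ?R" by (rule integral_mult_right_zero)
  finally show ?thesis .
qed

lemma gauss_neq_0: "gauss x \<noteq> 0" by (simp add: gauss_def)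

lemma gauss_le_1: "gauss x \<le> 1" by (simp add: gauss_def)

text \<open>The Gaussian has been rescaled to unit width, so that only \<beta> depends on the small
  parameter and dominated convergence applies.\<close>

lemma approx_identity:
  fixes \<beta> :: "real^'n \<Rightarrow> 'b::{banach,second_countable_topology}"
  assumes \<beta>: "continuous_on UNIV \<beta>" "\<And>x. norm (\<beta> x) \<le> C" and \<epsilon>: "\<epsilon> \<longlonglongrightarrow> 0"
  shows "(\<lambda>j. \<integral>z. gauss z *\<^sub>R \<beta> (x + \<epsilon> j *\<^sub>R z) \<partial>lborel) \<longlonglongrightarrow> (2 * pi) powr (real CARD('n) / 2) *\<^sub>R \<beta> x"
proof -
  have [measurable]: "\<beta> \<in> borel_measurable borel" using \<beta>(1) by (rule borel_measurable_continuous_onI)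
  have "(\<lambda>j. \<integral>z. gauss z *\<^sub>R \<beta> (x + \<epsilon> j *\<^sub>R z) \<partial>lborel) \<longlonglongrightarrow> (\<integral>z. gauss (z::real^'n) *\<^sub>R \<beta> x \<partial>lborel)"
  proof (rule integral_dominated_convergence)
    show "integrable lborel (\<lambda>z::real^'n. gauss z * C)" by (intro integrable_mult_left gauss_integrable)
    show "AE z in lborel. (\<lambda>j. gauss z *\<^sub>R \<beta> (x + \<epsilon> j *\<^sub>R z)) \<longlonglongrightarrow> gauss z *\<^sub>R \<beta> x"
    proof (intro AE_I2 tendsto_intros)
      fix z :: "real^'n"
      have "(\<lambda>j. x + \<epsilon> j *\<^sub>R z) \<longlonglongrightarrow> x + 0 *\<^sub>R z" by (intro tendsto_intros \<epsilon>)
      then show "(\<lambda>j. \<beta> (x + \<epsilon> j *\<^sub>R z)) \<longlonglongrightarrow> \<beta> x"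
        using continuous_on_tendsto_compose[OF \<beta>(1), of "\<lambda>j. x + \<epsilon> j *\<^sub>R z" x] by simp
    qed
    show "AE z in lborel. norm (gauss z *\<^sub>R \<beta> (x + \<epsilon> j *\<^sub>R z)) \<le> gauss z * C" for j
      using \<beta>(2) by (intro AE_I2) (simp add: abs_of_pos gauss_pos mult_left_mono less_imp_le)
  qed measurable
  moreover have "(\<integral>z. gauss (z::real^'n) *\<^sub>R \<beta> x \<partial>lborel) = (2 * pi) powr (real CARD('n) / 2) *\<^sub>R \<beta> x"
    by (subst integral_scaleR_left[OF gauss_integrable]) (simp only: gauss_integral)
  ultimately show ?thesis by simp
qed

definition ifourier :: "(real^'n \<Rightarrow> complex) \<Rightarrow> real^'n \<Rightarrow> complex" where
  "ifourier \<phi> \<xi> = fourier \<phi> (- \<xi>)"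

text \<open>The regularized inversion integral has two descriptions of its limit: by dominated
  convergence the integral without the Gaussian, and by the approximate identity a multiple of
  \<phi>. The constants match because \<open>fconst\<close> times the Gaussian integral is
  1.\<close>

lemma ifourier_fourier:
  fixes \<phi> :: "real^'n \<Rightarrow> complex"
  assumes \<phi>: "\<phi> \<in> schwartz"
  shows "ifourier (fourier \<phi>) = \<phi>"
proof
  fix x
  let ?G = "(2 * pi) powr (real CARD('n) / 2)" and ?c = "fconst TYPE('n)"
  let ?\<psi> = "fourier \<phi>"
  have \<psi>: "?\<psi> \<in> schwartz" using \<phi> by (rule fourier_schwartz)
  have [measurable]: "\<phi> \<in> borel_measurable borel" "?\<psi> \<in> borel_measurable borel" using \<phi> \<psi> by (auto intro: schwartz_measurable)
  define \<epsilon> where "\<epsilon> j = 1 / real (Suc j)" for j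
  have \<epsilon>: "\<epsilon> j > 0" "\<epsilon> \<longlonglongrightarrow> 0" for j using LIMSEQ_Suc[OF lim_1_over_n] by (auto simp: \<epsilon>_def[abs_def])
  let ?I = "\<lambda>j. \<integral>\<xi>. ?\<psi> \<xi> * (exp (\<i> * complex_of_real (x \<bullet> \<xi>)) * complex_of_real (gauss (\<epsilon> j *\<^sub>R \<xi>))) \<partial>lborel"
  have 1: "?I \<longlonglongrightarrow> (\<integral>\<xi>. ?\<psi> \<xi> * (exp (\<i> * complex_of_real (x \<bullet> \<xi>)) * complex_of_real 1) \<partial>lborel)"
  proof (rule integral_dominated_convergence)
    show "integrable lborel (\<lambda>\<xi>. norm (?\<psi> \<xi>))" using \<psi> by (intro integrable_norm schwartz_integrable)
    show "AE \<xi> in lborel. norm (?\<psi> \<xi> * (exp (\<i> * complex_of_real (x \<bullet> \<xi>)) * complex_of_real (gauss (\<epsilon> j *\<^sub>R \<xi>)))) \<le> norm (?\<psi> \<xi>)" for j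
      by (intro AE_I2) (simp add: norm_mult abs_of_pos gauss_pos gauss_le_1 mult_left_le)
    show "AE \<xi> in lborel. (\<lambda>j. ?\<psi> \<xi> * (exp (\<i> * complex_of_real (x \<bullet> \<xi>)) * complex_of_real (gauss (\<epsilon> j *\<^sub>R \<xi>))))
        \<longlonglongrightarrow> ?\<psi> \<xi> * (exp (\<i> * complex_of_real (x \<bullet> \<xi>)) * complex_of_real 1)"
    proof (intro AE_I2 tendsto_intros)
      fix \<xi> :: "real^'n"
      have "(\<lambda>j. gauss (\<epsilon> j *\<^sub>R \<xi>)) \<longlonglongrightarrow> exp (- (norm (0 *\<^sub>R \<xi>))\<^sup>2 / 2)"
        unfolding gauss_def by (intro tendsto_intros \<epsilon>) simp
      then show "(\<lambda>j. gauss (\<epsilon> j *\<^sub>R \<xi>)) \<longlonglongrightarrow> 1" by simp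
    qed
  qed measurable
  have I: "?I j = complex_of_real ?c * complex_of_real ?G * (\<integral>z. gauss z *\<^sub>R \<phi> (x + \<epsilon> j *\<^sub>R z) \<partial>lborel)" for j
  proof -
    have "?I j = complex_of_real ?c * (\<integral>\<xi>. (\<integral>y. exp (- \<i> * complex_of_real (y \<bullet> \<xi>)) * \<phi> y \<partial>lborel) * (exp (\<i> * complex_of_real (x \<bullet> \<xi>)) * complex_of_real (gauss (\<epsilon> j *\<^sub>R \<xi>))) \<partial>lborel)"
      unfolding fourier_eq mult.assoc by (rule integral_mult_right_zero)
    also have "\<dots> = complex_of_real ?c * (complex_of_real (?G * (1 / \<epsilon> j) ^ CARD('n)) * (\<integral>y. \<phi> y * complex_of_real (gauss ((1 / \<epsilon> j) *\<^sub>R (y - x))) \<partial>lborel))"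
      unfolding gauss_regularization[OF schwartz_integrable[OF \<phi>] \<epsilon>(1)] ..
    also have "(\<integral>y. \<phi> y * complex_of_real (gauss ((1 / \<epsilon> j) *\<^sub>R (y - x))) \<partial>lborel)
      = \<bar>\<epsilon> j\<bar> ^ DIM(real^'n) *\<^sub>R (\<integral>z. \<phi> (x + \<epsilon> j *\<^sub>R z) * complex_of_real (gauss ((1 / \<epsilon> j) *\<^sub>R ((x + \<epsilon> j *\<^sub>R z) - x))) \<partial>lborel)"
      by (rule lborel_integral_scale) (use \<epsilon>(1)[of j] in auto)
    also have "\<dots> = \<epsilon> j ^ CARD('n) *\<^sub>R (\<integral>z. gauss z *\<^sub>R \<phi> (x + \<epsilon> j *\<^sub>R z) \<partial>lborel)"
    proof -
      have "(1 / \<epsilon> j) *\<^sub>R ((x + \<epsilon> j *\<^sub>R z) - x) = z" for z using \<epsilon>(1)[of j] by simp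
      then show ?thesis using \<epsilon>(1)[of j] by (simp add: scaleR_conv_of_real[where 'a=complex] mult.commute)
    qed
    finally show ?thesis using \<epsilon>(1)[of j] by (simp add: scaleR_conv_of_real[where 'a=complex] power_one_over)
  qed
  obtain C where C: "C \<ge> 0" "\<And>x. norm (\<phi> x) \<le> C / (1 + norm x) ^ 0" using schwartz_bound[OF \<phi>] by metis
  have "?I \<longlonglongrightarrow> complex_of_real ?c * complex_of_real ?G * (?G *\<^sub>R \<phi> x)"
    unfolding I by (intro tendsto_intros approx_identity[where C=C] schwartz_continuous \<phi> \<epsilon>) (use C in auto)
  moreover have "complex_of_real ?c * complex_of_real ?G = 1"
    unfolding of_real_mult[symmetric] fconst_mult by simp
  ultimately have "(\<integral>\<xi>. ?\<psi> \<xi> * (exp (\<i> * complex_of_real (x \<bullet> \<xi>)) * complex_of_real 1) \<partial>lborel) = ?G *\<^sub>R \<phi> x"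
    using LIMSEQ_unique[OF 1] by simp
  moreover have "ifourier ?\<psi> x = complex_of_real ?c * (\<integral>\<xi>. ?\<psi> \<xi> * (exp (\<i> * complex_of_real (x \<bullet> \<xi>)) * complex_of_real 1) \<partial>lborel)"
    unfolding ifourier_def fourier_eq[of ?\<psi>] by (simp add: inner_commute mult.commute)
  ultimately have "ifourier ?\<psi> x = complex_of_real (?c * ?G) * \<phi> x" by (simp add: scaleR_conv_of_real)
  then show "ifourier ?\<psi> x = \<phi> x" unfolding fconst_mult by simp
qed

lemma fourier_reflect: "\<phi> \<in> schwartz \<Longrightarrow> fourier (\<lambda>x. \<phi> (- x)) \<xi> = fourier \<phi> (- \<xi>)"
  unfolding fourier_eq
  using lborel_integral_shift[of "\<lambda>x. exp (- \<i> * complex_of_real (x \<bullet> - \<xi>)) * \<phi> x" "-1" 0] schwartz_measurable[of \<phi>]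
  by simp

lemma schwartz_reflect: "\<phi> \<in> schwartz \<Longrightarrow> (\<lambda>x. \<phi> (- x)) \<in> schwartz"
  using schwartz_scale[of "-1" \<phi>] by simp

lemma ifourier_schwartz: "\<phi> \<in> schwartz \<Longrightarrow> ifourier \<phi> \<in> schwartz"
  unfolding ifourier_def[abs_def] by (intro schwartz_reflect fourier_schwartz)

lemma fourier_ifourier:
  assumes \<phi>: "\<phi> \<in> schwartz"
  shows "fourier (ifourier \<phi>) = \<phi>"
proof
  fix x
  have "fourier (ifourier \<phi>) x = fourier (fourier \<phi>) (- x)"
    unfolding ifourier_def[abs_def] by (rule fourier_reflect[OF fourier_schwartz[OF \<phi>]])
  also have "\<dots> = ifourier (fourier \<phi>) x" by (simp add: ifourier_def)
  also have "\<dots> = \<phi> x" by (simp add: ifourier_fourier[OF \<phi>])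
  finally show "fourier (ifourier \<phi>) x = \<phi> x" .
qed

section \<open>Bilinear identities and intertwining relations of the Fourier transform\<close>

lemma fourier_multiplication_formula:
  fixes \<phi> \<psi> :: "real^'n \<Rightarrow> complex"
  assumes \<phi>: "integrable lborel \<phi>" and \<psi>: "integrable lborel \<psi>"
  shows "(\<integral>x. fourier \<phi> x * \<psi> x \<partial>lborel) = (\<integral>x. \<phi> x * fourier \<psi> x \<partial>lborel)"
proof -
  have [measurable]: "\<phi> \<in> borel_measurable borel" "\<psi> \<in> borel_measurable borel"
    using \<phi> \<psi> by (auto simp: integrable_iff_bounded)
  let ?K = "\<lambda>y x. complex_of_real (fconst TYPE('n)) * (exp (- \<i> * complex_of_real (y \<bullet> x)) * \<phi> y * \<psi> x)"
  have "(\<integral>x. fourier \<phi> x * \<psi> x \<partial>lborel) = (\<integral>x. \<integral>y. ?K y x \<partial>lborel \<partial>lborel)"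
    unfolding fourier_eq integral_mult_left_zero integral_mult_right_zero by (simp only: mult.assoc integral_mult_right_zero)
  also have "\<dots> = (\<integral>y. \<integral>x. ?K y x \<partial>lborel \<partial>lborel)"
  proof (rule lborel_Fubini_bound)
    show "integrable lborel (\<lambda>y. fconst TYPE('n) * norm (\<phi> y))" "integrable lborel (\<lambda>y. norm (\<psi> y))"
      using \<phi> \<psi> by auto
    show "norm (?K y x) \<le> fconst TYPE('n) * norm (\<phi> y) * norm (\<psi> x)" for x y
      by (simp add: norm_mult abs_of_pos fconst_pos)
  qed measurable
  finally have F: "(\<integral>x. fourier \<phi> x * \<psi> x \<partial>lborel) = (\<integral>y. \<integral>x. ?K y x \<partial>lborel \<partial>lborel)" .
  have "?K y x = \<phi> y * (complex_of_real (fconst TYPE('n)) * (exp (- \<i> * complex_of_real (x \<bullet> y)) * \<psi> x))" for x y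
    by (simp add: inner_commute mult_ac)
  then show ?thesis unfolding F unfolding fourier_eq by (simp only: integral_mult_right_zero)
qed

lemma fourier_cnj: "cnj (fourier \<phi> \<xi>) = fourier (\<lambda>x. cnj (\<phi> x)) (- \<xi>)"
proof -
  have eq: "exp (- \<i> * complex_of_real (x \<bullet> - \<xi>)) * cnj (\<phi> x) = cnj (exp (- \<i> * complex_of_real (x \<bullet> \<xi>)) * \<phi> x)" for x
    by (simp add: exp_cnj)
  have "(\<integral>x. exp (- \<i> * complex_of_real (x \<bullet> - \<xi>)) * cnj (\<phi> x) \<partial>lborel)
      = cnj (\<integral>x. exp (- \<i> * complex_of_real (x \<bullet> \<xi>)) * \<phi> x \<partial>lborel)"
    unfolding eq by (rule Bochner_Integration.integral_cnj)
  then show ?thesis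
    by (simp only: fourier_eq complex_cnj_mult complex_cnj_complex_of_real)
qed

text \<open>The multiplication formula is applied to the conjugate of \<phi> and to the reflected
  transform of \<psi>; inversion then recovers \<psi>.\<close>

lemma fourier_parseval:
  fixes \<phi> \<psi> :: "real^'n \<Rightarrow> complex"
  assumes \<phi>: "\<phi> \<in> schwartz" and \<psi>: "\<psi> \<in> schwartz"
  shows "(\<integral>x. cnj (fourier \<phi> x) * fourier \<psi> x \<partial>lborel) = (\<integral>x. cnj (\<phi> x) * \<psi> x \<partial>lborel)"
proof -
  let ?c = "\<lambda>x. cnj (\<phi> x)"
  have ic: "integrable lborel ?c" using \<phi> by (simp add: schwartz_integrable)
  have F: "fourier \<psi> \<in> schwartz" using \<psi> by (rule fourier_schwartz)
  have "(\<integral>x. cnj (fourier \<phi> x) * fourier \<psi> x \<partial>lborel) = (\<integral>x. fourier ?c (- x) * fourier \<psi> x \<partial>lborel)"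
    unfolding fourier_cnj ..
  also have "\<dots> = (\<integral>x. fourier ?c x * fourier \<psi> (- x) \<partial>lborel)"
  proof -
    have "(\<lambda>x. fourier ?c x) = (\<lambda>x. cnj (fourier \<phi> (- x)))" by (simp add: fourier_cnj)
    moreover have "(\<lambda>x. cnj (fourier \<phi> (- x))) \<in> borel_measurable borel"
      by (intro borel_measurable_continuous_onI continuous_on_cnj schwartz_continuous schwartz_reflect fourier_schwartz \<phi>)
    ultimately have "fourier ?c \<in> borel_measurable borel" by simp
    moreover have "(\<lambda>x. fourier \<psi> (- x)) \<in> borel_measurable borel" using F by (intro schwartz_measurable schwartz_reflect)
    ultimately have "(\<lambda>x. fourier ?c x * fourier \<psi> (- x)) \<in> borel_measurable borel" by (rule borel_measurable_times)
    from lborel_integral_shift[OF this, of "-1" 0] show ?thesis by simp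
  qed
  also have "\<dots> = (\<integral>x. ?c x * fourier (\<lambda>x. fourier \<psi> (- x)) x \<partial>lborel)"
    using F by (intro fourier_multiplication_formula ic schwartz_integrable schwartz_reflect)
  also have "\<dots> = (\<integral>x. cnj (\<phi> x) * \<psi> x \<partial>lborel)"
    using fourier_ifourier[OF \<psi>] by (simp add: ifourier_def[abs_def])
  finally show ?thesis .
qed

lemma ifourier_plane_wave:
  "ifourier (\<lambda>x. exp (\<i> * complex_of_real (x \<bullet> k)) * \<phi> x) \<xi> = ifourier \<phi> (\<xi> + k)"
proof -
  have "exp (- \<i> * complex_of_real (x \<bullet> - \<xi>)) * (exp (\<i> * complex_of_real (x \<bullet> k)) * \<phi> x)
      = exp (- \<i> * complex_of_real (x \<bullet> - (\<xi> + k))) * \<phi> x" for x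
    by (simp add: inner_add_right inner_diff_right exp_add[symmetric] algebra_simps flip: mult.assoc)
  then show ?thesis by (simp only: ifourier_def fourier_eq)
qed

lemma ifourier_partial_deriv:
  "\<phi> \<in> schwartz \<Longrightarrow> ifourier (\<lambda>x. \<i> * partial_deriv k \<phi> x) \<xi> = complex_of_real (\<xi> $ k) * ifourier \<phi> \<xi>"
  by (simp add: ifourier_def fourier_cmult fourier_partial_deriv flip: mult.assoc)

lemma ifourier_add:
  "\<phi> \<in> schwartz \<Longrightarrow> \<psi> \<in> schwartz \<Longrightarrow> ifourier (\<lambda>x. \<phi> x + \<psi> x) \<xi> = ifourier \<phi> \<xi> + ifourier \<psi> \<xi>"
  by (simp add: ifourier_def fourier_add schwartz_integrable)

lemma ifourier_cmult: "ifourier (\<lambda>x. c * \<phi> x) \<xi> = c * ifourier \<phi> \<xi>"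
  by (simp add: ifourier_def fourier_cmult)

section \<open>The fundamental lemma of the calculus of variations\<close>

text \<open>Closed sets form an intersection stable generator of the Borel sets, so vanishing
  integrals propagate from them to all Borel sets.\<close>

lemma integral_zero_imp_AE_zero:
  fixes h :: "'a::euclidean_space \<Rightarrow> 'b::{banach,second_countable_topology}"
  assumes h: "integrable lborel h"
    and cl: "\<And>C. closed C \<Longrightarrow> set_lebesgue_integral lborel C h = 0"
  shows "AE x in lborel. h x = 0"
proof (rule sigma_finite_measure.density_zero[OF sigma_finite_lborel h])
  fix A :: "'a set" assume "A \<in> sets lborel"
  then have A: "A \<in> sigma_sets UNIV (Collect closed)" by (simp add: borel_eq_closed)
  have "Int_stable (Collect closed :: 'a set set)" "(Collect closed :: 'a set set) \<subseteq> Pow UNIV"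
    by (auto simp: Int_stable_def)
  from this A show "set_lebesgue_integral lborel A h = 0"
  proof (induction rule: sigma_sets_induct_disjoint)
    case (compl A)
    then have A: "A \<in> sets lborel" by (simp add: borel_eq_closed)
    have s: "set_integrable lborel B h" if "B \<in> sets lborel" for B
      using h that by (simp add: set_integrable_def integrable_mult_indicator)
    have eq: "set_lebesgue_integral lborel ((UNIV - A) \<union> A) h
        = set_lebesgue_integral lborel (UNIV - A) h + set_lebesgue_integral lborel A h"
      by (rule set_integral_Un) (use A s in auto)
    have "(UNIV - A) \<union> A = UNIV" by auto
    moreover have "set_lebesgue_integral lborel UNIV h = 0" by (rule cl) simp
    ultimately show ?case using eq compl(2) by (simp only: add_0_right)
  next
    case (union A)
    then have A: "A i \<in> sets lborel" for i by (auto simp: borel_eq_closed)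
    have "set_lebesgue_integral lborel (\<Union>i. A i) h = (\<Sum>i. set_lebesgue_integral lborel (A i) h)"
      by (rule lebesgue_integral_countable_add)
        (use A union(1) in \<open>auto simp: disjoint_family_on_def set_integrable_def intro!: integrable_mult_indicator[OF _ h]\<close>)
    then show ?case by (simp add: union(3))
  next
    case (basic A)
    then show ?case by (intro cl) simp
  qed (simp add: set_lebesgue_integral_def)
qed

lemma integral_continuous_zero_imp_AE_zero:
  fixes h :: "'a::euclidean_space \<Rightarrow> complex"
  assumes h: "integrable lborel h"
    and \<beta>: "\<And>\<beta>::'a \<Rightarrow> real. continuous_on UNIV \<beta> \<Longrightarrow> (\<And>x. \<bar>\<beta> x\<bar> \<le> 1) \<Longrightarrow> (\<integral>x. \<beta> x *\<^sub>R h x \<partial>lborel) = 0"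
  shows "AE x in lborel. h x = 0"
proof (rule integral_zero_imp_AE_zero[OF h])
  fix C :: "'a set" assume C: "closed C"
  have [measurable]: "h \<in> borel_measurable borel" "C \<in> sets borel" using h C by (auto simp: integrable_iff_bounded)
  show "set_lebesgue_integral lborel C h = 0"
  proof (cases "C = {}")
    case False
    \<comment> \<open>Continuous functions with values in [0, 1] that decrease to the indicator of
      C, because C is closed.\<close>
    define b where "b j x = max 0 (1 - real j * infdist x C)" for j x
    have cb: "continuous_on UNIV (b j)" for j unfolding b_def by (intro continuous_intros)
    have [measurable]: "b j \<in> borel_measurable borel" for j using cb by (rule borel_measurable_continuous_onI)
    have b1: "\<bar>b j x\<bar> \<le> 1" for j x unfolding b_def using infdist_nonneg[of x C] by auto
    have "(\<lambda>j. \<integral>x. b j x *\<^sub>R h x \<partial>lborel) \<longlonglongrightarrow> (\<integral>x. indicat_real C x *\<^sub>R h x \<partial>lborel)"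
    proof (rule integral_dominated_convergence)
      show "integrable lborel (\<lambda>x. norm (h x))" using h by (rule integrable_norm)
      show "AE x in lborel. norm (b j x *\<^sub>R h x) \<le> norm (h x)" for j
        using b1 by (intro AE_I2) (simp add: mult_left_le_one_le)
      show "AE x in lborel. (\<lambda>j. b j x *\<^sub>R h x) \<longlonglongrightarrow> indicat_real C x *\<^sub>R h x"
      proof (intro AE_I2 tendsto_intros)
        fix x
        show "(\<lambda>j. b j x) \<longlonglongrightarrow> indicat_real C x"
        proof (cases "x \<in> C")
          case True
          then have "infdist x C = 0" by simp
          then show ?thesis using True by (simp add: b_def)
        next
          case x: False
          then have "infdist x C > 0" using C \<open>C \<noteq> {}\<close> infdist_pos_not_in_closed by blast
          then obtain N where N: "1 < real N * infdist x C" using reals_Archimedean3 by blast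
          have "b j x = 0" if "j \<ge> N" for j
          proof -
            have "real N * infdist x C \<le> real j * infdist x C" using that by (intro mult_right_mono infdist_nonneg) auto
            then show ?thesis using N by (simp add: b_def)
          qed
          then have "\<forall>\<^sub>F j in sequentially. b j x = 0" unfolding eventually_sequentially by blast
          then show ?thesis using x by (simp add: tendsto_eventually)
        qed
      qed
    qed measurable
    moreover have "(\<integral>x. b j x *\<^sub>R h x \<partial>lborel) = 0" for j by (rule \<beta>[OF cb b1])
    ultimately show ?thesis by (simp add: LIMSEQ_const_iff set_lebesgue_integral_def)
  qed (simp add: set_lebesgue_integral_def)
qed

text \<open>By \<open>gauss_regularization\<close> all Gaussian means of h vanish. Fubini moves the
  averaging from h onto a bounded continuous test function, whose means converge to a multiple of
  it.\<close>

lemma fourier_L1_inj: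
  fixes h :: "real^'n \<Rightarrow> complex"
  assumes h: "integrable lborel h" and z: "\<And>\<xi>. (\<integral>y. exp (- \<i> * complex_of_real (y \<bullet> \<xi>)) * h y \<partial>lborel) = 0"
  shows "AE x in lborel. h x = 0"
proof (rule integral_continuous_zero_imp_AE_zero[OF h])
  fix \<beta> :: "real^'n \<Rightarrow> real" assume \<beta>: "continuous_on UNIV \<beta>" "\<And>x. \<bar>\<beta> x\<bar> \<le> 1"
  have [measurable]: "h \<in> borel_measurable borel" "\<beta> \<in> borel_measurable borel"
    using h \<beta>(1) by (auto simp: integrable_iff_bounded intro: borel_measurable_continuous_onI)
  let ?G = "(2 * pi) powr (real CARD('n) / 2)"
  define \<epsilon> where "\<epsilon> j = 1 / real (Suc j)" for j
  have \<epsilon>: "\<epsilon> j > 0" "\<epsilon> \<longlonglongrightarrow> 0" for j using LIMSEQ_Suc[OF lim_1_over_n] by (auto simp: \<epsilon>_def[abs_def])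
  have 0: "(\<integral>y. h y * complex_of_real (gauss ((1 / \<epsilon> j) *\<^sub>R (y - x))) \<partial>lborel) = 0" for j x
    using gauss_regularization[OF h \<epsilon>(1)[of j], of x] \<epsilon>(1)[of j] unfolding z by simp
  let ?B = "\<lambda>j y. \<integral>w. gauss w *\<^sub>R \<beta> (y + \<epsilon> j *\<^sub>R w) \<partial>lborel"
  have B0: "(\<integral>y. h y * complex_of_real (?B j y) \<partial>lborel) = 0" for j
  proof -
    let ?K = "\<lambda>y x. h y * complex_of_real (gauss ((1 / \<epsilon> j) *\<^sub>R (y - x)) * \<beta> x)"
    have K0: "h y * complex_of_real (?B j y) = complex_of_real ((1 / \<epsilon> j) ^ CARD('n)) * (\<integral>x. ?K y x \<partial>lborel)" for y
    proof -
      have "(\<integral>x. gauss ((1 / \<epsilon> j) *\<^sub>R (y - x)) * \<beta> x \<partial>lborel) = \<bar>\<epsilon> j\<bar> ^ DIM(real^'n) *\<^sub>R (\<integral>w. gauss ((1 / \<epsilon> j) *\<^sub>R (y - (y + \<epsilon> j *\<^sub>R w))) * \<beta> (y + \<epsilon> j *\<^sub>R w) \<partial>lborel)"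
        by (rule lborel_integral_scale) (use \<epsilon>(1)[of j] in auto)
      also have "\<dots> = \<epsilon> j ^ CARD('n) * ?B j y"
        using \<epsilon>(1)[of j] by (simp add: gauss_def)
      finally have "?B j y = (1 / \<epsilon> j) ^ CARD('n) * (\<integral>x. gauss ((1 / \<epsilon> j) *\<^sub>R (y - x)) * \<beta> x \<partial>lborel)"
        using \<epsilon>(1)[of j] by (simp add: power_one_over)
      then show ?thesis by (simp only: integral_mult_right_zero integral_complex_of_real) simp
    qed
    have "(\<integral>y. \<integral>x. ?K y x \<partial>lborel \<partial>lborel) = 0"
    proof -
      have "(\<integral>x. \<integral>y. ?K y x \<partial>lborel \<partial>lborel) = (\<integral>y. \<integral>x. ?K y x \<partial>lborel \<partial>lborel)"
      proof (rule lborel_pair.Fubini_integral)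
        have m: "(\<lambda>(y, x). ?K y x) \<in> borel_measurable (lborel \<Otimes>\<^sub>M lborel)" by measurable
        have ix: "integrable lborel (\<lambda>x. norm (?K y x))" and nx: "(\<integral>x. norm (?K y x) \<partial>lborel) \<le> norm (h y) * (\<integral>w. gauss ((1 / \<epsilon> j) *\<^sub>R (w::real^'n)) \<partial>lborel)" for y
        proof -
          have i: "integrable lborel (\<lambda>x. gauss ((1 / \<epsilon> j) *\<^sub>R (y - x)))"
            using lborel_integrable_shift[OF gauss_scale_integrable[of "1 / \<epsilon> j"], of "-1" y] \<epsilon>(1)[of j] by simp
          have le: "norm (?K y x) \<le> norm (h y) * gauss ((1 / \<epsilon> j) *\<^sub>R (y - x))" for x
            using \<beta>(2)[of x] by (simp add: norm_mult abs_mult abs_of_pos gauss_pos mult_left_mono mult_left_le less_imp_le)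
          show "integrable lborel (\<lambda>x. norm (?K y x))"
            by (rule Bochner_Integration.integrable_bound[OF integrable_mult_right[OF i, of "norm (h y)"]])
              (use le in \<open>auto intro!: AE_I2 simp: abs_of_nonneg gauss_pos less_imp_le simp del: norm_mult\<close>)
          then have "(\<integral>x. norm (?K y x) \<partial>lborel) \<le> (\<integral>x. norm (h y) * gauss ((1 / \<epsilon> j) *\<^sub>R (y - x)) \<partial>lborel)"
            by (intro Bochner_Integration.integral_mono integrable_mult_right i le)
          also have "\<dots> = norm (h y) * (\<integral>w. gauss ((1 / \<epsilon> j) *\<^sub>R (w::real^'n)) \<partial>lborel)"
            using lborel_integral_shift[of "\<lambda>w. gauss ((1 / \<epsilon> j) *\<^sub>R w)" "-1" y] by simp
          finally show "(\<integral>x. norm (?K y x) \<partial>lborel) \<le> norm (h y) * (\<integral>w. gauss ((1 / \<epsilon> j) *\<^sub>R (w::real^'n)) \<partial>lborel)" .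
        qed
        have "integrable (lborel \<Otimes>\<^sub>M lborel) (\<lambda>(y, x). ?K y x)"
        proof (rule lborel_pair.Fubini_integrable[OF m])
          show "integrable lborel (\<lambda>y. \<integral>x. norm (case (y, x) of (y, x) \<Rightarrow> ?K y x) \<partial>lborel)"
          proof (rule Bochner_Integration.integrable_bound)
            show "integrable lborel (\<lambda>y. norm (h y) * (\<integral>w. gauss ((1 / \<epsilon> j) *\<^sub>R (w::real^'n)) \<partial>lborel))"
              using h by (intro integrable_mult_left integrable_norm)
            show "AE y in lborel. norm (\<integral>x. norm (case (y, x) of (y, x) \<Rightarrow> ?K y x) \<partial>lborel) \<le> norm (norm (h y) * (\<integral>w. gauss ((1 / \<epsilon> j) *\<^sub>R (w::real^'n)) \<partial>lborel))"
              using nx by (intro AE_I2) (simp add: abs_of_nonneg, meson abs_ge_self order_trans)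
          qed measurable
          show "AE y in lborel. integrable lborel (\<lambda>x. case (y, x) of (y, x) \<Rightarrow> ?K y x)"
            using ix by (intro AE_I2) (simp add: integrable_norm_iff)
        qed
        then show "integrable (lborel \<Otimes>\<^sub>M lborel) (\<lambda>(y, x). ?K y x)" .
      qed
      moreover have "(\<integral>y. ?K y x \<partial>lborel) = 0" for x
      proof -
        have "?K y x = complex_of_real (\<beta> x) * (h y * complex_of_real (gauss ((1 / \<epsilon> j) *\<^sub>R (y - x))))" for y
          by (simp add: mult_ac)
        then show ?thesis by (simp only: integral_mult_right_zero 0 mult_zero_right)
      qed
      ultimately show ?thesis by simp
    qed
    then show ?thesis unfolding K0 by (simp only: integral_mult_right_zero mult_zero_right)
  qed
  have "(\<lambda>j. \<integral>y. h y * complex_of_real (?B j y) \<partial>lborel) \<longlonglongrightarrow> (\<integral>y. h y * complex_of_real (?G * \<beta> y) \<partial>lborel)"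
  proof (rule integral_dominated_convergence)
    show "integrable lborel (\<lambda>y. norm (h y) * ?G)" using h by (intro integrable_mult_left integrable_norm)
    show "AE y in lborel. (\<lambda>j. h y * complex_of_real (?B j y)) \<longlonglongrightarrow> h y * complex_of_real (?G * \<beta> y)"
    proof (intro AE_I2 tendsto_intros)
      fix y
      show "(\<lambda>j. ?B j y) \<longlonglongrightarrow> ?G * \<beta> y"
        using approx_identity[of \<beta> 1 \<epsilon> y] \<beta> \<epsilon>(2) by simp
    qed
    have bB: "\<bar>?B j y\<bar> \<le> ?G" for j y
    proof -
      have "norm (?B j y) \<le> (\<integral>w. gauss (w::real^'n) \<partial>lborel)"
      proof (rule order_trans[OF integral_norm_bound], rule Bochner_Integration.integral_mono')
        show "norm (gauss w *\<^sub>R \<beta> (y + \<epsilon> j *\<^sub>R w)) \<le> gauss w" for w :: "real^'n"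
          using \<beta>(2)[of "y + \<epsilon> j *\<^sub>R w"] by (simp add: abs_mult abs_of_pos gauss_pos mult_left_le less_imp_le)
      qed (use gauss_integrable gauss_pos less_imp_le in auto)
      then show ?thesis by (simp add: gauss_integral)
    qed
    show "AE y in lborel. norm (h y * complex_of_real (?B j y)) \<le> norm (h y) * ?G" for j
      using bB by (intro AE_I2) (simp add: norm_mult mult_left_mono)
  qed measurable
  then have "(\<integral>y. h y * complex_of_real (?G * \<beta> y) \<partial>lborel) = 0" unfolding B0 by (simp only: LIMSEQ_const_iff)
  moreover have "h y * complex_of_real (?G * \<beta> y) = complex_of_real ?G * (\<beta> y *\<^sub>R h y)" for y
    by (simp add: scaleR_conv_of_real mult_ac)
  ultimately have "complex_of_real ?G * (\<integral>y. \<beta> y *\<^sub>R h y \<partial>lborel) = 0" by (simp only: integral_mult_right_zero)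
  then show "(\<integral>x. \<beta> x *\<^sub>R h x \<partial>lborel) = 0" by simp
qed

text \<open>Plane waves times the Gaussian are Schwartz functions, so the hypothesis contains the
  vanishing of the Fourier transform of \<open>gauss\<close> times f; the Gaussian has no
  zeros.\<close>

lemma fundamental_lemma:
  fixes f :: "real^'n \<Rightarrow> complex"
  assumes [measurable]: "f \<in> borel_measurable borel"
    and int: "integrable lborel (\<lambda>x. gauss x *\<^sub>R f x)"
    and z: "\<And>\<phi>. \<phi> \<in> schwartz \<Longrightarrow> (\<integral>x. \<phi> x * f x \<partial>lborel) = 0"
  shows "AE x in lborel. f x = 0"
proof -
  have "AE x in lborel. gauss x *\<^sub>R f x = 0"
  proof (rule fourier_L1_inj[OF int])
    fix \<xi> :: "real^'n"
    have "(\<lambda>x. exp (\<i> * complex_of_real (x \<bullet> - \<xi>)) * complex_of_real (exp (- (norm x)\<^sup>2 / 2))) \<in> schwartz"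
      by (intro schwartz_plane_wave schwartz_gauss)
    from z[OF this] show "(\<integral>y. exp (- \<i> * complex_of_real (y \<bullet> \<xi>)) * (gauss y *\<^sub>R f y) \<partial>lborel) = 0"
      by (simp add: gauss_def scaleR_conv_of_real mult.assoc)
  qed
  then show ?thesis by eventually_elim (simp add: gauss_neq_0)
qed

section \<open>Square integrable functions with values in a Hilbert space\<close>

lemma scaleC_scaleR: "c *\<^sub>C (r *\<^sub>R x) = r *\<^sub>R (c *\<^sub>C (x::'e::fin_dim_hilbert))"
  by (simp add: scaleR_scaleC scaleC_scaleC mult.commute)

lemma scaleC_of_real: "complex_of_real r *\<^sub>C x = r *\<^sub>R (x::'e::fin_dim_hilbert)"
  by (simp add: scaleR_scaleC)

lemma cinner_scaleC_left: "cinner (c *\<^sub>C x) y = cnj c * cinner x (y::'e::fin_dim_hilbert)"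
  by (metis cinner_commute cinner_scaleC_right complex_cnj_mult)

lemma norm_scaleC: "norm (c *\<^sub>C x) = norm c * norm (x::'e::fin_dim_hilbert)"
proof -
  have "(norm (c *\<^sub>C x))\<^sup>2 = Re (cnj c * c * cinner x x)"
    by (simp add: power2_norm_eq_inner inner_eq_Re_cinner cinner_scaleC_left cinner_scaleC_right mult_ac)
  also have "cnj c * c = complex_of_real ((norm c)\<^sup>2)" using complex_norm_square[of c] by (simp add: mult.commute)
  also have "Re (complex_of_real ((norm c)\<^sup>2) * cinner x x) = (norm c)\<^sup>2 * (norm x)\<^sup>2"
    by (simp add: power2_norm_eq_inner[of x] inner_eq_Re_cinner)
  finally have "(norm (c *\<^sub>C x))\<^sup>2 = (norm c * norm x)\<^sup>2" by (simp add: power_mult_distrib)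
  then show ?thesis by simp
qed

lemma inner_scaleC_left: "inner (c *\<^sub>C x) y = inner x (cnj c *\<^sub>C (y::'e::fin_dim_hilbert))"
  by (simp add: inner_eq_Re_cinner cinner_scaleC_left cinner_scaleC_right)

lemma bounded_bilinear_scaleC: "bounded_bilinear (\<lambda>c (x::'e::fin_dim_hilbert). c *\<^sub>C x)"
proof (rule bounded_bilinear.intro)
  show "(r *\<^sub>R c) *\<^sub>C x = r *\<^sub>R (c *\<^sub>C x)" for r c and x :: 'e
    by (simp add: scaleR_conv_of_real[where 'a=complex] scaleR_scaleC scaleC_scaleC)
  show "\<exists>K. \<forall>a (b::'e). norm (a *\<^sub>C b) \<le> norm a * norm b * K"
    by (intro exI[of _ 1]) (simp add: norm_scaleC)
qed (simp_all add: scaleC_add_left scaleC_add_right scaleC_scaleR)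

interpretation scaleC: bounded_bilinear "\<lambda>c (x::'e::fin_dim_hilbert). c *\<^sub>C x"
  by (rule bounded_bilinear_scaleC)

lemma borel_measurable_scaleC [measurable (raw)]:
  fixes g :: "'a \<Rightarrow> 'e::fin_dim_hilbert"
  assumes "f \<in> borel_measurable M" "g \<in> borel_measurable M"
  shows "(\<lambda>x. f x *\<^sub>C g x) \<in> borel_measurable M"
  by (rule borel_measurable_continuous_Pair[OF assms])
    (intro scaleC.continuous_on continuous_intros)

lemma integral_scaleC:
  fixes f :: "'a \<Rightarrow> 'e::fin_dim_hilbert"
  shows "integrable M f \<Longrightarrow> (\<integral>x. c *\<^sub>C f x \<partial>M) = c *\<^sub>C (\<integral>x. f x \<partial>M)"
  by (rule integral_bounded_linear[OF scaleC.bounded_linear_right])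

text \<open>Such functions pair absolutely convergently with Schwartz functions. The class contains
  the weighted square integrable functions of every order, so one uniqueness lemma serves all
  Sobolev spaces.\<close>

definition tame :: "(real^'n \<Rightarrow> 'e::fin_dim_hilbert) \<Rightarrow> bool" where
  "tame f \<longleftrightarrow> f \<in> borel_measurable borel \<and> (\<exists>N. integrable lborel (\<lambda>x. norm (f x) / (1 + norm x) ^ N))"

lemma tame_integrable:
  assumes "tame f" and \<phi>: "\<phi> \<in> schwartz"
  shows "integrable lborel (\<lambda>x. \<phi> x *\<^sub>C f x)"
proof -
  obtain N where N: "integrable lborel (\<lambda>x. norm (f x) / (1 + norm x) ^ N)" using assms unfolding tame_def by blast
  have [measurable]: "f \<in> borel_measurable borel" "\<phi> \<in> borel_measurable borel"
    using assms schwartz_measurable by (auto simp: tame_def)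
  obtain C where C: "C \<ge> 0" "\<And>x. norm (\<phi> x) \<le> C / (1 + norm x) ^ N" using schwartz_bound[OF \<phi>] by metis
  show ?thesis
  proof (rule Bochner_Integration.integrable_bound[OF integrable_mult_right[OF N, of C]])
    show "AE x in lborel. norm (\<phi> x *\<^sub>C f x) \<le> norm (C * (norm (f x) / (1 + norm x) ^ N))"
    proof (intro AE_I2)
      fix x
      have "norm (\<phi> x *\<^sub>C f x) \<le> C / (1 + norm x) ^ N * norm (f x)"
        unfolding norm_scaleC by (intro mult_right_mono C) auto
      also have "\<dots> = C * (norm (f x) / (1 + norm x) ^ N)" by simp
      also have "\<dots> \<le> norm (C * (norm (f x) / (1 + norm x) ^ N))" by (metis abs_ge_self real_norm_def)
      finally show "norm (\<phi> x *\<^sub>C f x) \<le> norm (C * (norm (f x) / (1 + norm x) ^ N))" .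
    qed
  qed measurable
qed

lemma fun_dist_apply: "\<phi> \<in> schwartz \<Longrightarrow> fun_dist f \<phi> = (\<integral>x. \<phi> x *\<^sub>C f x \<partial>lborel)"
  by (simp add: fun_dist_def)

lemma fun_dist_cong_AE:
  assumes [measurable]: "f \<in> borel_measurable borel" "g \<in> borel_measurable borel"
    and ae: "AE x in lborel. f x = g x"
  shows "fun_dist f = fun_dist g"
proof
  fix \<phi>
  show "fun_dist f \<phi> = fun_dist g \<phi>"
  proof (cases "\<phi> \<in> schwartz")
    case True
    then have [measurable]: "\<phi> \<in> borel_measurable borel" by (rule schwartz_measurable)
    have "(\<integral>x. \<phi> x *\<^sub>C f x \<partial>lborel) = (\<integral>x. \<phi> x *\<^sub>C g x \<partial>lborel)"
      by (rule integral_cong_AE) (use ae in auto)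
    then show ?thesis using True by (simp add: fun_dist_def)
  qed (simp add: fun_dist_def)
qed

lemma bounded_linear_cinner: "bounded_linear (\<lambda>x. cinner e (x::'e::fin_dim_hilbert))"
proof (rule bounded_linear_intro[where K="2 * norm e"])
  fix x :: 'e
  have "Im (cinner e x) = inner e ((- \<i>) *\<^sub>C x)"
    by (simp add: inner_eq_Re_cinner cinner_scaleC_right)
  then have "\<bar>Im (cinner e x)\<bar> \<le> norm e * norm x"
    using Cauchy_Schwarz_ineq2[of e "(- \<i>) *\<^sub>C x"] by (simp add: norm_scaleC)
  moreover have "\<bar>Re (cinner e x)\<bar> \<le> norm e * norm x"
    using Cauchy_Schwarz_ineq2[of e x] by (simp add: inner_eq_Re_cinner)
  ultimately have "norm (cinner e x) \<le> 2 * (norm e * norm x)"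
    using cmod_le[of "cinner e x"] by linarith
  then show "norm (cinner e x) \<le> norm x * (2 * norm e)" by (simp only: mult_ac)
next
  show "cinner e (r *\<^sub>R x) = r *\<^sub>R cinner e x" for r and x :: 'e
    by (simp add: scaleR_scaleC cinner_scaleC_right scaleC_complex_def)
qed (rule cinner_add_right)

text \<open>Finitely many vectors span the space, so only finitely many null sets have to be
  united.\<close>

lemma AE_zero_if_cinner_zero:
  fixes f :: "'a \<Rightarrow> 'e::fin_dim_hilbert"
  assumes "\<And>e. AE x in M. cinner e (f x) = 0"
  shows "AE x in M. f x = 0"
proof -
  obtain B :: "'e set" where B: "finite B" "\<And>x::'e. \<exists>c. x = (\<Sum>b\<in>B. c b *\<^sub>C b)" using finite_dim by blast
  have "AE x in M. \<forall>b\<in>B. cinner b (f x) = 0" using B(1) assms by (intro AE_finite_allI)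
  then show ?thesis
  proof eventually_elim
    fix x assume *: "\<forall>b\<in>B. cinner b (f x) = 0"
    obtain c where c: "f x = (\<Sum>b\<in>B. c b *\<^sub>C b)" using B(2) by blast
    interpret L: bounded_linear "\<lambda>y. cinner (f x) y" by (rule bounded_linear_cinner)
    have 0: "cinner (f x) b = 0" if "b \<in> B" for b using * that cinner_commute[of "f x" b] by simp
    have "cinner (f x) (f x) = cinner (f x) (\<Sum>b\<in>B. c b *\<^sub>C b)" using c by simp
    also have "\<dots> = 0" by (simp add: L.sum cinner_scaleC_right 0)
    finally have "inner (f x) (f x) = 0" by (simp add: inner_eq_Re_cinner)
    then show "f x = 0" by simp
  qed
qed

text \<open>It makes the choices of representatives in \<open>weighted_L2_norm\<close> and
  \<open>rep\<close> harmless: any two agree almost everywhere. Testing each component reduces it to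
  the scalar fundamental lemma.\<close>

lemma fun_dist_inj:
  fixes f g :: "real^'n \<Rightarrow> 'e::fin_dim_hilbert"
  assumes f: "tame f" and g: "tame g" and eq: "\<And>\<phi>. \<phi> \<in> schwartz \<Longrightarrow> fun_dist f \<phi> = fun_dist g \<phi>"
  shows "AE x in lborel. f x = g x"
proof -
  have [measurable]: "f \<in> borel_measurable borel" "g \<in> borel_measurable borel" using f g by (auto simp: tame_def)
  have "AE x in lborel. cinner e (f x - g x) = 0" for e
  proof (rule fundamental_lemma)
    have [measurable]: "(\<lambda>x. cinner e (f x - g x)) \<in> borel_measurable borel"
      by (rule borel_measurable_continuous_onI[OF linear_continuous_on[OF bounded_linear_cinner], THEN measurable_compose[rotated]]) measurable
    show "(\<lambda>x. cinner e (f x - g x)) \<in> borel_measurable borel" by measurable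
    have int: "integrable lborel (\<lambda>x. \<phi> x *\<^sub>C (f x - g x))" if "\<phi> \<in> schwartz" for \<phi>
      unfolding scaleC.diff_right using that by (intro Bochner_Integration.integrable_diff tame_integrable f g)
    show "integrable lborel (\<lambda>x. gauss x *\<^sub>R cinner e (f x - g x))"
      using integrable_bounded_linear[OF bounded_linear_cinner int[OF schwartz_gauss], of e]
      by (simp only: cinner_scaleC_right gauss_def scaleR_conv_of_real)
    fix \<phi> :: "real^'n \<Rightarrow> complex" assume \<phi>: "\<phi> \<in> schwartz"
    have "(\<integral>x. \<phi> x * cinner e (f x - g x) \<partial>lborel) = cinner e (\<integral>x. \<phi> x *\<^sub>C (f x - g x) \<partial>lborel)"
      using integral_bounded_linear[OF bounded_linear_cinner int[OF \<phi>], of e] by (simp only: cinner_scaleC_right)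
    also have "(\<integral>x. \<phi> x *\<^sub>C (f x - g x) \<partial>lborel) = 0"
      using eq[OF \<phi>] \<phi> tame_integrable[OF f \<phi>] tame_integrable[OF g \<phi>] by (simp add: fun_dist_def scaleC.diff_right)
    finally show "(\<integral>x. \<phi> x * cinner e (f x - g x) \<partial>lborel) = 0"
      using cinner_scaleC_right[of e 0] by (simp add: scaleC.zero_left)
  qed
  then have "AE x in lborel. f x - g x = 0" by (rule AE_zero_if_cinner_zero)
  then show ?thesis by eventually_elim simp
qed

text \<open>The square of the Japanese bracket; order s therefore corresponds to the factor
  \<open>jb x powr (s / 2)\<close> on functions.\<close>

definition jb :: "real^'n \<Rightarrow> real" where "jb x = 1 + (norm x)\<^sup>2"

lemma jb_ge_1: "jb x \<ge> 1" by (simp add: jb_def)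
lemma jb_pos: "jb x > 0" by (simp add: jb_def add_pos_nonneg)
lemma jb_neq_0: "jb x \<noteq> 0" using jb_pos[of x] by simp
lemma jb_le: "jb x \<le> (1 + norm x) ^ 2" by (simp add: jb_def power2_eq_square algebra_simps)
lemma sobolev_weight_eq: "sobolev_weight s x = jb x powr s" by (simp add: sobolev_weight_def jb_def)
lemma sobolev_weight_0: "sobolev_weight 0 = (\<lambda>_. 1)"
  by (simp add: fun_eq_iff sobolev_weight_eq jb_neq_0)
lemma jb_measurable [measurable]: "jb \<in> borel_measurable borel" unfolding jb_def[abs_def] by measurable
lemma sobolev_weight_measurable [measurable]: "sobolev_weight s \<in> borel_measurable borel"
  unfolding sobolev_weight_def[abs_def] by measurable

text \<open>Cauchy-Schwarz in pointwise form: the integrand is u v, where the square of u is the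
  given integrand and the square of v is at most the standard majorant.\<close>

lemma weighted_square_tame:
  fixes f :: "real^'n \<Rightarrow> 'e::fin_dim_hilbert"
  assumes [measurable]: "f \<in> borel_measurable borel"
    and int: "integrable lborel (\<lambda>x. jb x powr s * (norm (f x))\<^sup>2)"
  shows "tame f"
proof -
  obtain M :: nat where M: "\<bar>s\<bar> \<le> real M" using real_arch_simple by blast
  \<comment> \<open>M absorbs the weight of order s, and the remaining CARD('n) powers make the
    square of v integrable.\<close>
  define N where "N = M + CARD('n)"
  have "integrable lborel (\<lambda>x. norm (f x) / (1 + norm x) ^ N)"
  proof (rule Bochner_Integration.integrable_bound)
    show "integrable lborel (\<lambda>x. jb x powr s * (norm (f x))\<^sup>2 + 1 / (1 + norm x) ^ (2 * CARD('n)))"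
      by (intro Bochner_Integration.integrable_add int integrable_inverse_power_norm)
    show "AE x in lborel. norm (norm (f x) / (1 + norm x) ^ N) \<le> norm (jb x powr s * (norm (f x))\<^sup>2 + 1 / (1 + norm x) ^ (2 * CARD('n)))"
    proof (intro AE_I2)
      fix x :: "real^'n"
      define u where "u = jb x powr (s / 2) * norm (f x)"
      define v where "v = jb x powr (- s / 2) / (1 + norm x) ^ N"
      have n1: "1 + norm x \<ge> 1" by simp
      have "jb x powr (- s) \<le> jb x powr (real M)" using M jb_ge_1[of x] by (intro powr_mono) auto
      also have "\<dots> = jb x ^ M" using jb_pos[of x] by (simp add: powr_realpow)
      also have "\<dots> \<le> ((1 + norm x) ^ 2) ^ M" using jb_le[of x] jb_pos[of x] by (intro power_mono) auto
      finally have p: "jb x powr (- s) \<le> (1 + norm x) ^ (2 * M)" by (simp add: power_mult)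
      have "v\<^sup>2 = jb x powr (- s) / (1 + norm x) ^ (2 * N)"
        using jb_pos[of x]
        by (simp add: v_def power_divide power2_eq_square powr_add[symmetric] power_mult power_mult_distrib mult.commute[of 2] flip: power_add)
      also have "\<dots> \<le> (1 + norm x) ^ (2 * M) / (1 + norm x) ^ (2 * N)" using p by (rule divide_right_mono) simp
      also have "\<dots> = 1 / (1 + norm x) ^ (2 * CARD('n))"
        using n1 by (simp add: N_def power_add distrib_left)
      finally have v: "v\<^sup>2 \<le> 1 / (1 + norm x) ^ (2 * CARD('n))" .
      have u: "u\<^sup>2 = jb x powr s * (norm (f x))\<^sup>2"
        using jb_pos[of x] by (simp add: u_def power_mult_distrib power2_eq_square flip: powr_add)
      have "norm (f x) / (1 + norm x) ^ N = u * v"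
        using jb_pos[of x] by (simp add: u_def v_def powr_minus field_simps)
      also have "\<dots> \<le> u\<^sup>2 + v\<^sup>2"
      proof -
        have "0 \<le> (u - v)\<^sup>2" "0 \<le> u * v" by (auto simp: u_def v_def)
        then show ?thesis by (simp add: power2_eq_square algebra_simps)
      qed
      also have "\<dots> \<le> jb x powr s * (norm (f x))\<^sup>2 + 1 / (1 + norm x) ^ (2 * CARD('n))" using u v by simp
      finally show "norm (norm (f x) / (1 + norm x) ^ N) \<le> norm (jb x powr s * (norm (f x))\<^sup>2 + 1 / (1 + norm x) ^ (2 * CARD('n)))"
        by simp
    qed
  qed measurable
  then show ?thesis using assms(1) by (auto simp: tame_def)
qed

lemma weighted_L2_rep_tame: "weighted_L2_rep (sobolev_weight s) u f \<Longrightarrow> tame f"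
  unfolding weighted_L2_rep_def sobolev_weight_eq using weighted_square_tame by blast

lemma weighted_L2_norm_eq:
  assumes f: "weighted_L2_rep (sobolev_weight s) u f"
  shows "weighted_L2_norm (sobolev_weight s) u = sqrt (\<integral>x. sobolev_weight s x * (norm (f x))\<^sup>2 \<partial>lborel)"
proof -
  let ?g = "SOME f. weighted_L2_rep (sobolev_weight s) u f"
  have g: "weighted_L2_rep (sobolev_weight s) u ?g" by (rule someI[of "weighted_L2_rep (sobolev_weight s) u", OF f])
  have "AE x in lborel. ?g x = f x"
    by (rule fun_dist_inj[OF weighted_L2_rep_tame[OF g] weighted_L2_rep_tame[OF f]])
      (use f g in \<open>simp add: weighted_L2_rep_def\<close>)
  moreover have [measurable]: "f \<in> borel_measurable borel" "?g \<in> borel_measurable borel"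
    using f g by (simp_all add: weighted_L2_rep_def)
  ultimately have "(\<integral>x. sobolev_weight s x * (norm (?g x))\<^sup>2 \<partial>lborel) = (\<integral>x. sobolev_weight s x * (norm (f x))\<^sup>2 \<partial>lborel)"
    by (intro integral_cong_AE) auto
  then show ?thesis by (simp add: weighted_L2_norm_def)
qed

definition sqi :: "(real^'n \<Rightarrow> 'e::fin_dim_hilbert) \<Rightarrow> bool" where
  "sqi f \<longleftrightarrow> f \<in> borel_measurable borel \<and> integrable lborel (\<lambda>x. (norm (f x))\<^sup>2)"

lemma sqi_measurable: "sqi f \<Longrightarrow> f \<in> borel_measurable borel" by (simp add: sqi_def)

lemma weighted_L2_rep_sqi: "weighted_L2_rep (\<lambda>_. 1) u f \<longleftrightarrow> sqi f \<and> u = fun_dist f"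
  by (simp add: weighted_L2_rep_def sqi_def)

lemma sqi_tame: "sqi f \<Longrightarrow> tame f"
  using weighted_L2_rep_tame[of 0 "fun_dist f" f] by (simp add: sobolev_weight_0 weighted_L2_rep_sqi)

lemma sqi_bound:
  assumes g: "sqi g" and [measurable]: "f \<in> borel_measurable borel" and le: "\<And>x. norm (f x) \<le> C * norm (g x)"
  shows "sqi f"
  unfolding sqi_def
proof (intro conjI assms(2))
  have "integrable lborel (\<lambda>x. C\<^sup>2 * (norm (g x))\<^sup>2)" using g by (simp add: sqi_def)
  then show "integrable lborel (\<lambda>x. (norm (f x))\<^sup>2)"
  proof (rule Bochner_Integration.integrable_bound)
    show "AE x in lborel. norm ((norm (f x))\<^sup>2) \<le> norm (C\<^sup>2 * (norm (g x))\<^sup>2)"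
      using power_mono[OF le, of _ 2] by (intro AE_I2) (simp add: power_mult_distrib)
  qed measurable
qed

lemma sqi_add:
  assumes "sqi f" "sqi g" shows "sqi (\<lambda>x. f x + g x)"
  unfolding sqi_def
proof (intro conjI)
  have [measurable]: "f \<in> borel_measurable borel" "g \<in> borel_measurable borel" using assms by (auto simp: sqi_def)
  show "(\<lambda>x. f x + g x) \<in> borel_measurable borel" by measurable
  have "integrable lborel (\<lambda>x. 2 * (norm (f x))\<^sup>2 + 2 * (norm (g x))\<^sup>2)" using assms by (simp add: sqi_def)
  then show "integrable lborel (\<lambda>x. (norm (f x + g x))\<^sup>2)"
  proof (rule Bochner_Integration.integrable_bound)
    have "(norm (f x + g x))\<^sup>2 \<le> 2 * (norm (f x))\<^sup>2 + 2 * (norm (g x))\<^sup>2" for x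
    proof -
      have "(norm (f x + g x))\<^sup>2 \<le> (norm (f x) + norm (g x))\<^sup>2" by (intro power_mono norm_triangle_ineq) auto
      moreover have "0 \<le> (norm (f x) - norm (g x))\<^sup>2" by simp
      ultimately show ?thesis by (simp add: power2_eq_square algebra_simps)
    qed
    then show "AE x in lborel. norm ((norm (f x + g x))\<^sup>2) \<le> norm (2 * (norm (f x))\<^sup>2 + 2 * (norm (g x))\<^sup>2)"
      by (intro AE_I2) simp
  qed measurable
qed

lemma sqi_scaleR: "sqi f \<Longrightarrow> sqi (\<lambda>x. r *\<^sub>R f x)"
  by (rule sqi_bound[of f _ "\<bar>r\<bar>"]) (auto dest: sqi_measurable)

lemma sqi_minus: "sqi f \<Longrightarrow> sqi (\<lambda>x. - f x)"
  by (rule sqi_bound[of f _ 1]) (auto dest: sqi_measurable)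

lemma sqi_diff: "sqi f \<Longrightarrow> sqi g \<Longrightarrow> sqi (\<lambda>x. f x - g x)"
  using sqi_add[of f "\<lambda>x. - g x"] sqi_minus[of g] by simp

lemma sqi_0: "sqi (\<lambda>x. 0)" by (simp add: sqi_def)

lemma sqi_inner:
  assumes "sqi f" "sqi g" shows "integrable lborel (\<lambda>x. norm (f x) * norm (g x))" "integrable lborel (\<lambda>x. inner (f x) (g x))"
proof -
  have [measurable]: "f \<in> borel_measurable borel" "g \<in> borel_measurable borel" using assms by (auto simp: sqi_def)
  have i: "integrable lborel (\<lambda>x. (norm (f x))\<^sup>2 + (norm (g x))\<^sup>2)" using assms by (simp add: sqi_def)
  have "norm (f x) * norm (g x) \<le> (norm (f x))\<^sup>2 + (norm (g x))\<^sup>2" for x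
  proof -
    have "0 \<le> (norm (f x) - norm (g x))\<^sup>2" "0 \<le> norm (f x) * norm (g x)" by auto
    moreover have "(norm (f x) - norm (g x))\<^sup>2 = (norm (f x))\<^sup>2 + (norm (g x))\<^sup>2 - 2 * (norm (f x) * norm (g x))"
      by (simp add: power2_eq_square algebra_simps)
    ultimately show ?thesis by linarith
  qed
  then show *: "integrable lborel (\<lambda>x. norm (f x) * norm (g x))"
    by (intro Bochner_Integration.integrable_bound[OF i] AE_I2) auto
  show "integrable lborel (\<lambda>x. inner (f x) (g x))"
    by (rule Bochner_Integration.integrable_bound[OF *]) (auto simp: Cauchy_Schwarz_ineq2)
qed

section \<open>The Hilbert space of square integrable functions\<close>

text \<open>Carving the type out of distributions makes equality of elements mean equality almost
  everywhere of representatives, without a quotient. Its elements are used mainly as functions of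
  the frequency: it is the common model of all Sobolev spaces.\<close>

typedef (overloaded) ('n::finite, 'e::fin_dim_hilbert) l2 = "L2 :: ('n, 'e) functional set"
proof
  show "fun_dist (\<lambda>x. 0) \<in> L2" using sqi_0 by (auto simp: weighted_L2_def weighted_L2_rep_sqi)
qed

definition rep :: "('n::finite, 'e::fin_dim_hilbert) l2 \<Rightarrow> real^'n \<Rightarrow> 'e" where
  "rep u = (SOME f. weighted_L2_rep (\<lambda>_. 1) (Rep_l2 u) f)"

definition mk :: "(real^'n \<Rightarrow> 'e) \<Rightarrow> ('n::finite, 'e::fin_dim_hilbert) l2" where
  "mk f = Abs_l2 (fun_dist f)"

lemma rep_sqi: "sqi (rep u)" and Rep_l2_eq: "Rep_l2 u = fun_dist (rep u)"
proof -
  have "\<exists>f. weighted_L2_rep (\<lambda>_. 1) (Rep_l2 u) f" using Rep_l2[of u] by (simp add: weighted_L2_def)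
  then have "weighted_L2_rep (\<lambda>_. 1) (Rep_l2 u) (rep u)" unfolding rep_def by (rule someI_ex)
  then show "sqi (rep u)" "Rep_l2 u = fun_dist (rep u)" by (simp_all add: weighted_L2_rep_sqi)
qed

lemma rep_measurable [measurable]: "rep u \<in> borel_measurable borel"
  using rep_sqi by (rule sqi_measurable)

lemma mk_rep: "mk (rep u) = u"
  by (simp add: mk_def Rep_l2_inverse flip: Rep_l2_eq)

lemma rep_mk: assumes "sqi f" shows "AE x in lborel. rep (mk f) x = f x"
proof -
  have "fun_dist f \<in> L2" using assms by (auto simp: weighted_L2_def weighted_L2_rep_sqi)
  then have "fun_dist (rep (mk f)) = fun_dist f" unfolding Rep_l2_eq[symmetric] mk_def by (rule Abs_l2_inverse)
  then show ?thesis by (intro fun_dist_inj sqi_tame rep_sqi assms) simp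
qed

lemma mk_cong: "f \<in> borel_measurable borel \<Longrightarrow> g \<in> borel_measurable borel \<Longrightarrow> AE x in lborel. f x = g x \<Longrightarrow> mk f = mk g"
  unfolding mk_def by (metis fun_dist_cong_AE)

lemma l2_eqI: "AE x in lborel. rep u x = rep v x \<Longrightarrow> u = v"
  using mk_cong[of "rep u" "rep v"] by (simp add: mk_rep)

instantiation l2 :: (finite, fin_dim_hilbert) real_inner
begin

definition "(0 :: ('a, 'b) l2) = mk (\<lambda>_. 0)"
definition "(u :: ('a, 'b) l2) + v = mk (\<lambda>x. rep u x + rep v x)"
definition "(u :: ('a, 'b) l2) - v = mk (\<lambda>x. rep u x - rep v x)"
definition "- (u :: ('a, 'b) l2) = mk (\<lambda>x. - rep u x)"
definition "r *\<^sub>R (u :: ('a, 'b) l2) = mk (\<lambda>x. r *\<^sub>R rep u x)"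
definition "inner (u :: ('a, 'b) l2) v = (\<integral>x. inner (rep u x) (rep v x) \<partial>lborel)"
definition norm_l2_def: "norm (u :: ('a, 'b) l2) = sqrt (inner u u)"
definition "sgn (u :: ('a, 'b) l2) = scaleR (inverse (norm u)) u"
definition dist_l2_def: "dist (u :: ('a, 'b) l2) v = norm (u - v)"
definition [code del]: "uniformity = (INF e\<in>{0<..}. principal {(x :: ('a, 'b) l2, y). dist x y < e})"
definition [code del]: "open U = (\<forall>x\<in>(U :: ('a, 'b) l2 set). eventually (\<lambda>(x', y). x' = x \<longrightarrow> y \<in> U) uniformity)"

lemma rep_0: "AE x in lborel. rep (0 :: ('a, 'b) l2) x = 0"
  unfolding zero_l2_def by (rule rep_mk[OF sqi_0])
lemma rep_add: "AE x in lborel. rep (u + v :: ('a, 'b) l2) x = rep u x + rep v x"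
  unfolding plus_l2_def by (rule rep_mk) (intro sqi_add rep_sqi)
lemma rep_diff: "AE x in lborel. rep (u - v :: ('a, 'b) l2) x = rep u x - rep v x"
  unfolding minus_l2_def by (rule rep_mk) (intro sqi_diff rep_sqi)
lemma rep_minus: "AE x in lborel. rep (- u :: ('a, 'b) l2) x = - rep u x"
  unfolding uminus_l2_def by (rule rep_mk) (intro sqi_minus rep_sqi)
lemma rep_scaleR: "AE x in lborel. rep (r *\<^sub>R u :: ('a, 'b) l2) x = r *\<^sub>R rep u x"
  unfolding scaleR_l2_def by (rule rep_mk) (intro sqi_scaleR rep_sqi)

lemma inner_l2_cong:
  assumes "AE x in lborel. rep u x = f x" "AE x in lborel. rep v x = g x"
    "f \<in> borel_measurable borel" "g \<in> borel_measurable borel"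
  shows "inner (u :: ('a, 'b) l2) v = (\<integral>x. inner (f x) (g x) \<partial>lborel)"
  unfolding inner_l2_def
proof (rule integral_cong_AE)
  show "AE x in lborel. inner (rep u x) (rep v x) = inner (f x) (g x)"
    using assms(1,2) by eventually_elim simp
qed (use assms in auto)

instance
proof
  fix u v w :: "('a, 'b) l2" and r q :: real
  show "u + v + w = u + (v + w)"
    by (rule l2_eqI) (use rep_add[of "u + v" w] rep_add[of u v] rep_add[of u "v + w"] rep_add[of v w] in \<open>eventually_elim, simp\<close>)
  show "u + v = v + u"
    by (rule l2_eqI) (use rep_add[of u v] rep_add[of v u] in \<open>eventually_elim, simp\<close>)
  show "0 + u = u"
    by (rule l2_eqI) (use rep_add[of 0 u] rep_0 in \<open>eventually_elim, simp\<close>)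
  show "- u + u = 0"
    by (rule l2_eqI) (use rep_add[of "- u" u] rep_minus[of u] rep_0 in \<open>eventually_elim, simp\<close>)
  show "u - v = u + - v"
    by (rule l2_eqI) (use rep_add[of u "- v"] rep_minus[of v] rep_diff[of u v] in \<open>eventually_elim, simp\<close>)
  show "r *\<^sub>R (u + v) = r *\<^sub>R u + r *\<^sub>R v"
    by (rule l2_eqI) (use rep_add[of u v] rep_scaleR[of r "u + v"] rep_scaleR[of r u] rep_scaleR[of r v] rep_add[of "r *\<^sub>R u" "r *\<^sub>R v"]
      in \<open>eventually_elim, simp add: scaleR_add_right\<close>)
  show "(r + q) *\<^sub>R u = r *\<^sub>R u + q *\<^sub>R u"
    by (rule l2_eqI) (use rep_scaleR[of "r + q" u] rep_scaleR[of r u] rep_scaleR[of q u] rep_add[of "r *\<^sub>R u" "q *\<^sub>R u"]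
      in \<open>eventually_elim, simp add: scaleR_add_left\<close>)
  show "r *\<^sub>R q *\<^sub>R u = (r * q) *\<^sub>R u"
    by (rule l2_eqI) (use rep_scaleR[of r "q *\<^sub>R u"] rep_scaleR[of q u] rep_scaleR[of "r * q" u] in \<open>eventually_elim, simp\<close>)
  show "1 *\<^sub>R u = u"
    by (rule l2_eqI) (use rep_scaleR[of 1 u] in \<open>eventually_elim, simp\<close>)
  show "inner u v = inner v u" unfolding inner_l2_def by (simp add: inner_commute)
  show "inner (u + v) w = inner u w + inner v w"
    by (subst inner_l2_cong[OF rep_add, of w "rep w"])
      (auto simp: inner_add_left inner_l2_def sqi_inner(2)[OF rep_sqi rep_sqi])
  show "inner (r *\<^sub>R u) v = r * inner u v"
    by (subst inner_l2_cong[OF rep_scaleR, of v "rep v"]) (auto simp: inner_l2_def)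
  show "0 \<le> inner u u" unfolding inner_l2_def by (intro integral_nonneg_AE) auto
  show "inner u u = 0 \<longleftrightarrow> u = 0"
  proof
    assume "inner u u = 0"
    then have "AE x in lborel. inner (rep u x) (rep u x) = 0"
      unfolding inner_l2_def by (subst (asm) integral_nonneg_eq_0_iff_AE) (auto intro: sqi_inner rep_sqi)
    then have "AE x in lborel. rep u x = rep 0 x" using rep_0 by eventually_elim simp
    then show "u = 0" by (rule l2_eqI)
  next
    assume "u = 0"
    then show "inner u u = 0"
      by (simp add: inner_l2_cong[OF rep_0 rep_0])
  qed
qed (simp_all add: norm_l2_def sgn_l2_def dist_l2_def uniformity_l2_def open_l2_def)

end

lemma norm_l2_mk:
  assumes "sqi f" shows "(norm (mk f))\<^sup>2 = (\<integral>x. (norm (f x))\<^sup>2 \<partial>lborel)"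
proof -
  have "(norm (mk f))\<^sup>2 = inner (mk f) (mk f)" by (rule power2_norm_eq_inner)
  also have "\<dots> = (\<integral>x. inner (f x) (f x) \<partial>lborel)"
    using assms by (intro inner_l2_cong rep_mk sqi_measurable)
  finally show ?thesis by (simp add: power2_norm_eq_inner)
qed

lemma norm_l2_rep: "(norm u)\<^sup>2 = (\<integral>x. (norm (rep u x))\<^sup>2 \<partial>lborel)"
  using norm_l2_mk[OF rep_sqi[of u]] by (simp add: mk_rep)

lemma nn_norm_l2_mk:
  assumes "sqi f" shows "ennreal ((norm (mk f))\<^sup>2) = (\<integral>\<^sup>+x. ennreal ((norm (f x))\<^sup>2) \<partial>lborel)"
  unfolding norm_l2_mk[OF assms] by (rule nn_integral_eq_integral[symmetric]) (use assms in \<open>auto simp: sqi_def\<close>)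

lemma mk_diff:
  assumes "sqi f" "sqi g" shows "mk (\<lambda>x. f x - g x) = mk f - mk g"
  by (rule l2_eqI)
    (use rep_mk[OF sqi_diff[OF assms]] assms[THEN rep_mk] rep_diff[of "mk f" "mk g"] in \<open>eventually_elim, simp\<close>)

text \<open>The Riesz-Fischer theorem. A rapidly Cauchy subsequence converges almost everywhere, and
  Fatou's lemma bounds its distance in norm from the pointwise limit.\<close>

instance l2 :: (finite, fin_dim_hilbert) banach
proof
  fix X :: "nat \<Rightarrow> ('a, 'b) l2" assume X: "Cauchy X"
  have "\<exists>N. \<forall>m\<ge>N. \<forall>n\<ge>N. norm (X m - X n) < (1/2) ^ j" for j :: nat
    using X unfolding Cauchy_iff by simp
  then obtain N where N: "\<And>j m n. m \<ge> N j \<Longrightarrow> n \<ge> N j \<Longrightarrow> norm (X m - X n) < (1/2) ^ j" by metis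
  \<comment> \<open>The summand j makes r strictly increasing, and the sum makes \<open>r j\<close>
    at least \<open>N j\<close>.\<close>
  define r where "r j = j + (\<Sum>i\<le>j. N i)" for j
  have r: "strict_mono r" by (rule strict_monoI_Suc) (simp add: r_def)
  have rN: "r j \<ge> N j" for j unfolding r_def using member_le_sum[of j "{..j}" N] by simp
  define f where "f j = rep (X (r j))" for j
  have fs: "sqi (f j)" for j by (simp add: f_def rep_sqi)
  have [measurable]: "f j \<in> borel_measurable borel" for j using fs by (rule sqi_measurable)
  have mkf: "mk (f j) = X (r j)" for j by (simp add: f_def mk_rep)
  have nn: "(\<integral>\<^sup>+x. ennreal ((norm (f k x - f j x))\<^sup>2) \<partial>lborel) = ennreal ((norm (X (r k) - X (r j)))\<^sup>2)" for k j
    using nn_norm_l2_mk[OF sqi_diff[OF fs fs], of k j] by (simp add: mk_diff fs mkf)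
  have close: "(norm (X (r k) - X (r j)))\<^sup>2 \<le> ((1/2) ^ j)\<^sup>2" if "k \<ge> j" for k j
  proof -
    have "r k \<ge> r j" using strict_mono_less_eq[OF r] that by simp
    then have "norm (X (r k) - X (r j)) < (1/2) ^ j" using rN[of j] by (intro N) auto
    then show ?thesis by (intro power_mono) auto
  qed
  have "(\<integral>\<^sup>+x. (\<Sum>j. ennreal (2 ^ j * (norm (f (Suc j) x - f j x))\<^sup>2)) \<partial>lborel) = (\<Sum>j. \<integral>\<^sup>+x. ennreal (2 ^ j * (norm (f (Suc j) x - f j x))\<^sup>2) \<partial>lborel)"
    by (rule nn_integral_suminf) measurable
  also have "\<dots> \<le> (\<Sum>j. ennreal ((1/2) ^ j))"
  proof (rule suminf_le)
    fix j
    have "(\<integral>\<^sup>+x. ennreal (2 ^ j * (norm (f (Suc j) x - f j x))\<^sup>2) \<partial>lborel) = ennreal (2 ^ j) * ennreal ((norm (X (r (Suc j)) - X (r j)))\<^sup>2)"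
      unfolding nn[symmetric] by (simp add: ennreal_mult nn_integral_cmult)
    also have "\<dots> = ennreal (2 ^ j * (norm (X (r (Suc j)) - X (r j)))\<^sup>2)" by (simp add: ennreal_mult)
    also have "\<dots> \<le> ennreal (2 ^ j * ((1/2) ^ j)\<^sup>2)" by (intro ennreal_leI mult_left_mono close) auto
    also have "2 ^ j * ((1/2) ^ j)\<^sup>2 = (1/2 :: real) ^ j" by (simp add: power2_eq_square power_one_over)
    finally show "(\<integral>\<^sup>+x. ennreal (2 ^ j * (norm (f (Suc j) x - f j x))\<^sup>2) \<partial>lborel) \<le> ennreal ((1/2) ^ j)" .
  qed auto
  also have "\<dots> = ennreal (\<Sum>j. (1/2) ^ j)" by (rule suminf_ennreal2) (auto intro!: summable_geometric)
  finally have "(\<integral>\<^sup>+x. (\<Sum>j. ennreal (2 ^ j * (norm (f (Suc j) x - f j x))\<^sup>2)) \<partial>lborel) < \<infinity>"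
    by (rule le_less_trans) simp
  then have "(\<integral>\<^sup>+x. (\<Sum>j. ennreal (2 ^ j * (norm (f (Suc j) x - f j x))\<^sup>2)) \<partial>lborel) \<noteq> \<infinity>"
    by (rule less_imp_neq)
  then have "AE x in lborel. (\<Sum>j. ennreal (2 ^ j * (norm (f (Suc j) x - f j x))\<^sup>2)) \<noteq> \<infinity>"
    by (rule nn_integral_PInf_AE[rotated]) measurable
  then have conv: "AE x in lborel. convergent (\<lambda>j. f j x)"
  proof eventually_elim
    fix x assume fin: "(\<Sum>j. ennreal (2 ^ j * (norm (f (Suc j) x - f j x))\<^sup>2)) \<noteq> \<infinity>"
    define C where "C = enn2real (\<Sum>j. ennreal (2 ^ j * (norm (f (Suc j) x - f j x))\<^sup>2))"
    have C: "2 ^ j * (norm (f (Suc j) x - f j x))\<^sup>2 \<le> C" for j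
    proof -
      have "ennreal (2 ^ j * (norm (f (Suc j) x - f j x))\<^sup>2) \<le> (\<Sum>j. ennreal (2 ^ j * (norm (f (Suc j) x - f j x))\<^sup>2))"
      proof -
        have "(\<Sum>i\<in>{j}. F i) \<le> (\<Sum>i. F i)" for F :: "nat \<Rightarrow> ennreal"
          by (rule sum_le_suminf[OF summableI]) simp_all
        then show ?thesis by simp
      qed
      also have "\<dots> = ennreal C"
        unfolding C_def by (rule ennreal_enn2real[symmetric]) (use fin in \<open>simp only: less_top infinity_ennreal_def\<close>)
      finally have "ennreal (2 ^ j * (norm (f (Suc j) x - f j x))\<^sup>2) \<le> ennreal C" .
      moreover have "C \<ge> 0" unfolding C_def by (rule enn2real_nonneg)
      ultimately show ?thesis by (simp only: ennreal_le_iff)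
    qed
    \<comment> \<open>The weight 2 ^ j in the series is affordable since the squared norms of the
      gaps decay like 4 ^ (- j); its payoff is geometric pointwise decay with ratio 1 / sqrt
      2.\<close>
    have "norm (f (Suc j) x - f j x) \<le> sqrt C * (1 / sqrt 2) ^ j" for j
    proof (rule power2_le_imp_le)
      have "(norm (f (Suc j) x - f j x))\<^sup>2 \<le> C * (1/2) ^ j"
        using C[of j] by (simp add: field_simps power_one_over)
      also have "\<dots> = (sqrt C * (1 / sqrt 2) ^ j)\<^sup>2"
      proof -
        have "((1 / sqrt 2) ^ j)\<^sup>2 = ((1 / sqrt 2)\<^sup>2) ^ j" by (simp only: power_mult[symmetric] mult.commute)
        also have "(1 / sqrt 2)\<^sup>2 = 1/2" by (simp add: power_divide)
        moreover have "C \<ge> 0" by (simp add: C_def)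
        ultimately show ?thesis by (simp only: power_mult_distrib real_sqrt_pow2)
      qed
      finally show "(norm (f (Suc j) x - f j x))\<^sup>2 \<le> (sqrt C * (1 / sqrt 2) ^ j)\<^sup>2" .
    qed (simp add: C_def)
    then have "norm (norm (f (Suc j) x - f j x)) \<le> sqrt C * (1 / sqrt 2) ^ j" for j by simp
    moreover have "summable (\<lambda>j. sqrt C * (1 / sqrt 2) ^ j)" by (rule summable_mult[OF summable_geometric]) simp
    ultimately have "summable (\<lambda>j. norm (f (Suc j) x - f j x))"
      by (rule summable_comparison_test'[rotated, where N=0])
    then have "summable (\<lambda>j. f (Suc j) x - f j x)" by (rule summable_norm_cancel)
    then have "convergent (\<lambda>n. f n x - f 0 x)"
      using sum_lessThan_telescope[of "\<lambda>j. f j x"] by (simp add: summable_iff_convergent)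
    then show "convergent (\<lambda>j. f j x)" using convergent_add[OF _ convergent_const[of "f 0 x"]] by fastforce
  qed
  define g where "g x = lim (\<lambda>j. f j x)" for x
  have [measurable]: "g \<in> borel_measurable borel" unfolding g_def[abs_def] by (rule borel_measurable_lim_metric) measurable
  have bound: "(\<integral>\<^sup>+x. ennreal ((norm (g x - f j x))\<^sup>2) \<partial>lborel) \<le> ennreal (((1/2) ^ j)\<^sup>2)" for j
  proof -
    have "(\<integral>\<^sup>+x. ennreal ((norm (g x - f j x))\<^sup>2) \<partial>lborel) = (\<integral>\<^sup>+x. liminf (\<lambda>k. ennreal ((norm (f k x - f j x))\<^sup>2)) \<partial>lborel)"
    proof (rule nn_integral_cong_AE, use conv in eventually_elim)
      fix x assume "convergent (\<lambda>j. f j x)"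
      then have "(\<lambda>k. f k x) \<longlonglongrightarrow> g x" unfolding g_def by (simp add: convergent_LIMSEQ_iff)
      then have "(\<lambda>k. ennreal ((norm (f k x - f j x))\<^sup>2)) \<longlonglongrightarrow> ennreal ((norm (g x - f j x))\<^sup>2)"
        by (intro tendsto_intros)
      then show "ennreal ((norm (g x - f j x))\<^sup>2) = liminf (\<lambda>k. ennreal ((norm (f k x - f j x))\<^sup>2))"
        by (intro lim_imp_Liminf[symmetric]) auto
    qed
    also have "\<dots> \<le> liminf (\<lambda>k. \<integral>\<^sup>+x. ennreal ((norm (f k x - f j x))\<^sup>2) \<partial>lborel)"
      by (rule nn_integral_liminf) measurable
    also have "\<dots> \<le> ennreal (((1/2) ^ j)\<^sup>2)"
    proof (rule Liminf_le)
      show "\<forall>\<^sub>F k in sequentially. (\<integral>\<^sup>+x. ennreal ((norm (f k x - f j x))\<^sup>2) \<partial>lborel) \<le> ennreal (((1/2) ^ j)\<^sup>2)"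
        unfolding nn eventually_sequentially by (intro exI[of _ j] allI impI ennreal_leI close)
    qed simp
    finally show ?thesis .
  qed
  have gf: "sqi (\<lambda>x. g x - f j x)" for j
    unfolding sqi_def
  proof (intro conjI integrableI_bounded)
    show "(\<integral>\<^sup>+x. ennreal (norm ((norm (g x - f j x))\<^sup>2)) \<partial>lborel) < \<infinity>"
      using bound[of j] by (auto simp: less_top[symmetric] dest: neq_top_trans[rotated])
  qed measurable
  have gs: "sqi g" using sqi_add[OF gf[of 0] fs[of 0]] by simp
  have le: "norm (X (r j) - mk g) \<le> (1/2) ^ j" for j
  proof (rule power2_le_imp_le)
    have "ennreal ((norm (mk g - X (r j)))\<^sup>2) \<le> ennreal (((1/2) ^ j)\<^sup>2)"
      using bound[of j] nn_norm_l2_mk[OF gf[of j]] by (simp add: mk_diff gs fs mkf)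
    then show "(norm (X (r j) - mk g))\<^sup>2 \<le> ((1/2) ^ j)\<^sup>2" by (simp add: norm_minus_commute)
  qed simp
  have "(\<lambda>j. X (r j) - mk g) \<longlonglongrightarrow> 0"
    by (rule Lim_null_comparison[OF always_eventually[OF allI[OF le]]]) (auto intro: LIMSEQ_realpow_zero)
  then have sub: "(\<lambda>j. X (r j)) \<longlonglongrightarrow> mk g" by (rule LIM_zero_cancel)
  have "X \<longlonglongrightarrow> mk g"
  proof (rule metric_LIMSEQ_I)
    fix e :: real assume e: "e > 0"
    then obtain N1 where N1: "\<And>m n. m \<ge> N1 \<Longrightarrow> n \<ge> N1 \<Longrightarrow> dist (X m) (X n) < e/2"
      using metric_CauchyD[OF X, of "e/2"] by auto
    obtain N2 where N2: "\<And>j. j \<ge> N2 \<Longrightarrow> dist (X (r j)) (mk g) < e/2"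
      using metric_LIMSEQ_D[OF sub, of "e/2"] e by auto
    have "dist (X n) (mk g) < e" if "n \<ge> N1" for n
    proof -
      have "r (max N1 N2) \<ge> N1" using seq_suble[OF r, of "max N1 N2"] by linarith
      then have "dist (X n) (X (r (max N1 N2))) < e/2" using that by (intro N1)
      moreover have "dist (X (r (max N1 N2))) (mk g) < e/2" by (rule N2) simp
      ultimately show ?thesis using dist_triangle[of "X n" "mk g" "X (r (max N1 N2))"] by linarith
    qed
    then show "\<exists>no. \<forall>n\<ge>no. dist (X n) (mk g) < e" by blast
  qed
  then show "convergent X" by (rule convergentI)
qed

section \<open>Multiplication and weighted translation of square integrable functions\<close>

lemma mk_norm_le:
  assumes f: "f \<in> borel_measurable borel" and le: "AE x in lborel. norm (f x) \<le> C * norm (rep u (x - k))" and "C \<ge> 0"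
  shows "sqi f" "norm (mk f) \<le> C * norm u"
proof -
  have i: "integrable lborel (\<lambda>x. (norm (rep u (x - k)))\<^sup>2)"
    using lborel_integrable_shift[of "\<lambda>x. (norm (rep u x))\<^sup>2" 1 "- k"] rep_sqi[of u] by (simp add: sqi_def)
  have le2: "AE x in lborel. (norm (f x))\<^sup>2 \<le> C\<^sup>2 * (norm (rep u (x - k)))\<^sup>2"
    using le by eventually_elim (simp add: power_mono power_mult_distrib[symmetric])
  have intf: "integrable lborel (\<lambda>x. (norm (f x))\<^sup>2)"
  proof (rule Bochner_Integration.integrable_bound[OF integrable_mult_right[OF i, of "C\<^sup>2"]])
    show "AE x in lborel. norm ((norm (f x))\<^sup>2) \<le> norm (C\<^sup>2 * (norm (rep u (x - k)))\<^sup>2)"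
      using le2 by eventually_elim simp
  qed (use f in measurable)
  then show s: "sqi f" using f by (simp add: sqi_def)
  have "(norm (mk f))\<^sup>2 \<le> (\<integral>x. C\<^sup>2 * (norm (rep u (x - k)))\<^sup>2 \<partial>lborel)"
    unfolding norm_l2_mk[OF s] by (rule integral_mono_AE[OF intf integrable_mult_right[OF i] le2])
  also have "\<dots> = C\<^sup>2 * (\<integral>x. (norm (rep u x))\<^sup>2 \<partial>lborel)"
    using lborel_integral_shift[of "\<lambda>x. (norm (rep u x))\<^sup>2" 1 "- k"] by simp
  also have "\<dots> = (C * norm u)\<^sup>2" by (simp add: norm_l2_rep power_mult_distrib)
  finally show "norm (mk f) \<le> C * norm u" by (rule power2_le_imp_le) (use \<open>C \<ge> 0\<close> in simp)
qed

lemma AE_lborel_shift: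
  fixes k :: "'a::euclidean_space"
  assumes "AE x in lborel. P x"
  shows "AE x in lborel. P (x - k)"
proof -
  have "AE x in distr lborel borel (\<lambda>x. - k + 1 *\<^sub>R x). P x"
    by (subst lborel_distr_scale_unit) (simp_all add: assms)
  then have "AE x in lborel. P (- k + 1 *\<^sub>R x)" by (rule AE_distrD[rotated]) simp
  then show ?thesis by simp
qed

definition mulop :: "(real^'n \<Rightarrow> complex) \<Rightarrow> ('n::finite, 'e::fin_dim_hilbert) l2 \<Rightarrow> ('n, 'e) l2" where
  "mulop p u = mk (\<lambda>x. p x *\<^sub>C rep u x)"

lemma mulop_props:
  fixes u :: "('n::finite, 'e::fin_dim_hilbert) l2"
  assumes p [measurable]: "p \<in> borel_measurable borel" and le: "\<And>x. norm (p x) \<le> C"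
  shows rep_mulop: "AE x in lborel. rep (mulop p u) x = p x *\<^sub>C rep u x"
    and norm_mulop_le: "norm (mulop p u) \<le> C * norm u"
    and bounded_linear_mulop: "bounded_linear (mulop p :: ('n, 'e) l2 \<Rightarrow> _)"
proof -
  have "C \<ge> 0" using le[of 0] norm_ge_zero order_trans by blast
  have "AE x in lborel. norm (p x *\<^sub>C rep u x) \<le> C * norm (rep u (x - 0))" for u :: "('n, 'e) l2"
    using le by (simp add: norm_scaleC mult_right_mono)
  note b = mk_norm_le[OF _ this \<open>C \<ge> 0\<close>]
  have s: "sqi (\<lambda>x. p x *\<^sub>C rep u x)" for u :: "('n, 'e) l2" by (rule b) measurable
  have r: "AE x in lborel. rep (mulop p u) x = p x *\<^sub>C rep u x" for u :: "('n, 'e) l2"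
    unfolding mulop_def using s by (rule rep_mk)
  have n: "norm (mulop p u) \<le> C * norm u" for u :: "('n, 'e) l2"
    unfolding mulop_def by (rule b) measurable
  from r n show "AE x in lborel. rep (mulop p u) x = p x *\<^sub>C rep u x" "norm (mulop p u) \<le> C * norm u" .
  show "bounded_linear (mulop p :: ('n, 'e) l2 \<Rightarrow> _)"
  proof (rule bounded_linear_intro[where K=C])
    show "norm (mulop p u) \<le> norm u * C" for u :: "('n, 'e) l2" using n by (simp add: mult.commute)
    show "mulop p (u + v) = mulop p u + mulop p v" for u v :: "('n, 'e) l2"
      by (rule l2_eqI) (use r[of "u + v"] r[of u] r[of v] rep_add[of u v] rep_add[of "mulop p u" "mulop p v"] in
        \<open>eventually_elim, simp add: scaleC_add_right\<close>)
    show "mulop p (c *\<^sub>R u) = c *\<^sub>R mulop p u" for c and u :: "('n, 'e) l2"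
      by (rule l2_eqI) (use r[of "c *\<^sub>R u"] r[of u] rep_scaleR[of c u] rep_scaleR[of c "mulop p u"] in
        \<open>eventually_elim, simp add: scaleC_scaleR\<close>)
  qed
qed

text \<open>Complex scalars act as constant multipliers: the type class structure of
  \<open>l2\<close> is only real, and complex linearity of an operator means that it commutes with
  \<open>csc\<close>.\<close>

definition csc :: "complex \<Rightarrow> ('n::finite, 'e::fin_dim_hilbert) l2 \<Rightarrow> ('n, 'e) l2" where
  "csc c = mulop (\<lambda>_. c)"

lemma rep_csc: "AE x in lborel. rep (csc c u) x = c *\<^sub>C rep u x"
  unfolding csc_def by (rule rep_mulop[of _ "norm c"]) auto

lemma norm_csc_le: "norm (csc c u) \<le> norm c * norm u"
  unfolding csc_def by (rule norm_mulop_le) auto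

lemma bounded_linear_csc: "bounded_linear (csc c)"
  unfolding csc_def by (rule bounded_linear_mulop[of _ "norm c"]) auto

text \<open>In the representation by square integrable functions used below, \<open>shift s k\<close> is the
  multiplication by \<open>x \<mapsto> exp (i \<langle>x, k\<rangle>)\<close> on the Sobolev space of order \<open>s\<close>.\<close>

definition shift :: "real \<Rightarrow> real^'n \<Rightarrow> ('n::finite, 'e::fin_dim_hilbert) l2 \<Rightarrow> ('n, 'e) l2" where
  "shift s k u = mk (\<lambda>\<xi>. ((jb \<xi> / jb (\<xi> - k)) powr (s / 2)) *\<^sub>R rep u (\<xi> - k))"

lemma jb_uminus: "jb (- x) = jb x" by (simp add: jb_def)

text \<open>Peetre's inequality. After the triangle inequality it compares two polynomials in the
  norms of k and \<xi> - k, whose difference is a sum of squares.\<close>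

lemma jb_peetre: "jb \<xi> \<le> (2 * jb k) * jb (\<xi> - k)"
proof -
  have "norm \<xi> \<le> norm (\<xi> - k) + norm k" using norm_triangle_ineq[of "\<xi> - k" k] by simp
  then have "(norm \<xi>)\<^sup>2 \<le> (norm (\<xi> - k) + norm k)\<^sup>2" by (intro power_mono) auto
  moreover have "(2 * (1 + b\<^sup>2)) * (1 + a\<^sup>2) - (1 + (a + b)\<^sup>2) = 1 + (a - b)\<^sup>2 + 2 * (a * b)\<^sup>2" for a b :: real
    by (simp add: power2_eq_square algebra_simps)
  then have "1 + (a + b)\<^sup>2 \<le> (2 * (1 + b\<^sup>2)) * (1 + a\<^sup>2)" for a b :: real
    by (metis add_nonneg_nonneg diff_ge_0_iff_ge mult_nonneg_nonneg zero_le_numeral zero_le_one zero_le_power2)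
  ultimately show ?thesis unfolding jb_def by (meson add_left_mono order_trans)
qed

text \<open>For negative s the quotient is inverted and Peetre's inequality is used at \<xi> - k
  with - k. What matters is polynomial growth in k, uniformly in \<xi>.\<close>

lemma jb_ratio_bound: "(jb \<xi> / jb (\<xi> - k)) powr (s / 2) \<le> (2 * jb k) powr (\<bar>s\<bar> / 2)"
proof (cases "s \<ge> 0")
  case True
  have "jb \<xi> / jb (\<xi> - k) \<le> 2 * jb k" using jb_peetre[of \<xi> k] jb_pos[of "\<xi> - k"] by (simp add: divide_le_eq)
  then have "(jb \<xi> / jb (\<xi> - k)) powr (s / 2) \<le> (2 * jb k) powr (s / 2)"
    using True jb_pos[of \<xi>] jb_pos[of "\<xi> - k"] by (intro powr_mono2) auto
  then show ?thesis using True by simp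
next
  case False
  have "jb (\<xi> - k) \<le> (2 * jb k) * jb \<xi>" using jb_peetre[of "\<xi> - k" "- k"] by (simp add: jb_uminus)
  then have "jb (\<xi> - k) / jb \<xi> \<le> 2 * jb k" using jb_pos[of \<xi>] by (simp add: divide_le_eq)
  then have "(jb (\<xi> - k) / jb \<xi>) powr (\<bar>s\<bar> / 2) \<le> (2 * jb k) powr (\<bar>s\<bar> / 2)"
    using jb_pos[of \<xi>] jb_pos[of "\<xi> - k"] by (intro powr_mono2) auto
  moreover have "(jb \<xi> / jb (\<xi> - k)) powr (s / 2) = (jb (\<xi> - k) / jb \<xi>) powr (\<bar>s\<bar> / 2)"
    using False jb_pos[of \<xi>] jb_pos[of "\<xi> - k"] by (simp add: powr_divide powr_minus field_simps)
  ultimately show ?thesis by simp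
qed

lemma shift_props:
  fixes u :: "('n::finite, 'e::fin_dim_hilbert) l2"
  shows rep_shift: "AE \<xi> in lborel. rep (shift s k u) \<xi> = ((jb \<xi> / jb (\<xi> - k)) powr (s / 2)) *\<^sub>R rep u (\<xi> - k)"
    and norm_shift_le: "norm (shift s k u) \<le> (2 * jb k) powr (\<bar>s\<bar> / 2) * norm u"
    and bounded_linear_shift: "bounded_linear (shift s k :: ('n, 'e) l2 \<Rightarrow> _)"
    and shift_csc: "shift s k (csc c u) = csc c (shift s k u)"
proof -
  let ?r = "\<lambda>\<xi>. (jb \<xi> / jb (\<xi> - k)) powr (s / 2)"
  have [measurable]: "?r \<in> borel_measurable borel" by measurable
  have "AE \<xi> in lborel. norm (?r \<xi> *\<^sub>R rep u (\<xi> - k)) \<le> (2 * jb k) powr (\<bar>s\<bar> / 2) * norm (rep u (\<xi> - k))" for u :: "('n, 'e) l2"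
    using jb_ratio_bound[of _ k s] by (simp add: mult_right_mono)
  note b = mk_norm_le[OF _ this powr_ge_zero]
  have s: "sqi (\<lambda>\<xi>. ?r \<xi> *\<^sub>R rep u (\<xi> - k))" for u :: "('n, 'e) l2" by (rule b) measurable
  have r: "AE \<xi> in lborel. rep (shift s k u) \<xi> = ?r \<xi> *\<^sub>R rep u (\<xi> - k)" for u :: "('n, 'e) l2"
    unfolding shift_def using s by (rule rep_mk)
  have n: "norm (shift s k u) \<le> (2 * jb k) powr (\<bar>s\<bar> / 2) * norm u" for u :: "('n, 'e) l2"
    unfolding shift_def by (rule b) measurable
  from r n show "AE \<xi> in lborel. rep (shift s k u) \<xi> = ?r \<xi> *\<^sub>R rep u (\<xi> - k)"
    "norm (shift s k u) \<le> (2 * jb k) powr (\<bar>s\<bar> / 2) * norm u" .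
  show "bounded_linear (shift s k :: ('n, 'e) l2 \<Rightarrow> _)"
  proof (rule bounded_linear_intro[where K="(2 * jb k) powr (\<bar>s\<bar> / 2)"])
    show "norm (shift s k u) \<le> norm u * (2 * jb k) powr (\<bar>s\<bar> / 2)" for u :: "('n, 'e) l2" using n[of u] by (simp add: mult.commute)
    show "shift s k (u + v) = shift s k u + shift s k v" for u v :: "('n, 'e) l2"
      by (rule l2_eqI) (use r[of "u + v"] r[of u] r[of v] AE_lborel_shift[OF rep_add[of u v], of k] rep_add[of "shift s k u" "shift s k v"] in
        \<open>eventually_elim, simp add: scaleR_add_right\<close>)
    show "shift s k (c *\<^sub>R u) = c *\<^sub>R shift s k u" for c and u :: "('n, 'e) l2"
      by (rule l2_eqI) (use r[of "c *\<^sub>R u"] r[of u] AE_lborel_shift[OF rep_scaleR[of c u], of k] rep_scaleR[of c "shift s k u"] in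
        \<open>eventually_elim, simp add: mult.commute\<close>)
  qed
  show "shift s k (csc c u) = csc c (shift s k u)"
    by (rule l2_eqI) (use r[of "csc c u"] r[of u] AE_lborel_shift[OF rep_csc[of c u], of k] rep_csc[of c "shift s k u"] in
      \<open>eventually_elim, simp add: scaleC_scaleR\<close>)
qed

section \<open>Sobolev spaces as images of the space of square integrable functions\<close>

definition wrep :: "real \<Rightarrow> ('n::finite, 'e::fin_dim_hilbert) l2 \<Rightarrow> real^'n \<Rightarrow> 'e" where
  "wrep s h = (\<lambda>\<xi>. (jb \<xi> powr (- s / 2)) *\<^sub>R rep h \<xi>)"

text \<open>The isometry from square integrable functions onto the Sobolev space of order \<open>s\<close>, inverse to
  the Fourier transform followed by multiplication by \<open>(1 + |\<xi>|\<^sup>2)\<^bsup>s/2\<^esup>\<close>.\<close>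

definition J :: "real \<Rightarrow> ('n::finite, 'e::fin_dim_hilbert) l2 \<Rightarrow> ('n, 'e) functional" where
  "J s h = transposed ifourier (fun_dist (wrep s h))"

lemma wrep_measurable [measurable]: "wrep s h \<in> borel_measurable borel"
  unfolding wrep_def by measurable

lemma wrep_weight: "sobolev_weight s \<xi> * (norm (wrep s h \<xi>))\<^sup>2 = (norm (rep h \<xi>))\<^sup>2"
proof -
  have "jb \<xi> powr s * (jb \<xi> powr (- s / 2))\<^sup>2 = 1"
    using jb_pos[of \<xi>] by (simp add: power2_eq_square jb_neq_0 flip: powr_add)
  then show ?thesis by (simp add: sobolev_weight_eq wrep_def power_mult_distrib flip: mult.assoc)
qed

lemma wrep_rep: "weighted_L2_rep (sobolev_weight s) (fun_dist (wrep s h)) (wrep s h)"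
  using rep_sqi[of h] by (simp add: weighted_L2_rep_def wrep_weight sqi_def)

lemma wrep_tame: "tame (wrep s h)"
  using wrep_rep by (rule weighted_L2_rep_tame)

lemma J_apply: "\<phi> \<in> schwartz \<Longrightarrow> J s h \<phi> = (\<integral>\<xi>. ifourier \<phi> \<xi> *\<^sub>C wrep s h \<xi> \<partial>lborel)"
  by (simp add: J_def transposed_def fun_dist_apply ifourier_schwartz)

lemma J_not_schwartz: "\<phi> \<notin> schwartz \<Longrightarrow> J s h \<phi> = 0"
  by (simp add: J_def transposed_def)

lemma J_integrable: "\<phi> \<in> schwartz \<Longrightarrow> integrable lborel (\<lambda>\<xi>. ifourier \<phi> \<xi> *\<^sub>C wrep s h \<xi>)"
  by (intro tame_integrable wrep_tame ifourier_schwartz)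

lemma J_cong:
  assumes "AE \<xi> in lborel. wrep s h \<xi> = f \<xi>" and [measurable]: "f \<in> borel_measurable borel" and \<phi>: "\<phi> \<in> schwartz"
  shows "J s h \<phi> = (\<integral>\<xi>. ifourier \<phi> \<xi> *\<^sub>C f \<xi> \<partial>lborel)"
proof -
  have [measurable]: "ifourier \<phi> \<in> borel_measurable borel" using \<phi> by (intro schwartz_measurable ifourier_schwartz)
  show ?thesis unfolding J_apply[OF \<phi>] using assms(1) by (intro integral_cong_AE) auto
qed

lemma J_add: "J s (u + v) = J s u + J s v"
proof
  fix \<phi>
  show "J s (u + v) \<phi> = (J s u + J s v) \<phi>"
  proof (cases "\<phi> \<in> schwartz")
    case True
    have "AE \<xi> in lborel. wrep s (u + v) \<xi> = wrep s u \<xi> + wrep s v \<xi>"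
      using rep_add[of u v] by eventually_elim (simp add: wrep_def scaleR_add_right)
    from J_cong[OF this _ True] show ?thesis
      using J_integrable[OF True, of s u] J_integrable[OF True, of s v] by (simp add: J_apply[OF True] scaleC_add_right)
  qed (simp add: J_not_schwartz)
qed

lemma J_csc: "J s (csc c u) = scaleF c (J s u)"
proof
  fix \<phi>
  show "J s (csc c u) \<phi> = scaleF c (J s u) \<phi>"
  proof (cases "\<phi> \<in> schwartz")
    case True
    have "AE \<xi> in lborel. wrep s (csc c u) \<xi> = c *\<^sub>C wrep s u \<xi>"
      using rep_csc[of c u] by eventually_elim (simp add: wrep_def scaleC_scaleR)
    from J_cong[OF this _ True] have "J s (csc c u) \<phi> = (\<integral>\<xi>. c *\<^sub>C (ifourier \<phi> \<xi> *\<^sub>C wrep s u \<xi>) \<partial>lborel)"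
      by (simp add: scaleC_scaleC mult.commute)
    then show ?thesis using J_integrable[OF True, of s u] by (simp add: J_apply[OF True] integral_scaleC scaleF_def)
  qed (simp add: J_not_schwartz scaleF_def scaleC.zero_right)
qed

lemma csc_of_real: "csc (complex_of_real r) u = r *\<^sub>R u"
  by (rule l2_eqI) (use rep_csc[of "complex_of_real r" u] rep_scaleR[of r u] in \<open>eventually_elim, simp add: scaleC_of_real\<close>)

lemma J_scaleR: "J s (r *\<^sub>R u) = scaleF (complex_of_real r) (J s u)"
  by (simp flip: csc_of_real J_csc)

lemma J_zero: "J s 0 = 0"
  using J_add[of s 0 0] by simp

lemma J_diff: "J s (u - v) = J s u - J s v"
  using J_add[of s "u - v" v] by (simp add: algebra_simps)

lemma J_sum: "J s (\<Sum>i\<in>I. u i) = (\<Sum>i\<in>I. J s (u i))"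
  by (induction I rule: infinite_finite_induct) (simp_all add: J_zero J_add)

lemma fourier_dist_J: "fourier_dist (J s h) = fun_dist (wrep s h)"
proof
  fix \<phi>
  show "fourier_dist (J s h) \<phi> = fun_dist (wrep s h) \<phi>"
    by (cases "\<phi> \<in> schwartz")
      (simp_all add: fourier_dist_def transposed_def J_def fourier_schwartz ifourier_fourier fun_dist_def)
qed

lemma J_inj: assumes "J s u = J s v" shows "u = v"
proof (rule l2_eqI)
  have "fun_dist (wrep s u) = fun_dist (wrep s v)" using assms by (simp flip: fourier_dist_J)
  then have "AE \<xi> in lborel. wrep s u \<xi> = wrep s v \<xi>" by (intro fun_dist_inj wrep_tame) simp
  then show "AE \<xi> in lborel. rep u \<xi> = rep v \<xi>" by eventually_elim (simp add: wrep_def jb_neq_0)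
qed

lemma J_eq_iff: "J s u = J s v \<longleftrightarrow> u = v"
  using J_inj by blast

lemma J_tempered: "J s h \<in> tempered"
  unfolding tempered_def
proof (intro CollectI conjI ballI allI impI)
  fix \<phi> \<psi> :: "real^'a \<Rightarrow> complex" assume \<phi>: "\<phi> \<in> schwartz" and \<psi>: "\<psi> \<in> schwartz"
  show "J s h (\<lambda>x. \<phi> x + \<psi> x) = J s h \<phi> + J s h \<psi>"
    using J_integrable[OF \<phi>, of s h] J_integrable[OF \<psi>, of s h]
    by (simp add: J_apply \<phi> \<psi> schwartz_add ifourier_add scaleC_add_left)
next
  fix c and \<phi> :: "real^'a \<Rightarrow> complex" assume \<phi>: "\<phi> \<in> schwartz"
  show "J s h (\<lambda>x. c * \<phi> x) = c *\<^sub>C J s h \<phi>"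
    using J_integrable[OF \<phi>, of s h] by (simp add: J_apply \<phi> schwartz_cmult ifourier_cmult integral_scaleC flip: scaleC_scaleC)
next
  obtain N where N: "integrable lborel (\<lambda>\<xi>. norm (wrep s h \<xi>) / (1 + norm \<xi>) ^ N)" using wrep_tame[of s h] by (auto simp: tame_def)
  obtain C M where C: "C \<ge> 0"
    "\<And>\<phi> \<xi>. \<phi> \<in> schwartz \<Longrightarrow> (1 + norm \<xi>) ^ N * norm (fourier \<phi> (\<xi> :: real^'a)) \<le> C * schwartz_seminorm M \<phi>"
    by (rule fourier_seminorm_bound[where 'n='a and N=N]) (rule that)
  define A where "A = (\<integral>\<xi>. norm (wrep s h \<xi>) / (1 + norm \<xi>) ^ N \<partial>lborel)"
  have "norm (J s h \<phi>) \<le> (C * A) * schwartz_seminorm M \<phi>" if \<phi>: "\<phi> \<in> schwartz" for \<phi>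
  proof -
    have "norm (J s h \<phi>) \<le> (\<integral>\<xi>. norm (ifourier \<phi> \<xi> *\<^sub>C wrep s h \<xi>) \<partial>lborel)"
      unfolding J_apply[OF \<phi>] by (rule integral_norm_bound)
    also have "\<dots> \<le> (\<integral>\<xi>. (C * schwartz_seminorm M \<phi>) * (norm (wrep s h \<xi>) / (1 + norm \<xi>) ^ N) \<partial>lborel)"
    proof (rule Bochner_Integration.integral_mono)
      fix \<xi> :: "real^'a"
      have p: "(1 + norm \<xi>) ^ N > 0" by (intro zero_less_power add_pos_nonneg) auto
      have "norm (ifourier \<phi> \<xi>) \<le> C * schwartz_seminorm M \<phi> / (1 + norm \<xi>) ^ N"
        using C(2)[OF \<phi>, of "- \<xi>"] p by (simp add: ifourier_def pos_le_divide_eq mult.commute)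
      then have "norm (ifourier \<phi> \<xi>) * norm (wrep s h \<xi>) \<le> (C * schwartz_seminorm M \<phi> / (1 + norm \<xi>) ^ N) * norm (wrep s h \<xi>)"
        by (rule mult_right_mono) simp
      then show "norm (ifourier \<phi> \<xi> *\<^sub>C wrep s h \<xi>) \<le> (C * schwartz_seminorm M \<phi>) * (norm (wrep s h \<xi>) / (1 + norm \<xi>) ^ N)"
        by (simp add: norm_scaleC)
    qed (intro integrable_norm J_integrable \<phi> integrable_mult_right N)+
    also have "\<dots> = (C * A) * schwartz_seminorm M \<phi>"
      unfolding A_def integral_mult_right_zero by (simp only: mult_ac)
    finally show ?thesis .
  qed
  then show "\<exists>N C. \<forall>\<phi>\<in>schwartz. norm (J s h \<phi>) \<le> C * schwartz_seminorm N \<phi>" by blast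
qed (rule J_not_schwartz)

text \<open>A member of the Sobolev space is recovered from its Fourier transform by inversion on
  test functions; the weight is moved into the representative.\<close>

lemma sobolev_eq: "(sobolev s :: ('n::finite, 'e::fin_dim_hilbert) functional set) = range (J s)"
proof
  show "range (J s :: ('n, 'e) l2 \<Rightarrow> _) \<subseteq> sobolev s"
  proof -
    have "fun_dist (wrep s h) \<in> weighted_L2 (sobolev_weight s)" for h :: "('n, 'e) l2"
      unfolding weighted_L2_def using wrep_rep[of s h] by blast
    then show ?thesis using J_tempered by (auto simp: sobolev_def fourier_dist_J)
  qed
  show "sobolev s \<subseteq> range (J s :: ('n, 'e) l2 \<Rightarrow> _)"
  proof
    fix u :: "('n, 'e) functional" assume "u \<in> sobolev s"
    then obtain f where t: "u \<in> tempered" and f: "weighted_L2_rep (sobolev_weight s) (fourier_dist u) f"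
      by (auto simp: sobolev_def weighted_L2_def)
    have [measurable]: "f \<in> borel_measurable borel" using f by (simp add: weighted_L2_rep_def)
    have ft: "tame f" using f by (rule weighted_L2_rep_tame)
    let ?g = "\<lambda>\<xi>. (jb \<xi> powr (s / 2)) *\<^sub>R f \<xi>"
    have "(norm (?g \<xi>))\<^sup>2 = sobolev_weight s \<xi> * (norm (f \<xi>))\<^sup>2" for \<xi>
      using jb_pos[of \<xi>] by (simp add: sobolev_weight_eq power_mult_distrib power2_eq_square[of "_ powr _"] flip: powr_add)
    then have g: "sqi ?g" using f by (simp add: sqi_def weighted_L2_rep_def)
    have ae: "AE \<xi> in lborel. wrep s (mk ?g) \<xi> = f \<xi>"
      using rep_mk[OF g]
    proof eventually_elim
      fix \<xi> assume "rep (mk ?g) \<xi> = ?g \<xi>"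
      moreover have "jb \<xi> powr (- s / 2) * jb \<xi> powr (s / 2) = 1" using jb_neq_0[of \<xi>] by (simp flip: powr_add)
      ultimately show "wrep s (mk ?g) \<xi> = f \<xi>" by (simp add: wrep_def)
    qed
    have "u \<phi> = J s (mk ?g) \<phi>" for \<phi>
    proof (cases "\<phi> \<in> schwartz")
      case True
      have "u \<phi> = fourier_dist u (ifourier \<phi>)"
        by (simp add: fourier_dist_def transposed_def ifourier_schwartz True fourier_ifourier)
      also have "\<dots> = fun_dist f (ifourier \<phi>)" using f by (simp add: weighted_L2_rep_def)
      also have "\<dots> = J s (mk ?g) \<phi>"
        unfolding J_cong[OF ae \<open>f \<in> borel_measurable borel\<close> True] by (rule fun_dist_apply[OF ifourier_schwartz[OF True]])
      finally show ?thesis .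
    qed (use t in \<open>simp add: tempered_def J_not_schwartz\<close>)
    then have "u = J s (mk ?g)" by (rule ext)
    then show "u \<in> range (J s)" by (rule range_eqI)
  qed
qed

lemma sobolev_norm_J: "sobolev_norm s (J s h) = norm h"
  unfolding sobolev_norm_def fourier_dist_J weighted_L2_norm_eq[OF wrep_rep] wrep_weight
  by (simp flip: norm_l2_rep)

text \<open>A plane wave translates the Fourier transform; the quotient of weights in
  \<open>shift\<close> compensates for the weight that is translated along with it.\<close>

lemma V_op_J: "V_op k (J s h) = J s (shift s k h)"
proof
  fix \<phi>
  show "V_op k (J s h) \<phi> = J s (shift s k h) \<phi>"
  proof (cases "\<phi> \<in> schwartz")
    case True
    have [measurable]: "ifourier \<phi> \<in> borel_measurable borel" using True by (intro schwartz_measurable ifourier_schwartz)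
    have "V_op k (J s h) \<phi> = (\<integral>\<xi>. ifourier \<phi> (\<xi> + k) *\<^sub>C wrep s h \<xi> \<partial>lborel)"
      by (simp add: V_op_def mult_op_def transposed_def True J_apply schwartz_plane_wave ifourier_plane_wave)
    also have "\<dots> = (\<integral>\<xi>. ifourier \<phi> \<xi> *\<^sub>C wrep s h (\<xi> - k) \<partial>lborel)"
      using lborel_integral_shift[of "\<lambda>\<xi>. ifourier \<phi> (\<xi> + k) *\<^sub>C wrep s h \<xi>" 1 "- k"] by simp
    also have "\<dots> = J s (shift s k h) \<phi>"
    proof (rule J_cong[symmetric, OF _ _ True])
      show "AE \<xi> in lborel. wrep s (shift s k h) \<xi> = wrep s h (\<xi> - k)"
        using rep_shift[of s k h]
      proof eventually_elim
        fix \<xi> assume r: "rep (shift s k h) \<xi> = (jb \<xi> / jb (\<xi> - k)) powr (s / 2) *\<^sub>R rep h (\<xi> - k)"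
        have "jb \<xi> powr (- s / 2) * (jb \<xi> / jb (\<xi> - k)) powr (s / 2) = jb (\<xi> - k) powr (- s / 2)"
          using jb_pos[of \<xi>] jb_pos[of "\<xi> - k"] by (simp add: powr_divide powr_minus field_simps)
        then show "wrep s (shift s k h) \<xi> = wrep s h (\<xi> - k)" by (simp add: wrep_def r)
      qed
    qed measurable
    finally show ?thesis .
  qed (simp add: V_op_def mult_op_def transposed_def J_not_schwartz)
qed

lemma J_mulop:
  assumes p: "p \<in> borel_measurable borel" "\<And>\<xi>. norm (p \<xi>) \<le> C"
    and \<phi>: "\<phi> \<in> schwartz"
  shows "J t (mulop p h) \<phi> = (\<integral>\<xi>. ifourier \<phi> \<xi> *\<^sub>C ((jb \<xi> powr (- t / 2)) *\<^sub>R (p \<xi> *\<^sub>C rep h \<xi>)) \<partial>lborel)"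
proof (rule J_cong[OF _ _ \<phi>])
  show "AE \<xi> in lborel. wrep t (mulop p h) \<xi> = (jb \<xi> powr (- t / 2)) *\<^sub>R (p \<xi> *\<^sub>C rep h \<xi>)"
    using rep_mulop[OF p, of h] by eventually_elim (simp add: wrep_def)
qed (use p in measurable)

text \<open>The symbol of \<open>P_op k\<close> divided by the bracket, so that it is bounded
  between the models of orders s and s - 1; it is the same for every s.\<close>

definition psym :: "'n \<Rightarrow> real^'n \<Rightarrow> complex" where
  "psym k \<xi> = complex_of_real (\<xi> $ k * jb \<xi> powr (- 1 / 2))"

lemma psym_bound: "norm (psym k \<xi>) \<le> 1"
proof -
  have "\<bar>\<xi> $ k\<bar>\<^sup>2 \<le> jb \<xi>" using component_le_norm_cart[of \<xi> k] power_mono[of "\<bar>\<xi> $ k\<bar>" "norm \<xi>" 2] by (simp add: jb_def)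
  then have "\<bar>\<xi> $ k\<bar> \<le> sqrt (jb \<xi>)" by (simp add: real_le_rsqrt)
  then have "\<bar>\<xi> $ k\<bar> / sqrt (jb \<xi>) \<le> 1" using jb_pos[of \<xi>] by simp
  moreover have "jb \<xi> powr (- 1 / 2) = 1 / sqrt (jb \<xi>)"
    using jb_pos[of \<xi>] by (simp add: powr_minus powr_half_sqrt inverse_eq_divide)
  ultimately show ?thesis unfolding psym_def norm_of_real using jb_pos[of \<xi>] by (simp add: abs_mult)
qed

lemma psym_measurable [measurable]: "psym k \<in> borel_measurable borel"
  unfolding psym_def[abs_def] by measurable

lemma P_op_J: "P_op k (J s h) = J (s - 1) (mulop (psym k) h)"
proof
  fix \<phi>
  show "P_op k (J s h) \<phi> = J (s - 1) (mulop (psym k) h) \<phi>"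
  proof (cases "\<phi> \<in> schwartz")
    case True
    have "P_op k (J s h) \<phi> = (\<integral>\<xi>. (complex_of_real (\<xi> $ k) * ifourier \<phi> \<xi>) *\<^sub>C wrep s h \<xi> \<partial>lborel)"
      by (simp add: P_op_def transposed_def True J_apply schwartz_cmult schwartz_partial ifourier_partial_deriv)
    moreover have "(complex_of_real (\<xi> $ k) * ifourier \<phi> \<xi>) *\<^sub>C wrep s h \<xi>
        = ifourier \<phi> \<xi> *\<^sub>C ((jb \<xi> powr (- (s - 1) / 2)) *\<^sub>R (psym k \<xi> *\<^sub>C rep h \<xi>))" for \<xi>
    proof -
      have "jb \<xi> powr (- (s - 1) / 2) * jb \<xi> powr (- 1 / 2) = jb \<xi> powr (- s / 2)"
        by (simp add: field_simps flip: powr_add)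
      then have "jb \<xi> powr (- (s - 1) / 2) * (\<xi> $ k * jb \<xi> powr (- 1 / 2)) = \<xi> $ k * jb \<xi> powr (- s / 2)"
        by (simp only: mult.left_commute)
      then have "(jb \<xi> powr (- (s - 1) / 2)) *\<^sub>R (psym k \<xi> *\<^sub>C rep h \<xi>) = (\<xi> $ k) *\<^sub>R wrep s h \<xi>"
        unfolding psym_def scaleC_of_real wrep_def by (simp only: scaleR_scaleR)
      then show ?thesis by (simp add: scaleR_scaleC scaleC_scaleC mult.commute)
    qed
    ultimately show ?thesis
      by (simp only: J_mulop[OF psym_measurable psym_bound True])
  qed (simp add: P_op_def transposed_def J_not_schwartz)
qed

text \<open>In the models, the inclusion of order s into order s - d becomes multiplication by this
  function, the same for every s.\<close>

definition emb :: "real \<Rightarrow> real^'n \<Rightarrow> complex" where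
  "emb d \<xi> = complex_of_real (jb \<xi> powr (- d / 2))"

lemma emb_bound: "d \<ge> 0 \<Longrightarrow> norm (emb d \<xi>) \<le> 1"
  using jb_ge_1[of \<xi>] powr_mono[of "- d / 2" 0 "jb \<xi>"] by (simp add: emb_def)

lemma emb_measurable [measurable]: "emb d \<in> borel_measurable borel"
  unfolding emb_def[abs_def] by measurable

lemma J_emb:
  assumes "d \<ge> 0"
  shows "J (s - d) (mulop (emb d) h) = J s h"
proof
  fix \<phi>
  show "J (s - d) (mulop (emb d) h) \<phi> = J s h \<phi>"
  proof (cases "\<phi> \<in> schwartz")
    case True
    have eq: "(jb \<xi> powr (- (s - d) / 2)) *\<^sub>R (emb d \<xi> *\<^sub>C rep h \<xi>) = wrep s h \<xi>" for \<xi>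
    proof -
      have "jb \<xi> powr (- (s - d) / 2) * jb \<xi> powr (- d / 2) = jb \<xi> powr (- s / 2)"
        by (simp add: field_simps flip: powr_add)
      then show ?thesis unfolding emb_def scaleC_of_real wrep_def by (simp only: scaleR_scaleR)
    qed
    show ?thesis by (simp only: J_mulop[OF emb_measurable emb_bound[OF assms] True] eq J_apply[OF True, of s h])
  qed (simp add: J_not_schwartz)
qed

section \<open>Plancherel's theorem\<close>

lemma borel_measurable_cnj [measurable (raw)]:
  assumes "f \<in> borel_measurable M" shows "(\<lambda>x. cnj (f x)) \<in> borel_measurable M"
  by (rule measurable_compose[OF assms borel_measurable_continuous_onI[OF continuous_on_cnj[OF continuous_on_id]]])

text \<open>Pairing with a fixed test function is continuous, so identities between distributions
  survive limits in \<open>l2\<close>.\<close>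

lemma J_bounded:
  fixes \<phi> :: "real^'n \<Rightarrow> complex"
  assumes \<phi>: "\<phi> \<in> schwartz"
  shows "bounded_linear (\<lambda>h::('n, 'e::fin_dim_hilbert) l2. J s h \<phi>)"
proof -
  let ?\<psi> = "ifourier \<phi>"
  have \<psi>: "?\<psi> \<in> schwartz" using \<phi> by (rule ifourier_schwartz)
  have [measurable]: "?\<psi> \<in> borel_measurable borel" using \<psi> by (rule schwartz_measurable)
  obtain M :: nat where M: "\<bar>s\<bar> \<le> real M" using real_arch_simple by blast
  obtain C where C: "C \<ge> 0" "\<And>x. norm (?\<psi> x) \<le> C / (1 + norm x) ^ (M + CARD('n))" using schwartz_bound[OF \<psi>] by metis
  define q where "q \<xi> = jb \<xi> powr (- s / 2) *\<^sub>R cnj (?\<psi> \<xi>)" for \<xi>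
  have [measurable]: "q \<in> borel_measurable borel"
    unfolding q_def[abs_def] by measurable
  have q: "norm (q \<xi>) \<le> C / (1 + norm \<xi>) ^ CARD('n)" for \<xi>
  proof -
    have "jb \<xi> powr (- s / 2) \<le> jb \<xi> powr (real M / 2)" using M jb_ge_1[of \<xi>] by (intro powr_mono) auto
    also have "\<dots> \<le> ((1 + norm \<xi>) ^ 2) powr (real M / 2)" using jb_le[of \<xi>] jb_pos[of \<xi>] by (intro powr_mono2) auto
    also have "\<dots> = (1 + norm \<xi>) ^ M"
    proof -
      have p: "1 + norm \<xi> > 0" using norm_ge_zero[of \<xi>] by linarith
      then have "(1 + norm \<xi>) ^ 2 = (1 + norm \<xi>) powr 2" by simp
      then have "((1 + norm \<xi>) ^ 2) powr (real M / 2) = (1 + norm \<xi>) powr real M" by (simp only: powr_powr) simp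
      then show ?thesis using powr_realpow[OF p, of M] by simp
    qed
    finally have "jb \<xi> powr (- s / 2) * norm (?\<psi> \<xi>) \<le> (1 + norm \<xi>) ^ M * (C / (1 + norm \<xi>) ^ (M + CARD('n)))"
      by (intro mult_mono C) auto
    also have "\<dots> = C / (1 + norm \<xi>) ^ CARD('n)"
    proof -
      have "1 + norm \<xi> \<noteq> 0" using norm_ge_zero[of \<xi>] by linarith
      then show ?thesis by (simp add: power_add)
    qed
    finally show ?thesis by (simp add: q_def)
  qed
  define A where "A = sqrt (\<integral>\<xi>. (norm (q \<xi>))\<^sup>2 \<partial>lborel)"
  have qi: "integrable lborel (\<lambda>\<xi>. (norm (q \<xi>))\<^sup>2)"
  proof (rule integrable_power_bound)
    fix \<xi> :: "real^'n"
    have "(norm (q \<xi>))\<^sup>2 \<le> (C / (1 + norm \<xi>) ^ CARD('n))\<^sup>2" by (intro power_mono q) auto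
    then show "norm ((norm (q \<xi>))\<^sup>2) \<le> C\<^sup>2 / (1 + norm \<xi>) ^ (2 * CARD('n))"
      by (simp add: power_divide mult.commute flip: power_mult)
  qed measurable
  have ys: "sqi (\<lambda>\<xi>. q \<xi> *\<^sub>C e)" for e :: 'e
    unfolding sqi_def norm_scaleC power_mult_distrib
    using integrable_mult_left[OF qi, of "(norm e)\<^sup>2"] by simp
  have ny: "norm (mk (\<lambda>\<xi>. q \<xi> *\<^sub>C e)) = A * norm e" for e :: 'e
  proof -
    have "(norm (mk (\<lambda>\<xi>. q \<xi> *\<^sub>C e)))\<^sup>2 = (A * norm e)\<^sup>2"
      unfolding norm_l2_mk[OF ys] norm_scaleC power_mult_distrib
      by (simp add: A_def)
    moreover have "0 \<le> A" by (simp add: A_def)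
    ultimately show ?thesis by (metis mult_nonneg_nonneg norm_ge_zero power2_eq_imp_eq)
  qed
  have ip: "inner e (J s h \<phi>) = inner (mk (\<lambda>\<xi>. q \<xi> *\<^sub>C e)) h" for e :: 'e and h :: "('n, 'e) l2"
  proof -
    have "inner e (J s h \<phi>) = (\<integral>\<xi>. inner e (?\<psi> \<xi> *\<^sub>C wrep s h \<xi>) \<partial>lborel)"
      unfolding J_apply[OF \<phi>] by (rule integral_inner_right[symmetric]) (rule J_integrable[OF \<phi>])
    also have "inner e (?\<psi> \<xi> *\<^sub>C wrep s h \<xi>) = inner (q \<xi> *\<^sub>C e) (rep h \<xi>)" for \<xi>
      by (simp add: q_def wrep_def scaleC.scaleR_left inner_scaleC_left scaleC_scaleR)
    then have "(\<integral>\<xi>. inner e (?\<psi> \<xi> *\<^sub>C wrep s h \<xi>) \<partial>lborel) = (\<integral>\<xi>. inner (q \<xi> *\<^sub>C e) (rep h \<xi>) \<partial>lborel)" by simp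
    also have "\<dots> = inner (mk (\<lambda>\<xi>. q \<xi> *\<^sub>C e)) h"
      by (rule inner_l2_cong[symmetric, OF rep_mk[OF ys]]) auto
    finally show ?thesis .
  qed
  show ?thesis
  proof (rule bounded_linear_intro[where K=A])
    fix h :: "('n, 'e) l2"
    \<comment> \<open>Testing in the direction e = \<open>J s h \<phi>\<close> itself bounds the
      norm by a single Cauchy-Schwarz inequality, A being independent of e.\<close>
    have "(norm (J s h \<phi>))\<^sup>2 \<le> A * norm (J s h \<phi>) * norm h"
      using Cauchy_Schwarz_ineq2[of "mk (\<lambda>\<xi>. q \<xi> *\<^sub>C J s h \<phi>)" h]
      unfolding power2_norm_eq_inner ip ny by linarith
    then have "norm (J s h \<phi>) * norm (J s h \<phi>) \<le> norm (J s h \<phi>) * (norm h * A)"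
      by (simp add: power2_eq_square mult_ac)
    moreover have "0 \<le> norm h * A" by (simp add: A_def)
    ultimately show "norm (J s h \<phi>) \<le> norm h * A"
      by (cases "J s h \<phi> = 0") auto
  next
    show "J s (u + v) \<phi> = J s u \<phi> + J s v \<phi>" for u v :: "('n, 'e) l2" by (simp add: J_add)
    show "J s (r *\<^sub>R u) \<phi> = r *\<^sub>R J s u \<phi>" for r and u :: "('n, 'e) l2"
      by (simp add: J_scaleR scaleF_def scaleC_of_real)
  qed
qed

lemma wrep_0: "wrep 0 h = rep h"
  by (simp add: wrep_def jb_neq_0)

lemma Rep_l2_J: "\<phi> \<in> schwartz \<Longrightarrow> Rep_l2 u \<phi> = J 0 u (fourier \<phi>)"
  by (simp add: Rep_l2_eq fun_dist_apply J_apply fourier_schwartz ifourier_fourier wrep_0)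

lemma Rep_l2_not_schwartz: "\<phi> \<notin> schwartz \<Longrightarrow> Rep_l2 u \<phi> = 0"
  by (simp add: Rep_l2_eq fun_dist_def)

definition gen :: "(real^'n \<Rightarrow> complex) \<Rightarrow> 'e \<Rightarrow> ('n::finite, 'e::fin_dim_hilbert) l2" where
  "gen \<phi> e = mk (\<lambda>x. \<phi> x *\<^sub>C e)"

lemma schwartz_sq_integrable:
  fixes \<phi> :: "real^'n \<Rightarrow> complex"
  assumes "\<phi> \<in> schwartz" shows "integrable lborel (\<lambda>x. (norm (\<phi> x))\<^sup>2)"
proof -
  obtain C where C: "C \<ge> 0" "\<And>x. norm (\<phi> x) \<le> C / (1 + norm x) ^ 0" using schwartz_bound[OF assms] by metis
  show ?thesis
  proof (rule Bochner_Integration.integrable_bound)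
  show "integrable lborel (\<lambda>x. C * norm (\<phi> x))" by (intro integrable_mult_right integrable_norm schwartz_integrable assms)
  show "AE x in lborel. norm ((norm (\<phi> x))\<^sup>2) \<le> norm (C * norm (\<phi> x))"
    using C by (intro AE_I2) (simp add: power2_eq_square mult_right_mono)
  have [measurable]: "\<phi> \<in> borel_measurable borel" using assms by (rule schwartz_measurable)
  show "(\<lambda>x. (norm (\<phi> x))\<^sup>2) \<in> borel_measurable lborel" by measurable
  qed
qed

lemma gen_sqi: "\<phi> \<in> schwartz \<Longrightarrow> sqi (\<lambda>x. \<phi> x *\<^sub>C e)"
  using schwartz_measurable[of \<phi>] schwartz_sq_integrable[of \<phi>]
  by (simp add: sqi_def norm_scaleC power_mult_distrib)

lemma rep_gen: "\<phi> \<in> schwartz \<Longrightarrow> AE x in lborel. rep (gen \<phi> e) x = \<phi> x *\<^sub>C e"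
  unfolding gen_def by (intro rep_mk gen_sqi)

lemma schwartz_cnj_mult_integrable:
  assumes "\<phi> \<in> schwartz" "\<psi> \<in> schwartz" shows "integrable lborel (\<lambda>x. cnj (\<phi> x) * \<psi> x)"
proof -
  obtain C where C: "C \<ge> 0" "\<And>x. norm (\<phi> x) \<le> C / (1 + norm x) ^ 0" using schwartz_bound[OF assms(1)] by metis
  show ?thesis
  proof (rule Bochner_Integration.integrable_bound)
    show "integrable lborel (\<lambda>x. C * norm (\<psi> x))" by (intro integrable_mult_right integrable_norm schwartz_integrable assms)
    show "(\<lambda>x. cnj (\<phi> x) * \<psi> x) \<in> borel_measurable lborel"
      using assms by (simp add: borel_measurable_continuous_onI continuous_on_mult continuous_on_cnj schwartz_continuous)
    show "AE x in lborel. norm (cnj (\<phi> x) * \<psi> x) \<le> norm (C * norm (\<psi> x))"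
      using C by (intro AE_I2) (simp add: norm_mult mult_right_mono)
  qed
qed

lemma inner_gen:
  assumes "\<phi> \<in> schwartz" "\<psi> \<in> schwartz"
  shows "inner (gen \<phi> e) (gen \<psi> e') = Re ((\<integral>x. cnj (\<phi> x) * \<psi> x \<partial>lborel) * cinner e e')"
proof -
  have [measurable]: "\<phi> \<in> borel_measurable borel" "\<psi> \<in> borel_measurable borel" using assms by (auto intro: schwartz_measurable)
  have "inner (gen \<phi> e) (gen \<psi> e') = (\<integral>x. inner (\<phi> x *\<^sub>C e) (\<psi> x *\<^sub>C e') \<partial>lborel)"
    by (rule inner_l2_cong[OF rep_gen[OF assms(1)] rep_gen[OF assms(2)]]) measurable
  also have "\<dots> = (\<integral>x. Re ((cnj (\<phi> x) * \<psi> x) * cinner e e') \<partial>lborel)"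
    by (simp add: inner_eq_Re_cinner cinner_scaleC_left cinner_scaleC_right mult_ac)
  also have "\<dots> = Re (\<integral>x. (cnj (\<phi> x) * \<psi> x) * cinner e e' \<partial>lborel)"
    by (intro integral_Re integrable_mult_left schwartz_cnj_mult_integrable assms)
  finally show ?thesis by simp
qed

text \<open>The fundamental lemma makes every component of a vector orthogonal to these elementary
  tensors vanish almost everywhere.\<close>

lemma closure_span_gen: "closure (span {gen \<phi> e | \<phi> e. \<phi> \<in> schwartz}) = (UNIV :: ('n::finite, 'e::fin_dim_hilbert) l2 set)"
proof (rule closed_subspace_eq_UNIV)
  fix z :: "('n, 'e) l2"
  assume z: "\<And>x. x \<in> closure (span {gen \<phi> e | \<phi> e. \<phi> \<in> schwartz}) \<Longrightarrow> inner z x = 0"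
  have g0: "inner (gen \<phi> e) z = 0" if "\<phi> \<in> schwartz" for \<phi> and e :: 'e
  proof -
    have "gen \<phi> e \<in> closure (span {gen \<phi> e | \<phi> e. \<phi> \<in> schwartz})"
      using that by (intro closure_subset[THEN subsetD] span_base) blast
    from z[OF this] show ?thesis by (simp add: inner_commute)
  qed
  have "AE x in lborel. cinner e (rep z x) = 0" for e
  proof -
    let ?f = "\<lambda>x. cinner (rep z x) e"
    have f: "?f = (\<lambda>x. cnj (cinner e (rep z x)))" by (simp add: cinner_commute[of "rep z _"])
    have [measurable]: "(\<lambda>x. cinner e (rep z x)) \<in> borel_measurable borel"
      by (rule borel_measurable_continuous_onI[OF linear_continuous_on[OF bounded_linear_cinner], THEN measurable_compose[rotated]]) measurable
    have int: "integrable lborel (\<lambda>x. \<phi> x * cinner (rep z x) e)" if \<phi>: "\<phi> \<in> schwartz" for \<phi>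
    proof -
      have "integrable lborel (\<lambda>x. cnj (cinner (\<phi> x *\<^sub>C e) (rep z x)))"
      proof -
        have [measurable]: "\<phi> \<in> borel_measurable borel" using \<phi> by (rule schwartz_measurable)
        have e: "cinner (\<phi> x *\<^sub>C e) (rep z x) = cnj (\<phi> x) * cinner e (rep z x)" for x by (rule cinner_scaleC_left)
        obtain K where K: "\<And>x::'e. norm (cinner e x) \<le> norm x * K" using bounded_linear.bounded[OF bounded_linear_cinner] by blast
        have i: "integrable lborel (\<lambda>x. norm (\<phi> x *\<^sub>C e) * norm (rep z x))" for e :: 'e
          by (rule sqi_inner(1)[OF gen_sqi[OF \<phi>] rep_sqi])
        show ?thesis
        proof (cases "e = 0")
          case True
          have "cinner (0::'e) y = 0" for y using cinner_scaleC_left[of 0 "0::'e" y] by (simp add: scaleC.zero_left)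
          with True show ?thesis by (simp add: scaleC.zero_right)
        next
          case False
          show ?thesis
          proof (rule Bochner_Integration.integrable_bound[OF integrable_mult_left[OF i[of e], of "\<bar>K\<bar> / norm e"]])
            show "AE x in lborel. norm (cnj (cinner (\<phi> x *\<^sub>C e) (rep z x))) \<le> norm (norm (\<phi> x *\<^sub>C e) * norm (rep z x) * (\<bar>K\<bar> / norm e))"
            proof (intro AE_I2)
              fix x
              have "norm (cinner e (rep z x)) \<le> norm (rep z x) * \<bar>K\<bar>"
                using K[of "rep z x"] by (rule order_trans) (simp add: mult_left_mono)
              then have "norm (\<phi> x) * norm (cinner e (rep z x)) \<le> norm (\<phi> x) * (norm (rep z x) * \<bar>K\<bar>)" by (rule mult_left_mono) simp
              then show "norm (cnj (cinner (\<phi> x *\<^sub>C e) (rep z x))) \<le> norm (norm (\<phi> x *\<^sub>C e) * norm (rep z x) * (\<bar>K\<bar> / norm e))"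
                using False by (simp add: e norm_mult norm_scaleC abs_mult)
            qed
            show "(\<lambda>x. cnj (cinner (\<phi> x *\<^sub>C e) (rep z x))) \<in> borel_measurable lborel"
              unfolding e by measurable
          qed
        qed
      qed
      then show ?thesis by (simp add: cinner_scaleC_left cinner_commute[of "rep z _"])
    qed
    have "AE x in lborel. ?f x = 0"
    proof (rule fundamental_lemma)
      show "?f \<in> borel_measurable borel" unfolding f by measurable
      show "integrable lborel (\<lambda>x. gauss x *\<^sub>R ?f x)"
        using int[OF schwartz_gauss] by (simp add: gauss_def scaleR_conv_of_real)
      fix \<phi> :: "real^'n \<Rightarrow> complex" assume \<phi>: "\<phi> \<in> schwartz"
      have Re0: "Re (\<integral>x. \<phi> x * ?f x \<partial>lborel) = 0" if \<phi>: "\<phi> \<in> schwartz" for \<phi>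
      proof -
        have [measurable]: "\<phi> \<in> borel_measurable borel" using \<phi> by (rule schwartz_measurable)
        have "0 = (\<integral>x. inner (\<phi> x *\<^sub>C e) (rep z x) \<partial>lborel)"
          unfolding g0[OF \<phi>, of e, symmetric] by (rule inner_l2_cong[OF rep_gen[OF \<phi>], of z "rep z"]) auto
        also have "\<dots> = (\<integral>x. Re (\<phi> x * ?f x) \<partial>lborel)"
          by (subst inner_commute) (simp add: inner_eq_Re_cinner cinner_scaleC_right)
        also have "\<dots> = Re (\<integral>x. \<phi> x * ?f x \<partial>lborel)" by (rule integral_Re[OF int[OF \<phi>]])
        finally show ?thesis by simp
      qed
      \<comment> \<open>The inner product of \<open>l2\<close> sees only real parts; the test
        function multiplied by i supplies the imaginary part.\<close>
      have "Re (\<i> * (\<integral>x. \<phi> x * ?f x \<partial>lborel)) = 0"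
        using Re0[OF schwartz_cmult[OF \<phi>, of "\<i>"]] unfolding mult.assoc integral_mult_right_zero .
      with Re0[OF \<phi>] show "(\<integral>x. \<phi> x * ?f x \<partial>lborel) = 0" by (simp add: complex_eq_iff)
    qed
    then show ?thesis by eventually_elim (metis cinner_commute complex_cnj_zero)
  qed
  then have "AE x in lborel. rep z x = 0" by (rule AE_zero_if_cinner_zero)
  with rep_0 show "z = 0" by (intro l2_eqI) (auto elim: eventually_elim2)
next
  show "subspace (closure (span {gen \<phi> e | \<phi> (e::'e). \<phi> \<in> (schwartz :: (real^'n \<Rightarrow> complex) set)}))"
  proof (rule subspaceI)
    let ?S = "span {gen \<phi> e | \<phi> (e::'e). \<phi> \<in> (schwartz :: (real^'n \<Rightarrow> complex) set)}"
    show "0 \<in> closure ?S" using closure_subset span_zero by blast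
    fix x assume "x \<in> closure ?S"
    then obtain f where f: "\<And>n. f n \<in> ?S" "f \<longlonglongrightarrow> x" unfolding closure_sequential by blast
    show "c *\<^sub>R x \<in> closure ?S" for c
      unfolding closure_sequential using f by (intro exI[of _ "\<lambda>n. c *\<^sub>R f n"]) (auto intro: span_scale tendsto_intros)
    fix y assume "y \<in> closure ?S"
    then obtain g where g: "\<And>n. g n \<in> ?S" "g \<longlonglongrightarrow> y" unfolding closure_sequential by blast
    show "x + y \<in> closure ?S"
      unfolding closure_sequential using f g by (intro exI[of _ "\<lambda>n. f n + g n"]) (auto intro: span_add tendsto_intros)
  qed
qed simp

text \<open>\<open>Rep_l2\<close> reads its argument in position and \<open>J 0\<close> in
  frequency; this links the two readings isometrically. The transform is extended as a relation: on
  the span M of its graph over elementary tensors the two components have equal norms, and each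
  component ranges over a dense set.\<close>

lemma plancherel:
  fixes w :: "('n::finite, 'e::fin_dim_hilbert) l2"
  shows "\<exists>x. Rep_l2 x = J 0 w \<and> norm x = norm w" and "\<exists>y. Rep_l2 w = J 0 y \<and> norm w = norm y"
proof -
  define G where "G = {(gen \<phi> e, gen (fourier \<phi>) e) | \<phi> (e::'e). \<phi> \<in> (schwartz :: (real^'n \<Rightarrow> complex) set)}"
  define S where "S = {gen \<phi> e | \<phi> (e::'e). \<phi> \<in> (schwartz :: (real^'n \<Rightarrow> complex) set)}"
  have fG: "fst ` G = S"
  proof
    show "S \<subseteq> fst ` G"
    proof
      fix u assume "u \<in> S"
      then obtain \<phi> e where "u = gen \<phi> e" "\<phi> \<in> schwartz" by (auto simp: S_def)
      then have "(u, gen (fourier \<phi>) e) \<in> G" unfolding G_def by blast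
      then show "u \<in> fst ` G" by force
    qed
  qed (unfold G_def S_def, auto, blast)
  have sG: "snd ` G = S"
  proof
    show "snd ` G \<subseteq> S" by (auto simp: G_def S_def) (blast intro: fourier_schwartz)
    show "S \<subseteq> snd ` G"
    proof
      fix u assume "u \<in> S"
      then obtain \<phi> e where "u = gen \<phi> e" "\<phi> \<in> schwartz" by (auto simp: S_def)
      then have "(gen (ifourier \<phi>) e, u) \<in> G"
        unfolding G_def by (auto intro!: exI[of _ "ifourier \<phi>"] exI[of _ e] simp: fourier_ifourier ifourier_schwartz)
      then show "u \<in> snd ` G" by force
    qed
  qed
  have G1: "Rep_l2 x \<phi> = J 0 y \<phi>" if xyG: "(x, y) \<in> G" and \<phi>: "\<phi> \<in> schwartz" for x y \<phi>
  proof -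
    obtain \<psi> e where xy: "x = gen \<psi> e" "y = gen (fourier \<psi>) e" and \<psi>: "\<psi> \<in> schwartz" using xyG by (auto simp: G_def)
    have [measurable]: "\<phi> \<in> borel_measurable borel" "\<psi> \<in> borel_measurable borel" "fourier \<psi> \<in> borel_measurable borel" "ifourier \<phi> \<in> borel_measurable borel"
      using \<phi> \<psi> by (auto intro: schwartz_measurable fourier_schwartz ifourier_schwartz)
    have bl: "bounded_linear (\<lambda>c. c *\<^sub>C e)" by (rule scaleC.bounded_linear_left)
    have pm: "integrable lborel (\<lambda>x. f x * g x)" if "f \<in> schwartz" "g \<in> schwartz" for f g :: "real^'n \<Rightarrow> complex"
    proof -
      have "g \<in> slowly_growing" using that(2) unfolding schwartz_iff slowly_growing_def diff_level_iff
        by (blast intro: decays_imp_slow)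
      from slowly_growing_mult_schwartz[OF this that(1)] show ?thesis using schwartz_integrable by (simp add: mult.commute)
    qed
    have "Rep_l2 x \<phi> = (\<integral>t. \<phi> t *\<^sub>C (\<psi> t *\<^sub>C e) \<partial>lborel)"
      unfolding Rep_l2_eq fun_dist_apply[OF \<phi>] xy
      by (rule integral_cong_AE) (use rep_gen[OF \<psi>, of e] in \<open>auto elim: eventually_mono\<close>)
    also have "\<dots> = (\<integral>t. \<phi> t * \<psi> t \<partial>lborel) *\<^sub>C e"
      unfolding scaleC_scaleC by (rule integral_bounded_linear[OF bl pm[OF \<phi> \<psi>]])
    also have "(\<integral>t. \<phi> t * \<psi> t \<partial>lborel) = (\<integral>t. ifourier \<phi> t * fourier \<psi> t \<partial>lborel)"
      using fourier_multiplication_formula[of "ifourier \<phi>" \<psi>] \<phi> \<psi>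
      by (simp add: schwartz_integrable ifourier_schwartz fourier_ifourier)
    also have "\<dots> *\<^sub>C e = (\<integral>t. ifourier \<phi> t *\<^sub>C (fourier \<psi> t *\<^sub>C e) \<partial>lborel)"
      unfolding scaleC_scaleC by (rule integral_bounded_linear[OF bl, symmetric]) (intro pm ifourier_schwartz fourier_schwartz \<phi> \<psi>)
    also have "\<dots> = J 0 y \<phi>"
      by (rule J_cong[OF _ _ \<phi>, symmetric]) (use rep_gen[OF fourier_schwartz[OF \<psi>], of e] in \<open>auto simp: wrep_0 xy\<close>)
    finally show ?thesis .
  qed
  have G2: "inner (fst p) (fst q) = inner (snd p) (snd q)" if "p \<in> G" "q \<in> G" for p q
    using that by (auto simp: G_def inner_gen fourier_schwartz fourier_parseval)
  define M where "M = span G"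
  have M1: "Rep_l2 (fst p) \<phi> = J 0 (snd p) \<phi>" if p: "p \<in> M" and \<phi>: "\<phi> \<in> schwartz" for p \<phi>
  proof -
    have "M \<subseteq> {p. Rep_l2 (fst p) \<phi> = J 0 (snd p) \<phi>}"
      unfolding M_def
    proof (rule span_minimal)
      show "G \<subseteq> {p. Rep_l2 (fst p) \<phi> = J 0 (snd p) \<phi>}" using G1 \<phi> by auto
      show "subspace {p. Rep_l2 (fst p) \<phi> = J 0 (snd p) \<phi>}"
        by (rule subspaceI) (simp_all add: Rep_l2_J \<phi> J_add J_zero J_scaleR scaleF_def)
    qed
    with p show ?thesis by blast
  qed
  have M2: "inner (fst p) (fst q) = inner (snd p) (snd q)" if p: "p \<in> M" and q: "q \<in> M" for p q
  proof -
    have *: "M \<subseteq> {p. inner (fst p) (fst q) = inner (snd p) (snd q)}" if "q \<in> G" for q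
      unfolding M_def
    proof (rule span_minimal)
      show "G \<subseteq> {p. inner (fst p) (fst q) = inner (snd p) (snd q)}" using G2 that by blast
    qed (rule subspaceI; simp add: inner_add_left)
    have "M \<subseteq> {q. inner (fst p) (fst q) = inner (snd p) (snd q)}"
      unfolding M_def
    proof (rule span_minimal)
      show "G \<subseteq> {q. inner (fst p) (fst q) = inner (snd p) (snd q)}" using * p by blast
    qed (rule subspaceI; simp add: inner_add_right)
    with q show ?thesis by blast
  qed
  have Mn: "norm (fst p) = norm (snd p)" if "p \<in> M" for p
    using M2[OF that that] by (simp add: norm_eq_sqrt_inner)
  have Md: "p - q \<in> M" if "p \<in> M" "q \<in> M" for p q using that unfolding M_def by (rule span_diff)
  have imf: "closure (fst ` M) = UNIV" and ims: "closure (snd ` M) = UNIV"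
    unfolding M_def linear_span_image[OF linear_fst, symmetric] linear_span_image[OF linear_snd, symmetric] fG sG S_def
    by (rule closure_span_gen)+
  have lim: "Rep_l2 x = J 0 y \<and> norm x = norm y" if p: "\<And>n. p n \<in> M" and x: "(\<lambda>n. fst (p n)) \<longlonglongrightarrow> x" and y: "(\<lambda>n. snd (p n)) \<longlonglongrightarrow> y" for p x y
  proof
    show "norm x = norm y"
      using tendsto_norm[OF x] tendsto_norm[OF y] LIMSEQ_unique by (simp add: Mn[OF p])
    show "Rep_l2 x = J 0 y"
    proof
      fix \<phi>
      show "Rep_l2 x \<phi> = J 0 y \<phi>"
      proof (cases "\<phi> \<in> schwartz")
        case True
        have "(\<lambda>n. J 0 (fst (p n)) (fourier \<phi>)) \<longlonglongrightarrow> J 0 x (fourier \<phi>)"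
          by (rule bounded_linear.tendsto[OF J_bounded[OF fourier_schwartz[OF True]] x])
        moreover have "(\<lambda>n. J 0 (snd (p n)) \<phi>) \<longlonglongrightarrow> J 0 y \<phi>"
          by (rule bounded_linear.tendsto[OF J_bounded[OF True] y])
        moreover have "J 0 (fst (p n)) (fourier \<phi>) = J 0 (snd (p n)) \<phi>" for n
          using M1[OF p True] by (simp add: Rep_l2_J True)
        ultimately show ?thesis using LIMSEQ_unique by (simp add: Rep_l2_J True)
      qed (simp add: Rep_l2_not_schwartz J_not_schwartz)
    qed
  qed
  \<comment> \<open>Equality of norms transfers the Cauchy property between the components, so an
    approximating sequence for one side converges on the other side as well.\<close>
  have isoC: "Cauchy (\<lambda>n. fst (p n)) \<longleftrightarrow> Cauchy (\<lambda>n. snd (p n))" if p: "\<And>n. p n \<in> M" for p :: "nat \<Rightarrow> _"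
    using Mn[OF Md[OF p p]] by (simp add: Cauchy_iff)
  show "\<exists>x. Rep_l2 x = J 0 w \<and> norm x = norm w"
  proof -
    have "w \<in> closure (snd ` M)" using ims by simp
    then obtain f where f: "\<And>n. f n \<in> snd ` M" "f \<longlonglongrightarrow> w" unfolding closure_sequential by blast
    then have "\<forall>n. \<exists>q. q \<in> M \<and> f n = snd q" by blast
    then obtain p where p: "\<And>n. p n \<in> M" "\<And>n. f n = snd (p n)" by metis
    have s: "(\<lambda>n. snd (p n)) \<longlonglongrightarrow> w" using f(2) unfolding ext[OF p(2)] .
    then have "Cauchy (\<lambda>n. fst (p n))" unfolding isoC[OF p(1)] by (rule LIMSEQ_imp_Cauchy)
    then obtain x where "(\<lambda>n. fst (p n)) \<longlonglongrightarrow> x" using Cauchy_convergent convergent_def by blast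
    from lim[OF p(1) this s] show ?thesis by blast
  qed
  show "\<exists>y. Rep_l2 w = J 0 y \<and> norm w = norm y"
  proof -
    have "w \<in> closure (fst ` M)" using imf by simp
    then obtain f where f: "\<And>n. f n \<in> fst ` M" "f \<longlonglongrightarrow> w" unfolding closure_sequential by blast
    then have "\<forall>n. \<exists>q. q \<in> M \<and> f n = fst q" by blast
    then obtain p where p: "\<And>n. p n \<in> M" "\<And>n. f n = fst (p n)" by metis
    have s: "(\<lambda>n. fst (p n)) \<longlonglongrightarrow> w" using f(2) unfolding ext[OF p(2)] .
    then have "Cauchy (\<lambda>n. snd (p n))" unfolding isoC[OF p(1), symmetric] by (rule LIMSEQ_imp_Cauchy)
    then obtain y where "(\<lambda>n. snd (p n)) \<longlonglongrightarrow> y" using Cauchy_convergent convergent_def by blast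
    from lim[OF p(1) s this] show ?thesis by blast
  qed
qed

lemma L2_eq: "(L2 :: ('n::finite, 'e::fin_dim_hilbert) functional set) = range (J 0)"
proof
  show "L2 \<subseteq> range (J 0 :: ('n, 'e) l2 \<Rightarrow> _)"
  proof
    fix u :: "('n, 'e) functional" assume "u \<in> L2"
    then have "Rep_l2 (Abs_l2 u) = u" by (rule Abs_l2_inverse)
    then show "u \<in> range (J 0)" using plancherel(2)[of "Abs_l2 u"] by auto
  qed
  show "range (J 0 :: ('n, 'e) l2 \<Rightarrow> _) \<subseteq> L2"
    using plancherel(1) Rep_l2 by (metis image_subsetI)
qed

lemma L2_norm_J: "L2_norm (J 0 y) = norm y"
proof -
  obtain x where x: "Rep_l2 x = J 0 y" "norm x = norm y" using plancherel(1) by blast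
  have "weighted_L2_rep (sobolev_weight 0) (Rep_l2 x) (rep x)"
    by (simp add: sobolev_weight_0 weighted_L2_rep_sqi rep_sqi Rep_l2_eq)
  from weighted_L2_norm_eq[OF this] have "L2_norm (Rep_l2 x) = sqrt ((norm x)\<^sup>2)"
    by (simp add: sobolev_weight_0 norm_l2_rep)
  then show ?thesis by (simp add: x)
qed

section \<open>Operators between Sobolev spaces as operators on the Hilbert space\<close>

definition clin :: "(('n::finite, 'e::fin_dim_hilbert) l2 \<Rightarrow>\<^sub>L ('n, 'e) l2) \<Rightarrow> bool" where
  "clin T \<longleftrightarrow> (\<forall>c u. T (csc c u) = csc c (T u))"

text \<open>T is S seen through the isometries \<open>J s\<close> and \<open>J t\<close>. The orders
  are parameters because one T may represent maps between many pairs of spaces, as happens for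
  derivatives and inclusions.\<close>

definition represents :: "real \<Rightarrow> real \<Rightarrow> (('n::finite, 'e::fin_dim_hilbert) functional \<Rightarrow> ('n, 'e) functional)
    \<Rightarrow> (('n, 'e) l2 \<Rightarrow>\<^sub>L ('n, 'e) l2) \<Rightarrow> bool" where
  "represents s t S T \<longleftrightarrow> (\<forall>h. J t (T h) = S (J s h))"

lemma representsD: "represents s t S T \<Longrightarrow> J t (T h) = S (J s h)"
  by (simp add: represents_def)

lemma norm_le_if_unit_ball_le:
  fixes f :: "'a::real_normed_vector \<Rightarrow> 'b::real_normed_vector"
  assumes "\<And>r x. f (r *\<^sub>R x) = r *\<^sub>R f x" "\<And>x. norm x \<le> 1 \<Longrightarrow> norm (f x) \<le> K"
  shows "norm (f x) \<le> K * norm x"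
proof (cases "x = 0")
  case True then show ?thesis using assms(1)[of 0 x] by simp
next
  case False
  have "norm (f ((1 / norm x) *\<^sub>R x)) \<le> K" by (rule assms(2)) simp
  then show ?thesis using False by (simp add: assms(1) divide_le_eq)
qed

lemma op_norm_represents:
  assumes T: "represents s t S T"
  shows "op_norm s t S = ennreal (norm T)"
proof (rule antisym)
  show "op_norm s t S \<le> ennreal (norm T)"
    unfolding op_norm_def
  proof (rule SUP_least)
    fix u :: "('a, 'b) functional" assume "u \<in> {u \<in> sobolev s. sobolev_norm s u \<le> 1}"
    then obtain h where h: "u = J s h" "norm h \<le> 1" by (auto simp: sobolev_eq sobolev_norm_J)
    have "norm (T h) \<le> norm T * norm h" by (rule norm_blinfun)
    also have "\<dots> \<le> norm T * 1" using h(2) by (intro mult_left_mono) auto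
    finally show "ennreal (sobolev_norm t (S u)) \<le> ennreal (norm T)"
      by (simp add: h(1) representsD[OF T, symmetric] sobolev_norm_J ennreal_leI)
  qed
  show "ennreal (norm T) \<le> op_norm s t S"
  proof (cases "op_norm s t S")
    case (real K)
    have "norm (T h) \<le> K" if "norm h \<le> 1" for h
    proof -
      have "ennreal (sobolev_norm t (S (J s h))) \<le> op_norm s t S"
        unfolding op_norm_def using that by (intro SUP_upper) (simp add: sobolev_eq sobolev_norm_J)
      then show ?thesis using real by (simp add: representsD[OF T, symmetric] sobolev_norm_J)
    qed
    then have "norm (T x) \<le> K * norm x" for x
      by (rule norm_le_if_unit_ball_le[OF blinfun.scaleR_right])
    then have "norm T \<le> K" using real by (intro norm_blinfun_bound) auto
    then show ?thesis using real by (simp add: ennreal_leI)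
  qed simp
qed

lemma bounded_op_represents:
  fixes S :: "('n::finite, 'e::fin_dim_hilbert) functional \<Rightarrow> ('n, 'e) functional"
  assumes S: "bounded_op s t S"
  obtains T where "represents s t S T" "clin T"
proof -
  have lin: "S (J s u + J s v) = S (J s u) + S (J s v)" "S (scaleF c (J s u)) = scaleF c (S (J s u))" for u v c
    using S by (auto simp: bounded_op_def clinear_on_def sobolev_eq)
  have "S (J s h) \<in> range (J t)" for h using S by (auto simp: bounded_op_def sobolev_eq image_subset_iff)
  then have "\<exists>g. J t g = S (J s h)" for h by (metis imageE)
  then obtain f where f: "\<And>h. J t (f h) = S (J s h)" by metis
  have fa: "f (u + v) = f u + f v" for u v by (rule J_inj[of t]) (simp add: f J_add lin)
  have fc: "f (csc c u) = csc c (f u)" for c u by (rule J_inj[of t]) (simp add: f J_csc lin)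
  have fr: "f (r *\<^sub>R u) = r *\<^sub>R f u" for r u using fc[of "complex_of_real r" u] by (simp add: csc_of_real)
  obtain K where K: "op_norm s t S = ennreal K" "K \<ge> 0" using S by (cases "op_norm s t S") (auto simp: bounded_op_def)
  have "norm (f h) \<le> K" if "norm h \<le> 1" for h
  proof -
    have "ennreal (sobolev_norm t (S (J s h))) \<le> op_norm s t S"
      unfolding op_norm_def using that by (intro SUP_upper) (simp add: sobolev_eq sobolev_norm_J)
    then show ?thesis using K by (simp add: f[symmetric] sobolev_norm_J)
  qed
  then have "norm (f h) \<le> K * norm h" for h by (rule norm_le_if_unit_ball_le[OF fr])
  then have "bounded_linear f" by (intro bounded_linear_intro[where K=K] fa fr) (simp add: mult.commute)
  then have "blinfun_apply (Blinfun f) = f" by (rule bounded_linear_Blinfun_apply)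
  then show thesis using f fc by (intro that[of "Blinfun f"]) (simp_all add: represents_def clin_def)
qed

section \<open>Plane waves as bounded operators and commutators with them\<close>

definition shiftL :: "real \<Rightarrow> real^'n \<Rightarrow> ('n::finite, 'e::fin_dim_hilbert) l2 \<Rightarrow>\<^sub>L ('n, 'e) l2" where
  "shiftL s k = Blinfun (shift s k)"

lemma shiftL_apply [simp]: "blinfun_apply (shiftL s k) = shift s k"
  unfolding shiftL_def by (rule bounded_linear_Blinfun_apply[OF bounded_linear_shift])

lemma norm_shiftL: "norm (shiftL s k) \<le> (2 * jb k) powr (\<bar>s\<bar> / 2)"
  by (rule norm_blinfun_bound) (use norm_shift_le in auto)

lemma shift_shift_uminus: "shift s (- k) (shift s k h) = h"
proof (rule J_inj[of s], rule ext)
  fix \<phi>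
  have e: "exp (\<i> * complex_of_real (x \<bullet> k)) * (exp (\<i> * complex_of_real (x \<bullet> - k)) * \<phi> x) = \<phi> x" for x
    by (simp add: exp_minus field_simps flip: mult.assoc)
  have "J s (shift s (- k) (shift s k h)) \<phi> = V_op (- k) (V_op k (J s h)) \<phi>" by (simp add: V_op_J)
  also have "\<dots> = J s h \<phi>"
  proof (cases "\<phi> \<in> schwartz")
    case True
    have "V_op (- k) (V_op k (J s h)) \<phi> = V_op k (J s h) (\<lambda>x. exp (\<i> * complex_of_real (x \<bullet> - k)) * \<phi> x)"
      unfolding V_op_def[of "- k"] mult_op_def transposed_def using True by simp
    also have "\<dots> = J s h (\<lambda>x. exp (\<i> * complex_of_real (x \<bullet> k)) * (exp (\<i> * complex_of_real (x \<bullet> - k)) * \<phi> x))"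
      unfolding V_op_def mult_op_def transposed_def using schwartz_plane_wave[OF True, of "- k"] by simp
    finally show ?thesis unfolding e .
  qed (simp add: V_op_def mult_op_def transposed_def J_not_schwartz)
  finally show "J s (shift s (- k) (shift s k h)) \<phi> = J s h \<phi>" .
qed

lemma shift_0: "shift s 0 h = h"
  by (rule l2_eqI) (use rep_shift[of s 0 h] in \<open>eventually_elim, simp add: jb_neq_0\<close>)

text \<open>The relation \<open>Cz\<close> expresses the class \<open>C\<^sup>u(Q)\<close> through commutators with the operators
  of multiplication by plane waves. In this form it is preserved by taking inverses.\<close>

definition Cz :: "real \<Rightarrow> real \<Rightarrow> (('n::finite, 'e::fin_dim_hilbert) l2 \<Rightarrow>\<^sub>L ('n, 'e) l2) \<Rightarrow> bool" where
  "Cz s t T \<longleftrightarrow> clin T \<and> ((\<lambda>k. (T o\<^sub>L shiftL s k) - (shiftL t k o\<^sub>L T)) \<longlongrightarrow> 0) (at 0)"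

lemma jb_tendsto: "((jb :: real^'n \<Rightarrow> real) \<longlongrightarrow> jb (0::real^'n)) (at 0)"
proof -
  have "isCont (jb :: real^'n \<Rightarrow> real) 0" unfolding jb_def[abs_def] by (intro continuous_intros)
  then show ?thesis by (simp only: isCont_def)
qed

text \<open>The commutator at k is the plane wave composed with the difference of the conjugates at
  k and at 0, and the norms of the plane waves stay bounded as k tends to 0.\<close>

lemma class_Cu_imp_Cz:
  fixes S :: "('n::finite, 'e::fin_dim_hilbert) functional \<Rightarrow> ('n, 'e) functional"
  assumes S: "class_Cu s t S"
  obtains T where "represents s t S T" "Cz s t T"
proof -
  obtain T where T: "represents s t S T" "clin T" using S bounded_op_represents unfolding class_Cu_def by blast
  let ?D = "\<lambda>k. (shiftL t (- k) o\<^sub>L T o\<^sub>L shiftL s k) - T"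
  have c: "J t (shift t (- k) (T (shift s k h))) = conj_V k S (J s h)" for k h
    by (simp add: conj_V_def V_op_J flip: representsD[OF T(1)])
  have r: "represents s t (\<lambda>u. conj_V k S u - conj_V 0 S u) (?D k)" for k
    unfolding represents_def
  proof
    fix h
    show "J t (?D k h) = conj_V k S (J s h) - conj_V 0 S (J s h)"
      using c[of k h] c[of 0 h] by (simp add: blinfun.diff_left J_diff shift_0)
  qed
  have "((\<lambda>k. op_norm s t (\<lambda>u. conj_V k S u - conj_V 0 S u)) \<longlongrightarrow> 0) (at 0)"
    using S unfolding class_Cu_def by blast
  then have "((\<lambda>k. ennreal (norm (?D k))) \<longlongrightarrow> ennreal 0) (at 0)" unfolding op_norm_represents[OF r] by simp
  then have n0: "((\<lambda>k. norm (?D k)) \<longlongrightarrow> 0) (at 0)" by (subst (asm) tendsto_ennreal_iff) auto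
  have eq: "(T o\<^sub>L shiftL s k) - (shiftL t k o\<^sub>L T) = shiftL t k o\<^sub>L ?D k" for k
  proof (rule blinfun_eqI)
    fix h
    have "shift t k (shift t (- k) v) = v" for v :: "('n, 'e) l2" using shift_shift_uminus[of t "- k" v] by simp
    moreover have "shift t k (u - v) = shift t k u - shift t k v" for u v :: "('n, 'e) l2"
      by (rule linear_diff[OF bounded_linear.linear[OF bounded_linear_shift]])
    ultimately show "((T o\<^sub>L shiftL s k) - (shiftL t k o\<^sub>L T)) h = (shiftL t k o\<^sub>L ?D k) h"
      by (simp add: blinfun.diff_left)
  qed
  note cj = jb_tendsto
  have "((\<lambda>k::real^'n. (2 * jb k) powr (\<bar>t\<bar> / 2)) \<longlongrightarrow> (2 * jb (0::real^'n)) powr (\<bar>t\<bar> / 2)) (at 0)"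
    by (intro tendsto_intros cj) (simp add: jb_neq_0)
  from tendsto_mult[OF this n0] have lim: "((\<lambda>k. (2 * jb k) powr (\<bar>t\<bar> / 2) * norm (?D k)) \<longlongrightarrow> 0) (at 0)" by simp
  have "((\<lambda>k. shiftL t k o\<^sub>L ?D k) \<longlongrightarrow> 0) (at 0)"
  proof (rule Lim_null_comparison[OF _ lim])
    have "norm (shiftL t k o\<^sub>L ?D k) \<le> (2 * jb k) powr (\<bar>t\<bar> / 2) * norm (?D k)" for k
      by (rule order_trans[OF norm_blinfun_compose]) (intro mult_right_mono norm_shiftL norm_ge_zero)
    then show "\<forall>\<^sub>F k in at 0. norm (shiftL t k o\<^sub>L ?D k) \<le> (2 * jb k) powr (\<bar>t\<bar> / 2) * norm (?D k)" by simp
  qed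
  then have "Cz s t T" using T(2) unfolding Cz_def eq by blast
  with T(1) show thesis by (rule that)
qed

lemma tendsto_0_compose_left: "(F \<longlongrightarrow> 0) net \<Longrightarrow> ((\<lambda>k. A o\<^sub>L F k) \<longlongrightarrow> 0) net"
  using bounded_bilinear.tendsto[OF bounded_bilinear_blinfun_compose tendsto_const, of F 0 net A] by simp

lemma tendsto_0_compose_right: "(F \<longlongrightarrow> 0) net \<Longrightarrow> ((\<lambda>k. F k o\<^sub>L A) \<longlongrightarrow> 0) net"
  using bounded_bilinear.tendsto[OF bounded_bilinear_blinfun_compose _ tendsto_const, of F 0 net A] by simp

text \<open>Commutators obey a product rule: U times the commutator of T, plus the commutator of U
  times T.\<close>

lemma Cz_compose:
  assumes T: "Cz s t T" and U: "Cz t r U"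
  shows "Cz s r (U o\<^sub>L T)"
proof -
  have eq: "((U o\<^sub>L T) o\<^sub>L shiftL s k) - (shiftL r k o\<^sub>L (U o\<^sub>L T))
      = (U o\<^sub>L ((T o\<^sub>L shiftL s k) - (shiftL t k o\<^sub>L T))) + (((U o\<^sub>L shiftL t k) - (shiftL r k o\<^sub>L U)) o\<^sub>L T)" for k
    by (rule blinfun_eqI) (simp add: blinfun.diff_left blinfun.diff_right blinfun.add_left)
  have "((\<lambda>k. (U o\<^sub>L ((T o\<^sub>L shiftL s k) - (shiftL t k o\<^sub>L T))) + (((U o\<^sub>L shiftL t k) - (shiftL r k o\<^sub>L U)) o\<^sub>L T)) \<longlongrightarrow> 0 + 0) (at 0)"
    using T U by (intro tendsto_add tendsto_0_compose_left tendsto_0_compose_right) (auto simp: Cz_def)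
  then show ?thesis using T U unfolding Cz_def eq by (simp add: clin_def)
qed

lemma csc_add: "csc c (u + v) = csc c u + csc c v"
  using bounded_linear_csc by (rule bounded_linear.linear[THEN linear_add])

lemma csc_diff: "csc c (u - v) = csc c u - csc c v"
  using bounded_linear_csc by (rule bounded_linear.linear[THEN linear_diff])

lemma csc_zero: "csc c 0 = 0"
  using bounded_linear_csc by (rule bounded_linear.linear[THEN linear_0])

lemma Cz_diff:
  assumes T: "Cz s t T" and U: "Cz s t U"
  shows "Cz s t (T - U)"
proof -
  have eq: "((T - U) o\<^sub>L shiftL s k) - (shiftL t k o\<^sub>L (T - U))
      = ((T o\<^sub>L shiftL s k) - (shiftL t k o\<^sub>L T)) - ((U o\<^sub>L shiftL s k) - (shiftL t k o\<^sub>L U))" for k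
    by (rule blinfun_eqI) (simp add: blinfun.diff_left blinfun.diff_right flip: shiftL_apply)
  have "((\<lambda>k. ((T o\<^sub>L shiftL s k) - (shiftL t k o\<^sub>L T)) - ((U o\<^sub>L shiftL s k) - (shiftL t k o\<^sub>L U))) \<longlongrightarrow> 0 - 0) (at 0)"
    using T U by (intro tendsto_diff) (auto simp: Cz_def)
  then show ?thesis using T U unfolding Cz_def eq by (simp add: clin_def blinfun.diff_left csc_diff)
qed

lemma Cz_zero: "Cz s t 0"
proof -
  have "((0::('a, 'b) l2 \<Rightarrow>\<^sub>L ('a, 'b) l2) o\<^sub>L shiftL s k) - (shiftL t k o\<^sub>L 0) = 0" for k
    by (rule blinfun_eqI) (simp add: blinfun.diff_left blinfun.zero_right flip: shiftL_apply)
  then show ?thesis by (simp add: Cz_def clin_def csc_zero)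
qed

lemma Cz_sum: "(\<And>i. i \<in> I \<Longrightarrow> Cz s t (T i)) \<Longrightarrow> Cz s t (\<Sum>i\<in>I. T i)"
proof (induction I rule: infinite_finite_induct)
  case (insert x F)
  have "Cz s t (T x - (0 - (\<Sum>i\<in>F. T i)))" using insert by (intro Cz_diff Cz_zero) auto
  then show ?case using insert by simp
qed (auto simp: Cz_zero)

text \<open>The commutator of R is minus that of T multiplied by R on both sides. This is how
  resolvents inherit the class from the coefficients.\<close>

lemma Cz_inverse:
  assumes T: "Cz s t T" and R: "R o\<^sub>L T = id_blinfun" "T o\<^sub>L R = id_blinfun"
  shows "Cz t s R"
proof -
  have RT: "R (T x) = x" and TR: "T (R x) = x" for x
    using R by (metis blinfun_apply_blinfun_compose id_blinfun.rep_eq)+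
  have "clin R"
    unfolding clin_def
  proof (intro allI)
    fix c u
    have "T (csc c (R u)) = csc c u" using T TR by (simp add: Cz_def clin_def)
    then show "R (csc c u) = csc c (R u)" by (metis RT)
  qed
  moreover have eq: "(R o\<^sub>L shiftL t k) - (shiftL s k o\<^sub>L R)
      = - (R o\<^sub>L (((T o\<^sub>L shiftL s k) - (shiftL t k o\<^sub>L T)) o\<^sub>L R))" for k
    by (rule blinfun_eqI) (simp add: blinfun.diff_left blinfun.diff_right blinfun.minus_left RT TR)
  have "((\<lambda>k. - (R o\<^sub>L (((T o\<^sub>L shiftL s k) - (shiftL t k o\<^sub>L T)) o\<^sub>L R))) \<longlongrightarrow> - 0) (at 0)"
    using T by (intro tendsto_minus tendsto_0_compose_left tendsto_0_compose_right) (auto simp: Cz_def)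
  ultimately show ?thesis unfolding Cz_def eq by simp
qed

definition mulL :: "(real^'n \<Rightarrow> complex) \<Rightarrow> ('n::finite, 'e::fin_dim_hilbert) l2 \<Rightarrow>\<^sub>L ('n, 'e) l2" where
  "mulL p = Blinfun (mulop p)"

lemma mulL_apply:
  assumes "p \<in> borel_measurable borel" "\<And>x. norm (p x) \<le> C"
  shows "blinfun_apply (mulL p) = mulop p"
  unfolding mulL_def by (rule bounded_linear_Blinfun_apply[OF bounded_linear_mulop[OF assms]])

lemma norm_mulL_le:
  assumes "p \<in> borel_measurable borel" "\<And>x. norm (p x) \<le> C"
  shows "norm (mulL p) \<le> C"
proof (rule norm_blinfun_bound)
  show "0 \<le> C" using assms(2)[of 0] norm_ge_zero order_trans by blast
  show "norm (mulL p x) \<le> C * norm x" for x unfolding mulL_apply[OF assms] by (rule norm_mulop_le[OF assms])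
qed

lemma clin_mulL:
  assumes "p \<in> borel_measurable borel" "\<And>x. norm (p x) \<le> C"
  shows "clin (mulL p)"
  unfolding clin_def mulL_apply[OF assms]
proof (intro allI)
  fix c and u :: "('a, 'b) l2"
  show "mulop p (csc c u) = csc c (mulop p u)"
    by (rule l2_eqI) (use rep_mulop[OF assms, of "csc c u"] rep_mulop[OF assms, of u] rep_csc[of c u] rep_csc[of c "mulop p u"] in
      \<open>eventually_elim, simp add: scaleC_scaleC mult.commute\<close>)
qed

lemma represents_P_op: "represents s (s - 1) (P_op k) (mulL (psym k))"
  by (simp add: represents_def P_op_J mulL_apply[OF psym_measurable psym_bound])

lemma represents_emb: "d \<ge> 0 \<Longrightarrow> represents s (s - d) (\<lambda>u. u) (mulL (emb d))"
  by (simp add: represents_def J_emb mulL_apply[OF emb_measurable emb_bound])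

lemma represents_compose: "represents s t S T \<Longrightarrow> represents t r S' T' \<Longrightarrow> represents s r (\<lambda>u. S' (S u)) (T' o\<^sub>L T)"
  by (simp add: represents_def)

lemma represents_diff: "represents s t S T \<Longrightarrow> represents s t S' T' \<Longrightarrow> represents s t (\<lambda>u. S u - S' u) (T - T')"
  by (simp add: represents_def blinfun.diff_left J_diff)

lemma represents_unique: "represents s t S T \<Longrightarrow> represents s t S T' \<Longrightarrow> T = T'"
  by (rule blinfun_eqI) (metis J_inj representsD)

lemma Cz_emb:
  assumes "d \<ge> 0" shows "Cz s (s - d) (mulL (emb d))"
proof -
  have "mulop (emb d) (shift s k h) = shift (s - d) k (mulop (emb d) h)" for k and h :: "('a, 'b) l2"
    by (rule J_inj[of "s - d"]) (simp add: J_emb[OF assms] flip: V_op_J)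
  then have "(mulL (emb d) o\<^sub>L shiftL s k) - (shiftL (s - d) k o\<^sub>L mulL (emb d)) = (0 :: ('a, 'b) l2 \<Rightarrow>\<^sub>L ('a, 'b) l2)" for k
    by (intro blinfun_eqI) (simp add: blinfun.diff_left mulL_apply[OF emb_measurable emb_bound[OF assms]])
  then show ?thesis using clin_mulL[OF emb_measurable emb_bound[OF assms]] by (simp add: Cz_def)
qed

text \<open>The commutator of \<open>P_op k\<close> with the plane wave of frequency a is the
  component of a along k times that plane wave. It has order 0, hence the inclusion
  \<open>?E\<close> after it, and it vanishes with a.\<close>

lemma Cz_P_op: "Cz s (s - 1) (mulL (psym k) :: ('n::finite, 'e::fin_dim_hilbert) l2 \<Rightarrow>\<^sub>L ('n, 'e) l2)"
proof -
  let ?P = "mulL (psym k) :: ('n, 'e) l2 \<Rightarrow>\<^sub>L ('n, 'e) l2" and ?E = "mulL (emb 1) :: ('n, 'e) l2 \<Rightarrow>\<^sub>L ('n, 'e) l2"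
  have P: "?P h = mulop (psym k) h" and E: "?E h = mulop (emb 1) h" for h
    by (simp_all add: mulL_apply[OF psym_measurable psym_bound] mulL_apply[OF emb_measurable emb_bound[of 1]])
  have eq: "(?P o\<^sub>L shiftL s a) - (shiftL (s - 1) a o\<^sub>L ?P) = (a $ k) *\<^sub>R (?E o\<^sub>L shiftL s a)" for a
  proof (rule blinfun_eqI)
    fix h :: "('n, 'e) l2"
    let ?e = "\<lambda>x. exp (\<i> * complex_of_real (x \<bullet> a))"
    have d: "?e differentiable at x" for x
      using slowly_growing_plane_wave[of a] unfolding slowly_growing_def by (blast intro: diff_level_differentiable)
    have "P_op k (V_op a (J s h)) = V_op a (P_op k (J s h)) + scaleF (complex_of_real (a $ k)) (V_op a (J s h))"
    proof
      fix \<phi>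
      show "P_op k (V_op a (J s h)) \<phi> = (V_op a (P_op k (J s h)) + scaleF (complex_of_real (a $ k)) (V_op a (J s h))) \<phi>"
      proof (cases "\<phi> \<in> schwartz")
        case \<phi>: True
        let ?f = "\<lambda>x. ?e x * \<phi> x"
        have f: "?f \<in> schwartz" using \<phi> by (rule schwartz_plane_wave)
        have p: "?e x * (\<i> * partial_deriv k \<phi> x) = \<i> * partial_deriv k ?f x + complex_of_real (a $ k) * ?f x" for x
          unfolding partial_deriv_mult[OF d schwartz_differentiable[OF \<phi>]] partial_deriv_plane_wave
          by (simp add: algebra_simps)
        have "P_op k (V_op a (J s h)) \<phi> = J s h (\<lambda>x. ?e x * (\<i> * partial_deriv k \<phi> x))"
          by (simp add: P_op_def V_op_def mult_op_def transposed_def \<phi> schwartz_cmult schwartz_partial)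
        also have "\<dots> = J s h (\<lambda>x. \<i> * partial_deriv k ?f x) + J s h (\<lambda>x. complex_of_real (a $ k) * ?f x)"
          unfolding p using J_tempered[of s h] f by (simp add: tempered_def schwartz_cmult schwartz_partial)
        also have "J s h (\<lambda>x. complex_of_real (a $ k) * ?f x) = complex_of_real (a $ k) *\<^sub>C J s h ?f"
          using J_tempered[of s h] f by (simp add: tempered_def)
        finally show ?thesis
          by (simp add: P_op_def V_op_def mult_op_def transposed_def scaleF_def \<phi> f)
      qed (simp add: P_op_def V_op_def mult_op_def transposed_def scaleF_def scaleC.zero_right)
    qed
    then have "J (s - 1) (mulop (psym k) (shift s a h)) = J (s - 1) (shift (s - 1) a (mulop (psym k) h) + (a $ k) *\<^sub>R mulop (emb 1) (shift s a h))"
      by (simp add: V_op_J P_op_J J_add J_scaleR J_emb)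
    from J_inj[OF this] show "((?P o\<^sub>L shiftL s a) - (shiftL (s - 1) a o\<^sub>L ?P)) h = ((a $ k) *\<^sub>R (?E o\<^sub>L shiftL s a)) h"
      by (simp add: blinfun.diff_left blinfun.scaleR_left P E)
  qed
  have "((\<lambda>a. (a $ k) *\<^sub>R (?E o\<^sub>L shiftL s a)) \<longlongrightarrow> 0) (at 0)"
  proof (rule Lim_null_comparison)
    note cj = jb_tendsto
    have "((\<lambda>a::real^'n. \<bar>a $ k\<bar> * (2 * jb a) powr (\<bar>s\<bar> / 2)) \<longlongrightarrow> \<bar>0 $ k\<bar> * (2 * jb (0::real^'n)) powr (\<bar>s\<bar> / 2)) (at 0)"
      by (intro tendsto_intros cj) (simp add: jb_neq_0)
    then show "((\<lambda>a::real^'n. \<bar>a $ k\<bar> * (2 * jb a) powr (\<bar>s\<bar> / 2)) \<longlongrightarrow> 0) (at 0)" by simp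
    have "norm ((a $ k) *\<^sub>R (?E o\<^sub>L shiftL s a)) \<le> \<bar>a $ k\<bar> * (2 * jb a) powr (\<bar>s\<bar> / 2)" for a
    proof -
      have "norm (?E o\<^sub>L shiftL s a) \<le> norm ?E * norm (shiftL s a :: ('n, 'e) l2 \<Rightarrow>\<^sub>L ('n, 'e) l2)" by (rule norm_blinfun_compose)
      also have "\<dots> \<le> 1 * (2 * jb a) powr (\<bar>s\<bar> / 2)"
        by (intro mult_mono norm_mulL_le norm_shiftL emb_bound) auto
      finally show ?thesis by (simp add: mult_left_mono)
    qed
    then show "\<forall>\<^sub>F a in at 0. norm ((a $ k) *\<^sub>R (?E o\<^sub>L shiftL s a)) \<le> \<bar>a $ k\<bar> * (2 * jb a) powr (\<bar>s\<bar> / 2)" by simp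
  qed
  then show ?thesis unfolding Cz_def eq using clin_mulL[OF psym_measurable psym_bound] by blast
qed

section \<open>Multiplication by functions as superposition of plane waves\<close>

text \<open>A vector valued integral defined by its inner products and produced by the Riesz
  theorem; only scalar functions have to be measurable.\<close>

lemma weak_integral:
  fixes F :: "'a::euclidean_space \<Rightarrow> 'h::{real_inner,banach}"
  assumes meas: "\<And>y. (\<lambda>k. inner y (F k)) \<in> borel_measurable borel"
    and B: "integrable lborel B" and le: "\<And>k. norm (F k) \<le> B k"
  shows "integrable lborel (\<lambda>k. inner y (F k))"
    and "\<exists>v. \<forall>y. inner y v = (\<integral>k. inner y (F k) \<partial>lborel)"
    and "\<bar>\<integral>k. inner y (F k) \<partial>lborel\<bar> \<le> norm y * (\<integral>k. B k \<partial>lborel)"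
proof -
  have B0: "0 \<le> B k" for k using le[of k] norm_ge_zero order_trans by blast
  have b: "\<bar>inner y (F k)\<bar> \<le> norm y * B k" for y k
    using Cauchy_Schwarz_ineq2[of y "F k"] mult_left_mono[OF le[of k], of "norm y"] by simp
  have int: "integrable lborel (\<lambda>k. inner y (F k))" for y
    by (rule Bochner_Integration.integrable_bound[OF integrable_mult_right[OF B, of "norm y"]])
      (use meas b B0 in \<open>auto simp: abs_mult\<close>)
  then show "integrable lborel (\<lambda>k. inner y (F k))" .
  have nb: "\<bar>\<integral>k. inner y (F k) \<partial>lborel\<bar> \<le> norm y * (\<integral>k. B k \<partial>lborel)" for y
  proof -
    have "\<bar>\<integral>k. inner y (F k) \<partial>lborel\<bar> \<le> (\<integral>k. \<bar>inner y (F k)\<bar> \<partial>lborel)"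
      using integral_norm_bound[of lborel "\<lambda>k. inner y (F k)"] by simp
    also have "\<dots> \<le> (\<integral>k. norm y * B k \<partial>lborel)"
      by (intro Bochner_Integration.integral_mono b integrable_mult_right B) (use int in auto)
    finally show ?thesis by simp
  qed
  then show "\<bar>\<integral>k. inner y (F k) \<partial>lborel\<bar> \<le> norm y * (\<integral>k. B k \<partial>lborel)" .
  have "bounded_linear (\<lambda>y. \<integral>k. inner y (F k) \<partial>lborel)"
    by (rule bounded_linear_intro[where K="\<integral>k. B k \<partial>lborel"]) (use int nb in \<open>auto simp: inner_add_left\<close>)
  then obtain v where "\<And>y. (\<integral>k. inner y (F k) \<partial>lborel) = inner v y" using riesz by blast
  then show "\<exists>v. \<forall>y. inner y v = (\<integral>k. inner y (F k) \<partial>lborel)" by (metis inner_commute)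
qed

lemma csc_csc: "csc c (csc d u) = csc (c * d) u"
  by (rule l2_eqI) (use rep_csc[of c "csc d u"] rep_csc[of d u] rep_csc[of "c * d" u] in \<open>eventually_elim, simp add: scaleC_scaleC\<close>)

text \<open>The norm on order s of the plane wave with frequency \<epsilon> k, times that of
  \<gamma> k, is at most this for all \<epsilon> in [0, 1]. Rounding |s| up keeps the exponents
  integral, so \<open>schwartz_integrable_power\<close> applies.\<close>

definition gbound :: "real \<Rightarrow> (real^'n \<Rightarrow> complex) \<Rightarrow> real^'n \<Rightarrow> real" where
  "gbound s \<gamma> k = 2 ^ nat \<lceil>\<bar>s\<bar>\<rceil> * ((1 + norm k) ^ (2 * nat \<lceil>\<bar>s\<bar>\<rceil>) * norm (\<gamma> k))"

lemma shift_bound_poly: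
  assumes "0 \<le> \<epsilon>" "\<epsilon> \<le> 1"
  shows "(2 * jb (\<epsilon> *\<^sub>R k)) powr (\<bar>s\<bar> / 2) \<le> 2 ^ nat \<lceil>\<bar>s\<bar>\<rceil> * (1 + norm k) ^ (2 * nat \<lceil>\<bar>s\<bar>\<rceil>)"
proof -
  let ?M = "nat \<lceil>\<bar>s\<bar>\<rceil>"
  have "norm (\<epsilon> *\<^sub>R k) \<le> norm k" using assms by (simp add: mult_left_le_one_le)
  then have "jb (\<epsilon> *\<^sub>R k) \<le> jb k" unfolding jb_def by (intro add_left_mono power_mono) auto
  then have le: "2 * jb (\<epsilon> *\<^sub>R k) \<le> 2 * (1 + norm k) ^ 2" using jb_le[of k] by simp
  have "(2 * jb (\<epsilon> *\<^sub>R k)) powr (\<bar>s\<bar> / 2) \<le> (2 * jb (\<epsilon> *\<^sub>R k)) powr (real ?M)"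
    using jb_ge_1[of "\<epsilon> *\<^sub>R k"] by (intro powr_mono) linarith+
  also have "\<dots> = (2 * jb (\<epsilon> *\<^sub>R k)) ^ ?M" using jb_pos[of "\<epsilon> *\<^sub>R k"] by (intro powr_realpow) simp
  also have "\<dots> \<le> (2 * (1 + norm k) ^ 2) ^ ?M" using le jb_pos[of "\<epsilon> *\<^sub>R k"] by (intro power_mono) auto
  finally show ?thesis by (simp add: power_mult_distrib power_mult)
qed

lemma gbound_integrable: "\<gamma> \<in> schwartz \<Longrightarrow> integrable lborel (gbound s \<gamma>)"
  unfolding gbound_def[abs_def] by (intro integrable_mult_right schwartz_integrable_power)

context
  fixes \<gamma> :: "real^'n \<Rightarrow> complex" and \<epsilon> :: real
  assumes \<gamma>: "\<gamma> \<in> schwartz" and \<epsilon>: "0 \<le> \<epsilon>" "\<epsilon> \<le> 1"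
begin

lemma wave_norm_le:
  fixes h :: "('n, 'e::fin_dim_hilbert) l2"
  shows "norm (csc (\<gamma> k) (shift s (\<epsilon> *\<^sub>R k) h)) \<le> gbound s \<gamma> k * norm h"
proof -
  have "norm (csc (\<gamma> k) (shift s (\<epsilon> *\<^sub>R k) h)) \<le> norm (\<gamma> k) * norm (shift s (\<epsilon> *\<^sub>R k) h)" by (rule norm_csc_le)
  also have "\<dots> \<le> norm (\<gamma> k) * ((2 ^ nat \<lceil>\<bar>s\<bar>\<rceil> * (1 + norm k) ^ (2 * nat \<lceil>\<bar>s\<bar>\<rceil>)) * norm h)"
    by (intro mult_left_mono order_trans[OF norm_shift_le] mult_right_mono shift_bound_poly \<epsilon>) auto
  finally show ?thesis by (simp add: gbound_def mult_ac)
qed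

lemma inner_wave:
  fixes y h :: "('n, 'e::fin_dim_hilbert) l2"
  shows "inner y (csc (\<gamma> k) (shift s (\<epsilon> *\<^sub>R k) h))
    = (\<integral>\<xi>. inner (rep y \<xi>) (\<gamma> k *\<^sub>C (((jb \<xi> / jb (\<xi> - \<epsilon> *\<^sub>R k)) powr (s / 2)) *\<^sub>R rep h (\<xi> - \<epsilon> *\<^sub>R k))) \<partial>lborel)"
  by (rule inner_l2_cong[of y "rep y"])
    (use rep_csc[of "\<gamma> k" "shift s (\<epsilon> *\<^sub>R k) h"] rep_shift[of s "\<epsilon> *\<^sub>R k" h] in \<open>auto elim: eventually_elim2\<close>)

lemma wave_measurable:
  fixes y h :: "('n, 'e::fin_dim_hilbert) l2"
  shows "(\<lambda>k. inner y (csc (\<gamma> k) (shift s (\<epsilon> *\<^sub>R k) h))) \<in> borel_measurable borel"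
proof -
  have [measurable]: "\<gamma> \<in> borel_measurable borel" using \<gamma> by (rule schwartz_measurable)
  show ?thesis unfolding inner_wave by measurable
qed

lemma wave_operator_ex:
  "\<exists>G :: ('n, 'e::fin_dim_hilbert) l2 \<Rightarrow>\<^sub>L ('n, 'e) l2.
     (\<forall>y h. inner y (G h) = (\<integral>k. inner y (csc (\<gamma> k) (shift s (\<epsilon> *\<^sub>R k) h)) \<partial>lborel))"
proof -
  let ?F = "\<lambda>(h :: ('n, 'e) l2) k. csc (\<gamma> k) (shift s (\<epsilon> *\<^sub>R k) h)"
  note W = weak_integral[OF wave_measurable integrable_mult_left[OF gbound_integrable[OF \<gamma>]] wave_norm_le]
  have "\<forall>h. \<exists>v. \<forall>y. inner y v = (\<integral>k. inner y (?F h k) \<partial>lborel)" using W(2) by blast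
  then obtain g where g: "\<And>y h. inner y (g h) = (\<integral>k. inner y (?F h k) \<partial>lborel)" by metis
  have lin: "linear (shift s k :: ('n, 'e) l2 \<Rightarrow> _)" for k by (rule bounded_linear.linear[OF bounded_linear_shift])
  have linc: "linear (csc c :: ('n, 'e) l2 \<Rightarrow> _)" for c by (rule bounded_linear.linear[OF bounded_linear_csc])
  have ga: "g (u + v) = g u + g v" for u v
  proof (rule vector_eq_ldot[THEN iffD1], rule allI)
    fix y
    show "inner y (g (u + v)) = inner y (g u + g v)"
      using W(1)[of y s u] W(1)[of y s v] by (simp add: inner_add_right g linear_add[OF lin] linear_add[OF linc])
  qed
  have gr: "g (r *\<^sub>R u) = r *\<^sub>R g u" for r u
  proof (rule vector_eq_ldot[THEN iffD1], rule allI)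
    fix y
    show "inner y (g (r *\<^sub>R u)) = inner y (r *\<^sub>R g u)"
      by (simp add: g linear_cmul[OF lin] linear_cmul[OF linc])
  qed
  have "bounded_linear g"
  proof (rule bounded_linear_intro[where K="\<integral>k. gbound s \<gamma> k \<partial>lborel", OF ga gr])
    fix h
    have "(norm (g h))\<^sup>2 \<le> norm (g h) * (norm h * (\<integral>k. gbound s \<gamma> k \<partial>lborel))"
      using W(3)[of "g h" s h] by (simp add: power2_norm_eq_inner g mult_ac)
    then have "norm (g h) * norm (g h) \<le> norm (g h) * (norm h * (\<integral>k. gbound s \<gamma> k \<partial>lborel))" by (simp add: power2_eq_square)
    moreover have "0 \<le> norm h * (\<integral>k. gbound s \<gamma> k \<partial>lborel)" by (simp add: gbound_def)
    ultimately show "norm (g h) \<le> norm h * (\<integral>k. gbound s \<gamma> k \<partial>lborel)" by (cases "g h = 0") auto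
  qed
  then have "blinfun_apply (Blinfun g) = g" by (rule bounded_linear_Blinfun_apply)
  then show ?thesis using g by (intro exI[of _ "Blinfun g"]) simp
qed

text \<open>The superposition with density \<gamma> of the plane waves of frequencies \<epsilon> k,
  as a weak integral on the model of order s.\<close>

definition wave_op :: "real \<Rightarrow> ('n, 'e::fin_dim_hilbert) l2 \<Rightarrow>\<^sub>L ('n, 'e) l2" where
  "wave_op s = (SOME G :: ('n, 'e) l2 \<Rightarrow>\<^sub>L ('n, 'e) l2. \<forall>y h. inner y (G h) = (\<integral>k. inner y (csc (\<gamma> k) (shift s (\<epsilon> *\<^sub>R k) h)) \<partial>lborel))"

lemma inner_wave_op:
  "inner (y :: ('n, 'e::fin_dim_hilbert) l2) (wave_op s h) = (\<integral>k. inner y (csc (\<gamma> k) (shift s (\<epsilon> *\<^sub>R k) h)) \<partial>lborel)"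
  using someI_ex[OF wave_operator_ex[of s, where 'e='e]] unfolding wave_op_def[symmetric] by auto

text \<open>The weak integral is really multiplication by g. Paired with a test function it becomes
  a double integral over the wave parameter k and the frequency variable \<xi>, and exchanging the
  order of integration assembles the transform of g \<phi>.\<close>

lemma represents_wave_op:
  assumes g: "\<And>x. g x = (\<integral>k. \<gamma> k * exp (\<i> * complex_of_real (x \<bullet> (\<epsilon> *\<^sub>R k))) \<partial>lborel)" and gs: "g \<in> schwartz"
  shows "represents s s (mult_op g) (wave_op s :: ('n, 'e::fin_dim_hilbert) l2 \<Rightarrow>\<^sub>L ('n, 'e) l2)"
  unfolding represents_def
proof (intro allI ext)
  fix h :: "('n, 'e) l2" and \<phi> :: "real^'n \<Rightarrow> complex"
  have [measurable]: "\<gamma> \<in> borel_measurable borel" using \<gamma> by (rule schwartz_measurable)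
  show "J s (wave_op s h) \<phi> = mult_op g (J s h) \<phi>"
  proof (cases "\<phi> \<in> schwartz")
    case \<phi>: True
    have [measurable]: "\<phi> \<in> borel_measurable borel" "ifourier \<phi> \<in> borel_measurable borel"
      using \<phi> by (auto intro: schwartz_measurable ifourier_schwartz)
    have "g \<in> slowly_growing" using gs unfolding schwartz_iff slowly_growing_def diff_level_iff by (blast intro: decays_imp_slow)
    then have g\<phi>: "(\<lambda>x. g x * \<phi> x) \<in> schwartz" using \<phi> by (rule slowly_growing_mult_schwartz)
    have F1: "ifourier (\<lambda>x. g x * \<phi> x) \<xi> = (\<integral>k. \<gamma> k * ifourier \<phi> (\<xi> + \<epsilon> *\<^sub>R k) \<partial>lborel)" for \<xi>
    proof -
      let ?e = "\<lambda>x. exp (- \<i> * complex_of_real (x \<bullet> - \<xi>))"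
      let ?K = "\<lambda>k x. complex_of_real (fconst TYPE('n)) * (?e x * (\<gamma> k * exp (\<i> * complex_of_real (x \<bullet> (\<epsilon> *\<^sub>R k))) * \<phi> x))"
      have "ifourier (\<lambda>x. g x * \<phi> x) \<xi> = (\<integral>x. \<integral>k. ?K k x \<partial>lborel \<partial>lborel)"
        unfolding ifourier_def fourier_eq g by (simp only: integral_mult_right_zero integral_mult_left_zero)
      also have "\<dots> = (\<integral>k. \<integral>x. ?K k x \<partial>lborel \<partial>lborel)"
      proof (rule lborel_Fubini_bound)
        show "integrable lborel (\<lambda>k. fconst TYPE('n) * norm (\<gamma> k))" "integrable lborel (\<lambda>x. norm (\<phi> x))"
          using \<gamma> \<phi> schwartz_integrable by auto
        show "norm (?K k x) \<le> fconst TYPE('n) * norm (\<gamma> k) * norm (\<phi> x)" for k x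
          by (simp add: norm_mult abs_of_pos fconst_pos)
        show "(\<lambda>(k, x). ?K k x) \<in> borel_measurable (lborel \<Otimes>\<^sub>M lborel)" by measurable
      qed
      also have "\<dots> = (\<integral>k. \<gamma> k * ifourier (\<lambda>x. exp (\<i> * complex_of_real (x \<bullet> (\<epsilon> *\<^sub>R k))) * \<phi> x) \<xi> \<partial>lborel)"
      proof -
        have "?K k x = \<gamma> k * (complex_of_real (fconst TYPE('n)) * (?e x * (exp (\<i> * complex_of_real (x \<bullet> (\<epsilon> *\<^sub>R k))) * \<phi> x)))" for k x
          by (simp only: mult_ac)
        then show ?thesis unfolding ifourier_def fourier_eq by (simp only: integral_mult_right_zero)
      qed
      finally show ?thesis unfolding ifourier_plane_wave .
    qed
    obtain N where N: "integrable lborel (\<lambda>\<xi>. norm (wrep s h \<xi>) / (1 + norm \<xi>) ^ N)" using wrep_tame[of s h] by (auto simp: tame_def)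
    obtain C where C: "C \<ge> 0" "\<And>x. norm (ifourier \<phi> x) \<le> C / (1 + norm x) ^ N"
      using schwartz_bound[OF ifourier_schwartz[OF \<phi>]] by metis
    let ?H = "\<lambda>k \<xi>. \<gamma> k *\<^sub>C (ifourier \<phi> (\<xi> + \<epsilon> *\<^sub>R k) *\<^sub>C wrep s h \<xi>)"
    have Hm: "(\<lambda>(k, \<xi>). ?H k \<xi>) \<in> borel_measurable (lborel \<Otimes>\<^sub>M lborel)" by measurable
    \<comment> \<open>The decay of the transform of \<phi> at \<xi> + \<epsilon> k is traded for
      decay at \<xi>, at the price of a power of 1 + norm k that the rapidly decreasing \<gamma>
      absorbs.\<close>
    have Hle: "norm (?H k \<xi>) \<le> (C * ((1 + norm k) ^ N * norm (\<gamma> k))) * (norm (wrep s h \<xi>) / (1 + norm \<xi>) ^ N)" for k \<xi>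
    proof -
      have p: "1 + norm \<xi> > 0" "1 + norm (\<xi> + \<epsilon> *\<^sub>R k) > 0" using norm_ge_zero[of \<xi>] norm_ge_zero[of "\<xi> + \<epsilon> *\<^sub>R k"] by linarith+
      have "norm (\<epsilon> *\<^sub>R k) \<le> norm k" using \<epsilon> by (simp add: mult_left_le_one_le)
      then have "1 + norm \<xi> \<le> 1 + (norm (\<xi> + \<epsilon> *\<^sub>R k) + norm k)" using norm_triangle_ineq4[of "\<xi> + \<epsilon> *\<^sub>R k" "\<epsilon> *\<^sub>R k"] by simp
      also have "\<dots> \<le> (1 + norm (\<xi> + \<epsilon> *\<^sub>R k)) * (1 + norm k)" by (simp add: algebra_simps)
      finally have "(1 + norm \<xi>) ^ N \<le> (1 + norm (\<xi> + \<epsilon> *\<^sub>R k)) ^ N * (1 + norm k) ^ N"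
        using p unfolding power_mult_distrib[symmetric] by (intro power_mono) auto
      then have "1 / (1 + norm (\<xi> + \<epsilon> *\<^sub>R k)) ^ N \<le> (1 + norm k) ^ N / (1 + norm \<xi>) ^ N"
        using p by (simp add: field_simps)
      then have "C * (1 / (1 + norm (\<xi> + \<epsilon> *\<^sub>R k)) ^ N) \<le> C * ((1 + norm k) ^ N / (1 + norm \<xi>) ^ N)"
        using C(1) by (rule mult_left_mono)
      then have "norm (ifourier \<phi> (\<xi> + \<epsilon> *\<^sub>R k)) \<le> C * ((1 + norm k) ^ N / (1 + norm \<xi>) ^ N)"
        using C(2)[of "\<xi> + \<epsilon> *\<^sub>R k"] by simp
      then have "norm (\<gamma> k) * (norm (ifourier \<phi> (\<xi> + \<epsilon> *\<^sub>R k)) * norm (wrep s h \<xi>)) \<le> norm (\<gamma> k) * ((C * ((1 + norm k) ^ N / (1 + norm \<xi>) ^ N)) * norm (wrep s h \<xi>))"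
        by (intro mult_left_mono mult_right_mono) auto
      then show ?thesis by (simp add: norm_scaleC mult_ac)
    qed
    have HA: "integrable lborel (\<lambda>k. C * ((1 + norm k) ^ N * norm (\<gamma> k)))" by (intro integrable_mult_right schwartz_integrable_power \<gamma>)
    have Hint: "integrable (lborel \<Otimes>\<^sub>M lborel) (\<lambda>(k, \<xi>). ?H k \<xi>)"
      by (rule prod_integrable_bound[OF Hm HA N]) (use Hle in simp)
    have Ji: "J s (csc (\<gamma> k) (shift s (\<epsilon> *\<^sub>R k) h)) \<phi> = (\<integral>\<xi>. ?H k \<xi> \<partial>lborel)" for k
    proof -
      have "J s (csc (\<gamma> k) (shift s (\<epsilon> *\<^sub>R k) h)) \<phi> = \<gamma> k *\<^sub>C J s h (\<lambda>x. exp (\<i> * complex_of_real (x \<bullet> (\<epsilon> *\<^sub>R k))) * \<phi> x)"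
        by (simp add: J_csc scaleF_def V_op_def mult_op_def transposed_def \<phi> flip: V_op_J)
      moreover have "integrable lborel (\<lambda>\<xi>. ifourier \<phi> (\<xi> + \<epsilon> *\<^sub>R k) *\<^sub>C wrep s h \<xi>)"
        using J_integrable[OF schwartz_plane_wave[OF \<phi>, of "\<epsilon> *\<^sub>R k"], of s h] by (simp only: ifourier_plane_wave)
      ultimately show ?thesis
        by (simp only: J_apply[OF schwartz_plane_wave[OF \<phi>]] ifourier_plane_wave integral_scaleC)
    qed
    have "inner e (J s (wave_op s h) \<phi>) = inner e (mult_op g (J s h) \<phi>)" for e
    proof -
      have "bounded_linear (\<lambda>v::('n, 'e) l2. inner e (J s v \<phi>))"
        by (rule bounded_linear_compose[OF bounded_linear_inner_right J_bounded[OF \<phi>]])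
      \<comment> \<open>By the Riesz theorem the component e of the pairing with \<phi> is an inner
        product with some y, the form in which \<open>inner_wave_op\<close> evaluates the weak
        integral.\<close>
      then obtain y where y: "\<And>v::('n, 'e) l2. inner e (J s v \<phi>) = inner y v" using riesz by blast
      have "inner e (J s (wave_op s h) \<phi>) = (\<integral>k. inner e (\<integral>\<xi>. ?H k \<xi> \<partial>lborel) \<partial>lborel)"
        unfolding y inner_wave_op by (simp flip: y Ji)
      also have "\<dots> = inner e (\<integral>k. \<integral>\<xi>. ?H k \<xi> \<partial>lborel \<partial>lborel)"
        using lborel_pair.integrable_fst'[OF Hint] by (intro integral_inner_right) simp
      also have "(\<integral>k. \<integral>\<xi>. ?H k \<xi> \<partial>lborel \<partial>lborel) = (\<integral>\<xi>. \<integral>k. ?H k \<xi> \<partial>lborel \<partial>lborel)"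
        by (rule lborel_pair.Fubini_integral[symmetric, OF Hint])
      also have "\<dots> = (\<integral>\<xi>. ifourier (\<lambda>x. g x * \<phi> x) \<xi> *\<^sub>C wrep s h \<xi> \<partial>lborel)"
      proof -
        have i: "integrable lborel (\<lambda>k. \<gamma> k * ifourier \<phi> (\<xi> + \<epsilon> *\<^sub>R k))" for \<xi>
        proof -
          obtain D where D: "\<And>x. norm (ifourier \<phi> x) \<le> D / (1 + norm x) ^ 0"
            using schwartz_bound[OF ifourier_schwartz[OF \<phi>]] by metis
          show ?thesis
          proof (rule Bochner_Integration.integrable_bound)
          show "integrable lborel (\<lambda>k. norm (\<gamma> k) * D)" using \<gamma> schwartz_integrable by auto
          have "norm (\<gamma> k) * norm (ifourier \<phi> (\<xi> + \<epsilon> *\<^sub>R k)) \<le> norm (\<gamma> k) * \<bar>D\<bar>" for k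
            by (intro mult_left_mono order_trans[OF D]) auto
          then show "AE k in lborel. norm (\<gamma> k * ifourier \<phi> (\<xi> + \<epsilon> *\<^sub>R k)) \<le> norm (norm (\<gamma> k) * D)"
            by (intro AE_I2) (simp add: norm_mult abs_mult)
          qed measurable
        qed
        have "(\<integral>k. ?H k \<xi> \<partial>lborel) = (\<integral>k. \<gamma> k * ifourier \<phi> (\<xi> + \<epsilon> *\<^sub>R k) \<partial>lborel) *\<^sub>C wrep s h \<xi>" for \<xi>
          unfolding scaleC_scaleC by (rule integral_bounded_linear[OF scaleC.bounded_linear_left i])
        then show ?thesis unfolding F1 by simp
      qed
      also have "\<dots> = mult_op g (J s h) \<phi>"
        by (simp add: mult_op_def transposed_def \<phi> J_apply[OF g\<phi>])
      finally show ?thesis .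
    qed
    then show ?thesis using vector_eq_ldot[of "J s (wave_op s h) \<phi>" "mult_op g (J s h) \<phi>"] by blast
  qed (simp add: mult_op_def transposed_def J_not_schwartz)
qed

text \<open>The commutator with a superposition is the superposition of the commutators; complex
  linearity of T carries the density \<gamma> k through it.\<close>

lemma wave_op_commutator_bound:
  fixes T :: "('n, 'e::fin_dim_hilbert) l2 \<Rightarrow>\<^sub>L ('n, 'e) l2"
  assumes T: "clin T" and B: "integrable lborel B"
    and le: "\<And>k. norm (\<gamma> k) * norm ((T o\<^sub>L shiftL s (\<epsilon> *\<^sub>R k)) - (shiftL t (\<epsilon> *\<^sub>R k) o\<^sub>L T)) \<le> B k"
  shows "norm ((T o\<^sub>L wave_op s) - (wave_op t o\<^sub>L T)) \<le> (\<integral>k. B k \<partial>lborel)"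
proof (rule norm_blinfun_bound)
  let ?N = "\<lambda>k. (T o\<^sub>L shiftL s (\<epsilon> *\<^sub>R k)) - (shiftL t (\<epsilon> *\<^sub>R k) o\<^sub>L T)"
  have B0: "0 \<le> B k" for k using le[of k] by (meson mult_nonneg_nonneg norm_ge_zero order_trans)
  then show I0: "0 \<le> (\<integral>k. B k \<partial>lborel)" by simp
  fix h
  define x where "x = ((T o\<^sub>L wave_op s) - (wave_op t o\<^sub>L T)) h"
  \<comment> \<open>y is the adjoint of T applied to x; it absorbs T so that
    \<open>inner_wave_op\<close> applies to both terms of the commutator.\<close>
  obtain y where y: "\<And>v. inner x (T v) = inner y v"
    using riesz[OF bounded_linear_compose[OF bounded_linear_inner_right[of x] blinfun.bounded_linear_right[of T]]] by blast
  note W = weak_integral[OF wave_measurable integrable_mult_left[OF gbound_integrable[OF \<gamma>]] wave_norm_le]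
  have eq: "inner y (csc (\<gamma> k) (shift s (\<epsilon> *\<^sub>R k) h)) - inner x (csc (\<gamma> k) (shift t (\<epsilon> *\<^sub>R k) (T h))) = inner x (csc (\<gamma> k) (?N k h))" for k
    using T by (simp add: clin_def csc_diff inner_diff_right blinfun.diff_left flip: y)
  have "(norm x)\<^sup>2 = inner x (T (wave_op s h)) - inner x (wave_op t (T h))"
    unfolding power2_norm_eq_inner by (subst (2) x_def) (simp add: blinfun.diff_left inner_diff_right)
  also have "\<dots> = (\<integral>k. inner x (csc (\<gamma> k) (?N k h)) \<partial>lborel)"
    unfolding y inner_wave_op eq[symmetric] using W(1)[of y s h] W(1)[of x t "T h"] by simp
  also have "\<dots> \<le> (\<integral>k. (norm x * norm h) * B k \<partial>lborel)"
  proof (rule Bochner_Integration.integral_mono)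
    show "integrable lborel (\<lambda>k. inner x (csc (\<gamma> k) (?N k h)))"
      unfolding eq[symmetric] using W(1)[of y s h] W(1)[of x t "T h"] by simp
    show "integrable lborel (\<lambda>k. (norm x * norm h) * B k)" using B by simp
    fix k
    have "inner x (csc (\<gamma> k) (?N k h)) \<le> norm x * norm (csc (\<gamma> k) (?N k h))" by (rule norm_cauchy_schwarz)
    also have "\<dots> \<le> norm x * (norm (\<gamma> k) * (norm (?N k) * norm h))"
      by (intro mult_left_mono order_trans[OF norm_csc_le] norm_blinfun) auto
    also have "\<dots> = (norm x * norm h) * (norm (\<gamma> k) * norm (?N k))" by (simp only: mult_ac)
    also have "\<dots> \<le> (norm x * norm h) * B k" by (intro mult_left_mono le) auto
    finally show "inner x (csc (\<gamma> k) (?N k h)) \<le> (norm x * norm h) * B k" .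
  qed
  finally have "norm x * norm x \<le> norm x * ((\<integral>k. B k \<partial>lborel) * norm h)" by (simp add: power2_eq_square mult_ac)
  moreover have "0 \<le> (\<integral>k. B k \<partial>lborel) * norm h" using I0 by simp
  ultimately show "norm (((T o\<^sub>L wave_op s) - (wave_op t o\<^sub>L T)) h) \<le> (\<integral>k. B k \<partial>lborel) * norm h"
    unfolding x_def[symmetric] by (cases "x = 0") auto
qed

end

text \<open>Where \<epsilon> k is near 0 the commutators are small by assumption. Elsewhere they are
  only polynomially bounded, but there 1 \<le> \<epsilon> norm k / \<rho>, which buys a factor
  \<epsilon> for one more power of norm k.\<close>

lemma wave_op_commutator_small:
  fixes T :: "('n::finite, 'e::fin_dim_hilbert) l2 \<Rightarrow>\<^sub>L ('n, 'e) l2"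
  assumes \<gamma>: "\<gamma> \<in> schwartz" and T: "Cz s t T" and \<delta>: "\<delta> > 0"
  shows "\<exists>\<epsilon>0>0. \<forall>\<epsilon>. 0 < \<epsilon> \<longrightarrow> \<epsilon> < \<epsilon>0 \<longrightarrow> norm ((T o\<^sub>L wave_op \<gamma> \<epsilon> s) - (wave_op \<gamma> \<epsilon> t o\<^sub>L T)) < \<delta>"
proof -
  let ?N = "\<lambda>k. (T o\<^sub>L shiftL s k) - (shiftL t k o\<^sub>L T)"
  define M where "M = nat \<lceil>\<bar>s\<bar>\<rceil> + nat \<lceil>\<bar>t\<bar>\<rceil>"
  define A where "A = (\<integral>k. norm (\<gamma> k) \<partial>lborel)"
  have A0: "A \<ge> 0" by (simp add: A_def)
  have iA: "integrable lborel (\<lambda>k. norm (\<gamma> k))" using \<gamma> schwartz_integrable by auto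
  obtain \<rho> where \<rho>: "\<rho> > 0" "\<And>k. norm k < \<rho> \<Longrightarrow> norm (?N k) < \<delta> / (2 * (A + 1))"
  proof -
    have "((\<lambda>k. ?N k) \<longlongrightarrow> 0) (at 0)" using T by (simp add: Cz_def)
    moreover have "\<delta> / (2 * (A + 1)) > 0" using \<delta> A0 by simp
    ultimately obtain \<rho> where "\<rho> > 0" and \<rho>: "\<forall>k. 0 < dist k 0 \<and> dist k 0 < \<rho> \<longrightarrow> dist (?N k) 0 < \<delta> / (2 * (A + 1))"
      unfolding Lim_at by blast
    have "?N 0 = 0" by (rule blinfun_eqI) (simp add: blinfun.diff_left shift_0)
    then have "norm (?N k) < \<delta> / (2 * (A + 1))" if "norm k < \<rho>" for k
      using \<rho>[rule_format, of k] that \<delta> A0 by (cases "k = 0") auto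
    then show thesis using \<open>\<rho> > 0\<close> that by blast
  qed
  define D where "D = 2 * norm T * 2 ^ M"
  have D0: "D \<ge> 0" by (simp add: D_def)
  define Q where "Q = (\<integral>k. (1 + norm k) ^ (2 * M + 1) * norm (\<gamma> k) \<partial>lborel)"
  have Q0: "Q \<ge> 0" by (simp add: Q_def)
  have iQ: "integrable lborel (\<lambda>k. (1 + norm k) ^ (2 * M + 1) * norm (\<gamma> k))" by (rule schwartz_integrable_power[OF \<gamma>])
  have crude: "norm (?N (\<epsilon> *\<^sub>R k)) \<le> D * (1 + norm k) ^ (2 * M)" if \<epsilon>: "0 \<le> \<epsilon>" "\<epsilon> \<le> 1" for \<epsilon> k
  proof -
    have b: "norm (shiftL r (\<epsilon> *\<^sub>R k) :: ('n, 'e) l2 \<Rightarrow>\<^sub>L ('n, 'e) l2) \<le> 2 ^ M * (1 + norm k) ^ (2 * M)" if "nat \<lceil>\<bar>r\<bar>\<rceil> \<le> M" for r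
    proof -
      have "norm (shiftL r (\<epsilon> *\<^sub>R k) :: ('n, 'e) l2 \<Rightarrow>\<^sub>L ('n, 'e) l2) \<le> 2 ^ nat \<lceil>\<bar>r\<bar>\<rceil> * (1 + norm k) ^ (2 * nat \<lceil>\<bar>r\<bar>\<rceil>)"
        by (rule order_trans[OF norm_shiftL shift_bound_poly[OF \<epsilon>]])
      also have "\<dots> \<le> 2 ^ M * (1 + norm k) ^ (2 * M)" using that by (intro mult_mono power_increasing) auto
      finally show ?thesis .
    qed
    have "norm (?N (\<epsilon> *\<^sub>R k)) \<le> norm (T o\<^sub>L shiftL s (\<epsilon> *\<^sub>R k)) + norm (shiftL t (\<epsilon> *\<^sub>R k) o\<^sub>L T)" by (rule norm_triangle_ineq4)
    also have "\<dots> \<le> norm T * (2 ^ M * (1 + norm k) ^ (2 * M)) + (2 ^ M * (1 + norm k) ^ (2 * M)) * norm T"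
      by (intro add_mono order_trans[OF norm_blinfun_compose] mult_mono b) (auto simp: M_def)
    also have "\<dots> = D * (1 + norm k) ^ (2 * M)" by (simp add: D_def)
    finally show ?thesis .
  qed
  \<comment> \<open>The part far from 0 contributes at most \<epsilon> D Q / \<rho>, which this
    choice keeps below \<delta>/4; the part near 0 contributes at most \<delta>/2. The bound 1 keeps
    the polynomial estimates uniform in \<epsilon>.\<close>
  define \<epsilon>0 where "\<epsilon>0 = min 1 (\<delta> * \<rho> / (4 * (D * Q + 1)))"
  have DQ: "D * Q \<ge> 0" using D0 Q0 by simp
  then have e0: "\<epsilon>0 > 0" using \<delta> \<rho> by (simp add: \<epsilon>0_def)
  have "norm ((T o\<^sub>L wave_op \<gamma> \<epsilon> s) - (wave_op \<gamma> \<epsilon> t o\<^sub>L T)) < \<delta>" if \<epsilon>: "0 < \<epsilon>" "\<epsilon> < \<epsilon>0" for \<epsilon>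
  proof -
    have \<epsilon>1: "0 \<le> \<epsilon>" "\<epsilon> \<le> 1" using \<epsilon> by (auto simp: \<epsilon>0_def)
    define B where "B k = \<delta> / (2 * (A + 1)) * norm (\<gamma> k) + (\<epsilon> / \<rho> * D) * ((1 + norm k) ^ (2 * M + 1) * norm (\<gamma> k))" for k
    have iB: "integrable lborel B" unfolding B_def by (intro Bochner_Integration.integrable_add integrable_mult_right iA iQ)
    have N: "norm (?N (\<epsilon> *\<^sub>R k)) \<le> \<delta> / (2 * (A + 1)) + (\<epsilon> / \<rho> * D) * (1 + norm k) ^ (2 * M + 1)" for k
    proof (cases "norm (\<epsilon> *\<^sub>R k) < \<rho>")
      case True
      have "0 \<le> (\<epsilon> / \<rho> * D) * (1 + norm k) ^ (2 * M + 1)" using \<epsilon>1 \<rho>(1) D0 by simp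
      then show ?thesis using \<rho>(2)[OF True] by linarith
    next
      case False
      then have "1 \<le> \<epsilon> / \<rho> * norm k" using \<epsilon>1 \<rho>(1) by (simp add: field_simps)
      also have "\<dots> \<le> \<epsilon> / \<rho> * (1 + norm k)" using \<epsilon>1 \<rho>(1) by (intro mult_left_mono) auto
      finally have "(D * (1 + norm k) ^ (2 * M)) * 1 \<le> (D * (1 + norm k) ^ (2 * M)) * (\<epsilon> / \<rho> * (1 + norm k))"
        using D0 by (intro mult_left_mono) auto
      then have "D * (1 + norm k) ^ (2 * M) \<le> (\<epsilon> / \<rho> * D) * (1 + norm k) ^ (2 * M + 1)" by (simp add: mult_ac)
      moreover have "0 \<le> \<delta> / (2 * (A + 1))" using \<delta> A0 by simp
      ultimately show ?thesis using crude[OF \<epsilon>1, of k] by linarith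
    qed
    have "norm (\<gamma> k) * norm (?N (\<epsilon> *\<^sub>R k)) \<le> B k" for k
      using mult_left_mono[OF N[of k], of "norm (\<gamma> k)"] by (simp add: B_def algebra_simps)
    then have "norm ((T o\<^sub>L wave_op \<gamma> \<epsilon> s) - (wave_op \<gamma> \<epsilon> t o\<^sub>L T)) \<le> (\<integral>k. B k \<partial>lborel)"
      using T by (intro wave_op_commutator_bound[OF \<gamma> \<epsilon>1 _ iB]) (auto simp: Cz_def)
    also have "\<dots> = \<delta> / (2 * (A + 1)) * A + (\<epsilon> / \<rho> * D) * Q"
    proof -
      have i1: "integrable lborel (\<lambda>k. \<delta> / (2 * (A + 1)) * norm (\<gamma> k))" by (rule integrable_mult_right[OF iA])
      have i2: "integrable lborel (\<lambda>k. (\<epsilon> / \<rho> * D) * ((1 + norm k) ^ (2 * M + 1) * norm (\<gamma> k)))" by (rule integrable_mult_right[OF iQ])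
      show ?thesis unfolding B_def Bochner_Integration.integral_add[OF i1 i2] integral_mult_right_zero
        by (simp only: A_def Q_def)
    qed
    also have "\<dots> < \<delta>"
    proof -
      have "\<delta> / (2 * (A + 1)) * A \<le> \<delta> / 2" using \<delta> A0 by (simp add: field_simps)
      moreover have "(\<epsilon> / \<rho> * D) * Q \<le> \<delta> / 4"
      proof -
        have "\<epsilon> * (4 * (D * Q + 1)) \<le> \<delta> * \<rho>" using \<epsilon> DQ by (simp add: \<epsilon>0_def less_divide_eq less_imp_le)
        then have "4 * (\<epsilon> * (D * Q)) \<le> \<delta> * \<rho>" using \<epsilon>(1) by (simp add: algebra_simps)
        then show ?thesis using \<rho>(1) by (simp add: field_simps)
      qed
      ultimately show ?thesis using \<delta> by linarith
    qed
    finally show ?thesis .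
  qed
  with e0 show ?thesis by blast
qed

section \<open>Compactness\<close>

lemma exp_i_lipschitz: "norm (exp (- \<i> * complex_of_real s) - exp (- \<i> * complex_of_real t)) \<le> \<bar>s - t\<bar>"
proof -
  have "exp (- \<i> * complex_of_real s) - exp (- \<i> * complex_of_real t)
      = exp (- \<i> * complex_of_real t) * (exp (\<i> * complex_of_real (t - s)) - 1)"
    by (simp add: right_diff_distrib flip: exp_add)
  then have "norm (exp (- \<i> * complex_of_real s) - exp (- \<i> * complex_of_real t)) = norm (exp (\<i> * complex_of_real (t - s)) - 1)"
    by (simp add: norm_mult)
  also have "\<dots> \<le> \<bar>t - s\<bar>" using iexp_approx1[of "t - s" 0] by simp
  finally show ?thesis by simp
qed

text \<open>\<gamma> is the Fourier transform of a Schwartz function, and integrating the Lipschitz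
  bound for exponentials against that function gives the constant.\<close>

lemma schwartz_lipschitz:
  fixes \<gamma> :: "real^'n \<Rightarrow> complex"
  assumes "\<gamma> \<in> schwartz"
  obtains L where "L \<ge> 0" "\<And>x y. norm (\<gamma> x - \<gamma> y) \<le> L * norm (x - y)"
proof -
  define \<psi> where "\<psi> = ifourier \<gamma>"
  have \<psi>: "\<psi> \<in> schwartz" and \<gamma>: "\<gamma> = fourier \<psi>"
    using assms by (auto simp: \<psi>_def ifourier_schwartz fourier_ifourier)
  define c where "c = fconst TYPE('n)"
  have c: "c \<ge> 0" using fconst_pos less_imp_le by (auto simp: c_def)
  have i: "integrable lborel (\<lambda>x. (1 + norm x) ^ 1 * norm (\<psi> x))" by (rule schwartz_integrable_power[OF \<psi>])
  have fi: "integrable lborel (\<lambda>t. exp (- \<i> * complex_of_real (t \<bullet> x)) * \<psi> t)" for x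
    by (rule fourier_integrable[OF schwartz_integrable[OF \<psi>]])
  define A where "A = (\<integral>t. (1 + norm t) ^ 1 * norm (\<psi> t) \<partial>lborel)"
  have "norm (\<gamma> x - \<gamma> y) \<le> (c * A) * norm (x - y)" for x y
  proof -
    let ?d = "\<lambda>t. exp (- \<i> * complex_of_real (t \<bullet> x)) * \<psi> t - exp (- \<i> * complex_of_real (t \<bullet> y)) * \<psi> t"
    have "\<gamma> x - \<gamma> y = complex_of_real c * (\<integral>t. ?d t \<partial>lborel)"
      by (simp only: \<gamma> fourier_eq c_def Bochner_Integration.integral_diff[OF fi fi] right_diff_distrib)
    then have "norm (\<gamma> x - \<gamma> y) = c * norm (\<integral>t. ?d t \<partial>lborel)" using c by (simp add: norm_mult)
    moreover have "norm (\<integral>t. ?d t \<partial>lborel) \<le> norm (x - y) * A"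
    proof -
    have "norm (\<integral>t. ?d t \<partial>lborel) \<le> (\<integral>t. norm (?d t) \<partial>lborel)" by (rule integral_norm_bound)
    also have "\<dots> \<le> (\<integral>t. norm (x - y) * ((1 + norm t) ^ 1 * norm (\<psi> t)) \<partial>lborel)"
    proof (intro Bochner_Integration.integral_mono integrable_mult_right[OF i] integrable_norm Bochner_Integration.integrable_diff fi)
      fix t
      have "norm (?d t) = norm (exp (- \<i> * complex_of_real (t \<bullet> x)) - exp (- \<i> * complex_of_real (t \<bullet> y))) * norm (\<psi> t)"
        by (simp only: left_diff_distrib[symmetric] norm_mult)
      also have "\<dots> \<le> \<bar>t \<bullet> x - t \<bullet> y\<bar> * norm (\<psi> t)" by (intro mult_right_mono exp_i_lipschitz) simp
      also have "\<bar>t \<bullet> x - t \<bullet> y\<bar> \<le> norm t * norm (x - y)"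
        using Cauchy_Schwarz_ineq2[of t "x - y"] by (simp add: inner_diff_right)
      also have "\<dots> \<le> (1 + norm t) * norm (x - y)" by (intro mult_right_mono) auto
      finally show "norm (?d t) \<le> norm (x - y) * ((1 + norm t) ^ 1 * norm (\<psi> t))"
        by (simp add: mult_ac mult_left_mono mult_right_mono)
    qed
    also have "\<dots> = norm (x - y) * A" by (simp only: A_def integral_mult_right_zero)
    finally show ?thesis .
    qed
    ultimately show ?thesis using mult_left_mono[OF _ c] by (simp only: mult.assoc mult.commute[of A])
  qed
  moreover have "c * A \<ge> 0" using c by (simp add: A_def)
  ultimately show ?thesis using that by blast
qed

text \<open>On the frequency side the operator \<open>wave_op \<gamma> 1 0\<close> is this
  convolution. It picks a representative defined at every point, to which a pointwise compactness
  theorem can be applied.\<close>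

definition convol :: "(real^'n \<Rightarrow> complex) \<Rightarrow> ('n::finite, 'e::fin_dim_hilbert) l2 \<Rightarrow> real^'n \<Rightarrow> 'e" where
  "convol \<gamma> h \<xi> = (\<integral>\<eta>. \<gamma> (\<xi> - \<eta>) *\<^sub>C rep h \<eta> \<partial>lborel)"

lemma rep_sq_integrable: "integrable lborel (\<lambda>\<eta>. (norm (rep h \<eta>))\<^sup>2)"
  using rep_sqi[of h] by (simp add: sqi_def)

lemma mult_le_square_sum: "a * b \<le> a\<^sup>2 / l + l * b\<^sup>2" if "l > 0" for a b l :: real
proof -
  have "0 \<le> (a - l * b)\<^sup>2 / l + a\<^sup>2 / l + l * b\<^sup>2" using that by simp
  also have "\<dots> = 2 * (a\<^sup>2 / l + l * b\<^sup>2 - a * b)" using that by (simp add: power2_eq_square field_simps)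
  finally show ?thesis by simp
qed

lemma sqi_bounded_support:
  fixes f :: "real^'n \<Rightarrow> 'e::fin_dim_hilbert"
  assumes f: "f \<in> borel_measurable borel" and M: "0 \<le> M"
    and le: "\<And>\<xi>. norm (f \<xi>) \<le> M * indicator (cball 0 R) \<xi>"
  shows "sqi f" and "(norm (mk f))\<^sup>2 \<le> M\<^sup>2 * measure lborel (cball (0::real^'n) R)"
proof -
  have ib: "integrable lborel (indicator (cball (0::real^'n) R) :: _ \<Rightarrow> real)"
    by (intro integrable_real_indicator emeasure_bounded_finite) auto
  then have i: "integrable lborel (\<lambda>\<xi>. M\<^sup>2 * indicator (cball (0::real^'n) R) \<xi> :: real)" by (rule integrable_mult_right)
  have le2: "(norm (f \<xi>))\<^sup>2 \<le> M\<^sup>2 * indicator (cball 0 R) \<xi>" for \<xi>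
  proof -
    have "(norm (f \<xi>))\<^sup>2 \<le> (M * indicator (cball 0 R) \<xi>)\<^sup>2" by (intro power_mono le) simp
    then show ?thesis by (cases "norm \<xi> \<le> R") simp_all
  qed
  have int: "integrable lborel (\<lambda>\<xi>. (norm (f \<xi>))\<^sup>2)"
    by (rule Bochner_Integration.integrable_bound[OF i]) (use f le2 in \<open>auto simp: abs_mult\<close>)
  then show s: "sqi f" using f by (simp add: sqi_def)
  have "(norm (mk f))\<^sup>2 \<le> (\<integral>\<xi>. M\<^sup>2 * indicator (cball (0::real^'n) R) \<xi> \<partial>lborel)"
    unfolding norm_l2_mk[OF s] by (rule Bochner_Integration.integral_mono[OF int i le2])
  then show "(norm (mk f))\<^sup>2 \<le> M\<^sup>2 * measure lborel (cball (0::real^'n) R)" by simp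
qed

context
  fixes \<gamma> :: "real^'n \<Rightarrow> complex"
  assumes \<gamma>: "\<gamma> \<in> schwartz"
begin

lemma reflected_integrable:
  assumes "integrable lborel (\<lambda>x. F (\<gamma> x))" shows "integrable lborel (\<lambda>\<eta>. F (\<gamma> (\<xi> - \<eta>)) :: real)"
  using lborel_integrable_shift[OF assms, of "-1" \<xi>] by simp

lemma reflected_integral:
  assumes "integrable lborel (\<lambda>x. F (\<gamma> x))"
  shows "(\<integral>\<eta>. F (\<gamma> (\<xi> - \<eta>)) \<partial>lborel) = (\<integral>x. F (\<gamma> x) \<partial>lborel :: real)"
  using lborel_integral_shift[of "\<lambda>x. F (\<gamma> x)" "-1" \<xi>] assms by (simp add: integrable_iff_bounded)

lemma gamma_measurable [measurable]: "\<gamma> \<in> borel_measurable borel"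
  using \<gamma> by (rule schwartz_measurable)

lemma convol_norm_le: "norm (\<gamma> (\<xi> - \<eta>) *\<^sub>C rep h \<eta>) \<le> (norm (\<gamma> (\<xi> - \<eta>)))\<^sup>2 + (norm (rep h \<eta>))\<^sup>2"
  using mult_le_square_sum[of 1 "norm (\<gamma> (\<xi> - \<eta>))" "norm (rep h \<eta>)"] by (simp add: norm_scaleC)

lemma convol_dominating_integrable:
  "integrable lborel (\<lambda>\<eta>. (norm (\<gamma> (\<xi> - \<eta>)))\<^sup>2 + (norm (rep h \<eta>))\<^sup>2)"
  by (rule Bochner_Integration.integrable_add[OF reflected_integrable[OF schwartz_sq_integrable[OF \<gamma>]] rep_sq_integrable])

lemma convol_integrable: "integrable lborel (\<lambda>\<eta>. \<gamma> (\<xi> - \<eta>) *\<^sub>C rep h \<eta>)"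
proof (rule Bochner_Integration.integrable_bound[OF convol_dominating_integrable])
  show "AE \<eta> in lborel. norm (\<gamma> (\<xi> - \<eta>) *\<^sub>C rep h \<eta>) \<le> norm ((norm (\<gamma> (\<xi> - \<eta>)))\<^sup>2 + (norm (rep h \<eta>))\<^sup>2)"
    by (intro AE_I2 order_trans[OF convol_norm_le]) simp
qed measurable

lemma convol_bound:
  assumes "norm h \<le> 1"
  shows "norm (convol \<gamma> h \<xi>) \<le> (\<integral>x. (norm (\<gamma> x))\<^sup>2 \<partial>lborel) + 1"
proof -
  have "norm (convol \<gamma> h \<xi>) \<le> (\<integral>\<eta>. norm (\<gamma> (\<xi> - \<eta>) *\<^sub>C rep h \<eta>) \<partial>lborel)"
    unfolding convol_def by (rule integral_norm_bound)
  also have "\<dots> \<le> (\<integral>\<eta>. (norm (\<gamma> (\<xi> - \<eta>)))\<^sup>2 + (norm (rep h \<eta>))\<^sup>2 \<partial>lborel)"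
    by (intro Bochner_Integration.integral_mono integrable_norm convol_integrable convol_dominating_integrable convol_norm_le)
  also have "\<dots> = (\<integral>x. (norm (\<gamma> x))\<^sup>2 \<partial>lborel) + (norm h)\<^sup>2"
    unfolding norm_l2_rep reflected_integral[OF schwartz_sq_integrable[OF \<gamma>], of \<xi>, symmetric]
    by (rule Bochner_Integration.integral_add[OF reflected_integrable[OF schwartz_sq_integrable[OF \<gamma>]] rep_sq_integrable])
  also have "(norm h)\<^sup>2 \<le> 1" using assms by (simp add: power_le_one)
  finally show ?thesis by simp
qed

text \<open>The squared difference of the translates of \<gamma> is bounded by its Lipschitz
  estimate times the sum of their norms, which is integrable. The parameter l balances this against
  the norm of h and is set to half the tolerance later.\<close>

lemma convol_equicontinuous:
  assumes h: "norm h \<le> 1" and l: "l > 0" and L: "\<And>x y. norm (\<gamma> x - \<gamma> y) \<le> L * norm (x - y)"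
  shows "norm (convol \<gamma> h \<xi> - convol \<gamma> h \<zeta>) \<le> L * norm (\<xi> - \<zeta>) / l * (2 * (\<integral>x. norm (\<gamma> x) \<partial>lborel)) + l"
proof -
  have ig: "integrable lborel (\<lambda>x. norm (\<gamma> x))" using schwartz_integrable[OF \<gamma>] by simp
  note rg = reflected_integrable[OF ig]
  let ?c = "L * norm (\<xi> - \<zeta>) / l"
  let ?D = "\<lambda>\<eta>. ?c * (norm (\<gamma> (\<xi> - \<eta>)) + norm (\<gamma> (\<zeta> - \<eta>))) + l * (norm (rep h \<eta>))\<^sup>2"
  have i1: "integrable lborel (\<lambda>\<eta>. norm (\<gamma> (\<xi> - \<eta>)) + norm (\<gamma> (\<zeta> - \<eta>)))"
    by (rule Bochner_Integration.integrable_add[OF rg rg])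
  note i2 = integrable_mult_right[OF i1, of ?c] and i3 = integrable_mult_right[OF rep_sq_integrable, of l h]
  have le: "norm (\<gamma> (\<xi> - \<eta>) *\<^sub>C rep h \<eta> - \<gamma> (\<zeta> - \<eta>) *\<^sub>C rep h \<eta>) \<le> ?D \<eta>" for \<eta>
  proof -
    let ?a = "norm (\<gamma> (\<xi> - \<eta>) - \<gamma> (\<zeta> - \<eta>))"
    have "norm (\<gamma> (\<xi> - \<eta>) *\<^sub>C rep h \<eta> - \<gamma> (\<zeta> - \<eta>) *\<^sub>C rep h \<eta>) = ?a * norm (rep h \<eta>)"
      by (simp only: scaleC.diff_left[symmetric] norm_scaleC)
    also have "\<dots> \<le> ?a\<^sup>2 / l + l * (norm (rep h \<eta>))\<^sup>2" by (rule mult_le_square_sum[OF l])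
    also have "?a\<^sup>2 \<le> (L * norm (\<xi> - \<zeta>)) * (norm (\<gamma> (\<xi> - \<eta>)) + norm (\<gamma> (\<zeta> - \<eta>)))"
      unfolding power2_eq_square using L[of "\<xi> - \<eta>" "\<zeta> - \<eta>"] norm_triangle_ineq4[of "\<gamma> (\<xi> - \<eta>)" "\<gamma> (\<zeta> - \<eta>)"]
      by (intro mult_mono) (auto intro: order_trans[OF norm_ge_zero])
    finally show ?thesis using l by (simp add: divide_right_mono)
  qed
  have "convol \<gamma> h \<xi> - convol \<gamma> h \<zeta> = (\<integral>\<eta>. \<gamma> (\<xi> - \<eta>) *\<^sub>C rep h \<eta> - \<gamma> (\<zeta> - \<eta>) *\<^sub>C rep h \<eta> \<partial>lborel)"
    unfolding convol_def by (rule Bochner_Integration.integral_diff[symmetric, OF convol_integrable convol_integrable])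
  also have "norm \<dots> \<le> (\<integral>\<eta>. norm (\<gamma> (\<xi> - \<eta>) *\<^sub>C rep h \<eta> - \<gamma> (\<zeta> - \<eta>) *\<^sub>C rep h \<eta>) \<partial>lborel)"
    by (rule integral_norm_bound)
  also have "\<dots> \<le> (\<integral>\<eta>. ?D \<eta> \<partial>lborel)"
    by (intro Bochner_Integration.integral_mono integrable_norm Bochner_Integration.integrable_diff convol_integrable le
        Bochner_Integration.integrable_add[OF i2 i3])
  also have "\<dots> = ?c * (2 * (\<integral>x. norm (\<gamma> x) \<partial>lborel)) + l * (norm h)\<^sup>2"
    by (simp only: Bochner_Integration.integral_add[OF i2 i3] integral_mult_right_zero Bochner_Integration.integral_add[OF rg rg]
        reflected_integral[OF ig] norm_l2_rep mult_2)
  also have "l * (norm h)\<^sup>2 \<le> l * 1" using h l by (intro mult_left_mono) (auto simp: power_le_one)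
  finally show ?thesis by simp
qed

lemma convol_measurable [measurable]: "convol \<gamma> h \<in> borel_measurable borel"
  unfolding convol_def[abs_def] by measurable

lemma inner_wave_convol:
  fixes y h :: "('n, 'e::fin_dim_hilbert) l2"
  shows "inner y (wave_op \<gamma> 1 0 h) = (\<integral>\<xi>. inner (rep y \<xi>) (convol \<gamma> h \<xi>) \<partial>lborel)"
proof -
  let ?F = "\<lambda>k \<xi>. inner (rep y \<xi>) (\<gamma> k *\<^sub>C rep h (\<xi> - k))"
  have one: "(jb \<xi> / jb (\<xi> - k)) powr (0 / 2) = 1" for \<xi> k :: "real^'n" by (simp add: jb_neq_0)
  have eq: "inner y (csc (\<gamma> k) (shift 0 (1 *\<^sub>R k) h)) = (\<integral>\<xi>. ?F k \<xi> \<partial>lborel)" for k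
    using inner_wave[OF \<gamma>, of 1 y k 0 h] by (simp only: one) simp
  let ?B = "\<lambda>k \<xi>. norm (\<gamma> k) * ((norm (rep y \<xi>))\<^sup>2 + (norm (rep h (\<xi> - k)))\<^sup>2)"
  have ih: "integrable lborel (\<lambda>\<xi>. (norm (rep h (\<xi> - k)))\<^sup>2)" for k
    using lborel_integrable_shift[OF rep_sq_integrable[of h], of 1 "- k"] by simp
  note ib = integrable_mult_right[OF Bochner_Integration.integrable_add[OF rep_sq_integrable ih]]
  have Ib: "(\<integral>\<xi>. ?B k \<xi> \<partial>lborel) = norm (\<gamma> k) * ((norm y)\<^sup>2 + (norm h)\<^sup>2)" for k
    using lborel_integral_shift[of "\<lambda>\<xi>. (norm (rep h \<xi>))\<^sup>2" 1 "- k"]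
    by (simp add: Bochner_Integration.integral_add[OF rep_sq_integrable ih] norm_l2_rep)
  have nB: "norm (?B k \<xi>) = ?B k \<xi>" for k \<xi> by (simp add: abs_mult)
  have iB: "integrable (lborel \<Otimes>\<^sub>M lborel) (\<lambda>(k, \<xi>). ?B k \<xi>)"
  proof (rule lborel_pair.Fubini_integrable)
    have "integrable lborel (\<lambda>k. norm (\<gamma> k) * ((norm y)\<^sup>2 + (norm h)\<^sup>2))" using schwartz_integrable[OF \<gamma>] by simp
    then show "integrable lborel (\<lambda>k. \<integral>\<xi>. norm (case (k, \<xi>) of (k, \<xi>) \<Rightarrow> ?B k \<xi>) \<partial>lborel)"
      by (simp only: prod.case nB Ib)
  qed (use ib in \<open>auto simp: case_prod_beta\<close>)
  have iF: "integrable (lborel \<Otimes>\<^sub>M lborel) (\<lambda>(k, \<xi>). ?F k \<xi>)"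
  proof (rule Bochner_Integration.integrable_bound[OF iB])
    have "norm (?F k \<xi>) \<le> norm (?B k \<xi>)" for k \<xi>
    proof -
      have "norm (?F k \<xi>) \<le> norm (rep y \<xi>) * norm (\<gamma> k *\<^sub>C rep h (\<xi> - k))" using Cauchy_Schwarz_ineq2 by simp
      also have "\<dots> = norm (\<gamma> k) * (norm (rep y \<xi>) * norm (rep h (\<xi> - k)))" by (simp add: norm_scaleC mult_ac)
      also have "\<dots> \<le> ?B k \<xi>"
        using mult_le_square_sum[of 1 "norm (rep y \<xi>)" "norm (rep h (\<xi> - k))"] by (intro mult_left_mono) auto
      finally show ?thesis by (simp add: abs_mult)
    qed
    then show "AE p in lborel \<Otimes>\<^sub>M lborel. norm (case p of (k, \<xi>) \<Rightarrow> ?F k \<xi>) \<le> norm (case p of (k, \<xi>) \<Rightarrow> ?B k \<xi>)"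
      by (intro AE_I2) (simp add: case_prod_beta)
  qed measurable
  have c: "integrable lborel (\<lambda>k. \<gamma> k *\<^sub>C rep h (\<xi> - k))" "(\<integral>k. \<gamma> k *\<^sub>C rep h (\<xi> - k) \<partial>lborel) = convol \<gamma> h \<xi>" for \<xi>
    using lborel_integrable_shift[OF convol_integrable[of \<xi> h], of "-1" \<xi>] lborel_integral_shift[of "\<lambda>\<eta>. \<gamma> (\<xi> - \<eta>) *\<^sub>C rep h \<eta>" "-1" \<xi>]
    by (simp_all add: convol_def)
  have "inner y (wave_op \<gamma> 1 0 h) = (\<integral>k. \<integral>\<xi>. ?F k \<xi> \<partial>lborel \<partial>lborel)"
    using inner_wave_op[OF \<gamma>, of 1 y 0 h] by (simp only: eq)
  also have "\<dots> = (\<integral>\<xi>. \<integral>k. ?F k \<xi> \<partial>lborel \<partial>lborel)" by (rule lborel_pair.Fubini_integral[symmetric, OF iF])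
  also have "\<dots> = (\<integral>\<xi>. inner (rep y \<xi>) (convol \<gamma> h \<xi>) \<partial>lborel)"
  proof -
    have "(\<integral>k. ?F k \<xi> \<partial>lborel) = inner (rep y \<xi>) (convol \<gamma> h \<xi>)" for \<xi>
      using integral_inner_right[OF c(1), of "rep y \<xi>" \<xi>] by (simp add: c(2))
    then show ?thesis by simp
  qed
  finally show ?thesis .
qed

context
  fixes p :: "real^'n \<Rightarrow> complex" and R :: real
  assumes pm [measurable]: "p \<in> borel_measurable borel" and p: "\<And>\<xi>. norm (p \<xi>) \<le> indicator (cball 0 R) \<xi>"
begin

lemma p_le_1: "norm (p \<xi>) \<le> 1"
  by (rule order_trans[OF p]) (simp add: indicator_def)

lemma mul_bounded_support:
  fixes f :: "real^'n \<Rightarrow> 'e::fin_dim_hilbert"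
  assumes "0 \<le> M" "\<And>\<xi>. \<xi> \<in> cball 0 R \<Longrightarrow> norm (f \<xi>) \<le> M"
  shows "norm (p \<xi> *\<^sub>C f \<xi>) \<le> M * indicator (cball 0 R) \<xi>"
proof -
  have "norm (p \<xi> *\<^sub>C f \<xi>) \<le> indicator (cball 0 R) \<xi> * norm (f \<xi>)"
    unfolding norm_scaleC by (intro mult_right_mono p) simp
  also have "\<dots> \<le> M * indicator (cball 0 R) \<xi>" using assms by (auto simp: indicator_def)
  finally show ?thesis .
qed

text \<open>The weak integral is known only through inner products, so the multiplier is moved onto
  the test vector as its conjugate before the convolution can be recognized.\<close>

lemma mul_wave_convol:
  fixes h :: "('n, 'e::fin_dim_hilbert) l2"
  assumes h: "norm h \<le> 1"
  shows "sqi (\<lambda>\<xi>. p \<xi> *\<^sub>C convol \<gamma> h \<xi>)"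
    and "mulop p (wave_op \<gamma> 1 0 h) = mk (\<lambda>\<xi>. p \<xi> *\<^sub>C convol \<gamma> h \<xi>)"
proof -
  let ?q = "\<lambda>\<xi>. p \<xi> *\<^sub>C convol \<gamma> h \<xi>"
  show s: "sqi ?q"
  proof (rule sqi_bounded_support(1))
    show "0 \<le> (\<integral>x. (norm (\<gamma> x))\<^sup>2 \<partial>lborel) + 1" by (simp add: add_nonneg_nonneg)
    then show "norm (?q \<xi>) \<le> ((\<integral>x. (norm (\<gamma> x))\<^sup>2 \<partial>lborel) + 1) * indicator (cball 0 R) \<xi>" for \<xi>
      by (rule mul_bounded_support) (rule convol_bound[OF h])
  qed measurable
  show "mulop p (wave_op \<gamma> 1 0 h) = mk ?q"
  proof (rule vector_eq_ldot[THEN iffD1], rule allI)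
    fix y :: "('n, 'e) l2"
    let ?p = "\<lambda>\<xi>. cnj (p \<xi>)" and ?G = "wave_op \<gamma> 1 0 h"
    have y: "AE \<xi> in lborel. rep (mulop ?p y) \<xi> = ?p \<xi> *\<^sub>C rep y \<xi>"
      by (rule rep_mulop[of _ 1]) (use p_le_1 in auto)
    have "inner y (mulop p ?G) = (\<integral>\<xi>. inner (rep y \<xi>) (p \<xi> *\<^sub>C rep ?G \<xi>) \<partial>lborel)"
      by (rule inner_l2_cong[OF _ rep_mulop[OF pm p_le_1]]) auto
    also have "\<dots> = (\<integral>\<xi>. inner (?p \<xi> *\<^sub>C rep y \<xi>) (rep ?G \<xi>) \<partial>lborel)" by (simp add: inner_scaleC_left)
    also have "\<dots> = inner (mulop ?p y) ?G" by (rule inner_l2_cong[symmetric, OF y]) auto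
    also have "\<dots> = (\<integral>\<xi>. inner (rep (mulop ?p y) \<xi>) (convol \<gamma> h \<xi>) \<partial>lborel)" by (rule inner_wave_convol)
    also have "\<dots> = (\<integral>\<xi>. inner (rep y \<xi>) (?q \<xi>) \<partial>lborel)"
      by (rule integral_cong_AE) (use y in \<open>auto elim!: eventually_mono simp: inner_scaleC_left\<close>)
    also have "\<dots> = inner y (mk ?q)" by (rule inner_l2_cong[symmetric, OF _ rep_mk[OF s]]) auto
    finally show "inner y (mulop p ?G) = inner y (mk ?q)" .
  qed
qed

text \<open>The convolutions with vectors of the unit ball are uniformly bounded and equicontinuous,
  so Arzela-Ascoli gives uniform convergence on the frequency ball along a subsequence. The ball has
  finite measure, so convergence in norm follows.\<close>

lemma compact_mul_wave:
  "compact_blinfun (mulL p o\<^sub>L (wave_op \<gamma> 1 0 :: ('n, 'e::fin_dim_hilbert) l2 \<Rightarrow>\<^sub>L ('n, 'e) l2))"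
proof (rule compact_blinfun_unit_ballI)
  fix f :: "nat \<Rightarrow> ('n, 'e) l2" assume f: "\<And>j. norm (f j) \<le> 1"
  obtain L where L: "L \<ge> 0" "\<And>x y. norm (\<gamma> x - \<gamma> y) \<le> L * norm (x - y)" using schwartz_lipschitz[OF \<gamma>] by blast
  define A where "A = (\<integral>x. norm (\<gamma> x) \<partial>lborel)"
  have A: "A \<ge> 0" by (simp add: A_def)
  have eqc: "\<exists>d. 0 < d \<and> (\<forall>n y. y \<in> cball 0 R \<and> norm (x - y) < d \<longrightarrow> norm (convol \<gamma> (f n) x - convol \<gamma> (f n) y) < e)"
    if e: "0 < e" for x e
  proof (intro exI[of _ "(e / 2) * (e / 2) / (L * (2 * A) + 1)"] conjI allI impI)
    have LA: "L * (2 * A) + 1 > 0" using L A by (intro add_nonneg_pos mult_nonneg_nonneg) auto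
    then show "0 < (e / 2) * (e / 2) / (L * (2 * A) + 1)" using e by simp
    fix n y assume y: "y \<in> cball 0 R \<and> norm (x - y) < (e / 2) * (e / 2) / (L * (2 * A) + 1)"
    \<comment> \<open>With l = e/2 the estimate is a sum of two terms, and the chosen radius makes
      the first of them smaller than e/2 as well.\<close>
    have "L * norm (x - y) / (e / 2) * (2 * A) = (norm (x - y) * (L * (2 * A))) / (e / 2)" by (simp add: mult_ac)
    also have "\<dots> \<le> (norm (x - y) * (L * (2 * A) + 1)) / (e / 2)" using e by (intro divide_right_mono mult_left_mono) auto
    also have "\<dots> < (e / 2 * (e / 2)) / (e / 2)" 
    proof (rule divide_strict_right_mono)
      show "norm (x - y) * (L * (2 * A) + 1) < e / 2 * (e / 2)" using y LA by (simp only: pos_less_divide_eq)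
    qed (use e in simp)
    finally have "L * norm (x - y) / (e / 2) * (2 * A) + e / 2 < e" using e by simp
    then show "norm (convol \<gamma> (f n) x - convol \<gamma> (f n) y) < e"
      using convol_equicontinuous[OF f[of n] _ L(2), of "e / 2" x y] e unfolding A_def by linarith
  qed
  obtain g r where r: "strict_mono (r :: nat \<Rightarrow> nat)"
    and g: "\<And>e. 0 < e \<Longrightarrow> \<exists>N. \<forall>n x. n \<ge> N \<and> x \<in> cball 0 R \<longrightarrow> norm (convol \<gamma> (f (r n)) x - g x) < e"
    using Arzela_Ascoli[of "cball 0 R" "\<lambda>n. convol \<gamma> (f n)", OF compact_cball convol_bound[OF f] eqc] by metis
  let ?q = "\<lambda>n \<xi>. p \<xi> *\<^sub>C convol \<gamma> (f (r n)) \<xi>"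
  let ?v = "measure lborel (cball (0::real^'n) R)"
  have "Cauchy (\<lambda>n. mk (?q n))"
  proof (rule CauchyI)
    fix e :: real assume e: "0 < e"
    \<comment> \<open>Functions at most 2 d in size on the ball of volume v have squared norm at
      most 4 d^2 v, and v < (v + 1)^2 makes this less than e^2.\<close>
    define d where "d = e / (2 * (?v + 1))"
    have v: "?v \<ge> 0" by simp
    have d: "d > 0" using e v by (simp add: d_def add_nonneg_pos)
    obtain N where N: "\<And>n x. n \<ge> N \<Longrightarrow> x \<in> cball 0 R \<Longrightarrow> norm (convol \<gamma> (f (r n)) x - g x) < d" using g[OF d] by blast
    have "norm (mk (?q i) - mk (?q j)) < e" if ij: "i \<ge> N" "j \<ge> N" for i j
    proof -
      have le: "norm (convol \<gamma> (f (r i)) \<xi> - convol \<gamma> (f (r j)) \<xi>) \<le> 2 * d" if "\<xi> \<in> cball 0 R" for \<xi>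
        using norm_triangle_ineq4[of "convol \<gamma> (f (r i)) \<xi> - g \<xi>" "convol \<gamma> (f (r j)) \<xi> - g \<xi>"] N[OF ij(1) that] N[OF ij(2) that] by simp
      have "mk (?q i) - mk (?q j) = mk (\<lambda>\<xi>. p \<xi> *\<^sub>C (convol \<gamma> (f (r i)) \<xi> - convol \<gamma> (f (r j)) \<xi>))"
        unfolding scaleC.diff_right by (rule mk_diff[symmetric, OF mul_wave_convol(1)[OF f] mul_wave_convol(1)[OF f]])
      then have "(norm (mk (?q i) - mk (?q j)))\<^sup>2 \<le> (2 * d)\<^sup>2 * ?v"
        using d le by (simp only:) (intro sqi_bounded_support(2) mul_bounded_support, auto)
      also have "\<dots> < e\<^sup>2"
      proof -
        have "(?v + 1)\<^sup>2 = ?v + (?v * ?v + ?v + 1)" by (simp add: power2_eq_square algebra_simps)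
        then have "?v < (?v + 1)\<^sup>2" using v zero_le_square[of ?v] by linarith
        then have "(2 * d)\<^sup>2 * ?v < (2 * d)\<^sup>2 * (?v + 1)\<^sup>2" using d by (intro mult_strict_left_mono) auto
        also have "\<dots> = (d * (2 * (?v + 1)))\<^sup>2" by (simp only: power_mult_distrib mult_ac)
        also have "d * (2 * (?v + 1)) = e"
        proof -
          have "0 < 2 * (?v + 1)" by (intro mult_pos_pos add_nonneg_pos v) auto
          note nz = less_imp_neq[OF this, symmetric]
          show ?thesis unfolding nonzero_eq_divide_eq[OF nz, symmetric] d_def by (rule refl)
        qed
        finally show ?thesis .
      qed
      finally show ?thesis by (rule power_less_imp_less_base) (use e in simp)
    qed
    then show "\<exists>M. \<forall>m\<ge>M. \<forall>n\<ge>M. norm (mk (?q m) - mk (?q n)) < e" by blast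
  qed
  moreover have "(mulL p o\<^sub>L wave_op \<gamma> 1 0) (f (r j)) = mk (?q j)" for j
    by (simp add: mulL_apply[OF pm p_le_1] mul_wave_convol(2)[OF f])
  ultimately show "\<exists>r::nat \<Rightarrow> nat. strict_mono r \<and> convergent (\<lambda>j. (mulL p o\<^sub>L (wave_op \<gamma> 1 0 :: ('n, 'e) l2 \<Rightarrow>\<^sub>L ('n, 'e) l2)) (f (r j)))"
    using r by (intro exI[of _ r] conjI) (auto dest: Cauchy_convergent)
qed

end

text \<open>A Rellich type statement: beyond a large frequency radius \<open>emb d\<close> is
  uniformly small since d > 0, so the operator is a norm limit of its low frequency truncations,
  which are compact.\<close>

lemma compact_emb_wave:
  assumes "d > 0"
  shows "compact_blinfun (mulL (emb d) o\<^sub>L (wave_op \<gamma> 1 0 :: ('n, 'e::fin_dim_hilbert) l2 \<Rightarrow>\<^sub>L ('n, 'e) l2))"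
proof (rule compact_blinfun_limit)
  fix e :: real assume e: "e > 0"
  let ?G = "wave_op \<gamma> 1 0 :: ('n, 'e) l2 \<Rightarrow>\<^sub>L ('n, 'e) l2"
  define c where "c = e / (norm ?G + 1)"
  have c: "c > 0" using e by (simp add: c_def add_nonneg_pos)
  have "((\<lambda>R::real. (1 + R\<^sup>2) powr (- d / 2)) \<longlongrightarrow> 0) at_top" using assms by real_asymp
  then have "eventually (\<lambda>R::real. (1 + R\<^sup>2) powr (- d / 2) < c) at_top" by (rule order_tendstoD(2)[OF _ c])
  then obtain R where R: "R \<ge> 0" "(1 + R\<^sup>2) powr (- d / 2) < c"
    using eventually_conj[OF eventually_ge_at_top[of 0]] eventually_happens'[OF trivial_limit_at_top_linorder] by blast
  define p where "p \<xi> = (if norm \<xi> \<le> R then emb d \<xi> else 0)" for \<xi> :: "real^'n"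
  define q where "q \<xi> = (if norm \<xi> \<le> R then 0 else emb d \<xi>)" for \<xi> :: "real^'n"
  have d: "d \<ge> 0" using assms by simp
  have pm: "p \<in> borel_measurable borel" and qm: "q \<in> borel_measurable borel"
    unfolding p_def[abs_def] q_def[abs_def] by measurable
  have ple: "norm (p \<xi>) \<le> indicator (cball 0 R) \<xi>" for \<xi> using emb_bound[OF d, of \<xi>] by (simp add: p_def indicator_def)
  have p1: "norm (p \<xi>) \<le> 1" for \<xi> using emb_bound[OF d, of \<xi>] by (simp add: p_def)
  have qc: "norm (q \<xi>) \<le> (1 + R\<^sup>2) powr (- d / 2)" for \<xi>
  proof (cases "norm \<xi> \<le> R")
    case False
    then have "1 + R\<^sup>2 \<le> jb \<xi>" using R(1) by (simp add: jb_def power_mono)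
    moreover have "0 < 1 + R\<^sup>2" by (simp add: add_pos_nonneg)
    ultimately have "jb \<xi> powr (- d / 2) \<le> (1 + R\<^sup>2) powr (- d / 2)" using d by (intro powr_mono2') auto
    then show ?thesis using False by (simp add: q_def emb_def)
  qed (simp add: q_def)
  have pq: "emb d \<xi> - p \<xi> = q \<xi>" for \<xi> by (simp add: p_def q_def)
  have "mulop (emb d) h - mulop p h = mulop q h" for h :: "('n, 'e) l2"
    by (rule l2_eqI)
      (use rep_mulop[OF emb_measurable emb_bound[OF d], of h] rep_mulop[OF pm p1, of h] rep_mulop[OF qm qc, of h] rep_diff[of "mulop (emb d) h" "mulop p h"] in
      \<open>eventually_elim, simp add: pq flip: scaleC.diff_left\<close>)
  then have "(mulL (emb d) o\<^sub>L ?G) - (mulL p o\<^sub>L ?G) = mulL q o\<^sub>L ?G"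
    by (intro blinfun_eqI) (simp add: blinfun.diff_left mulL_apply[OF emb_measurable emb_bound[OF d]] mulL_apply[OF pm p1] mulL_apply[OF qm qc])
  then have "norm ((mulL (emb d) o\<^sub>L ?G) - (mulL p o\<^sub>L ?G)) \<le> norm (mulL q :: ('n, 'e) l2 \<Rightarrow>\<^sub>L ('n, 'e) l2) * norm ?G"
    by (simp add: norm_blinfun_compose)
  also have "\<dots> \<le> (1 + R\<^sup>2) powr (- d / 2) * norm ?G" by (intro mult_right_mono norm_mulL_le[OF qm qc]) simp
  also have "\<dots> \<le> c * norm ?G" using R by (intro mult_right_mono) auto
  also have "\<dots> < c * (norm ?G + 1)" using c by simp
  also have "\<dots> = e" by (simp add: c_def add_nonneg_eq_0_iff)
  finally have "norm ((mulL (emb d) o\<^sub>L ?G) - (mulL p o\<^sub>L ?G)) < e" .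
  then show "\<exists>L. compact_blinfun L \<and> norm ((mulL (emb d) o\<^sub>L ?G) - L) < e"
    using compact_mul_wave[OF pm ple] by blast
qed

end

section \<open>Cut-offs in position as operators on the model\<close>

lemma plane_wave_superposition:
  fixes g :: "real^'n \<Rightarrow> complex"
  assumes "g \<in> schwartz"
  shows "g (\<epsilon> *\<^sub>R x) = (\<integral>k. (complex_of_real (fconst TYPE('n)) * fourier g k) * exp (\<i> * complex_of_real (x \<bullet> (\<epsilon> *\<^sub>R k))) \<partial>lborel)"
proof -
  have "g (\<epsilon> *\<^sub>R x) = fourier (fourier g) (- (\<epsilon> *\<^sub>R x))"
    using ifourier_fourier[OF assms] by (metis ifourier_def)
  also have "\<dots> = (\<integral>k. complex_of_real (fconst TYPE('n)) * (exp (- \<i> * complex_of_real (k \<bullet> (- (\<epsilon> *\<^sub>R x)))) * fourier g k) \<partial>lborel)"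
    unfolding fourier_eq[of "fourier g"] by simp
  finally show ?thesis by (simp add: inner_commute mult_ac)
qed

text \<open>By Fourier inversion, for Schwartz g and 0 < \<epsilon> \<le> 1, this is multiplication
  by g(\<epsilon> x) on the model of order s.\<close>

definition cut :: "(real^'n \<Rightarrow> complex) \<Rightarrow> real \<Rightarrow> real \<Rightarrow> ('n, 'e::fin_dim_hilbert) l2 \<Rightarrow>\<^sub>L ('n::finite, 'e) l2" where
  "cut g = wave_op (\<lambda>k. complex_of_real (fconst TYPE('n)) * fourier g k)"

context
  fixes g :: "real^'n \<Rightarrow> complex"
  assumes g: "g \<in> schwartz"
begin

lemma cut_symbol: "(\<lambda>k. complex_of_real (fconst TYPE('n)) * fourier g k) \<in> schwartz"
  by (intro schwartz_cmult fourier_schwartz g)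

lemma represents_cut:
  assumes "0 < \<epsilon>" "\<epsilon> \<le> 1"
  shows "represents s s (mult_op (\<lambda>x. g (\<epsilon> *\<^sub>R x))) (cut g \<epsilon> s)"
  unfolding cut_def
  by (rule represents_wave_op[OF cut_symbol _ _ plane_wave_superposition[OF g] schwartz_scale[OF _ g]]) (use assms in auto)

text \<open>Both sides represent the same multiplication as a map from order s to order s - d, and
  representatives are unique.\<close>

lemma cut_emb:
  assumes "0 < \<epsilon>" "\<epsilon> \<le> 1" "d \<ge> 0"
  shows "cut g \<epsilon> (s - d) o\<^sub>L mulL (emb d) = mulL (emb d) o\<^sub>L cut g \<epsilon> s"
  by (rule represents_unique[OF represents_compose[OF represents_emb represents_cut] represents_compose[OF represents_cut represents_emb]])
    (use assms in auto)

end

text \<open>The compactness argument by convolution was carried out at scale 1; absorbing \<epsilon>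
  into g makes it available at every scale.\<close>

lemma cut_scale:
  assumes "g \<in> schwartz" "0 < \<epsilon>" "\<epsilon> \<le> 1"
  shows "cut g \<epsilon> s = cut (\<lambda>x. g (\<epsilon> *\<^sub>R x)) 1 s"
proof (rule represents_unique[OF represents_cut[OF assms]])
  show "represents s s (mult_op (\<lambda>x. g (\<epsilon> *\<^sub>R x))) (cut (\<lambda>x. g (\<epsilon> *\<^sub>R x)) 1 s)"
    using represents_cut[OF schwartz_scale[OF _ assms(1)], of \<epsilon> 1 s] assms(2) by simp
qed

lemma compact_cut_emb:
  fixes g :: "real^'n \<Rightarrow> complex"
  assumes g: "g \<in> schwartz" and "0 < \<epsilon>" "\<epsilon> \<le> 1" "d > 0"
  shows "compact_blinfun (cut g \<epsilon> (- d) o\<^sub>L (mulL (emb d) :: ('n, 'e::fin_dim_hilbert) l2 \<Rightarrow>\<^sub>L ('n, 'e) l2))"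
proof -
  let ?E = "mulL (emb d) :: ('n, 'e) l2 \<Rightarrow>\<^sub>L ('n, 'e) l2"
  have "cut g \<epsilon> (- d) o\<^sub>L ?E = ?E o\<^sub>L cut g \<epsilon> 0" using cut_emb[OF g, of \<epsilon> d 0] assms by simp
  also have "\<dots> = ?E o\<^sub>L cut (\<lambda>x. g (\<epsilon> *\<^sub>R x)) 1 0" by (subst cut_scale[OF assms(1-3)]) (rule refl)
  also have "compact_blinfun \<dots>"
    unfolding cut_def using assms by (intro compact_emb_wave cut_symbol schwartz_scale) auto
  finally show ?thesis .
qed

text \<open>An operator of class \<open>C\<^sup>u(Q)\<close> almost commutes with slowly varying cut-offs, and a cut-off
  followed by a gain of regularity is compact.\<close>

lemma compact_if_vanishing_at_infinity:
  fixes W :: "('n::finite, 'e::fin_dim_hilbert) l2 \<Rightarrow>\<^sub>L ('n, 'e) l2"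
  assumes g: "g \<in> schwartz" and d: "d > 0" and W: "Cz (- d) t W"
    and lim: "((\<lambda>r. norm (W - (cut g (1 / r) t o\<^sub>L W))) \<longlongrightarrow> 0) at_top"
  shows "compact_blinfun (W o\<^sub>L mulL (emb d))"
proof (rule compact_blinfun_limit)
  fix e :: real assume e: "e > 0"
  let ?E = "mulL (emb d) :: ('n, 'e) l2 \<Rightarrow>\<^sub>L ('n, 'e) l2"
  obtain \<epsilon>0 where \<epsilon>0: "\<epsilon>0 > 0"
    "\<And>\<epsilon>. 0 < \<epsilon> \<Longrightarrow> \<epsilon> < \<epsilon>0 \<Longrightarrow> norm ((W o\<^sub>L cut g \<epsilon> (- d)) - (cut g \<epsilon> t o\<^sub>L W)) < e / 2"
    using wave_op_commutator_small[OF cut_symbol[OF g] W, of "e / 2"] e unfolding cut_def by auto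
  have "eventually (\<lambda>r. norm (W - (cut g (1 / r) t o\<^sub>L W)) < e / 2) at_top"
    by (rule order_tendstoD(2)[OF lim]) (use e in simp)
  moreover have "eventually (\<lambda>r. r > 1 / \<epsilon>0 \<and> r > 1) at_top" by (intro eventually_conj eventually_gt_at_top)
  ultimately obtain r where r: "norm (W - (cut g (1 / r) t o\<^sub>L W)) < e / 2" "r > 1 / \<epsilon>0" "r > 1"
    using eventually_happens'[OF trivial_limit_at_top_linorder eventually_conj] by blast
  define \<epsilon> where "\<epsilon> = 1 / r"
  have \<epsilon>: "0 < \<epsilon>" "\<epsilon> \<le> 1" "\<epsilon> < \<epsilon>0" using r \<epsilon>0(1) by (auto simp: \<epsilon>_def field_simps)
  let ?G = "cut g \<epsilon> (- d)" and ?H = "cut g \<epsilon> t"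
  \<comment> \<open>W - W G is split through H W: the first bracket is small because W vanishes at
    infinity, the second because W almost commutes with the cut-off.\<close>
  have eq: "(W o\<^sub>L ?E) - (W o\<^sub>L (?G o\<^sub>L ?E)) = ((W - (?H o\<^sub>L W)) - ((W o\<^sub>L ?G) - (?H o\<^sub>L W))) o\<^sub>L ?E"
    by (rule blinfun_eqI) (simp add: blinfun.diff_left)
  have "norm ((W o\<^sub>L ?E) - (W o\<^sub>L (?G o\<^sub>L ?E))) \<le> norm ((W - (?H o\<^sub>L W)) - ((W o\<^sub>L ?G) - (?H o\<^sub>L W))) * norm ?E"
    unfolding eq by (rule norm_blinfun_compose)
  also have "\<dots> \<le> norm ((W - (?H o\<^sub>L W)) - ((W o\<^sub>L ?G) - (?H o\<^sub>L W))) * 1"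
    using d by (intro mult_left_mono norm_mulL_le emb_bound) auto
  also have "\<dots> \<le> norm (W - (?H o\<^sub>L W)) + norm ((W o\<^sub>L ?G) - (?H o\<^sub>L W))"
    unfolding mult_1_right by (rule norm_triangle_ineq4)
  also have "\<dots> < e" using r(1) \<epsilon>0(2)[OF \<epsilon>(1,3)] unfolding \<epsilon>_def by linarith
  finally have "norm ((W o\<^sub>L ?E) - (W o\<^sub>L (?G o\<^sub>L ?E))) < e" .
  moreover have "compact_blinfun (W o\<^sub>L (?G o\<^sub>L ?E))"
    by (rule compact_blinfun_compose_left[OF compact_cut_emb[OF g \<epsilon>(1,2) d]])
  ultimately show "\<exists>L. compact_blinfun L \<and> norm ((W o\<^sub>L ?E) - L) < e" by blast
qed

section \<open>The operators in divergence form\<close>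

text \<open>Hiding the representing operator lets iterated derivatives be treated by induction on
  the maps themselves.\<close>

definition Cu_op :: "real \<Rightarrow> real \<Rightarrow> (('n::finite, 'e::fin_dim_hilbert) functional \<Rightarrow> ('n, 'e) functional) \<Rightarrow> bool" where
  "Cu_op s t S \<longleftrightarrow> (\<exists>T. represents s t S T \<and> Cz s t T)"

lemma Cu_op_compose: "Cu_op s t S \<Longrightarrow> Cu_op t r S' \<Longrightarrow> Cu_op s r (\<lambda>u. S' (S u))"
  unfolding Cu_op_def using represents_compose Cz_compose by metis

lemma Cu_op_id: "Cu_op s s (\<lambda>u. u)"
  unfolding Cu_op_def
  by (rule exI[of _ id_blinfun]) (auto simp: represents_def Cz_def clin_def intro!: tendsto_eventually always_eventually blinfun_eqI simp: blinfun.diff_left)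

lemma Cu_op_P_funpow: "Cu_op s (s - real n) (P_op k ^^ n)"
proof (induction n)
  case 0
  then show ?case using Cu_op_id by (simp add: id_def)
next
  case (Suc n)
  have "Cu_op (s - real n) (s - real n - 1) (P_op k)"
    unfolding Cu_op_def using represents_P_op Cz_P_op by blast
  from Cu_op_compose[OF Suc this] show ?case by (simp add: o_def algebra_simps)
qed

lemma Cu_op_P_pow: "Cu_op s (s - real (mi_order \<alpha>)) (P_pow \<alpha>)"
proof -
  have "Cu_op s (s - real (\<Sum>k\<leftarrow>ks. \<alpha> k)) (foldr (\<lambda>k. P_op k ^^ \<alpha> k) ks)" for ks
  proof (induction ks)
    case Nil
    then show ?case using Cu_op_id by (simp add: id_def)
  next
    case (Cons k ks)
    from Cu_op_compose[OF Cons Cu_op_P_funpow[of _ "\<alpha> k" k]] show ?case by (simp add: o_def algebra_simps)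
  qed
  from this[of "sorted_list_of_set UNIV"] show ?thesis
    unfolding P_pow_def[abs_def] mi_order_def by (simp add: sum_list_distinct_conv_sum_set)
qed

lemma represents_sum:
  "(\<And>i. i \<in> I \<Longrightarrow> represents s t (S i) (T i)) \<Longrightarrow> represents s t (\<lambda>u. \<Sum>i\<in>I. S i u) (\<Sum>i\<in>I. T i)"
  by (simp add: represents_def blinfun.sum_left J_sum)

lemma mulL_const: "blinfun_apply (mulL (\<lambda>_. c)) = csc c"
  unfolding csc_def by (rule mulL_apply[of _ "norm c"]) auto

lemma scaleF_Cu_op: "represents s s (scaleF c) (mulL (\<lambda>_. c))" "Cz s s (mulL (\<lambda>_. c))"
proof -
  note c = mulL_const
  show "represents s s (scaleF c) (mulL (\<lambda>_. c))" by (simp add: represents_def J_csc c)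
  show "Cz s s (mulL (\<lambda>_. c))"
    unfolding Cz_def clin_def c
    by (auto intro!: tendsto_eventually always_eventually blinfun_eqI simp: blinfun.diff_left c shift_csc csc_csc mult.commute)
qed

lemma schwartz_mult: "g \<in> schwartz \<Longrightarrow> \<phi> \<in> schwartz \<Longrightarrow> (\<lambda>x. g x * \<phi> x) \<in> schwartz"
proof (rule slowly_growing_mult_schwartz)
  have "diff_level decays N f \<Longrightarrow> diff_level slow N f" for N and f :: "real^'a \<Rightarrow> complex"
    by (induction N arbitrary: f) (auto intro: decays_imp_slow)
  then show "g \<in> slowly_growing" if "g \<in> schwartz" using that unfolding slowly_growing_def schwartz_iff by blast
qed

lemma mult_op_cutoff_complement:
  assumes g: "g \<in> schwartz" and v: "v \<in> tempered"
  shows "mult_op (\<lambda>x. 1 - g x) v = v - mult_op g v"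
proof
  fix \<phi> :: "real^'a \<Rightarrow> complex"
  show "mult_op (\<lambda>x. 1 - g x) v \<phi> = (v - mult_op g v) \<phi>"
  proof (cases "\<phi> \<in> schwartz")
    case True
    have s: "(\<lambda>x. g x * \<phi> x) \<in> schwartz" by (rule schwartz_mult[OF g True])
    have "(\<lambda>x. \<phi> x - g x * \<phi> x) \<in> schwartz" by (rule schwartz_diff[OF True s])
    moreover have add: "\<And>\<phi> \<psi>. \<phi> \<in> schwartz \<Longrightarrow> \<psi> \<in> schwartz \<Longrightarrow> v (\<lambda>x. \<phi> x + \<psi> x) = v \<phi> + v \<psi>"
      using v by (simp add: tempered_def)
    ultimately have "v (\<lambda>x. \<phi> x - g x * \<phi> x) + v (\<lambda>x. g x * \<phi> x) = v \<phi>"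
      using add[of "\<lambda>x. \<phi> x - g x * \<phi> x" "\<lambda>x. g x * \<phi> x"] s by simp
    then show ?thesis using True by (simp add: mult_op_def transposed_def algebra_simps)
  next
    case False
    then show ?thesis using v by (simp add: mult_op_def transposed_def tempered_def)
  qed
qed

lemma cutoff_schwartz:
  assumes "smooth \<theta>" "eventually (\<lambda>x. \<theta> x = 1) at_infinity"
  shows "(\<lambda>x. 1 - \<theta> x) \<in> schwartz"
proof -
  obtain R where "\<And>x. R \<le> norm x \<Longrightarrow> \<theta> x = 1" using assms(2) by (auto simp: eventually_at_infinity)
  then show ?thesis using assms(1) by (intro smooth_compact_support_schwartz[of _ R] smooth_const_diff) auto
qed

text \<open>Multiplication by \<theta>(x / r) is the identity minus the cut-off by g = 1 - \<theta>
  at scale 1 / r. The hypothesis is thus a statement about C minus its cut-off.\<close>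

lemma decay_imp_cut_tendsto:
  fixes S :: "('n::finite, 'e::fin_dim_hilbert) functional \<Rightarrow> ('n, 'e) functional"
  assumes C: "represents s t S C" and g: "(\<lambda>x. 1 - \<theta> x) \<in> schwartz"
    and lim: "((\<lambda>r. op_norm s t (\<lambda>u. mult_op (\<lambda>x. \<theta> ((1 / r) *\<^sub>R x)) (S u))) \<longlongrightarrow> 0) at_top"
  shows "((\<lambda>r. norm (C - (cut (\<lambda>x. 1 - \<theta> x) (1 / r) t o\<^sub>L C))) \<longlongrightarrow> 0) at_top"
proof -
  let ?g = "\<lambda>x. 1 - \<theta> x"
  have "op_norm s t (\<lambda>u. mult_op (\<lambda>x. \<theta> ((1 / r) *\<^sub>R x)) (S u)) = ennreal (norm (C - (cut ?g (1 / r) t o\<^sub>L C)))"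
    if r: "r \<ge> 1" for r
  proof (rule op_norm_represents)
    have "mult_op (\<lambda>x. \<theta> ((1 / r) *\<^sub>R x)) (J t h) = J t h - mult_op (\<lambda>x. ?g ((1 / r) *\<^sub>R x)) (J t h)" for h :: "('n, 'e) l2"
      using mult_op_cutoff_complement[OF schwartz_scale[OF _ g, of "1 / r"] J_tempered[of t h]] r by simp
    moreover have "represents t t (mult_op (\<lambda>x. ?g ((1 / r) *\<^sub>R x))) (cut ?g (1 / r) t :: ('n, 'e) l2 \<Rightarrow>\<^sub>L ('n, 'e) l2)"
      by (rule represents_cut[OF g]) (use r in auto)
    ultimately show "represents s t (\<lambda>u. mult_op (\<lambda>x. \<theta> ((1 / r) *\<^sub>R x)) (S u)) (C - (cut ?g (1 / r) t o\<^sub>L C))"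
      by (simp add: represents_def blinfun.diff_left J_diff flip: representsD[OF C])
  qed
  then have "eventually (\<lambda>r. op_norm s t (\<lambda>u. mult_op (\<lambda>x. \<theta> ((1 / r) *\<^sub>R x)) (S u)) = ennreal (norm (C - (cut ?g (1 / r) t o\<^sub>L C)))) at_top"
    by (auto intro: eventually_mono[OF eventually_ge_at_top[of "1::real"]])
  from Lim_transform_eventually[OF lim this]
  have "((\<lambda>r. ennreal (norm (C - (cut ?g (1 / r) t o\<^sub>L C)))) \<longlongrightarrow> ennreal 0) at_top" by simp
  then show ?thesis by (subst (asm) tendsto_ennreal_iff) auto
qed

text \<open>C stands for a difference of coefficients and Q for a derivative of a resolvent. The
  decay at infinity sits in the left factor and passes to the product because Q is bounded.\<close>

lemma compact_coefficient_difference: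
  fixes S :: "('n::finite, 'e::fin_dim_hilbert) functional \<Rightarrow> ('n, 'e) functional"
  assumes C: "represents s t S C" "Cz s t C" and g: "(\<lambda>x. 1 - \<theta> x) \<in> schwartz"
    and lim: "((\<lambda>r. op_norm s t (\<lambda>u. mult_op (\<lambda>x. \<theta> ((1 / r) *\<^sub>R x)) (S u))) \<longlongrightarrow> 0) at_top"
    and Q: "Cz (- d) s Q" and d: "d > 0"
  shows "compact_blinfun ((C o\<^sub>L Q) o\<^sub>L mulL (emb d))"
proof (rule compact_if_vanishing_at_infinity[OF g d Cz_compose[OF Q C(2)]])
  let ?G = "\<lambda>r. cut (\<lambda>x. 1 - \<theta> x) (1 / r) t :: ('n, 'e) l2 \<Rightarrow>\<^sub>L ('n, 'e) l2"
  have "norm ((C o\<^sub>L Q) - (?G r o\<^sub>L (C o\<^sub>L Q))) \<le> norm (C - (?G r o\<^sub>L C)) * norm Q" for r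
  proof -
    have "(C o\<^sub>L Q) - (?G r o\<^sub>L (C o\<^sub>L Q)) = (C - (?G r o\<^sub>L C)) o\<^sub>L Q"
      by (rule blinfun_eqI) (simp add: blinfun.diff_left)
    then show ?thesis by (simp add: norm_blinfun_compose)
  qed
  then have "\<forall>\<^sub>F r in at_top. norm (norm ((C o\<^sub>L Q) - (?G r o\<^sub>L (C o\<^sub>L Q)))) \<le> norm (C - (?G r o\<^sub>L C)) * norm Q" by simp
  then show "((\<lambda>r. norm ((C o\<^sub>L Q) - (?G r o\<^sub>L (C o\<^sub>L Q)))) \<longlongrightarrow> 0) at_top"
    by (rule Lim_null_comparison) (rule tendsto_mult_left_zero[OF decay_imp_cut_tendsto[OF C(1) g lim]])
qed

lemma bij_if_represents:
  assumes T: "represents s t S T" and S: "bij_betw S (sobolev s) (sobolev t)"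
  shows "bij (blinfun_apply T)"
proof (rule bijI)
  show "inj (blinfun_apply T)"
  proof (rule injI)
    fix u v assume "T u = T v"
    then have "S (J s u) = S (J s v)" by (simp flip: representsD[OF T])
    then have "J s u = J s v" using S by (auto simp: bij_betw_def sobolev_eq inj_on_def)
    then show "u = v" by (rule J_inj)
  qed
  show "surj (blinfun_apply T)"
    unfolding surj_def
  proof
    fix v
    have "J t v \<in> S ` sobolev s" using S by (auto simp: bij_betw_def sobolev_eq)
    then obtain u where "J t v = S (J s u)" by (auto simp: sobolev_eq)
    then have "J t v = J t (T u)" by (simp add: representsD[OF T])
    then show "\<exists>u. v = T u" using J_inj by blast
  qed
qed

text \<open>The choice is immaterial by \<open>represents_unique\<close>.\<close>

definition P_powL :: "real \<Rightarrow> ('n \<Rightarrow> nat) \<Rightarrow> ('n::{finite,linorder}, 'e::fin_dim_hilbert) l2 \<Rightarrow>\<^sub>L ('n, 'e) l2" where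
  "P_powL s \<alpha> = (SOME T. represents s (s - real (mi_order \<alpha>)) (P_pow \<alpha>) T \<and> Cz s (s - real (mi_order \<alpha>)) T)"

lemma P_powL: "represents s (s - real (mi_order \<alpha>)) (P_pow \<alpha>) (P_powL s \<alpha>)" "Cz s (s - real (mi_order \<alpha>)) (P_powL s \<alpha>)"
  using someI_ex[OF Cu_op_P_pow[unfolded Cu_op_def, of s \<alpha>]] unfolding P_powL_def[symmetric] by auto

text \<open>The orders in each term run from m to m - |\<beta>|, then by the coefficient to
  |\<alpha>| - m, and by the outer derivative down to - m; this explains the order parameters of the
  two derivatives.\<close>

definition divL :: "nat \<Rightarrow> (('n \<Rightarrow> nat) \<Rightarrow> ('n \<Rightarrow> nat) \<Rightarrow> ('n, 'e) l2 \<Rightarrow>\<^sub>L ('n, 'e) l2)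
    \<Rightarrow> ('n::{finite,linorder}, 'e::fin_dim_hilbert) l2 \<Rightarrow>\<^sub>L ('n, 'e) l2" where
  "divL m C = (\<Sum>\<alpha> | mi_order \<alpha> \<le> m. \<Sum>\<beta> | mi_order \<beta> \<le> m.
     P_powL (real (mi_order \<alpha>) - real m) \<alpha> o\<^sub>L (C \<alpha> \<beta> o\<^sub>L P_powL (real m) \<beta>))"

lemma represents_divL:
  assumes "\<And>\<alpha> \<beta>. mi_order \<alpha> \<le> m \<Longrightarrow> mi_order \<beta> \<le> m \<Longrightarrow>
    represents (real m - real (mi_order \<beta>)) (real (mi_order \<alpha>) - real m) (a \<alpha> \<beta>) (C \<alpha> \<beta>)"
  shows "represents (real m) (- real m) (DaD m a) (divL m C)"
proof -
  have "represents (real m) (- real m) (\<lambda>u. P_pow \<alpha> (a \<alpha> \<beta> (P_pow \<beta> u)))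
      (P_powL (real (mi_order \<alpha>) - real m) \<alpha> o\<^sub>L (C \<alpha> \<beta> o\<^sub>L P_powL (real m) \<beta>))"
    if "mi_order \<alpha> \<le> m" "mi_order \<beta> \<le> m" for \<alpha> \<beta>
    using represents_compose[OF represents_compose[OF P_powL(1) assms[OF that]] P_powL(1)[of "real (mi_order \<alpha>) - real m" \<alpha>]] by simp
  then show ?thesis unfolding DaD_def[abs_def] divL_def by (intro represents_sum) auto
qed

lemma Cz_divL:
  assumes "\<And>\<alpha> \<beta>. mi_order \<alpha> \<le> m \<Longrightarrow> mi_order \<beta> \<le> m \<Longrightarrow> Cz (real m - real (mi_order \<beta>)) (real (mi_order \<alpha>) - real m) (C \<alpha> \<beta>)"
  shows "Cz (real m) (- real m) (divL m C)"
proof -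
  have "Cz (real m) (- real m) (P_powL (real (mi_order \<alpha>) - real m) \<alpha> o\<^sub>L (C \<alpha> \<beta> o\<^sub>L P_powL (real m) \<beta>))"
    if "mi_order \<alpha> \<le> m" "mi_order \<beta> \<le> m" for \<alpha> \<beta>
    using Cz_compose[OF Cz_compose[OF P_powL(2) assms[OF that]] P_powL(2)[of "real (mi_order \<alpha>) - real m" \<alpha>]] by simp
  then show ?thesis unfolding divL_def by (intro Cz_sum) auto
qed

lemma divL_diff: "divL m C - divL m C' = divL m (\<lambda>\<alpha> \<beta>. C \<alpha> \<beta> - C' \<alpha> \<beta>)"
  by (rule blinfun_eqI) (simp add: divL_def blinfun.sum_left blinfun.diff_left blinfun.diff_right sum_subtractf)

text \<open>As a map from order m to order - m the scalar z acts through the inclusion, which loses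
  2 m orders.\<close>

definition shiftedL :: "nat \<Rightarrow> complex \<Rightarrow> (('n \<Rightarrow> nat) \<Rightarrow> ('n \<Rightarrow> nat) \<Rightarrow> ('n, 'e) l2 \<Rightarrow>\<^sub>L ('n, 'e) l2)
    \<Rightarrow> ('n::{finite,linorder}, 'e::fin_dim_hilbert) l2 \<Rightarrow>\<^sub>L ('n, 'e) l2" where
  "shiftedL m z C = divL m C - (mulL (emb (2 * real m)) o\<^sub>L mulL (\<lambda>_. z))"

lemma represents_shiftedL:
  assumes "\<And>\<alpha> \<beta>. mi_order \<alpha> \<le> m \<Longrightarrow> mi_order \<beta> \<le> m \<Longrightarrow>
    represents (real m - real (mi_order \<beta>)) (real (mi_order \<alpha>) - real m) (a \<alpha> \<beta>) (C \<alpha> \<beta>)"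
  shows "represents (real m) (- real m) (shift_op (DaD m a) z) (shiftedL m z C)"
  using represents_diff[OF represents_divL[where m=m and a=a and C=C]
      represents_compose[OF scaleF_Cu_op(1)[of "real m" z] represents_emb[of "2 * real m" "real m"], simplified]] assms
  by (simp add: shift_op_def[abs_def] shiftedL_def)

lemma Cz_shiftedL:
  assumes "\<And>\<alpha> \<beta>. mi_order \<alpha> \<le> m \<Longrightarrow> mi_order \<beta> \<le> m \<Longrightarrow> Cz (real m - real (mi_order \<beta>)) (real (mi_order \<alpha>) - real m) (C \<alpha> \<beta>)"
  shows "Cz (real m) (- real m) (shiftedL m z C)"
  using Cz_diff[OF Cz_divL[where m=m and C=C]
      Cz_compose[OF scaleF_Cu_op(2)[of "real m" z] Cz_emb[of "2 * real m" "real m"], simplified]] assms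
  by (simp add: shiftedL_def)

lemma compact_divL_compose:
  assumes "\<And>\<alpha> \<beta>. mi_order \<alpha> \<le> m \<Longrightarrow> mi_order \<beta> \<le> m \<Longrightarrow> compact_blinfun ((C \<alpha> \<beta> o\<^sub>L (P_powL (real m) \<beta> o\<^sub>L Q)) o\<^sub>L E)"
  shows "compact_blinfun ((divL m C o\<^sub>L Q) o\<^sub>L E)"
proof -
  have eq: "(divL m C o\<^sub>L Q) o\<^sub>L E = (\<Sum>\<alpha> | mi_order \<alpha> \<le> m. \<Sum>\<beta> | mi_order \<beta> \<le> m.
     P_powL (real (mi_order \<alpha>) - real m) \<alpha> o\<^sub>L ((C \<alpha> \<beta> o\<^sub>L (P_powL (real m) \<beta> o\<^sub>L Q)) o\<^sub>L E))"
    by (rule blinfun_eqI) (simp add: divL_def blinfun.sum_left)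
  show ?thesis unfolding eq by (intro compact_blinfun_sum compact_blinfun_compose_left assms) auto
qed

section \<open>Operators in \<open>L\<^sup>2\<close> given by a resolvent\<close>

interpretation scaleF: vector_space "scaleF :: complex \<Rightarrow> ('n::finite, 'e::fin_dim_hilbert) functional \<Rightarrow> _"
  by (rule vector_space_scaleF)

lemma csc_diff_left: "csc (c - d) u = csc c u - csc d u"
  by (rule J_inj[of 0]) (simp add: J_csc J_diff scaleF.scale_left_diff_distrib)

lemma csc_Re_Im: "csc c u = Re c *\<^sub>R u + Im c *\<^sub>R csc \<i> u"
proof (rule J_inj[of 0])
  have "c = complex_of_real (Re c) + complex_of_real (Im c) * \<i>" by (metis complex_eq mult.commute)
  then have "scaleF c (J 0 u) = scaleF (complex_of_real (Re c) + complex_of_real (Im c) * \<i>) (J 0 u)"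
    by (rule arg_cong)
  then show "J 0 (csc c u) = J 0 (Re c *\<^sub>R u + Im c *\<^sub>R csc \<i> u)"
    by (simp only: J_csc J_add J_scaleR scaleF.scale_left_distrib scaleF.scale_scale)
qed

lemma J_eq_0_iff: "J s u = 0 \<longleftrightarrow> u = 0"
  using J_eq_iff[of s u 0] by (simp add: J_zero)

lemma L2_tendsto_J: "L2_tendsto (\<lambda>j. J 0 (y j)) (J 0 l) \<longleftrightarrow> y \<longlonglongrightarrow> l"
  by (simp add: L2_tendsto_def L2_norm_J tendsto_norm_zero_iff LIM_zero_iff flip: J_diff)

lemma subspace_L2: "module.subspace scaleF (L2 :: ('n::finite, 'e::fin_dim_hilbert) functional set)"
  unfolding scaleF.subspace_def L2_eq
proof (intro conjI ballI allI)
  show "0 \<in> range (J 0 :: ('n, 'e) l2 \<Rightarrow> _)" by (metis J_zero rangeI)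
qed (auto simp flip: J_add J_csc)

lemma closed_iff_L2:
  "closed R \<longleftrightarrow> (\<forall>f g. (\<forall>j. f j \<in> J 0 ` R) \<and> g \<in> L2 \<and> L2_tendsto f g \<longrightarrow> g \<in> J 0 ` R)" (is "_ \<longleftrightarrow> ?C")
proof
  assume R: "closed R"
  show ?C
  proof (intro allI impI)
    fix f g assume "(\<forall>j. f j \<in> J 0 ` R) \<and> g \<in> L2 \<and> L2_tendsto f g"
    then obtain y l where y: "\<And>j. y j \<in> R" "f = (\<lambda>j. J 0 (y j))" "g = J 0 l" "L2_tendsto f g"
      unfolding L2_eq image_iff by metis
    then have "l \<in> R" using R L2_tendsto_J closed_sequentially by metis
    then show "g \<in> J 0 ` R" using y by simp
  qed
next
  assume C: ?C
  show "closed R" unfolding closed_sequential_limits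
  proof (intro allI impI)
    fix y l assume "(\<forall>j. y j \<in> R) \<and> y \<longlonglongrightarrow> l"
    then have "J 0 l \<in> J 0 ` R" using C[rule_format, of "\<lambda>j. J 0 (y j)" "J 0 l"] by (auto simp: L2_tendsto_J L2_eq)
    then show "l \<in> R" using J_inj by blast
  qed
qed

lemma span_J: "x \<in> span M \<Longrightarrow> J s x \<in> module.span scaleF (J s ` M)"
proof -
  have "span M \<subseteq> {x. J s x \<in> scaleF.span (J s ` M)}"
    by (rule span_minimal)
      (auto simp: subspace_def J_zero J_add J_scaleR intro: scaleF.span_base scaleF.span_zero scaleF.span_add scaleF.span_scale)
  then show "x \<in> span M \<Longrightarrow> J s x \<in> module.span scaleF (J s ` M)" by blast
qed

text \<open>The real span of M together with its multiples by i is closed under complex scalars, so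
  it contains the complex span.\<close>

lemma J_span:
  fixes x :: "('n::finite, 'e::fin_dim_hilbert) l2"
  assumes "J s x \<in> module.span scaleF (J s ` M)"
  shows "x \<in> span (M \<union> csc \<i> ` M)"
proof -
  let ?V = "span (M \<union> csc \<i> ` M)"
  have "?V \<subseteq> {x. csc \<i> x \<in> ?V}"
  proof (rule span_minimal)
    show "M \<union> csc \<i> ` M \<subseteq> {x. csc \<i> x \<in> ?V}"
    proof
      fix x assume "x \<in> M \<union> csc \<i> ` M"
      then show "x \<in> {x. csc \<i> x \<in> ?V}"
      proof
        assume "x \<in> csc \<i> ` M"
        then obtain w where w: "w \<in> M" "x = csc \<i> w" by blast
        then have "csc \<i> x = - 1 *\<^sub>R w" using csc_of_real[of "- 1" w] by (simp add: csc_csc)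
        moreover have "- 1 *\<^sub>R w \<in> ?V" using w by (intro span_scale span_base) auto
        ultimately show ?thesis by simp
      qed (auto intro: span_base)
    qed
    have "csc \<i> (r *\<^sub>R w) = r *\<^sub>R csc \<i> w" for r and w :: "('n, 'e) l2"
      by (rule linear_cmul[OF bounded_linear.linear[OF bounded_linear_csc]])
    then show "subspace {x. csc \<i> x \<in> ?V}"
      by (auto simp: subspace_def csc_zero csc_add intro: span_zero span_add span_scale)
  qed
  then have csc: "csc c x \<in> ?V" if "x \<in> ?V" for c x
    unfolding csc_Re_Im[of c] using that by (intro span_add span_scale) auto
  have "scaleF.span (J s ` M) \<subseteq> J s ` ?V"
  proof (rule scaleF.span_minimal)
    show "J s ` M \<subseteq> J s ` ?V" by (auto intro: span_base)
    show "scaleF.subspace (J s ` ?V)"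
      unfolding scaleF.subspace_def
    proof (intro conjI ballI allI)
      show "0 \<in> J s ` ?V" using J_zero[of s] span_zero by (metis imageI)
      show "u + v \<in> J s ` ?V" if "u \<in> J s ` ?V" "v \<in> J s ` ?V" for u v
        using that by (auto simp flip: J_add intro: span_add)
      show "scaleF c u \<in> J s ` ?V" if "u \<in> J s ` ?V" for c u
        using that csc by (auto simp flip: J_csc)
    qed
  qed
  then show ?thesis using assms J_inj by blast
qed

text \<open>The unbounded operator is encoded by a bounded one: the domain is the range of S, and
  the formula for A says that S is the inverse of A - z. All properties of A are then read off from
  S.\<close>

locale resolvent_pair =
  fixes D :: "('n::finite, 'e::fin_dim_hilbert) functional set"
    and A :: "('n, 'e) functional \<Rightarrow> ('n, 'e) functional"
    and z :: complex and S :: "('n, 'e) l2 \<Rightarrow>\<^sub>L ('n, 'e) l2"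
  assumes clin_S: "clin S" and D_eq: "D = range (\<lambda>f. J 0 (S f))"
    and A_eq: "A (J 0 (S f)) = J 0 (f + csc z (S f))"
begin

lemma S_csc: "S (csc c f) = csc c (S f)"
  using clin_S by (simp add: clin_def)

text \<open>This is A - \<mu> composed with S, the resolvent at z: a bounded operator with the same
  Fredholm properties as A - \<mu>.\<close>

definition X :: "complex \<Rightarrow> ('n, 'e) l2 \<Rightarrow>\<^sub>L ('n, 'e) l2" where
  "X \<mu> = id_blinfun - (mulL (\<lambda>_. \<mu> - z) o\<^sub>L S)"

lemma X_apply: "X \<mu> f = f - csc (\<mu> - z) (S f)"
  by (simp add: X_def blinfun.diff_left mulL_const)

lemma shift_op_eq: "shift_op A \<mu> (J 0 (S f)) = J 0 (X \<mu> f)"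
  by (simp add: shift_op_def A_eq X_apply csc_diff_left J_csc J_diff J_add algebra_simps)

lemma shift_op_z: "shift_op A z (J 0 (S f)) = J 0 f"
proof -
  have "csc (z - z) (S f) = 0" unfolding csc_diff_left by simp
  then show ?thesis unfolding shift_op_eq X_apply by simp
qed

lemma S_inj: "S f = S g \<Longrightarrow> f = g"
  by (metis J_inj shift_op_z)

lemma closed_operator: "closed_operator D A"
  unfolding closed_operator_def
proof (intro conjI allI impI)
  show "D \<subseteq> L2" by (auto simp: D_eq L2_eq)
  show "A ` D \<subseteq> L2" by (auto simp: D_eq L2_eq A_eq)
  have add: "J 0 (S f) + J 0 (S g) = J 0 (S (f + g))" for f g by (simp add: J_add blinfun.add_right)
  have scale: "scaleF c (J 0 (S f)) = J 0 (S (csc c f))" for c f by (simp add: J_csc S_csc)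
  show "clinear_on D A"
    unfolding clinear_on_def scaleF.subspace_def D_eq
  proof (intro conjI ballI allI)
    show "0 \<in> range (\<lambda>f. J 0 (S f))" by (rule range_eqI[of _ _ 0]) (simp add: J_zero blinfun.zero_right)
    show "A (u + v) = A u + A v" if uv: "u \<in> range (\<lambda>f. J 0 (S f))" "v \<in> range (\<lambda>f. J 0 (S f))" for u v
    proof -
      obtain f g where "u = J 0 (S f)" "v = J 0 (S g)" using uv by blast
      moreover have "A (J 0 (S (f + g))) = J 0 (f + csc z (S f)) + J 0 (g + csc z (S g))"
        unfolding A_eq by (simp add: blinfun.add_right csc_add J_add)
      ultimately show ?thesis by (simp only: add A_eq)
    qed
    show "A (scaleF c u) = scaleF c (A u)" if u: "u \<in> range (\<lambda>f. J 0 (S f))" for c u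
    proof -
      obtain f where "u = J 0 (S f)" using u by blast
      moreover have "A (J 0 (S (csc c f))) = scaleF c (J 0 (f + csc z (S f)))"
        unfolding A_eq by (simp add: S_csc csc_add csc_csc mult.commute flip: J_csc)
      ultimately show ?thesis by (simp only: scale A_eq)
    qed
  qed (auto simp: add scale)
  fix f u v
  assume *: "(\<forall>j. f j \<in> D) \<and> u \<in> L2 \<and> v \<in> L2 \<and> L2_tendsto f u \<and> L2_tendsto (\<lambda>j. A (f j)) v"
  then obtain h y w where h: "f = (\<lambda>j. J 0 (S (h j)))" and y: "u = J 0 y" and w: "v = J 0 w"
    unfolding D_eq L2_eq image_iff by metis
  have 1: "(\<lambda>j. S (h j)) \<longlonglongrightarrow> y" and 2: "(\<lambda>j. h j + csc z (S (h j))) \<longlonglongrightarrow> w"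
    using * unfolding h y w A_eq by (simp_all only: L2_tendsto_J)
  have 3: "(\<lambda>j. csc z (S (h j))) \<longlonglongrightarrow> csc z y" by (rule bounded_linear.tendsto[OF bounded_linear_csc 1])
  \<comment> \<open>Since \<open>h j\<close> is A - z applied to \<open>f j\<close>, it converges,
    and continuity of S identifies the limit of the f j as an element of the domain.\<close>
  have "h \<longlonglongrightarrow> w - csc z y" using tendsto_diff[OF 2 3] by simp
  then have "(\<lambda>j. S (h j)) \<longlonglongrightarrow> S (w - csc z y)" by (intro tendsto_intros)
  then have y': "y = S (w - csc z y)" using 1 LIMSEQ_unique by blast
  show "u \<in> D" unfolding D_eq y by (subst y') blast
  have "A u = J 0 ((w - csc z y) + csc z y)" 
    using A_eq[of "w - csc z y"] unfolding y'[symmetric] y .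
  then show "A u = v" by (simp add: w)
qed

lemma bij_betw_shift_op: "bij_betw (shift_op A z) D L2"
  unfolding bij_betw_def
proof
  show "inj_on (shift_op A z) D" by (rule inj_onI) (auto simp: D_eq shift_op_z J_eq_iff)
  show "shift_op A z ` D = L2" by (auto simp: D_eq L2_eq shift_op_z image_image)
qed

lemma resolvent_eq: "resolvent D A z (J 0 f) = J 0 (S f)"
  unfolding resolvent_def using bij_betw_shift_op
  by (intro inv_into_f_eq) (auto simp: bij_betw_def shift_op_z D_eq)

lemma in_resolvent_set: "z \<in> resolvent_set D A"
  unfolding resolvent_set_def mem_Collect_eq
proof (intro conjI bij_betw_shift_op exI ballI)
  show "L2_norm (resolvent D A z u) \<le> norm S * L2_norm u" if "u \<in> L2" for u
    using that by (auto simp: L2_eq resolvent_eq L2_norm_J norm_blinfun)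
qed

text \<open>S maps the kernel of \<open>X \<mu>\<close> bijectively onto that of A - \<mu>; what has
  to be reconciled are complex spans of functionals and real spans in the model.\<close>

lemma kernel_iff:
  "(\<exists>B. finite B \<and> {u \<in> D. shift_op A \<mu> u = 0} \<subseteq> module.span scaleF B) \<longleftrightarrow>
   (\<exists>B. finite B \<and> {f. X \<mu> f = 0} \<subseteq> span B)" (is "?L \<longleftrightarrow> ?R")
proof -
  have N: "{u \<in> D. shift_op A \<mu> u = 0} = J 0 ` blinfun_apply S ` {f. X \<mu> f = 0}"
    by (auto simp: D_eq shift_op_eq J_eq_0_iff)
  have S: "linear (blinfun_apply S)" by (rule bounded_linear.linear[OF blinfun.bounded_linear_right])
  show ?thesis
  proof
    assume ?L
    then obtain B where B: "finite B" "J 0 ` blinfun_apply S ` {f. X \<mu> f = 0} \<subseteq> scaleF.span B" unfolding N by blast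
    \<comment> \<open>B need not consist of elements of the kernel. A maximal independent subset of
      the kernel does, is finite by comparison with B, and can be pulled back through S.\<close>
    obtain B' where B': "B' \<subseteq> J 0 ` blinfun_apply S ` {f. X \<mu> f = 0}" "scaleF.independent B'"
      "J 0 ` blinfun_apply S ` {f. X \<mu> f = 0} \<subseteq> scaleF.span B'"
      using scaleF.maximal_independent_subset by blast
    have "finite B'" using scaleF.independent_span_bound[OF B(1) B'(2)] B'(1) B(2) by blast
    moreover have "B' \<subseteq> (\<lambda>f. J 0 (S f)) ` UNIV" using B'(1) by blast
    ultimately obtain F where F: "finite F" "B' = (\<lambda>f. J 0 (S f)) ` F" using finite_subset_image by metis
    have "f \<in> span (F \<union> csc \<i> ` F)" if f: "X \<mu> f = 0" for f
    proof -
      have "J 0 (S f) \<in> scaleF.span (J 0 ` blinfun_apply S ` F)" using f B'(3) unfolding F(2) image_image by blast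
      then have "S f \<in> span (blinfun_apply S ` F \<union> csc \<i> ` blinfun_apply S ` F)" by (rule J_span)
      also have "blinfun_apply S ` F \<union> csc \<i> ` blinfun_apply S ` F = blinfun_apply S ` (F \<union> csc \<i> ` F)"
        by (simp add: image_Un image_image S_csc)
      also have "span \<dots> = blinfun_apply S ` span (F \<union> csc \<i> ` F)" by (rule linear_span_image[OF S])
      finally show ?thesis using S_inj by blast
    qed
    then show ?R using F(1) by (intro exI[of _ "F \<union> csc \<i> ` F"]) auto
  next
    assume ?R
    then obtain B where B: "finite B" "{f. X \<mu> f = 0} \<subseteq> span B" by blast
    have "J 0 (S f) \<in> scaleF.span (J 0 ` blinfun_apply S ` B)" if "X \<mu> f = 0" for f
    proof (rule span_J)
      show "S f \<in> span (blinfun_apply S ` B)" unfolding linear_span_image[OF S] using that B(2) by blast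
    qed
    then show ?L unfolding N using B(1) by (intro exI[of _ "J 0 ` blinfun_apply S ` B"]) auto
  qed
qed

lemma fredholm_iff: "fredholm D (shift_op A \<mu>) \<longleftrightarrow> fredholm_blinfun (X \<mu>)"
proof -
  let ?R = "range (blinfun_apply (X \<mu>))"
  have im: "shift_op A \<mu> ` D = J 0 ` ?R" by (auto simp: D_eq shift_op_eq image_image)
  \<comment> \<open>The range is stable under complex scalars, so only the finite set of additional
    generators has to be enlarged by its multiples by i.\<close>
  have R: "csc c ` ?R \<subseteq> ?R" for c
  proof -
    have "csc c (X \<mu> f) = X \<mu> (csc c f)" for f by (simp add: X_apply S_csc csc_diff csc_csc mult.commute)
    then show ?thesis by auto
  qed
  have "(\<exists>B \<subseteq> L2. finite B \<and> L2 \<subseteq> scaleF.span (J 0 ` ?R \<union> B)) \<longleftrightarrow> (\<exists>B. finite B \<and> span (?R \<union> B) = UNIV)" (is "?L \<longleftrightarrow> ?r")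
  proof
    assume ?L
    then obtain B where "B \<subseteq> range (J 0)" "finite B" and B: "L2 \<subseteq> scaleF.span (J 0 ` ?R \<union> B)" by (auto simp: L2_eq)
    then obtain F where F: "finite F" "B = J 0 ` F" using finite_subset_image by metis
    have "y \<in> span (?R \<union> (F \<union> csc \<i> ` F))" for y
    proof -
      have "J 0 y \<in> scaleF.span (J 0 ` (?R \<union> F))" using B by (auto simp: F(2) L2_eq image_Un)
      then have "y \<in> span ((?R \<union> F) \<union> csc \<i> ` (?R \<union> F))" by (rule J_span)
      also have "\<dots> \<subseteq> span (?R \<union> (F \<union> csc \<i> ` F))" by (rule span_mono) (use R[of \<i>] in blast)
      finally show ?thesis .
    qed
    then show ?r using F(1) by (intro exI[of _ "F \<union> csc \<i> ` F"]) auto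
  next
    assume ?r
    then obtain B where B: "finite B" "span (?R \<union> B) = UNIV" by blast
    have "J 0 y \<in> scaleF.span (J 0 ` ?R \<union> J 0 ` B)" for y
      using span_J[of y "?R \<union> B" 0] B(2) by (simp add: image_Un)
    then show ?L using B(1) by (intro exI[of _ "J 0 ` B"]) (auto simp: L2_eq)
  qed
  then show ?thesis
    unfolding fredholm_def fredholm_blinfun_def im kernel_iff closed_iff_L2[of ?R, symmetric] by blast
qed

end

text \<open>The operators \<open>X \<mu>\<close> of the two pairs differ by (\<mu> - z) times the
  compact difference of the resolvents, whatever \<mu> is.\<close>

lemma fredholm_if_compact_difference:
  assumes S: "resolvent_pair D A z S" and T: "resolvent_pair D' B z T" and c: "compact_blinfun (S - T)"
    and f: "fredholm D (shift_op A \<mu>)"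
  shows "fredholm D' (shift_op B \<mu>)"
proof -
  interpret a: resolvent_pair D A z S by (rule S)
  interpret b: resolvent_pair D' B z T by (rule T)
  have "b.X \<mu> = a.X \<mu> + (mulL (\<lambda>_. \<mu> - z) o\<^sub>L (S - T))"
    by (rule blinfun_eqI) (simp add: a.X_apply b.X_apply blinfun.add_left blinfun.diff_left mulL_const csc_diff)
  then have "fredholm_blinfun (b.X \<mu>)"
    using f by (simp add: fredholm_blinfun_add_compact compact_blinfun_compose_left c a.fredholm_iff)
  then show ?thesis by (simp add: b.fredholm_iff)
qed

lemma compact_perturbation_if_compact_difference:
  assumes S: "resolvent_pair D A z S" and T: "resolvent_pair D' B z T" and c: "compact_blinfun (S - T)"
  shows "compact_perturbation D' B D A"
proof -
  interpret a: resolvent_pair D A z S by (rule S)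
  interpret b: resolvent_pair D' B z T by (rule T)
  let ?K = "\<lambda>u. resolvent D A z u - resolvent D' B z u"
  have K: "?K (J 0 f) = J 0 ((S - T) f)" for f
    by (simp add: a.resolvent_eq b.resolvent_eq J_diff blinfun.diff_left)
  have ST: "(S - T) (csc c f) = csc c ((S - T) f)" for c f
    by (simp add: blinfun.diff_left a.S_csc b.S_csc csc_diff)
  have "compact_operator ?K"
    unfolding compact_operator_def clinear_on_def
  proof (intro conjI allI ballI impI subspace_L2)
    show "?K (u + v) = ?K u + ?K v" if uv: "u \<in> L2" "v \<in> L2" for u v
    proof -
      obtain f g where "u = J 0 f" "v = J 0 g" using uv by (auto simp: L2_eq)
      then show ?thesis by (simp only: K blinfun.add_right flip: J_add)
    qed
    show "?K (scaleF c u) = scaleF c (?K u)" if u: "u \<in> L2" for c u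
    proof -
      obtain f where "u = J 0 f" using u by (auto simp: L2_eq)
      then show ?thesis by (simp only: K ST flip: J_csc)
    qed
    show "?K ` L2 \<subseteq> L2" by (auto simp: L2_eq K)
    fix f :: "nat \<Rightarrow> ('a, 'b) functional" assume "\<forall>j. f j \<in> L2 \<and> L2_norm (f j) \<le> 1"
    then obtain y where y: "f = (\<lambda>j. J 0 (y j))" unfolding L2_eq image_iff by metis
    then have "norm (y j) \<le> 1" for j using \<open>\<forall>j. f j \<in> L2 \<and> L2_norm (f j) \<le> 1\<close> by (simp add: L2_norm_J)
    then obtain r l where "strict_mono (r :: nat \<Rightarrow> nat)" "(\<lambda>j. (S - T) (y (r j))) \<longlonglongrightarrow> l"
      using compact_blinfunD[OF c] by blast
    then show "\<exists>(r :: nat \<Rightarrow> nat) g. strict_mono r \<and> g \<in> L2 \<and> L2_tendsto (\<lambda>j. ?K (f (r j))) g"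
      unfolding y K by (intro exI[of _ r] exI[of _ "J 0 l"]) (auto simp: L2_tendsto_J L2_eq)
  qed
  then show ?thesis
    unfolding compact_perturbation_def
    using a.closed_operator b.closed_operator a.in_resolvent_set b.in_resolvent_set by blast
qed

text \<open>The resolvent in L2 factors as the inclusion of L2 into order - m, the inverse of the
  form, and the inclusion of order m into L2.\<close>

lemma resolvent_pair_restriction:
  fixes A :: "('n::finite, 'e::fin_dim_hilbert) functional \<Rightarrow> ('n, 'e) functional"
  assumes m: "m \<ge> 0" and T: "represents m (- m) (shift_op A z) T"
    and R: "R o\<^sub>L T = id_blinfun" "T o\<^sub>L R = id_blinfun" "clin R"
  shows "resolvent_pair {u \<in> sobolev m. A u \<in> L2} A z (mulL (emb m) o\<^sub>L (R o\<^sub>L mulL (emb m)))"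
proof -
  let ?E = "mulL (emb m) :: ('n, 'e) l2 \<Rightarrow>\<^sub>L ('n, 'e) l2"
  let ?S = "?E o\<^sub>L (R o\<^sub>L ?E)"
  have RT: "R (T x) = x" and TR: "T (R x) = x" for x
    using R by (metis blinfun_apply_blinfun_compose id_blinfun.rep_eq)+
  have E: "J 0 (?E h) = J m h" "J (- m) (?E h) = J 0 h" for h
    using representsD[OF represents_emb[OF m, of m], of h] representsD[OF represents_emb[OF m, of 0], of h] by simp_all
  have A: "A u = shift_op A z u + scaleF z u" for u by (simp add: shift_op_def)
  have S: "J 0 (?S f) = J m (R (?E f))" for f by (simp add: E)
  have AS: "A (J 0 (?S f)) = J 0 (f + csc z (?S f))" for f
  proof -
    have "shift_op A z (J 0 (?S f)) = J 0 f" unfolding S representsD[OF T, symmetric] TR by (rule E)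
    then show ?thesis using A[of "J 0 (?S f)"] by (simp only: J_add J_csc)
  qed
  show ?thesis
  proof
    have "clin ?E" by (rule clin_mulL[OF emb_measurable emb_bound[OF m]])
    then show "clin ?S" using R(3) by (simp add: clin_def)
    show "A (J 0 (?S f)) = J 0 (f + csc z (?S f))" for f by (rule AS)
    show "{u \<in> sobolev m. A u \<in> L2} = range (\<lambda>f. J 0 (?S f))"
    proof (intro equalityI subsetI)
      fix u assume u: "u \<in> {u \<in> sobolev m. A u \<in> L2}"
      then have "u \<in> range (J m)" "A u \<in> range (J 0)" by (simp_all add: sobolev_eq L2_eq)
      then obtain h w where h: "u = J m h" and w: "A u = J 0 w" by blast
      \<comment> \<open>f is the element of L2 that A - z assigns to u; the inverse of the form then
        returns u.\<close>
      define f where "f = w - csc z (?E h)"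
      have "J (- m) (T h) = A u - scaleF z u" unfolding representsD[OF T] h by (simp add: shift_op_def)
      also have "\<dots> = J 0 f" unfolding w unfolding f_def h by (simp add: J_diff J_csc E)
      also have "\<dots> = J (- m) (?E f)" by (simp add: E)
      finally have "T h = ?E f" by (rule J_inj)
      then have "h = R (?E f)" using RT by metis
      then have "u = J 0 (?S f)" unfolding S h by (rule arg_cong)
      then show "u \<in> range (\<lambda>f. J 0 (?S f))" by (rule range_eqI)
    next
      fix u assume "u \<in> range (\<lambda>f. J 0 (?S f))"
      then obtain f where f: "u = J 0 (?S f)" by blast
      then have "u \<in> sobolev m" unfolding S by (simp add: sobolev_eq)
      moreover have "A u \<in> L2" unfolding f AS L2_eq by blast
      ultimately show "u \<in> {u \<in> sobolev m. A u \<in> L2}" by simp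
    qed
  qed
qed

theorem proposition5p1:
  fixes a b :: "('n::{finite,linorder}, 'e::fin_dim_hilbert) coefficients"
    and m :: nat
    and \<theta> :: "real^'n::{finite,linorder} \<Rightarrow> complex"
  assumes "m \<ge> 1"
    and a_Cu: "\<And>\<alpha> \<beta>. mi_order \<alpha> \<le> m \<Longrightarrow> mi_order \<beta> \<le> m \<Longrightarrow>
      class_Cu (real m - real (mi_order \<beta>)) (real (mi_order \<alpha>) - real m) (a \<alpha> \<beta>)"
    and b_Cu: "\<And>\<alpha> \<beta>. mi_order \<alpha> \<le> m \<Longrightarrow> mi_order \<beta> \<le> m \<Longrightarrow>
      class_Cu (real m - real (mi_order \<beta>)) (real (mi_order \<alpha>) - real m) (b \<alpha> \<beta>)"
    and bijective: "\<exists>z. bij_betw (shift_op (DaD m a) z) (sobolev (real m)) (sobolev (- real m)) \<and>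
      bij_betw (shift_op (DaD m b) z) (sobolev (real m)) (sobolev (- real m))"
    and "smooth \<theta>"
    and "eventually (\<lambda>x. \<theta> x = 0) (nhds 0)"
    and "eventually (\<lambda>x. \<theta> x = 1) at_infinity"
    and decay: "\<And>\<alpha> \<beta>. mi_order \<alpha> \<le> m \<Longrightarrow> mi_order \<beta> \<le> m \<Longrightarrow>
      ((\<lambda>r. op_norm (real m - real (mi_order \<beta>)) (real (mi_order \<alpha>) - real m)
              (\<lambda>u. mult_op (\<lambda>x. \<theta> ((1 / r) *\<^sub>R x)) (a \<alpha> \<beta> u - b \<alpha> \<beta> u))) \<longlongrightarrow> 0) at_top"
  shows "compact_perturbation (Delta_dom m b) (DaD m b) (Delta_dom m a) (DaD m a) \<and>
    essential_spectrum (Delta_dom m b) (DaD m b) = essential_spectrum (Delta_dom m a) (DaD m a)"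
proof -
  let ?s = "\<lambda>\<beta>::'n \<Rightarrow> nat. real m - real (mi_order \<beta>)" and ?t = "\<lambda>\<alpha>::'n \<Rightarrow> nat. real (mi_order \<alpha>) - real m"
  obtain z where z: "bij_betw (shift_op (DaD m a) z) (sobolev (real m)) (sobolev (- real m))"
    "bij_betw (shift_op (DaD m b) z) (sobolev (real m)) (sobolev (- real m))" using bijective by blast
  have "\<exists>T. mi_order \<alpha> \<le> m \<longrightarrow> mi_order \<beta> \<le> m \<longrightarrow> represents (?s \<beta>) (?t \<alpha>) (a \<alpha> \<beta>) T \<and> Cz (?s \<beta>) (?t \<alpha>) T" for \<alpha> \<beta>
    using class_Cu_imp_Cz[OF a_Cu] by metis
  then obtain C where C: "\<And>\<alpha> \<beta>. mi_order \<alpha> \<le> m \<Longrightarrow> mi_order \<beta> \<le> m \<Longrightarrow> represents (?s \<beta>) (?t \<alpha>) (a \<alpha> \<beta>) (C \<alpha> \<beta>)"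
    "\<And>\<alpha> \<beta>. mi_order \<alpha> \<le> m \<Longrightarrow> mi_order \<beta> \<le> m \<Longrightarrow> Cz (?s \<beta>) (?t \<alpha>) (C \<alpha> \<beta>)" by metis
  have "\<exists>T. mi_order \<alpha> \<le> m \<longrightarrow> mi_order \<beta> \<le> m \<longrightarrow> represents (?s \<beta>) (?t \<alpha>) (b \<alpha> \<beta>) T \<and> Cz (?s \<beta>) (?t \<alpha>) T" for \<alpha> \<beta>
    using class_Cu_imp_Cz[OF b_Cu] by metis
  then obtain C' where C': "\<And>\<alpha> \<beta>. mi_order \<alpha> \<le> m \<Longrightarrow> mi_order \<beta> \<le> m \<Longrightarrow> represents (?s \<beta>) (?t \<alpha>) (b \<alpha> \<beta>) (C' \<alpha> \<beta>)"
    "\<And>\<alpha> \<beta>. mi_order \<alpha> \<le> m \<Longrightarrow> mi_order \<beta> \<le> m \<Longrightarrow> Cz (?s \<beta>) (?t \<alpha>) (C' \<alpha> \<beta>)" by metis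
  let ?A = "shiftedL m z C" and ?B = "shiftedL m z C'" and ?E = "mulL (emb (real m)) :: ('n, 'e) l2 \<Rightarrow>\<^sub>L ('n, 'e) l2"
  have rA: "represents (real m) (- real m) (shift_op (DaD m a) z) ?A" by (rule represents_shiftedL[OF C(1)])
  have rB: "represents (real m) (- real m) (shift_op (DaD m b) z) ?B" by (rule represents_shiftedL[OF C'(1)])
  obtain Q where Q: "Q o\<^sub>L ?A = id_blinfun" "?A o\<^sub>L Q = id_blinfun"
    using bij_blinfun_inverse[OF bij_if_represents[OF rA z(1)]] by blast
  obtain Q' where Q': "Q' o\<^sub>L ?B = id_blinfun" "?B o\<^sub>L Q' = id_blinfun"
    using bij_blinfun_inverse[OF bij_if_represents[OF rB z(2)]] by blast
  have cQ: "Cz (- real m) (real m) Q" by (rule Cz_inverse[OF Cz_shiftedL[OF C(2)] Q])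
  have cQ': "Cz (- real m) (real m) Q'" by (rule Cz_inverse[OF Cz_shiftedL[OF C'(2)] Q'])
  define F where "F \<alpha> \<beta> = C \<alpha> \<beta> - C' \<alpha> \<beta>" for \<alpha> \<beta>
  \<comment> \<open>The terms with z cancel, so the difference of the two operators is again in
    divergence form, with coefficients F.\<close>
  have AB: "?A - ?B = divL m F"
    unfolding shiftedL_def F_def divL_diff[symmetric] by simp
  have "compact_blinfun ((divL m F o\<^sub>L Q') o\<^sub>L ?E)"
  proof (rule compact_divL_compose)
    fix \<alpha> \<beta> :: "'n \<Rightarrow> nat" assume \<alpha>\<beta>: "mi_order \<alpha> \<le> m" "mi_order \<beta> \<le> m"
    show "compact_blinfun ((F \<alpha> \<beta> o\<^sub>L (P_powL (real m) \<beta> o\<^sub>L Q')) o\<^sub>L ?E)"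
    \<comment> \<open>The gain d is m, positive because m \<ge> 1: \<open>?E\<close> includes L2
      into order - m, which is where \<open>Q'\<close> acts.\<close>
    proof (rule compact_coefficient_difference)
      show "represents (?s \<beta>) (?t \<alpha>) (\<lambda>u. a \<alpha> \<beta> u - b \<alpha> \<beta> u) (F \<alpha> \<beta>)"
        unfolding F_def by (rule represents_diff[OF C(1)[OF \<alpha>\<beta>] C'(1)[OF \<alpha>\<beta>]])
      show "Cz (?s \<beta>) (?t \<alpha>) (F \<alpha> \<beta>)" unfolding F_def by (rule Cz_diff[OF C(2)[OF \<alpha>\<beta>] C'(2)[OF \<alpha>\<beta>]])
      show "(\<lambda>x. 1 - \<theta> x) \<in> schwartz" using assms by (intro cutoff_schwartz)
      show "Cz (- real m) (?s \<beta>) (P_powL (real m) \<beta> o\<^sub>L Q')" by (rule Cz_compose[OF cQ' P_powL(2)])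
    qed (use decay[OF \<alpha>\<beta>] \<open>m \<ge> 1\<close> in auto)
  qed
  \<comment> \<open>The second resolvent identity for the inverses of the forms, Q - Q' = - Q (A -
    B) Q', restricted to L2 by \<open>?E\<close> on both sides.\<close>
  then have "compact_blinfun (?E o\<^sub>L (- Q o\<^sub>L ((divL m F o\<^sub>L Q') o\<^sub>L ?E)))" 
    by (rule compact_blinfun_compose_left[OF compact_blinfun_compose_left])
  also have "?E o\<^sub>L (- Q o\<^sub>L ((divL m F o\<^sub>L Q') o\<^sub>L ?E)) = (?E o\<^sub>L (Q o\<^sub>L ?E)) - (?E o\<^sub>L (Q' o\<^sub>L ?E))"
  proof (rule blinfun_eqI)
    fix h
    have "Q (?A x) = x" "?B (Q' x) = x" for x
      using Q(1) Q'(2) by (metis blinfun_apply_blinfun_compose id_blinfun.rep_eq)+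
    then show "(?E o\<^sub>L (- Q o\<^sub>L ((divL m F o\<^sub>L Q') o\<^sub>L ?E))) h = ((?E o\<^sub>L (Q o\<^sub>L ?E)) - (?E o\<^sub>L (Q' o\<^sub>L ?E))) h"
      unfolding AB[symmetric] by (simp add: blinfun.diff_left blinfun.diff_right blinfun.minus_left blinfun.minus_right)
  qed
  finally have c: "compact_blinfun ((?E o\<^sub>L (Q o\<^sub>L ?E)) - (?E o\<^sub>L (Q' o\<^sub>L ?E)))" .
  \<comment> \<open>The two inclusions between the essential spectra use the difference with
    opposite signs.\<close>
  have c': "compact_blinfun ((?E o\<^sub>L (Q' o\<^sub>L ?E)) - (?E o\<^sub>L (Q o\<^sub>L ?E)))"
    using compact_blinfun_compose_left[OF c, of "- id_blinfun"]
    by (rule back_subst[of compact_blinfun]) (simp add: blinfun_eqI blinfun.diff_left blinfun.minus_left)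
  have rpa: "resolvent_pair (Delta_dom m a) (DaD m a) z (?E o\<^sub>L (Q o\<^sub>L ?E))"
    unfolding Delta_dom_def using cQ by (intro resolvent_pair_restriction[OF _ rA Q]) (auto simp: Cz_def)
  have rpb: "resolvent_pair (Delta_dom m b) (DaD m b) z (?E o\<^sub>L (Q' o\<^sub>L ?E))"
    unfolding Delta_dom_def using cQ' by (intro resolvent_pair_restriction[OF _ rB Q']) (auto simp: Cz_def)
  show ?thesis
    unfolding essential_spectrum_def
    using compact_perturbation_if_compact_difference[OF rpa rpb c]
      fredholm_if_compact_difference[OF rpa rpb c] fredholm_if_compact_difference[OF rpb rpa c'] by blast
qed

end
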